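(* Let $\Omega\subset\mathbb{R}^3$ be a polyhedral domain and let $\mathcal{T}_0,\mathcal{T}_1,\mathcal{T}_2,\dots$ be a sequence of triangulations of $\Omega$ produced by the BEK local 3D red-green refinement procedure (conditions (1)--(6) of the context), with associated linear finite element spaces $\mathcal{S}_0\subset\mathcal{S}_1\subset\cdots\subset H^1_0(\Omega)$ and $L_2$-orthogonal projections $Q_j:L_2(\Omega)\to\mathcal{S}_j$, $Q_{-1}:=0$. Then there exist constants $0<c_1,c_2<\infty$, independent of $J$ and of $u$, such that for all $J\ge 0$ and all $u\in\mathcal{S}_J$ $$c_1\sum_{j=0}^J 2^{2j}\|(Q_j-Q_{j-1})u\|_{L_2(\Omega)}^2\;\le\;\|u\|_{H^1(\Omega)}^2\;\le\; c_2\sum_{j=0}^J 2^{2j}\|(Q_j-Q_{j-1})u\|_{L_2(\Omega)}^2 .$$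
   Context: Triangulations. Each $\mathcal{T}_j$ is a finite collection of tetrahedra with mutually disjoint interiors whose union covers (the closure of) $\Omega$. The initial triangulation $\mathcal{T}_0$ is conforming, shape regular and quasiuniform. $\mathcal{T}_{j+1}$ is obtained from $\mathcal{T}_j$ by refining some of its tetrahedra; the resulting subtetrahedra are the sons, the refined tetrahedron is their father (an unrefined tetrahedron is carried over unchanged to $\mathcal{T}_{j+1}$). A regular (red) refinement of a tetrahedron bisects all six edges and divides it into 8 subtetrahedra of equal volume: four congruent corner subtetrahedra similar to the father are cut off, and the remaining octahedron is cut into four further tetrahedra using one diagonal, the diagonal being chosen so that successive refinements remain nondegenerate. An irregular (green) refinement is a subdivision into tetrahedra with corners among the vertices and edge midpoints of the father in which at least one, but not all six, edges are refined; it is used to restore conformity. Sons of an irregular refinement are called irregular tetrahedra. The level of a tetrahedron is $L(\tau)=\min\{j:\tau\in\mathcal{T}_j\}$. BEK conditions: (1) Nestedness: each $\tau\in\mathcal{T}_j$ is covered by exactly one $\tau'\in\mathcal{T}_{j-1}$, and any corner of $\tau$ is a corner or an edge midpoint of $\tau'$. (2) Conformity: the intersection of any two tetrahedra in $\mathcal{T}_j$ is empty, a common vertex, a common edge or a common face. (3) Nondegeneracy: the interior angles of all tetrahedra in the sequence $\mathcal{T}_0,\mathcal{T}_1,\dots$ are bounded away from zero (uniform shape regularity). (4) Irregular tetrahedra are not refined further. (5) Only tetrahedra $\tau\in\mathcal{T}_j$ with $L(\tau)=j$ are refined in the construction of $\mathcal{T}_{j+1}$. (6) If three or more edges of a tetrahedron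 are refined and do not belong to a common face, then the tetrahedron is refined regularly. Finite element spaces. $\mathcal{S}_j$ is the space of continuous functions on $\Omega$ that are affine on each $\tau\in\mathcal{T}_j$ and vanish on $\partial\Omega$. *)

theory Defs
  imports "HOL-Analysis.Analysis"
begin

section \<open>Polyhedral domains and tetrahedra\<close>

text \<open>No Lipschitz condition is imposed; the condition \<open>interior (closure \<Omega>) = \<Omega>\<close> excludes
  slit domains.\<close>

definition polyhedral_domain :: "(real^3) set \<Rightarrow> bool" where
  "polyhedral_domain \<Omega> \<longleftrightarrow>
     open \<Omega> \<and> connected \<Omega> \<and> bounded \<Omega> \<and> \<Omega> \<noteq> {} \<and> interior (closure \<Omega>) = \<Omega> \<and>
     (\<exists>\<P>. finite \<P> \<and> (\<forall>P\<in>\<P>. polytope P) \<and> \<Union>\<P> = closure \<Omega>)"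

abbreviation tetrahedron :: "(real^3) set \<Rightarrow> bool" where
  "tetrahedron \<tau> \<equiv> 3 simplex \<tau>"

definition corners :: "(real^3) set \<Rightarrow> (real^3) set" where
  "corners \<tau> = {v. v extreme_point_of \<tau>}"

text \<open>An edge of a tetrahedron is represented by the set of its two endpoints.\<close>

definition edges :: "(real^3) set \<Rightarrow> (real^3) set set" where
  "edges \<tau> = {{a, b} | a b. a \<in> corners \<tau> \<and> b \<in> corners \<tau> \<and> a \<noteq> b}"

definition edge_midpoints :: "(real^3) set \<Rightarrow> (real^3) set" where
  "edge_midpoints \<tau> = {midpoint a b | a b. a \<in> corners \<tau> \<and> b \<in> corners \<tau> \<and> a \<noteq> b}"

text \<open>The interior angles are the angles of the triangular faces together with the dihedral
  angles. Both kinds are needed: slivers have large face angles, needles have large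
  dihedral angles.\<close>

definition vec_angle :: "real^3 \<Rightarrow> real^3 \<Rightarrow> real" where
  "vec_angle v w = arccos ((v \<bullet> w) / (norm v * norm w))"

definition face_angle :: "real^3 \<Rightarrow> real^3 \<Rightarrow> real^3 \<Rightarrow> real" where
  "face_angle a b c = vec_angle (b - a) (c - a)"

definition orth_part :: "real^3 \<Rightarrow> real^3 \<Rightarrow> real^3" where
  "orth_part e w = w - ((w \<bullet> e) / (e \<bullet> e)) *\<^sub>R e"

definition dihedral_angle :: "real^3 \<Rightarrow> real^3 \<Rightarrow> real^3 \<Rightarrow> real^3 \<Rightarrow> real" where
  "dihedral_angle a b c d = vec_angle (orth_part (b - a) (c - a)) (orth_part (b - a) (d - a))"

definition interior_angles :: "(real^3) set \<Rightarrow> real set" where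
  "interior_angles \<tau> =
     {face_angle a b c | a b c. {a, b, c} \<subseteq> corners \<tau> \<and> distinct [a, b, c]} \<union>
     {dihedral_angle a b c d | a b c d. {a, b, c, d} \<subseteq> corners \<tau> \<and> distinct [a, b, c, d]}"


section \<open>Triangulations and refinement of a single tetrahedron\<close>

definition triangulation_of :: "(real^3) set \<Rightarrow> (real^3) set set \<Rightarrow> bool" where
  "triangulation_of R \<T> \<longleftrightarrow>
     finite \<T> \<and> (\<forall>\<tau>\<in>\<T>. tetrahedron \<tau>) \<and>
     (\<forall>\<tau>\<in>\<T>. \<forall>\<tau>'\<in>\<T>. \<tau> \<noteq> \<tau>' \<longrightarrow> interior \<tau> \<inter> interior \<tau>' = {}) \<and> \<Union>\<T> = R"

text \<open>The faces of a simplex in the sense of \<open>face_of\<close> are the empty set, the vertices, edges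
  and triangular faces, and the simplex itself.\<close>

definition conforming :: "(real^3) set set \<Rightarrow> bool" where
  "conforming \<T> \<longleftrightarrow>
     (\<forall>\<tau>\<in>\<T>. \<forall>\<tau>'\<in>\<T>. (\<tau> \<inter> \<tau>') face_of \<tau> \<and> (\<tau> \<inter> \<tau>') face_of \<tau>')"

definition quasiuniform :: "(real^3) set set \<Rightarrow> bool" where
  "quasiuniform \<T> \<longleftrightarrow> (\<exists>C>0. \<forall>\<tau>\<in>\<T>. \<forall>\<tau>'\<in>\<T>. diameter \<tau> \<le> C * diameter \<tau>')"

text \<open>In the following \<open>S\<close> is the set of sons of \<open>\<tau>\<close>. An edge of \<open>\<tau>\<close> is refined if its midpoint
  is a corner of a son.\<close>

definition refined_edges :: "(real^3) set \<Rightarrow> (real^3) set set \<Rightarrow> (real^3) set set" where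
  "refined_edges \<tau> S =
     {{a, b} | a b. a \<in> corners \<tau> \<and> b \<in> corners \<tau> \<and> a \<noteq> b \<and>
        midpoint a b \<in> (\<Union>\<sigma>\<in>S. corners \<sigma>)}"

text \<open>The diagonal of the inner octahedron is the one joining the midpoints of \<open>ac\<close> and \<open>bd\<close>;
  since the labelling of the corners is arbitrary, every diagonal is admitted here.\<close>

definition regular_refinement :: "(real^3) set \<Rightarrow> (real^3) set set \<Rightarrow> bool" where
  "regular_refinement \<tau> S \<longleftrightarrow>
     (\<exists>a b c d. corners \<tau> = {a, b, c, d} \<and> distinct [a, b, c, d] \<and>
        S = {convex hull {a, midpoint a b, midpoint a c, midpoint a d},
             convex hull {b, midpoint a b, midpoint b c, midpoint b d},
             convex hull {c, midpoint a c, midpoint b c, midpoint c d},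
             convex hull {d, midpoint a d, midpoint b d, midpoint c d},
             convex hull {midpoint a c, midpoint b d, midpoint a b, midpoint b c},
             convex hull {midpoint a c, midpoint b d, midpoint b c, midpoint c d},
             convex hull {midpoint a c, midpoint b d, midpoint c d, midpoint a d},
             convex hull {midpoint a c, midpoint b d, midpoint a d, midpoint a b}})"

definition irregular_refinement :: "(real^3) set \<Rightarrow> (real^3) set set \<Rightarrow> bool" where
  "irregular_refinement \<tau> S \<longleftrightarrow>
     triangulation_of \<tau> S \<and>
     (\<forall>\<sigma>\<in>S. corners \<sigma> \<subseteq> corners \<tau> \<union> edge_midpoints \<tau>) \<and>
     refined_edges \<tau> S \<noteq> {} \<and> refined_edges \<tau> S \<noteq> edges \<tau>"


section \<open>Sequences of triangulations\<close>

definition sons :: "(nat \<Rightarrow> (real^3) set set) \<Rightarrow> nat \<Rightarrow> (real^3) set \<Rightarrow> (real^3) set set" where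
  "sons \<T> j \<tau> = {\<sigma> \<in> \<T> (Suc j). \<sigma> \<subseteq> \<tau>}"

text \<open>An unrefined tetrahedron is its own only son.\<close>

definition refinement_step :: "(nat \<Rightarrow> (real^3) set set) \<Rightarrow> nat \<Rightarrow> bool" where
  "refinement_step \<T> j \<longleftrightarrow>
     (\<forall>\<tau>\<in>\<T> j. sons \<T> j \<tau> = {\<tau>} \<or> regular_refinement \<tau> (sons \<T> j \<tau>) \<or>
        irregular_refinement \<tau> (sons \<T> j \<tau>))"

definition tet_level :: "(nat \<Rightarrow> (real^3) set set) \<Rightarrow> (real^3) set \<Rightarrow> nat" where
  "tet_level \<T> \<tau> = (LEAST j. \<tau> \<in> \<T> j)"

definition is_refined :: "(nat \<Rightarrow> (real^3) set set) \<Rightarrow> nat \<Rightarrow> (real^3) set \<Rightarrow> bool" where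
  "is_refined \<T> j \<tau> \<longleftrightarrow> \<tau> \<in> \<T> j \<and> sons \<T> j \<tau> \<noteq> {\<tau>}"

definition irregular_tet :: "(nat \<Rightarrow> (real^3) set set) \<Rightarrow> (real^3) set \<Rightarrow> bool" where
  "irregular_tet \<T> \<sigma> \<longleftrightarrow>
     (\<exists>j. \<exists>\<tau>\<in>\<T> j. irregular_refinement \<tau> (sons \<T> j \<tau>) \<and> \<sigma> \<in> sons \<T> j \<tau>)"

definition nested :: "(nat \<Rightarrow> (real^3) set set) \<Rightarrow> bool" where
  "nested \<T> \<longleftrightarrow>
     (\<forall>j. \<forall>\<tau>\<in>\<T> (Suc j). (\<exists>!\<tau>'. \<tau>' \<in> \<T> j \<and> \<tau> \<subseteq> \<tau>') \<and>
        (\<forall>\<tau>'\<in>\<T> j. \<tau> \<subseteq> \<tau>' \<longrightarrow> corners \<tau> \<subseteq> corners \<tau>' \<union> edge_midpoints \<tau>'))"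

definition nondegenerate :: "(nat \<Rightarrow> (real^3) set set) \<Rightarrow> bool" where
  "nondegenerate \<T> \<longleftrightarrow> (\<exists>\<theta>>0. \<forall>j. \<forall>\<tau>\<in>\<T> j. \<forall>\<alpha>\<in>interior_angles \<tau>. \<theta> \<le> \<alpha>)"

definition irregular_not_refined :: "(nat \<Rightarrow> (real^3) set set) \<Rightarrow> bool" where
  "irregular_not_refined \<T> \<longleftrightarrow> (\<forall>\<tau>. irregular_tet \<T> \<tau> \<longrightarrow> (\<forall>k. \<not> is_refined \<T> k \<tau>))"

definition only_newest_refined :: "(nat \<Rightarrow> (real^3) set set) \<Rightarrow> bool" where
  "only_newest_refined \<T> \<longleftrightarrow> (\<forall>j \<tau>. is_refined \<T> j \<tau> \<longrightarrow> tet_level \<T> \<tau> = j)"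

definition regular_if_three_edges :: "(nat \<Rightarrow> (real^3) set set) \<Rightarrow> bool" where
  "regular_if_three_edges \<T> \<longleftrightarrow>
     (\<forall>j. \<forall>\<tau>\<in>\<T> j. card (refined_edges \<tau> (sons \<T> j \<tau>)) \<ge> 3 \<and>
        \<not> (\<exists>F. F facet_of \<tau> \<and> (\<forall>e\<in>refined_edges \<tau> (sons \<T> j \<tau>). e \<subseteq> F)) \<longrightarrow>
        regular_refinement \<tau> (sons \<T> j \<tau>))"

text \<open>The Bornemann--Erdmann--Kornhuber (BEK) refinement procedure. Shape regularity of the
  initial triangulation is the instance \<open>j = 0\<close> of \<open>nondegenerate\<close>.\<close>

definition bek_sequence :: "(real^3) set \<Rightarrow> (nat \<Rightarrow> (real^3) set set) \<Rightarrow> bool" where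
  "bek_sequence \<Omega> \<T> \<longleftrightarrow>
     (\<forall>j. triangulation_of (closure \<Omega>) (\<T> j)) \<and>
     quasiuniform (\<T> 0) \<and>
     (\<forall>j. refinement_step \<T> j) \<and>
     nested \<T> \<and>
     (\<forall>j. conforming (\<T> j)) \<and>
     nondegenerate \<T> \<and>
     irregular_not_refined \<T> \<and>
     only_newest_refined \<T> \<and>
     regular_if_three_edges \<T>"


section \<open>The Lebesgue and Sobolev norms\<close>

definition in_L2 :: "(real^3) set \<Rightarrow> (real^3 \<Rightarrow> real) \<Rightarrow> bool" where
  "in_L2 \<Omega> f \<longleftrightarrow>
     set_borel_measurable lebesgue \<Omega> f \<and> set_integrable lebesgue \<Omega> (\<lambda>x. (f x)\<^sup>2)"

definition L2_inner :: "(real^3) set \<Rightarrow> (real^3 \<Rightarrow> real) \<Rightarrow> (real^3 \<Rightarrow> real) \<Rightarrow> real" where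
  "L2_inner \<Omega> f g = (LINT x:\<Omega>|lebesgue. f x * g x)"

definition L2_norm :: "(real^3) set \<Rightarrow> (real^3 \<Rightarrow> real) \<Rightarrow> real" where
  "L2_norm \<Omega> f = sqrt (L2_inner \<Omega> f f)"

definition partial_deriv :: "3 \<Rightarrow> (real^3 \<Rightarrow> real) \<Rightarrow> real^3 \<Rightarrow> real" where
  "partial_deriv i f x = frechet_derivative f (at x) (axis i 1)"

primrec C_k :: "nat \<Rightarrow> (real^3 \<Rightarrow> real) \<Rightarrow> bool" where
  "C_k 0 f \<longleftrightarrow> continuous_on UNIV f"
| "C_k (Suc k) f \<longleftrightarrow> f differentiable_on UNIV \<and> (\<forall>i. C_k k (partial_deriv i f))"

definition test_function :: "(real^3) set \<Rightarrow> (real^3 \<Rightarrow> real) \<Rightarrow> bool" where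
  "test_function \<Omega> \<phi> \<longleftrightarrow>
     (\<forall>k. C_k k \<phi>) \<and> compact (closure {x. \<phi> x \<noteq> 0}) \<and> closure {x. \<phi> x \<noteq> 0} \<subseteq> \<Omega>"

definition has_weak_partial ::
    "(real^3) set \<Rightarrow> 3 \<Rightarrow> (real^3 \<Rightarrow> real) \<Rightarrow> (real^3 \<Rightarrow> real) \<Rightarrow> bool" where
  "has_weak_partial \<Omega> i u g \<longleftrightarrow>
     in_L2 \<Omega> g \<and>
     (\<forall>\<phi>. test_function \<Omega> \<phi> \<longrightarrow> L2_inner \<Omega> u (partial_deriv i \<phi>) = - L2_inner \<Omega> g \<phi>)"

text \<open>Weak derivatives are unique only almost everywhere; the norm below does not depend on
  the representative chosen by \<open>SOME\<close>. It is meaningful for functions in \<open>H\<^sup>1(\<Omega>)\<close>, which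
  include all continuous piecewise affine functions.\<close>

definition weak_partial :: "(real^3) set \<Rightarrow> 3 \<Rightarrow> (real^3 \<Rightarrow> real) \<Rightarrow> real^3 \<Rightarrow> real" where
  "weak_partial \<Omega> i u = (SOME g. has_weak_partial \<Omega> i u g)"

definition H1_norm :: "(real^3) set \<Rightarrow> (real^3 \<Rightarrow> real) \<Rightarrow> real" where
  "H1_norm \<Omega> u = sqrt ((L2_norm \<Omega> u)\<^sup>2 + (\<Sum>i\<in>UNIV. (L2_norm \<Omega> (weak_partial \<Omega> i u))\<^sup>2))"


section \<open>Finite element spaces and orthogonal projections\<close>

text \<open>Functions on \<open>closure \<Omega>\<close> are represented by their extension by zero, which makes
  elements of \<open>fe_space\<close> unique as functions on the whole space.\<close>

definition fe_space :: "(real^3) set \<Rightarrow> (real^3) set set \<Rightarrow> (real^3 \<Rightarrow> real) set" where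
  "fe_space \<Omega> \<T> =
     {u. continuous_on (closure \<Omega>) u \<and>
         (\<forall>\<tau>\<in>\<T>. \<exists>a b. \<forall>x\<in>\<tau>. u x = a \<bullet> x + b) \<and>
         (\<forall>x\<in>frontier \<Omega>. u x = 0) \<and>
         (\<forall>x. x \<notin> closure \<Omega> \<longrightarrow> u x = 0)}"

definition L2_proj ::
    "(real^3) set \<Rightarrow> (real^3 \<Rightarrow> real) set \<Rightarrow> (real^3 \<Rightarrow> real) \<Rightarrow> (real^3 \<Rightarrow> real)" where
  "L2_proj \<Omega> S u = (THE q. q \<in> S \<and> (\<forall>v\<in>S. L2_inner \<Omega> (\<lambda>x. u x - q x) v = 0))"

text \<open>\<open>proj_diff \<Omega> \<T> j\<close> is the operator $Q_j - Q_{j-1}$, where $Q_{-1} = 0$.\<close>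

definition proj_diff ::
    "(real^3) set \<Rightarrow> (nat \<Rightarrow> (real^3) set set) \<Rightarrow> nat \<Rightarrow> (real^3 \<Rightarrow> real) \<Rightarrow> (real^3 \<Rightarrow> real)" where
  "proj_diff \<Omega> \<T> j u =
     (\<lambda>x. L2_proj \<Omega> (fe_space \<Omega> (\<T> j)) u x -
          (if j = 0 then 0 else L2_proj \<Omega> (fe_space \<Omega> (\<T> (j - 1))) u x))"

end

theory Submission
  imports Defs
begin

text \<open>
  By the parallelogram law the scaled first difference energies of \<open>u\<close> at the scales \<open>2\<^sup>-\<^sup>j\<close> telescope into
  a sum of scaled second difference energies, and these energies increase to the gradient energy of \<open>u\<close>.
  Both inequalities thereby become statements about second differences in \<open>L\<^sub>2\<close>.

  Lower bound: near a tetrahedron of size \<open>2\<^sup>-\<^sup>j\<close> the function \<open>u\<close> is affine up to its second differences at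
  that scale. A quasi-interpolant in \<open>\<S>\<^sub>j\<close> whose nodal values are combinations of ball averages that
  reproduce affine functions approximates \<open>u\<close> to the same order. On tetrahedra of level less than \<open>j\<close> it can
  be made exact: by condition (5) they are never refined again, so \<open>u\<close> is affine there. At boundary
  vertices the balls are placed outside \<open>\<Omega>\<close>, which gives the nodal value zero.

  Upper bound: the second difference with step \<open>z\<close> of a function in \<open>\<S>\<^sub>k\<close> vanishes away from strips of
  width about \<open>\<bar>z\<bar>\<close> along the faces, so its squared norm is at most of order \<open>(2\<^sup>k \<bar>z\<bar>)\<^sup>3\<close> times that of the
  function. As the exponent exceeds 2, the interaction of the levels decays geometrically.
\<close>

section \<open>L2 calculus on the whole space and dyadic differences\<close>

section \<open>Square integrable functions\<close>

text \<open>Finite element functions vanish on the boundary, so extension by zero keeps them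
  continuous. On the whole space translation is an isometry, as the difference calculus demands, and
  no extension operator enters, although \<open>\<Omega>\<close> may fail to be Lipschitz. Two
  demands on the quasi-interpolant conflict with averaging around a vertex: exactness on an old
  tetrahedron asks for data from a single tetrahedron, and a zero boundary value asks for data
  outside \<open>\<Omega>\<close>. Hence the balls are moved off the vertex \<open>p\<close>, to
  \<open>p + w\<close> and \<open>p + 2 w\<close>, and linear extrapolation restores exactness on
  affine functions. Room outside \<open>\<Omega>\<close> is found by writing the exterior as a
  finite union of open convex sets. The power 3 has two sources: the squared gradients give two
  factors of the step, the relative volume of the strips gives the third. The weight
  \<open>4 ^ m\<close> consumes two, and the last leaves a decay of \<open>sqrt (1 / 2)\<close> per
  level for the norms. The projections themselves are handled by orthogonality alone:
  \<open>Q_j - Q_(j-1)\<close> is bounded by the distance of \<open>u\<close> from any element of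
  the previous space.\<close>

definition square_integrable :: "'a measure \<Rightarrow> ('a \<Rightarrow> real) \<Rightarrow> bool" where
  "square_integrable M f \<longleftrightarrow> f \<in> borel_measurable M \<and> integrable M (\<lambda>x. (f x)\<^sup>2)"

definition nrm :: "'a measure \<Rightarrow> ('a \<Rightarrow> real) \<Rightarrow> real" where
  "nrm M f = sqrt (LINT x|M. (f x)\<^sup>2)"

lemma nrm_nonneg [simp]: "0 \<le> nrm M f"
  by (simp add: nrm_def)

lemma nrm_power2: "(nrm M f)\<^sup>2 = (LINT x|M. (f x)\<^sup>2)"
  by (simp add: nrm_def)

lemma square_integrable_mult:
  assumes "square_integrable M f" "square_integrable M g"
  shows "integrable M (\<lambda>x. f x * g x)"
proof (rule Bochner_Integration.integrable_bound)
  show "integrable M (\<lambda>x. (f x)\<^sup>2 + (g x)\<^sup>2)"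
    using assms by (auto simp: square_integrable_def)
  show "(\<lambda>x. f x * g x) \<in> borel_measurable M"
    using assms by (auto simp: square_integrable_def)
  show "AE x in M. norm (f x * g x) \<le> norm ((f x)\<^sup>2 + (g x)\<^sup>2)"
  proof (rule AE_I2)
    fix x
    have "0 \<le> (\<bar>f x\<bar> - \<bar>g x\<bar>)\<^sup>2" by simp
    then have "2 * (\<bar>f x\<bar> * \<bar>g x\<bar>) \<le> (f x)\<^sup>2 + (g x)\<^sup>2"
      by (simp add: power2_diff)
    moreover have "0 \<le> \<bar>f x\<bar> * \<bar>g x\<bar>" by simp
    ultimately have "\<bar>f x\<bar> * \<bar>g x\<bar> \<le> (f x)\<^sup>2 + (g x)\<^sup>2" by linarith
    then show "norm (f x * g x) \<le> norm ((f x)\<^sup>2 + (g x)\<^sup>2)"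
      by (simp add: abs_mult)
  qed
qed

lemma square_integrable_cmult:
  "square_integrable M f \<Longrightarrow> square_integrable M (\<lambda>x. c * f x)"
  by (auto simp: square_integrable_def power_mult_distrib)

lemma square_integrable_add:
  assumes "square_integrable M f" "square_integrable M g"
  shows "square_integrable M (\<lambda>x. f x + g x)"
proof -
  have "integrable M (\<lambda>x. (f x)\<^sup>2 + (g x)\<^sup>2 + 2 * (f x * g x))"
    using assms square_integrable_mult[OF assms] by (simp add: square_integrable_def)
  then have "integrable M (\<lambda>x. (f x + g x)\<^sup>2)"
    by (simp add: power2_sum mult.assoc)
  then show ?thesis using assms by (auto simp: square_integrable_def)
qed

lemma square_integrable_diff:
  assumes "square_integrable M f" "square_integrable M g"
  shows "square_integrable M (\<lambda>x. f x - g x)"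
  using square_integrable_add[OF assms(1) square_integrable_cmult[OF assms(2), of "-1"]] by simp

lemma square_integrable_sum:
  assumes "\<And>i. i \<in> I \<Longrightarrow> square_integrable M (f i)"
  shows "square_integrable M (\<lambda>x. \<Sum>i\<in>I. f i x)"
  using assms
proof (induction I rule: infinite_finite_induct)
  case (insert i I)
  then show ?case using square_integrable_add[of M "f i" "\<lambda>x. \<Sum>i\<in>I. f i x"] by simp
qed (auto simp: square_integrable_def)

lemma Cauchy_Schwarz_integral:
  assumes f: "square_integrable M f" and g: "square_integrable M g"
  shows "(LINT x|M. f x * g x)\<^sup>2 \<le> (LINT x|M. (f x)\<^sup>2) * (LINT x|M. (g x)\<^sup>2)"
proof -
  define A where "A = (LINT x|M. (f x)\<^sup>2)"
  define B where "B = (LINT x|M. (g x)\<^sup>2)"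
  define C where "C = (LINT x|M. f x * g x)"
  have A0: "A \<ge> 0" "B \<ge> 0" by (auto simp: A_def B_def)
  have q: "A * s\<^sup>2 + 2 * s * t * C + B * t\<^sup>2 \<ge> 0" for s t
  proof -
    have "0 \<le> (LINT x|M. (s * f x + t * g x)\<^sup>2)" by simp
    also have "(\<lambda>x. (s * f x + t * g x)\<^sup>2) = (\<lambda>x. s\<^sup>2 * (f x)\<^sup>2 + 2 * s * t * (f x * g x) + t\<^sup>2 * (g x)\<^sup>2)"
      by (auto simp: power2_sum power_mult_distrib algebra_simps)
    also have "(LINT x|M. s\<^sup>2 * (f x)\<^sup>2 + 2 * s * t * (f x * g x) + t\<^sup>2 * (g x)\<^sup>2)
       = s\<^sup>2 * A + 2 * s * t * C + t\<^sup>2 * B"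
      using f g square_integrable_mult[OF f g]
      by (subst Bochner_Integration.integral_add Bochner_Integration.integral_mult_right,
          auto simp: square_integrable_def A_def B_def C_def)+
    finally show ?thesis by (simp add: mult.commute)
  qed
  have "C\<^sup>2 \<le> A * B"
  proof (cases "A = 0")
    case True
    have "C = 0"
    proof (rule ccontr)
      assume "C \<noteq> 0"
      \<comment> \<open>With \<open>A = 0\<close> the form is affine in \<open>s\<close>; at this
        \<open>s\<close> its value is \<open>- B - 2\<close>, which is negative.\<close>
      have "0 \<le> 2 * (- (B + 1) / C) * C + B"
        using q[of "- (B + 1) / C" 1] True by simp
      then show False using \<open>C \<noteq> 0\<close> A0 by simp
    qed
    then show ?thesis using True by simp
  next
    case False
    then have "A > 0" using A0 by simp
    \<comment> \<open>The minimising ratio \<open>s / t = - C / A\<close>, taken without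
      division.\<close>
    have "0 \<le> A * (-C)\<^sup>2 + 2 * (-C) * A * C + B * A\<^sup>2" using q[of "-C" A] by simp
    also have "\<dots> = A * (A * B - C\<^sup>2)" by (simp add: power2_eq_square algebra_simps)
    finally show ?thesis using \<open>A > 0\<close> by (simp add: zero_le_mult_iff)
  qed
  then show ?thesis by (simp add: A_def B_def C_def)
qed

lemma nrm_triangle:
  assumes f: "square_integrable M f" and g: "square_integrable M g"
  shows "nrm M (\<lambda>x. f x + g x) \<le> nrm M f + nrm M g"
proof -
  have "(nrm M (\<lambda>x. f x + g x))\<^sup>2 = (LINT x|M. (f x)\<^sup>2 + 2 * (f x * g x) + (g x)\<^sup>2)"
    unfolding nrm_power2 by (rule Bochner_Integration.integral_cong) (auto simp: power2_sum)
  also have eq: "\<dots> = (nrm M f)\<^sup>2 + 2 * (LINT x|M. f x * g x) + (nrm M g)\<^sup>2"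
      using f g square_integrable_mult[OF f g]
      by (simp add: square_integrable_def nrm_power2)
  finally have eq: "(nrm M (\<lambda>x. f x + g x))\<^sup>2 = (nrm M f)\<^sup>2 + 2 * (LINT x|M. f x * g x) + (nrm M g)\<^sup>2" .
  have "(LINT x|M. f x * g x) \<le> nrm M f * nrm M g"
  proof (rule power2_le_imp_le)
    show "(LINT x|M. f x * g x)\<^sup>2 \<le> (nrm M f * nrm M g)\<^sup>2"
      using Cauchy_Schwarz_integral[OF f g] by (simp add: nrm_power2 power_mult_distrib)
  qed simp
  then have "(nrm M (\<lambda>x. f x + g x))\<^sup>2 \<le> (nrm M f + nrm M g)\<^sup>2"
    using eq power2_sum[of "nrm M f" "nrm M g"] by linarith
  then show ?thesis by (rule power2_le_imp_le) simp
qed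

lemma nrm_cmult: "nrm M (\<lambda>x. c * f x) = \<bar>c\<bar> * nrm M f"
  by (simp add: nrm_def power_mult_distrib real_sqrt_mult)

lemma nrm_sum_le:
  assumes "\<And>i. i \<in> I \<Longrightarrow> square_integrable M (f i)"
  shows "nrm M (\<lambda>x. \<Sum>i\<in>I. f i x) \<le> (\<Sum>i\<in>I. nrm M (f i))"
  using assms
proof (induction I rule: infinite_finite_induct)
  case (insert i I)
  have "nrm M (\<lambda>x. \<Sum>i\<in>insert i I. f i x) = nrm M (\<lambda>x. f i x + (\<Sum>i\<in>I. f i x))"
    using insert by simp
  also have "\<dots> \<le> nrm M (f i) + nrm M (\<lambda>x. \<Sum>i\<in>I. f i x)"
    using insert by (intro nrm_triangle square_integrable_sum) auto
  finally show ?case using insert by simp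
qed (auto simp: nrm_def)

section \<open>Continuous functions with bounded support\<close>

text \<open>A class in which every integral converges and which is closed under translation, sums
  and products; it contains the zero extensions of finite element functions as well as all test
  functions.\<close>

definition cc :: "('a::euclidean_space \<Rightarrow> real) set" where
  "cc = {f. continuous_on UNIV f \<and> bounded {x. f x \<noteq> 0}}"

lemma cc_continuous: "f \<in> cc \<Longrightarrow> continuous_on UNIV f"
  by (simp add: cc_def)

lemma cc_measurable [measurable_dest]: "f \<in> cc \<Longrightarrow> f \<in> borel_measurable borel"
  by (simp add: cc_def borel_measurable_continuous_onI)

lemma cc_support:
  assumes "f \<in> cc" obtains r where "r > 0" "\<And>x. norm x > r \<Longrightarrow> f x = 0"
proof -
  from assms obtain r where r: "\<And>x. f x \<noteq> 0 \<Longrightarrow> norm x \<le> r"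
    unfolding cc_def bounded_iff by auto
  show thesis
  proof (rule that[of "max r 1"])
    show "f x = 0" if "norm x > max r 1" for x using r[of x] that by fastforce
  qed simp
qed

lemma cc_integrable:
  assumes "f \<in> cc" shows "integrable lborel f"
proof -
  obtain r where r: "\<And>x. norm x > r \<Longrightarrow> f x = 0" using cc_support[OF assms] by blast
  have "integrable lborel (\<lambda>x. indicator (cball 0 r) x *\<^sub>R f x)"
    by (intro borel_integrable_compact) (use cc_continuous[OF assms] continuous_on_subset in auto)
  also have "(\<lambda>x. indicator (cball 0 r) x *\<^sub>R f x) = f"
    using r by (auto simp: indicator_def fun_eq_iff not_le)
  finally show ?thesis .
qed

lemma cc_mult_left:
  assumes "f \<in> cc" "continuous_on UNIV g" shows "(\<lambda>x. g x * f x) \<in> cc"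
proof -
  have "{x. g x * f x \<noteq> 0} \<subseteq> {x. f x \<noteq> 0}" by auto
  then have "bounded {x. g x * f x \<noteq> 0}"
    using assms unfolding cc_def by (metis (no_types, lifting) bounded_subset mem_Collect_eq)
  then show ?thesis using assms by (auto simp: cc_def intro!: continuous_intros)
qed

lemma cc_cmult: "f \<in> cc \<Longrightarrow> (\<lambda>x. c * f x) \<in> cc"
  by (rule cc_mult_left) auto

lemma cc_add:
  assumes "f \<in> cc" "g \<in> cc" shows "(\<lambda>x. f x + g x) \<in> cc"
proof -
  have "{x. f x + g x \<noteq> 0} \<subseteq> {x. f x \<noteq> 0} \<union> {x. g x \<noteq> 0}" by auto
  then have "bounded {x. f x + g x \<noteq> 0}"
    using assms unfolding cc_def by (metis (no_types, lifting) bounded_Un bounded_subset mem_Collect_eq)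
  then show ?thesis using assms by (auto simp: cc_def intro!: continuous_intros)
qed

lemma cc_diff:
  assumes "f \<in> cc" "g \<in> cc" shows "(\<lambda>x. f x - g x) \<in> cc"
  using cc_add[OF assms(1) cc_cmult[OF assms(2), of "-1"]] by simp

lemma cc_zero: "(\<lambda>x. 0) \<in> cc"
  by (simp add: cc_def)

lemma cc_sum:
  assumes "\<And>i. i \<in> I \<Longrightarrow> f i \<in> cc" shows "(\<lambda>x. \<Sum>i\<in>I. f i x) \<in> cc"
  using assms
  by (induction I rule: infinite_finite_induct) (auto intro: cc_zero cc_add)

lemma cc_translate:
  assumes "f \<in> cc" shows "(\<lambda>x. f (x + z)) \<in> cc"
proof -
  have "{x. f (x + z) \<noteq> 0} \<subseteq> (\<lambda>x. -z + x) ` {x. f x \<noteq> 0}"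
  proof
    fix x assume "x \<in> {x. f (x + z) \<noteq> 0}"
    then show "x \<in> (\<lambda>x. -z + x) ` {x. f x \<noteq> 0}"
      by (intro image_eqI[of _ _ "x + z"]) auto
  qed
  then have "bounded {x. f (x + z) \<noteq> 0}"
    using assms bounded_translation unfolding cc_def by (metis (no_types, lifting) bounded_subset mem_Collect_eq)
  moreover have "continuous_on UNIV (\<lambda>x. f (x + z))"
    by (rule continuous_on_compose2[OF cc_continuous[OF assms]]) (auto intro!: continuous_intros)
  ultimately show ?thesis by (simp add: cc_def)
qed

lemma cc_power2: "f \<in> cc \<Longrightarrow> (\<lambda>x. (f x)\<^sup>2) \<in> cc"
  unfolding power2_eq_square by (rule cc_mult_left) (auto simp: cc_continuous)

lemma cc_square_integrable: "f \<in> cc \<Longrightarrow> square_integrable lborel f"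
  using cc_measurable[of f] cc_integrable[OF cc_power2, of f] by (auto simp: square_integrable_def)

lemma cc_mult_integrable: "f \<in> cc \<Longrightarrow> g \<in> cc \<Longrightarrow> integrable lborel (\<lambda>x. f x * g x)"
  by (intro cc_integrable cc_mult_left cc_continuous)

text \<open>Continuity turns an almost everywhere statement into a pointwise one, since a nonempty
  open set is not negligible. This makes projections unique as functions and not only as
  classes.\<close>

lemma cc_eq_0:
  assumes f: "f \<in> cc" and 0: "(LINT x|lborel. (f x)\<^sup>2) = 0"
  shows "f x = 0"
proof -
  have "AE x in lborel. (f x)\<^sup>2 = 0"
    using integral_nonneg_eq_0_iff_AE[of lborel "\<lambda>x. (f x)\<^sup>2"] cc_integrable[OF cc_power2[OF f]] 0 by simp
  then have "AE x in lborel. f x = 0" by simp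
  then have "f x = 0 \<or> f x \<noteq> 0 \<and> False"
  proof (cases "f x = 0")
    case False
    have "open {x. f x \<noteq> 0}"
      using open_Collect_neq[OF cc_continuous[OF f], of "\<lambda>_. 0"] by simp
    moreover have "negligible {x. f x \<noteq> 0}"
      using \<open>AE x in lborel. f x = 0\<close>
      unfolding negligible_iff_null_sets eventually_ae_filter
      by (auto intro: null_sets_completion_subset null_sets_completionI)
    ultimately have "{x. f x \<noteq> 0} = {}" using open_not_negligible by blast
    then show ?thesis by blast
  qed simp
  then show ?thesis by simp
qed

lemma integral_translate:
  fixes f :: "'a::euclidean_space \<Rightarrow> real"
  assumes "f \<in> borel_measurable borel"
  shows "(LINT x|lborel. f (x + z)) = (LINT x|lborel. f x)"
proof -
  have "(LINT x|lborel. f x) = (LINT x|distr lborel borel ((+) z). f x)"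
    by (subst lborel_distr_plus) simp
  also have "\<dots> = (LINT x|lborel. f (z + x))"
    using assms by (subst integral_distr) auto
  finally show ?thesis by (simp add: add.commute)
qed

lemma nrm_translate: "f \<in> cc \<Longrightarrow> nrm lborel (\<lambda>x. f (x + z)) = nrm lborel f"
  unfolding nrm_def by (subst integral_translate[of "\<lambda>x. (f x)\<^sup>2"]) (auto dest: cc_measurable)

section \<open>First and second differences\<close>

definition diff1 :: "'a::real_vector \<Rightarrow> ('a \<Rightarrow> real) \<Rightarrow> 'a \<Rightarrow> real" where
  "diff1 z u x = u (x + z) - u x"

text \<open>The forward form makes this the first difference, with step \<open>z\<close>, of
  \<open>diff1 z u\<close>.\<close>

definition diff2 :: "'a::real_vector \<Rightarrow> ('a \<Rightarrow> real) \<Rightarrow> 'a \<Rightarrow> real" where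
  "diff2 z u x = u (x + 2 *\<^sub>R z) - 2 * u (x + z) + u x"

lemma cc_diff1: "u \<in> cc \<Longrightarrow> diff1 z u \<in> cc"
  unfolding diff1_def by (intro cc_diff cc_translate)

lemma cc_diff2: "u \<in> cc \<Longrightarrow> diff2 z u \<in> cc"
  unfolding diff2_def by (intro cc_diff cc_translate cc_add cc_cmult)

lemma nrm_diff1_le: "u \<in> cc \<Longrightarrow> nrm lborel (diff1 z u) \<le> 2 * nrm lborel u"
  using nrm_triangle[of lborel "\<lambda>x. u (x + z)" "\<lambda>x. (-1) * u x"] nrm_translate[of u z] nrm_cmult[of lborel "-1" u]
    square_integrable_cmult[OF cc_square_integrable, of u "-1"]
  by (simp add: diff1_def[abs_def] cc_square_integrable cc_translate)

lemma nrm_diff2_le: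
  assumes "u \<in> cc" shows "nrm lborel (diff2 z u) \<le> 4 * nrm lborel u"
proof -
  have "diff2 z u = (\<lambda>x. diff1 z u (x + z) + (-1) * diff1 z u x)"
    by (auto simp: diff2_def diff1_def fun_eq_iff scaleR_2 algebra_simps)
  then have "nrm lborel (diff2 z u) \<le> nrm lborel (\<lambda>x. diff1 z u (x + z)) + nrm lborel (\<lambda>x. (-1) * diff1 z u x)"
    using assms by (simp only:, intro nrm_triangle) (intro cc_square_integrable cc_translate cc_diff1 cc_cmult, assumption)+
  also have "\<dots> = 2 * nrm lborel (diff1 z u)"
    by (subst nrm_cmult) (simp add: nrm_translate cc_diff1 assms)
  also have "\<dots> \<le> 4 * nrm lborel u"
    using nrm_diff1_le[OF assms, of z] by simp
  finally show ?thesis .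
qed

text \<open>Divided by the square of the step size, this makes sums of second differences over dyadic scales telescope.\<close>

lemma diff2_parallelogram:
  assumes u: "u \<in> cc"
  shows "(nrm lborel (diff2 z u))\<^sup>2 + (nrm lborel (diff1 (2 *\<^sub>R z) u))\<^sup>2 = 4 * (nrm lborel (diff1 z u))\<^sup>2"
proof -
  let ?d = "diff1 z u"
  have d: "?d \<in> cc" "(\<lambda>x. ?d (x + z)) \<in> cc" using u by (auto intro: cc_diff1 cc_translate)
  have "(nrm lborel (diff2 z u))\<^sup>2 + (nrm lborel (diff1 (2 *\<^sub>R z) u))\<^sup>2
      = (LINT x|lborel. (diff2 z u x)\<^sup>2 + (diff1 (2 *\<^sub>R z) u x)\<^sup>2)"
    using u by (simp add: nrm_power2 cc_integrable cc_power2 cc_diff1 cc_diff2)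
  also have "\<dots> = (LINT x|lborel. 2 * (?d (x + z))\<^sup>2 + 2 * (?d x)\<^sup>2)"
    by (rule Bochner_Integration.integral_cong)
      (auto simp: diff1_def diff2_def scaleR_2 power2_eq_square algebra_simps)
  also have "\<dots> = 2 * (nrm lborel (\<lambda>x. ?d (x + z)))\<^sup>2 + 2 * (nrm lborel ?d)\<^sup>2"
    using cc_integrable[OF cc_power2[OF d(1)]] cc_integrable[OF cc_power2[OF d(2)]] by (simp add: nrm_power2)
  finally show ?thesis using nrm_translate[OF d(1)] by simp
qed

text \<open>The squared norm of a difference quotient: \<open>4 ^ n\<close> is the inverse square of
  the factor \<open>1 / 2 ^ n\<close> in the step.\<close>

definition diff_energy :: "'a::euclidean_space \<Rightarrow> ('a \<Rightarrow> real) \<Rightarrow> nat \<Rightarrow> real" where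
  "diff_energy z u n = 4 ^ n * (nrm lborel (diff1 ((1 / 2 ^ n) *\<^sub>R z) u))\<^sup>2"

lemma diff_energy_Suc:
  assumes "u \<in> cc"
  shows "diff_energy z u (Suc n) =
    diff_energy z u n + 4 ^ n * (nrm lborel (diff2 ((1 / 2 ^ Suc n) *\<^sub>R z) u))\<^sup>2"
proof -
  have "4 * (nrm lborel (diff1 ((1 / 2 ^ Suc n) *\<^sub>R z) u))\<^sup>2 =
      (nrm lborel (diff2 ((1 / 2 ^ Suc n) *\<^sub>R z) u))\<^sup>2 + (nrm lborel (diff1 ((1 / 2 ^ n) *\<^sub>R z) u))\<^sup>2"
    using diff2_parallelogram[OF assms, of "(1 / 2 ^ Suc n) *\<^sub>R z"] by simp
  then have "4 ^ n * (4 * (nrm lborel (diff1 ((1 / 2 ^ Suc n) *\<^sub>R z) u))\<^sup>2) =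
      4 ^ n * ((nrm lborel (diff2 ((1 / 2 ^ Suc n) *\<^sub>R z) u))\<^sup>2 + (nrm lborel (diff1 ((1 / 2 ^ n) *\<^sub>R z) u))\<^sup>2)"
    by simp
  then show ?thesis
    by (simp only: diff_energy_def power_Suc distrib_left mult.assoc mult.left_commute add.commute)
qed

lemma diff_energy_sum:
  assumes "u \<in> cc"
  shows "diff_energy z u n = diff_energy z u 0 +
    (\<Sum>m<n. 4 ^ m * (nrm lborel (diff2 ((1 / 2 ^ Suc m) *\<^sub>R z) u))\<^sup>2)"
proof (induction n)
  case (Suc n)
  then show ?case by (simp only: diff_energy_Suc[OF assms] sum.lessThan_Suc)
qed simp

text \<open>The increments are squares. Monotonicity later lets the limit, the gradient energy,
  dominate the energy at every single scale.\<close>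

lemma incseq_diff_energy: "u \<in> cc \<Longrightarrow> incseq (diff_energy z u)"
  by (rule incseq_SucI) (simp add: diff_energy_Suc)

section \<open>A Whitney inequality: affine approximation controlled by second differences\<close>

section \<open>Approximately affine functions\<close>

text \<open>Each \<open>t\<close> is the midpoint of an endpoint, where \<open>g\<close> vanishes,
  and another point of the interval. So the supremum \<open>S\<close> of
  \<open>\<bar>g\<bar>\<close>, finite by the crude bound \<open>K\<close>, satisfies
  \<open>S <= (\<delta> + S) / 2\<close>.\<close>

lemma approx_Jensen_interval:
  fixes g :: "real \<Rightarrow> real"
  assumes bdd: "\<And>t. t \<in> {0..1} \<Longrightarrow> \<bar>g t\<bar> \<le> K"
    and J: "\<And>s t. s \<in> {0..1} \<Longrightarrow> t \<in> {0..1} \<Longrightarrow> \<bar>g s + g t - 2 * g ((s + t) / 2)\<bar> \<le> \<delta>"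
    and g0: "g 0 = 0" and g1: "g 1 = 0" and t: "t \<in> {0..1}"
  shows "\<bar>g t\<bar> \<le> \<delta>"
proof -
  define S where "S = (SUP t\<in>{0..1}. \<bar>g t\<bar>)"
  have bdda: "bdd_above ((\<lambda>t. \<bar>g t\<bar>) ` {0..1})"
    using bdd by (intro bdd_aboveI2[of _ _ K]) auto
  have le: "\<bar>g t\<bar> \<le> S" if "t \<in> {0..1}" for t
    unfolding S_def by (rule cSUP_upper) (use that bdda in auto)
  have "\<bar>g t\<bar> \<le> (\<delta> + S) / 2" if t: "t \<in> {0..1}" for t
  proof (cases "t \<le> 1 / 2")
    case True
    then have "\<bar>g 0 + g (2 * t) - 2 * g ((0 + 2 * t) / 2)\<bar> \<le> \<delta>" using t by (intro J) auto
    moreover have "\<bar>g (2 * t)\<bar> \<le> S" using True t by (intro le) auto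
    ultimately show ?thesis using g0 by simp
  next
    case False
    then have "\<bar>g 1 + g (2 * t - 1) - 2 * g ((1 + (2 * t - 1)) / 2)\<bar> \<le> \<delta>" using t by (intro J) auto
    moreover have "\<bar>g (2 * t - 1)\<bar> \<le> S" using False t by (intro le) auto
    ultimately show ?thesis using g1 by simp
  qed
  then have "S \<le> (\<delta> + S) / 2"
    unfolding S_def by (intro cSUP_least) auto
  then show ?thesis using le[OF t] by simp
qed

text \<open>Stability of the Jensen equation in the sense of Hyers and Ulam: near-linearity on each
  axis comes from the interval version, and near-additivity glues the axes together.\<close>

lemma approx_Jensen_ball:
  fixes f :: "'a::euclidean_space \<Rightarrow> real" and \<delta> :: real
  assumes R: "R > 0"
    and bdd: "\<And>y. norm y \<le> R \<Longrightarrow> \<bar>f y\<bar> \<le> K"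
    and J: "\<And>p q. norm p \<le> R \<Longrightarrow> norm q \<le> R \<Longrightarrow> \<bar>f p + f q - 2 * f ((1/2) *\<^sub>R (p + q))\<bar> \<le> \<delta>"
  shows "\<exists>a. \<forall>y. norm y \<le> R \<longrightarrow> \<bar>f y - f 0 - a \<bullet> y\<bar> \<le> 4 * DIM('a) * \<delta>"
proof -
  define \<phi> where "\<phi> y = f y - f 0" for y
  have \<phi>0: "\<phi> 0 = 0" by (simp add: \<phi>_def)
  have J': "\<bar>\<phi> p + \<phi> q - 2 * \<phi> ((1/2) *\<^sub>R (p + q))\<bar> \<le> \<delta>" if "norm p \<le> R" "norm q \<le> R" for p q
    using J[OF that] by (simp add: \<phi>_def)
  \<comment> \<open>The pairs \<open>(y, z)\<close> and \<open>(y + z, 0)\<close> have the same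
    midpoint, so its value cancels between the two defects.\<close>
  have add: "\<bar>\<phi> (y + z) - \<phi> y - \<phi> z\<bar> \<le> 2 * \<delta>" if "norm y \<le> R" "norm z \<le> R" "norm (y + z) \<le> R" for y z
    using J'[OF that(1,2)] J'[OF that(3), of 0] \<phi>0 R by simp
  have \<delta>0: "\<delta> \<ge> 0" using J'[of 0 0] R by simp
  have line: "\<bar>\<phi> (t *\<^sub>R b) - t / R * \<phi> (R *\<^sub>R b)\<bar> \<le> 2 * \<delta>" if b: "b \<in> Basis" and t: "\<bar>t\<bar> \<le> R" for b t
  proof -
    have nb: "norm b = 1" using b by simp
    define g where "g s = \<phi> ((s * R) *\<^sub>R b) - s * \<phi> (R *\<^sub>R b)" for s
    have g: "\<bar>g s\<bar> \<le> \<delta>" if "s \<in> {0..1}" for s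
    proof (rule approx_Jensen_interval[of g "K + \<bar>f 0\<bar> + (K + \<bar>f 0\<bar>)"])
      show "g 0 = 0" "g 1 = 0" by (simp_all add: g_def \<phi>0)
      show "\<bar>g s\<bar> \<le> K + \<bar>f 0\<bar> + (K + \<bar>f 0\<bar>)" if "s \<in> {0..1}" for s
      proof -
        have 1: "\<bar>\<phi> ((s * R) *\<^sub>R b)\<bar> \<le> K + \<bar>f 0\<bar>"
          using bdd[of "(s * R) *\<^sub>R b"] that R nb by (simp add: \<phi>_def mult_left_le_one_le)
        have 2: "\<bar>\<phi> (R *\<^sub>R b)\<bar> \<le> K + \<bar>f 0\<bar>"
          using bdd[of "R *\<^sub>R b"] R nb by (simp add: \<phi>_def)
        have "\<bar>s * \<phi> (R *\<^sub>R b)\<bar> \<le> 1 * \<bar>\<phi> (R *\<^sub>R b)\<bar>"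
          unfolding abs_mult using that by (intro mult_right_mono) auto
        with 1 2 show ?thesis unfolding g_def by linarith
      qed
      show "\<bar>g s + g t - 2 * g ((s + t) / 2)\<bar> \<le> \<delta>" if st: "s \<in> {0..1}" "t \<in> {0..1}" for s t
      proof -
        have "\<bar>\<phi> ((s * R) *\<^sub>R b) + \<phi> ((t * R) *\<^sub>R b) - 2 * \<phi> ((1/2) *\<^sub>R ((s * R) *\<^sub>R b + (t * R) *\<^sub>R b))\<bar> \<le> \<delta>"
          by (rule J') (use st R nb in \<open>auto simp: mult_left_le_one_le\<close>)
        also have "(1/2) *\<^sub>R ((s * R) *\<^sub>R b + (t * R) *\<^sub>R b) = ((s + t) / 2 * R) *\<^sub>R b"
          by (simp add: algebra_simps add_divide_distrib)
        finally show ?thesis by (simp add: g_def algebra_simps add_divide_distrib)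
      qed
    qed (use that in auto)
    define s where "s = \<bar>t\<bar> / R"
    have s: "s \<in> {0..1}" "s * R = \<bar>t\<bar>" using t R by (auto simp: s_def)
    have *: "\<bar>\<phi> (\<bar>t\<bar> *\<^sub>R b) - \<bar>t\<bar> / R * \<phi> (R *\<^sub>R b)\<bar> \<le> \<delta>" using g[OF s(1)] s(2) by (simp add: g_def s_def)
    show ?thesis
    proof (cases "t \<ge> 0")
      case True then show ?thesis using * \<delta>0 by simp
    next
      case False
      \<comment> \<open>The points \<open>t b\<close> and \<open>- t b\<close> have midpoint 0, so
        \<open>\<phi>\<close> is odd up to \<open>\<delta>\<close>; this transfers the bound from
        positive to negative \<open>t\<close>.\<close>
      have "\<bar>\<phi> (t *\<^sub>R b) + \<phi> ((-t) *\<^sub>R b) - 2 * \<phi> ((1/2) *\<^sub>R (t *\<^sub>R b + (-t) *\<^sub>R b))\<bar> \<le> \<delta>"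
        by (rule J') (use t nb in auto)
      then have "\<bar>\<phi> (t *\<^sub>R b) + \<phi> (- (t *\<^sub>R b))\<bar> \<le> \<delta>" by (simp add: \<phi>0)
      moreover have "\<bar>\<phi> (- (t *\<^sub>R b)) + t / R * \<phi> (R *\<^sub>R b)\<bar> \<le> \<delta>" using * False by simp
      moreover have "\<bar>A + B\<bar> \<le> \<delta> \<Longrightarrow> \<bar>B + X\<bar> \<le> \<delta> \<Longrightarrow> \<bar>A - X\<bar> \<le> 2 * \<delta>" for A B X :: real
        by linarith
      ultimately show ?thesis by blast
    qed
  qed
  \<comment> \<open>The slope along each axis is read off at the endpoint
    \<open>R b\<close>.\<close>
  define a where "a = (\<Sum>b\<in>Basis. (\<phi> (R *\<^sub>R b) / R) *\<^sub>R b)"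
  have "\<bar>f y - f 0 - a \<bullet> y\<bar> \<le> 4 * DIM('a) * \<delta>" if y: "norm y \<le> R" for y
  proof -
    \<comment> \<open>The coordinates of \<open>y\<close> are added one at a time. Each costs
      \<open>2 * \<delta>\<close> for additivity and \<open>2 * \<delta>\<close> for its axis, and
      the partial sums stay in the ball because coordinates are only dropped.\<close>
    have "\<bar>\<phi> (\<Sum>b\<in>I. (y \<bullet> b) *\<^sub>R b) - (\<Sum>b\<in>I. (y \<bullet> b) / R * \<phi> (R *\<^sub>R b))\<bar> \<le> 4 * card I * \<delta>"
      if "I \<subseteq> Basis" for I
    proof -
      have "finite I" using that finite_Basis finite_subset by blast
      then show ?thesis using that
      proof (induction I)
        case (insert b I)
        have nI: "norm (\<Sum>b\<in>J. (y \<bullet> b) *\<^sub>R b) \<le> R" if "J \<subseteq> Basis" for J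
        proof -
          have "norm (\<Sum>b\<in>J. (y \<bullet> b) *\<^sub>R b) \<le> norm y"
          proof (rule norm_le_componentwise)
            fix i :: 'a assume i: "i \<in> Basis"
            have "finite J" using that finite_Basis finite_subset by blast
            have "(\<Sum>b\<in>J. (y \<bullet> b) *\<^sub>R b) \<bullet> i = (\<Sum>b\<in>J. if b = i then y \<bullet> b else 0)"
              unfolding inner_sum_left
              by (rule sum.cong) (use that i in \<open>auto simp: inner_Basis\<close>)
            also have "\<dots> = (if i \<in> J then y \<bullet> i else 0)" using \<open>finite J\<close> by simp
            finally show "\<bar>(\<Sum>b\<in>J. (y \<bullet> b) *\<^sub>R b) \<bullet> i\<bar> \<le> \<bar>y \<bullet> i\<bar>" by simp
          qed
          then show ?thesis using y by simp
        qed
        have b: "b \<in> Basis" using insert by simp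
        have yb: "\<bar>y \<bullet> b\<bar> \<le> R" using Basis_le_norm[OF b, of y] y by simp
        have eq: "(\<Sum>b\<in>insert b I. (y \<bullet> b) *\<^sub>R b) = (y \<bullet> b) *\<^sub>R b + (\<Sum>b\<in>I. (y \<bullet> b) *\<^sub>R b)"
          using insert by simp
        have "\<bar>\<phi> (\<Sum>b\<in>insert b I. (y \<bullet> b) *\<^sub>R b) - \<phi> ((y \<bullet> b) *\<^sub>R b) - \<phi> (\<Sum>b\<in>I. (y \<bullet> b) *\<^sub>R b)\<bar> \<le> 2 * \<delta>"
          unfolding eq by (rule add) (use nI[of I] nI[of "insert b I"] eq insert yb b in auto)
        moreover have "\<bar>\<phi> ((y \<bullet> b) *\<^sub>R b) - (y \<bullet> b) / R * \<phi> (R *\<^sub>R b)\<bar> \<le> 2 * \<delta>" by (rule line[OF b yb])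
        moreover have "\<bar>\<phi> (\<Sum>b\<in>I. (y \<bullet> b) *\<^sub>R b) - (\<Sum>b\<in>I. (y \<bullet> b) / R * \<phi> (R *\<^sub>R b))\<bar> \<le> 4 * card I * \<delta>"
          using insert by auto
        moreover have "(\<Sum>b\<in>insert b I. (y \<bullet> b) / R * \<phi> (R *\<^sub>R b)) =
            (y \<bullet> b) / R * \<phi> (R *\<^sub>R b) + (\<Sum>b\<in>I. (y \<bullet> b) / R * \<phi> (R *\<^sub>R b))" using insert by simp
        moreover have "4 * card (insert b I) * \<delta> = 4 * \<delta> + 4 * card I * \<delta>"
          using insert by (simp add: algebra_simps)
        ultimately show ?case by linarith
      qed (simp add: \<phi>0)
    qed
    from this[of Basis] have "\<bar>\<phi> y - (\<Sum>b\<in>Basis. (y \<bullet> b) / R * \<phi> (R *\<^sub>R b))\<bar> \<le> 4 * DIM('a) * \<delta>"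
      by (simp add: euclidean_representation)
    also have "(\<Sum>b\<in>Basis. (y \<bullet> b) / R * \<phi> (R *\<^sub>R b)) = a \<bullet> y"
      unfolding a_def inner_sum_left by (intro sum.cong) (auto simp: inner_commute)
    finally show ?thesis by (simp add: \<phi>_def)
  qed
  then show ?thesis by blast
qed

section \<open>Integrals over balls\<close>

lemma set_integrable_compact:
  fixes f :: "'a::euclidean_space \<Rightarrow> real"
  assumes "compact S" "continuous_on S f" shows "set_integrable lborel S f"
  using borel_integrable_compact[OF assms] by (simp add: set_integrable_def)

lemma set_integral_translate:
  fixes f :: "'a::euclidean_space \<Rightarrow> real"
  assumes "f \<in> borel_measurable borel" "S \<in> sets borel"
  shows "(LINT x:S|lborel. f x) = (LINT x:{x. x + z \<in> S}|lborel. f (x + z))"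
proof -
  have "(LINT x|lborel. indicator S x *\<^sub>R f x) = (LINT x|distr lborel borel ((+) z). indicator S x *\<^sub>R f x)"
    by (subst lborel_distr_plus) simp
  also have "\<dots> = (LINT x|lborel. indicator S (z + x) *\<^sub>R f (z + x))"
    using assms by (subst integral_distr) auto
  finally show ?thesis
    by (simp add: set_lebesgue_integral_def add.commute indicator_def)
qed

lemma set_integral_scale:
  fixes f :: "'a::euclidean_space \<Rightarrow> real"
  assumes f: "f \<in> borel_measurable borel" "S \<in> sets borel" and c: "c > 0"
  shows "(LINT x:S|lborel. f x) = c ^ DIM('a) * (LINT x:{x. c *\<^sub>R x \<in> S}|lborel. f (c *\<^sub>R x))"
proof -
  define T where "T = (\<lambda>x::'a. 0 + c *\<^sub>R x)"
  have "(LINT x|lborel. indicator S x *\<^sub>R f x)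
      = (LINT x|density (distr lborel borel T) (\<lambda>_. \<bar>c\<bar> ^ DIM('a)). indicator S x *\<^sub>R f x)"
    using c unfolding T_def by (subst lborel_affine[of c 0]) auto
  also have "\<dots> = (LINT x|distr lborel borel T. c ^ DIM('a) *\<^sub>R (indicator S x *\<^sub>R f x))"
    using c f by (subst integral_density) (auto simp: T_def)
  also have "\<dots> = (LINT x|lborel. c ^ DIM('a) *\<^sub>R (indicator S (T x) *\<^sub>R f (T x)))"
    using f by (subst integral_distr) (auto simp: T_def)
  finally show ?thesis
    by (simp add: set_lebesgue_integral_def indicator_def T_def)
qed

lemma set_integral_Times:
  fixes f :: "'a::euclidean_space \<times> 'b::euclidean_space \<Rightarrow> real"
  assumes f: "continuous_on UNIV f" and S: "compact S" and T: "compact T"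
  shows "(LINT z:S \<times> T|lborel. f z) = (LINT x:S|lborel. (LINT y:T|lborel. f (x, y)))"
    and "set_integrable lborel S (\<lambda>x. (LINT y:T|lborel. f (x, y)))"
proof -
  have int: "integrable lborel (\<lambda>z. indicator (S \<times> T) z *\<^sub>R f z)"
    by (intro borel_integrable_compact compact_Times S T continuous_on_subset[OF f]) auto
  then have int': "integrable (lborel \<Otimes>\<^sub>M lborel) (\<lambda>z. indicator (S \<times> T) z *\<^sub>R f z)"
    by (simp add: lborel_prod)
  have *: "(LINT y|lborel. indicator (S \<times> T) (x, y) *\<^sub>R f (x, y)) = indicator S x *\<^sub>R (LINT y:T|lborel. f (x, y))" for x
    by (auto simp: set_lebesgue_integral_def indicator_def)
  show "(LINT z:S \<times> T|lborel. f z) = (LINT x:S|lborel. (LINT y:T|lborel. f (x, y)))"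
    using lborel_pair.integral_fst'[OF int']
    by (simp only: * lborel_prod) (simp add: set_lebesgue_integral_def)
  show "set_integrable lborel S (\<lambda>x. (LINT y:T|lborel. f (x, y)))"
    using lborel_pair.integrable_fst'[OF int'] by (simp only: *) (simp add: set_integrable_def)
qed

lemma content_cball_pos: "0 < r \<Longrightarrow> 0 < measure lborel (cball (c::'a::euclidean_space) r)"
  by (simp add: content_cball)

lemma content_cball_mult:
  "0 \<le> r \<Longrightarrow> measure lborel (cball (c::'a::euclidean_space) (k * r)) = k ^ DIM('a) * measure lborel (cball (0::'a) r)" if "0 \<le> k"
  using that by (simp add: content_cball power_mult_distrib)

lemma set_integral_const_lborel:
  fixes c :: real
  assumes "compact S" shows "(LINT x:S|lborel. c) = measure lborel S * c"
  using assms emeasure_compact_finite[OF assms] by (subst set_integral_const) (auto simp: borel_compact)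

lemma set_integral_nonneg_real:
  fixes f :: "'a \<Rightarrow> real"
  assumes "\<And>x. x \<in> S \<Longrightarrow> 0 \<le> f x" shows "0 \<le> (LINT x:S|M. f x)"
  unfolding set_lebesgue_integral_def by (rule Bochner_Integration.integral_nonneg) (use assms in \<open>auto simp: indicator_def\<close>)

lemma set_integral_mono_set:
  fixes f :: "'a \<Rightarrow> real"
  assumes "set_integrable M T f" "S \<in> sets M" "S \<subseteq> T" "\<And>x. x \<in> T \<Longrightarrow> 0 \<le> f x"
  shows "(LINT x:S|M. f x) \<le> (LINT x:T|M. f x)"
proof -
  have "set_integrable M S f" using set_integrable_subset[OF assms(1-3)] .
  then show ?thesis using assms
    unfolding set_lebesgue_integral_def set_integrable_def
    by (intro Bochner_Integration.integral_mono) (auto simp: indicator_def)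
qed

text \<open>The variance of \<open>f\<close> around its mean \<open>m\<close> is nonnegative; a null
  set is treated apart because the mean divides by the measure.\<close>

lemma set_integral_square_le:
  fixes f :: "'a::euclidean_space \<Rightarrow> real"
  assumes S: "compact S" and f: "continuous_on UNIV f"
  shows "(LINT x:S|lborel. f x)\<^sup>2 \<le> measure lborel S * (LINT x:S|lborel. (f x)\<^sup>2)"
proof (cases "measure lborel S = 0")
  case True
  then have "AE x in lborel. x \<notin> S"
    using S emeasure_compact_finite[OF S]
    by (intro AE_not_in) (auto simp: null_sets_def borel_compact emeasure_eq_measure2 ennreal_eq_0_iff measure_def enn2real_eq_0_iff)
  then have "(LINT x:S|lborel. f x) = 0"
    unfolding set_lebesgue_integral_def by (intro integral_eq_zero_AE) (auto simp: indicator_def elim: eventually_mono)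
  then show ?thesis using True by simp
next
  case False
  then have pos: "measure lborel S > 0" by (simp add: less_le)
  define m where "m = (LINT x:S|lborel. f x) / measure lborel S"
  have i: "set_integrable lborel S f" "set_integrable lborel S (\<lambda>x. (f x)\<^sup>2)" "set_integrable lborel S (\<lambda>x. c::real)" for c
    using S f by (auto intro!: set_integrable_compact continuous_intros intro: continuous_on_subset)
  have "0 \<le> (LINT x:S|lborel. (f x - m)\<^sup>2)" by (rule set_integral_nonneg_real) simp
  also have "(\<lambda>x. (f x - m)\<^sup>2) = (\<lambda>x. (f x)\<^sup>2 - (2 * m) * f x + m\<^sup>2)" by (auto simp: power2_diff algebra_simps)
  also have "(LINT x:S|lborel. (f x)\<^sup>2 - (2 * m) * f x + m\<^sup>2) =
      (LINT x:S|lborel. (f x)\<^sup>2) - 2 * m * (LINT x:S|lborel. f x) + measure lborel S * m\<^sup>2"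
    using i by (subst set_integral_add set_integral_diff set_integral_mult_right, auto simp: set_integral_const_lborel[OF S])+
  also have "(LINT x:S|lborel. f x) = m * measure lborel S" using pos by (simp add: m_def)
  finally have "measure lborel S * m\<^sup>2 \<le> (LINT x:S|lborel. (f x)\<^sup>2)" by (simp add: power2_eq_square algebra_simps)
  then have "measure lborel S * (measure lborel S * m\<^sup>2) \<le> measure lborel S * (LINT x:S|lborel. (f x)\<^sup>2)" using pos by simp
  also have "measure lborel S * (measure lborel S * m\<^sup>2) = (LINT x:S|lborel. f x)\<^sup>2"
    using pos by (simp add: m_def power2_eq_square)
  finally show ?thesis .
qed

section \<open>Local approximation by affine functions\<close>

text \<open>At the pair \<open>(P, P + e)\<close> this is
  \<open>diff2 ((1/2) *\<^sub>R e) u P\<close>; the symmetric form allows the two points to be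
  averaged independently.\<close>

definition mid_defect :: "('a::euclidean_space \<Rightarrow> real) \<Rightarrow> 'a \<times> 'a \<Rightarrow> real" where
  "mid_defect u z = u (fst z) + u (snd z) - 2 * u ((1/2) *\<^sub>R (fst z + snd z))"

lemma continuous_on_cc:
  assumes "u \<in> cc" "continuous_on S f" shows "continuous_on S (\<lambda>x. u (f x))"
  by (rule continuous_on_compose2[OF cc_continuous[OF assms(1)] assms(2)]) auto

lemma continuous_on_mid_defect:
  assumes "u \<in> cc" "continuous_on S f" shows "continuous_on S (\<lambda>x. mid_defect u (f x))"
  unfolding mid_defect_def by (intro continuous_intros continuous_on_cc[OF assms(1)] assms(2))

text \<open>Local counterpart of the norms of \<open>diff2\<close>: summed over balls of bounded
  overlap it becomes an integral of such norms over the step, see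
  \<open>jensen_energy_sum_le\<close>.\<close>

definition jensen_energy :: "('a::euclidean_space \<Rightarrow> real) \<Rightarrow> 'a \<Rightarrow> real \<Rightarrow> real" where
  "jensen_energy u x R = (LINT z:cball x R \<times> cball x R|lborel. (mid_defect u z)\<^sup>2)"

definition avg :: "('a::euclidean_space \<Rightarrow> real) \<Rightarrow> real \<Rightarrow> 'a \<Rightarrow> real" where
  "avg u r c = (LINT s:cball 0 r|lborel. u (c + s)) / measure lborel (cball (0::'a) r)"

lemma half_scaleR_shift: "(1/2) *\<^sub>R ((x + a) + (x + b)) = x + (1/2) *\<^sub>R (a + b)" for x :: "'a::real_vector"
proof -
  have "(x + a) + (x + b) = 2 *\<^sub>R x + (a + b)" by (simp add: scaleR_2)
  then show ?thesis by (simp only: scaleR_add_right) simp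
qed

text \<open>Averaging the defect over two independent shifts turns an L2 bound on
  \<open>mid_defect\<close> into a pointwise bound for averages. The midpoint then carries a
  different average \<open>\<mu>\<close>, which a second application eliminates; hence the factor
  2.\<close>

lemma avg_Jensen:
  fixes u :: "'a::euclidean_space \<Rightarrow> real"
  assumes u: "u \<in> cc" and \<rho>: "\<rho> > 0" and p: "norm p \<le> \<rho>" and q: "norm q \<le> \<rho>"
  defines "V \<equiv> measure lborel (cball (0::'a) \<rho>)"
  shows "\<bar>avg u \<rho> (x + p) + avg u \<rho> (x + q) - 2 * avg u \<rho> (x + (1/2) *\<^sub>R (p + q))\<bar>
           \<le> 2 * (sqrt (jensen_energy u x (2 * \<rho>)) / V)"
proof -
  let ?B = "cball (0::'a) \<rho>"
  have V: "V > 0" using \<rho> by (simp add: V_def content_cball_pos)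
  \<comment> \<open>The midpoint of two independent uniform points of the ball is not uniformly
    distributed, so this is not \<open>avg u \<rho>\<close>.\<close>
  define \<mu> where "\<mu> c = (LINT z:?B \<times> ?B|lborel. u (x + c + (1/2) *\<^sub>R (fst z + snd z))) / V\<^sup>2" for c
  have cB: "compact (?B \<times> ?B)" by (intro compact_Times) auto
  have main: "\<bar>avg u \<rho> (x + p) + avg u \<rho> (x + q) - 2 * \<mu> ((1/2) *\<^sub>R (p + q))\<bar> \<le> sqrt (jensen_energy u x (2 * \<rho>)) / V"
    if p: "norm p \<le> \<rho>" and q: "norm q \<le> \<rho>" for p q
  proof -
    define h where "h z = mid_defect u (z + (x + p, x + q))" for z
    have ch: "continuous_on UNIV h" unfolding h_def by (intro continuous_on_mid_defect[OF u] continuous_intros)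
    have 1: "(LINT z:?B \<times> ?B|lborel. u (x + p + fst z)) = V * (V * avg u \<rho> (x + p))"
    proof -
      have "continuous_on UNIV (\<lambda>z::'a \<times> 'a. u (x + p + fst z))" by (intro continuous_on_cc[OF u] continuous_intros)
      from set_integral_Times(1)[OF this, of ?B ?B]
      have "(LINT z:?B \<times> ?B|lborel. u (x + p + fst z)) = (LINT s:?B|lborel. V * u (x + p + s))"
        by (simp only: compact_cball fst_conv set_integral_const_lborel V_def)
      also have "\<dots> = V * (LINT s:?B|lborel. u (x + p + s))" by (rule set_integral_mult_right)
      also have "(LINT s:?B|lborel. u (x + p + s)) = V * avg u \<rho> (x + p)" using V unfolding avg_def V_def by simp
      finally show ?thesis .
    qed
    have 2: "(LINT z:?B \<times> ?B|lborel. u (x + q + snd z)) = V * (V * avg u \<rho> (x + q))"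
    proof -
      have "continuous_on UNIV (\<lambda>z::'a \<times> 'a. u (x + q + snd z))" by (intro continuous_on_cc[OF u] continuous_intros)
      from set_integral_Times(1)[OF this, of ?B ?B]
      have "(LINT z:?B \<times> ?B|lborel. u (x + q + snd z)) = V * (LINT s:?B|lborel. u (x + q + s))"
        by (simp only: compact_cball snd_conv set_integral_const_lborel V_def)
      also have "(LINT s:?B|lborel. u (x + q + s)) = V * avg u \<rho> (x + q)" using V unfolding avg_def V_def by simp
      finally show ?thesis .
    qed
    have h: "h z = u (x + p + fst z) + u (x + q + snd z) - 2 * u (x + (1/2) *\<^sub>R (p + q) + (1/2) *\<^sub>R (fst z + snd z))" for z
    proof -
      have "fst (z + (x + p, x + q)) + snd (z + (x + p, x + q)) = (x + (p + fst z)) + (x + (q + snd z))"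
        by (simp add: add_ac)
      then have "(1/2) *\<^sub>R (fst (z + (x + p, x + q)) + snd (z + (x + p, x + q))) =
         x + (1/2) *\<^sub>R ((p + fst z) + (q + snd z))"
        by (simp only: half_scaleR_shift)
      also have "(p + fst z) + (q + snd z) = (p + q) + (fst z + snd z)" by (simp add: add_ac)
      also have "x + (1/2) *\<^sub>R ((p + q) + (fst z + snd z)) = x + (1/2) *\<^sub>R (p + q) + (1/2) *\<^sub>R (fst z + snd z)"
        by (simp only: scaleR_add_right add.assoc)
      finally show ?thesis by (simp add: h_def mid_defect_def add_ac)
    qed
    have "(LINT z:?B \<times> ?B|lborel. h z) = V * (V * avg u \<rho> (x + p)) + V * (V * avg u \<rho> (x + q)) - 2 * (\<mu> ((1/2) *\<^sub>R (p + q)) * V\<^sup>2)"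
    proof -
      have "(LINT z:?B \<times> ?B|lborel. h z) = (LINT z:?B \<times> ?B|lborel. u (x + p + fst z)) + (LINT z:?B \<times> ?B|lborel. u (x + q + snd z))
          - 2 * (LINT z:?B \<times> ?B|lborel. u (x + (1/2) *\<^sub>R (p + q) + (1/2) *\<^sub>R (fst z + snd z)))"
        unfolding h
        by (subst set_integral_add set_integral_diff set_integral_mult_right,
            auto intro!: set_integrable_compact cB continuous_intros continuous_on_cc[OF u] set_integral_add)+
      then show ?thesis unfolding 1 2 using V by (simp add: \<mu>_def)
    qed
    also have "\<dots> = V\<^sup>2 * (avg u \<rho> (x + p) + avg u \<rho> (x + q) - 2 * \<mu> ((1/2) *\<^sub>R (p + q)))"
      by (simp add: power2_eq_square algebra_simps)
    finally have int: "(LINT z:?B \<times> ?B|lborel. h z) = V\<^sup>2 * (avg u \<rho> (x + p) + avg u \<rho> (x + q) - 2 * \<mu> ((1/2) *\<^sub>R (p + q)))" .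
    have VV: "measure lborel (?B \<times> ?B) = V\<^sup>2"
    proof -
      have "measure lborel (?B \<times> ?B) = (LINT z:?B \<times> ?B|lborel. 1)" using set_integral_const_lborel[OF cB, of 1] by simp
      also have "\<dots> = V\<^sup>2" using set_integral_Times(1)[of "\<lambda>z. 1" ?B ?B]
        by (simp add: set_integral_const_lborel V_def power2_eq_square)
      finally show ?thesis .
    qed
    have "(V\<^sup>2 * (avg u \<rho> (x + p) + avg u \<rho> (x + q) - 2 * \<mu> ((1/2) *\<^sub>R (p + q))))\<^sup>2 \<le> V\<^sup>2 * (LINT z:?B \<times> ?B|lborel. (h z)\<^sup>2)"
      using set_integral_square_le[OF cB ch] by (simp add: int VV)
    \<comment> \<open>As \<open>norm p\<close> and \<open>norm q\<close> are at most
      \<open>\<rho>\<close>, the shift carries the product of \<open>\<rho>\<close>-balls into the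
      product of \<open>2 * \<rho>\<close>-balls around \<open>x\<close>.\<close>
    also have "(LINT z:?B \<times> ?B|lborel. (h z)\<^sup>2) \<le> jensen_energy u x (2 * \<rho>)"
    proof -
      let ?C = "cball x (2 * \<rho>)"
      have "jensen_energy u x (2 * \<rho>) = (LINT z:{z. z + (x + p, x + q) \<in> ?C \<times> ?C}|lborel. (h z)\<^sup>2)"
        unfolding jensen_energy_def h_def
        by (rule set_integral_translate) (auto intro!: borel_measurable_continuous_onI continuous_intros continuous_on_mid_defect[OF u] borel_compact compact_Times)
      moreover have "(LINT z:?B \<times> ?B|lborel. (h z)\<^sup>2) \<le> (LINT z:{z. z + (x + p, x + q) \<in> ?C \<times> ?C}|lborel. (h z)\<^sup>2)"
      proof (rule set_integral_mono_set)
        have "{z. z + (x + p, x + q) \<in> ?C \<times> ?C} = (\<lambda>z. - (x + p, x + q) + z) ` (?C \<times> ?C)"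
          by (auto simp: image_iff algebra_simps intro!: bexI[of _ "_ + (x + p, x + q)"])
        then have "compact {z. z + (x + p, x + q) \<in> ?C \<times> ?C}"
          by (simp only:, intro compact_translation compact_Times) auto
        then show "set_integrable lborel {z. z + (x + p, x + q) \<in> ?C \<times> ?C} (\<lambda>z. (h z)\<^sup>2)"
          by (intro set_integrable_compact continuous_intros continuous_on_subset[OF ch]) auto
        show "?B \<times> ?B \<in> sets lborel" using cB by (simp add: borel_compact)
        have "norm (- s - p) \<le> 2 * \<rho>" "norm (- s - q) \<le> 2 * \<rho>" if "norm s \<le> \<rho>" for s
          using norm_triangle_ineq4[of "-s" p] norm_triangle_ineq4[of "-s" q] that p q by auto
        then show "?B \<times> ?B \<subseteq> {z. z + (x + p, x + q) \<in> ?C \<times> ?C}"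
          by (auto simp: dist_norm norm_minus_commute[of x] add.assoc[symmetric] add.commute[of x])
      qed auto
      ultimately show ?thesis by simp
    qed
    finally have "(V\<^sup>2 * (avg u \<rho> (x + p) + avg u \<rho> (x + q) - 2 * \<mu> ((1/2) *\<^sub>R (p + q))))\<^sup>2 \<le> V\<^sup>2 * jensen_energy u x (2 * \<rho>)"
      using V by simp
    then have "V\<^sup>2 * ((V * (avg u \<rho> (x + p) + avg u \<rho> (x + q) - 2 * \<mu> ((1/2) *\<^sub>R (p + q))))\<^sup>2) \<le> V\<^sup>2 * jensen_energy u x (2 * \<rho>)"
      by (simp add: power_mult_distrib power2_eq_square algebra_simps)
    then have "(V * (avg u \<rho> (x + p) + avg u \<rho> (x + q) - 2 * \<mu> ((1/2) *\<^sub>R (p + q))))\<^sup>2 \<le> jensen_energy u x (2 * \<rho>)"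
      using V by simp
    then have "\<bar>V * (avg u \<rho> (x + p) + avg u \<rho> (x + q) - 2 * \<mu> ((1/2) *\<^sub>R (p + q)))\<bar> \<le> sqrt (jensen_energy u x (2 * \<rho>))"
      by (simp add: real_le_rsqrt)
    then show ?thesis using V by (simp add: abs_mult pos_le_divide_eq mult.commute)
  qed
  \<comment> \<open>The same estimate for the coinciding pair \<open>(m, m)\<close> compares
    \<open>\<mu> m\<close> with \<open>avg u \<rho> (x + m)\<close>.\<close>
  define m where "m = (1/2) *\<^sub>R (p + q)"
  have nm: "norm m \<le> \<rho>" using norm_triangle_ineq[of p q] p q by (simp add: m_def)
  have mm: "(1/2) *\<^sub>R (m + m) = m" using half_scaleR_shift[of m 0 0] by simp
  show ?thesis
    using main[OF p q] main[OF nm nm] unfolding mm m_def[symmetric] by linarith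
qed

text \<open>The averages of \<open>u\<close> satisfy an approximate Jensen equation pointwise, so
  \<open>approx_Jensen_ball\<close> makes them nearly affine; \<open>u\<close> differs from a
  combination of averages only by an averaged defect. In the constant, 1 stands for that defect and
  \<open>(16 * DIM('a))\<^sup>2\<close> for the averages, where \<open>\<delta>\<close> contains a
  factor 2; the outer 2 splits the square of the sum.\<close>

lemma Whitney_affine:
  fixes u :: "'a::euclidean_space \<Rightarrow> real"
  assumes u: "u \<in> cc" and \<rho>: "\<rho> > 0"
  shows "\<exists>a b. (LINT y:cball x \<rho>|lborel. (u y - (a \<bullet> y + b))\<^sup>2)
     \<le> 2 * (1 + (16 * DIM('a))\<^sup>2) * jensen_energy u x (2 * \<rho>) / measure lborel (cball (0::'a) \<rho>)"
proof -
  let ?B = "cball (0::'a) \<rho>" and ?C = "cball (0::'a) (2 * \<rho>)"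
  define V where "V = measure lborel ?B"
  define W where "W = measure lborel ?C"
  define E where "E = jensen_energy u x (2 * \<rho>)"
  have V: "V > 0" using \<rho> by (simp add: V_def content_cball_pos)
  have WV: "W = 2 ^ DIM('a) * V" using content_cball_mult[of 2 \<rho> 0] \<rho> by (simp add: W_def V_def)
  have W: "W > 0" "V \<le> W" using V by (auto simp: WV)
  define \<delta> where "\<delta> = 2 * (sqrt E / V)"
  have E0: "E \<ge> 0" unfolding E_def jensen_energy_def by (rule set_integral_nonneg_real) simp
  obtain K where K: "\<And>y. \<bar>u y\<bar> \<le> K"
  proof -
    obtain r where r: "r > 0" "\<And>x. norm x > r \<Longrightarrow> u x = 0" using cc_support[OF u] by blast
    have "compact (u ` cball 0 r)"
      by (rule compact_continuous_image[OF continuous_on_subset[OF cc_continuous[OF u]]]) auto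
    then obtain K where K: "\<And>y. y \<in> cball 0 r \<Longrightarrow> \<bar>u y\<bar> \<le> K"
      using compact_imp_bounded bounded_iff[of "u ` cball 0 r"] by (metis image_eqI real_norm_def)
    have "\<bar>u y\<bar> \<le> max K 0" for y
      using K[of y] r(2)[of y] by (cases "norm y \<le> r") auto
    then show thesis using that by blast
  qed
  have "\<exists>a. \<forall>y. norm y \<le> \<rho> \<longrightarrow> \<bar>avg u \<rho> (x + y) - avg u \<rho> (x + 0) - a \<bullet> y\<bar> \<le> 4 * DIM('a) * \<delta>"
  proof (rule approx_Jensen_ball[OF \<rho>])
    show "\<bar>avg u \<rho> (x + p) + avg u \<rho> (x + q) - 2 * avg u \<rho> (x + (1/2) *\<^sub>R (p + q))\<bar> \<le> \<delta>"
      if "norm p \<le> \<rho>" "norm q \<le> \<rho>" for p q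
      using avg_Jensen[OF u \<rho> that] by (simp add: \<delta>_def V_def E_def)
    show "\<bar>avg u \<rho> (x + y)\<bar> \<le> K" for y
    proof -
      have "\<bar>LINT s:?B|lborel. u (x + y + s)\<bar> \<le> (LINT s:?B|lborel. \<bar>u (x + y + s)\<bar>)"
        by (rule set_integral_norm_bound[where 'a=real and f="\<lambda>s. u (x + y + s)", unfolded real_norm_def])
          (intro set_integrable_compact continuous_on_cc[OF u] continuous_intros; simp)
      also have "\<dots> \<le> (LINT s:?B|lborel. K)"
        by (rule set_integral_mono) (use K in \<open>auto intro!: set_integrable_compact continuous_on_cc[OF u] continuous_intros\<close>)
      also have "\<dots> = V * K" by (simp add: set_integral_const_lborel V_def)
      finally show ?thesis using V by (simp add: avg_def V_def[symmetric] field_simps)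
    qed
  qed
  then obtain a where a: "\<And>y. norm y \<le> \<rho> \<Longrightarrow> \<bar>avg u \<rho> (x + y) - avg u \<rho> x - a \<bullet> y\<bar> \<le> 4 * DIM('a) * \<delta>" by auto
  define M where "M = avg u (2 * \<rho>) x"
  define g where "g y = (LINT s:?C|lborel. mid_defect u (x + y, x + s))" for y
  \<comment> \<open>Averaging the midpoint defect of \<open>(x + y, x + s)\<close> over \<open>s\<close> expresses \<open>u (x + y)\<close> by ball averages, and those are nearly affine in \<open>y\<close>.\<close>
  have g: "u (x + y) = 2 * avg u \<rho> (x + (1/2) *\<^sub>R y) - M + g y / W" for y
  proof -
    \<comment> \<open>The shift \<open>s\<close> runs over the ball of radius
      \<open>2 * \<rho>\<close> exactly so that \<open>s / 2\<close> fills the ball of radius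
      \<open>\<rho>\<close>.\<close>
    have "(LINT s:?C|lborel. u (x + (1/2) *\<^sub>R y + (1/2) *\<^sub>R s)) = 2 ^ DIM('a) * (LINT s:?B|lborel. u (x + (1/2) *\<^sub>R y + s))"
    proof -
      have "{s::'a. 2 *\<^sub>R s \<in> ?C} = ?B" by auto
      then show ?thesis
        by (subst set_integral_scale[where c=2])
          (auto intro!: borel_measurable_continuous_onI continuous_on_cc[OF u] continuous_intros)
    qed
    also have "\<dots> = W * avg u \<rho> (x + (1/2) *\<^sub>R y)" using V by (simp add: avg_def V_def[symmetric] WV)
    finally have 1: "(LINT s:?C|lborel. u (x + (1/2) *\<^sub>R y + (1/2) *\<^sub>R s)) = W * avg u \<rho> (x + (1/2) *\<^sub>R y)" .
    have "mid_defect u (x + y, x + s) = u (x + y) + u (x + s) - 2 * u (x + (1/2) *\<^sub>R y + (1/2) *\<^sub>R s)" for s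
    proof -
      have "(1/2) *\<^sub>R ((x + y) + (x + s)) = x + (1/2) *\<^sub>R y + (1/2) *\<^sub>R s"
        by (subst half_scaleR_shift) (simp add: scaleR_add_right)
      then show ?thesis by (simp add: mid_defect_def)
    qed
    then have "g y = (LINT s:?C|lborel. u (x + y)) + (LINT s:?C|lborel. u (x + s)) - 2 * (LINT s:?C|lborel. u (x + (1/2) *\<^sub>R y + (1/2) *\<^sub>R s))"
      unfolding g_def
      by (simp only:, subst set_integral_add set_integral_diff set_integral_mult_right,
            auto intro!: set_integrable_compact continuous_intros continuous_on_cc[OF u] set_integral_add)+
    then have "g y = W * u (x + y) + W * M - 2 * (W * avg u \<rho> (x + (1/2) *\<^sub>R y))"
      unfolding 1 using W by (simp add: set_integral_const_lborel W_def M_def avg_def)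
    then have "g y / W = u (x + y) + M - 2 * avg u \<rho> (x + (1/2) *\<^sub>R y)"
      using W by (simp add: field_simps)
    then show ?thesis by simp
  qed
  have cont_mid: "continuous_on UNIV (\<lambda>z. (mid_defect u (x + fst z, x + snd z))\<^sup>2)"
    by (intro continuous_intros continuous_on_mid_defect[OF u])
  \<comment> \<open>The value at \<open>y = 0\<close> of the averaged part in the formula for
    \<open>u (x + y)\<close>.\<close>
  define b where "b = 2 * avg u \<rho> x - M"
  have pt: "(u (x + y) - (a \<bullet> y + b))\<^sup>2 \<le> 2 * ((1 / W) * (LINT s:?C|lborel. (mid_defect u (x + y, x + s))\<^sup>2)) + 2 * (8 * DIM('a) * \<delta>)\<^sup>2"
    if y: "y \<in> ?B" for y
  proof -
    have "norm ((1/2) *\<^sub>R y) \<le> \<rho>" using y \<rho> by simp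
    from a[OF this] have "\<bar>2 * avg u \<rho> (x + (1/2) *\<^sub>R y) - 2 * avg u \<rho> x - a \<bullet> y\<bar> \<le> 8 * DIM('a) * \<delta>" by (simp add: abs_le_iff)
    then have "(2 * avg u \<rho> (x + (1/2) *\<^sub>R y) - 2 * avg u \<rho> x - a \<bullet> y)\<^sup>2 \<le> (8 * DIM('a) * \<delta>)\<^sup>2"
      by (metis abs_ge_zero power2_abs power_mono)
    moreover have "(g y / W)\<^sup>2 \<le> (1 / W) * (LINT s:?C|lborel. (mid_defect u (x + y, x + s))\<^sup>2)"
    proof -
      have "(g y)\<^sup>2 \<le> W * (LINT s:?C|lborel. (mid_defect u (x + y, x + s))\<^sup>2)"
        unfolding g_def W_def by (rule set_integral_square_le) (auto intro!: continuous_intros continuous_on_mid_defect[OF u])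
      then show ?thesis using W by (simp add: power_divide power2_eq_square field_simps)
    qed
    moreover have "u (x + y) - (a \<bullet> y + b) = g y / W + (2 * avg u \<rho> (x + (1/2) *\<^sub>R y) - 2 * avg u \<rho> x - a \<bullet> y)"
      using g[of y] by (simp add: b_def)
    moreover have "(s + t)\<^sup>2 \<le> 2 * s\<^sup>2 + 2 * t\<^sup>2" for s t :: real
      using zero_le_power2[of "s - t"] unfolding power2_sum power2_diff by linarith
    ultimately show ?thesis by (smt (verit))
  qed
  have Fub: "(LINT y:?B|lborel. (LINT s:?C|lborel. (mid_defect u (x + y, x + s))\<^sup>2)) \<le> E"
    and Fubi: "set_integrable lborel ?B (\<lambda>y. (LINT s:?C|lborel. (mid_defect u (x + y, x + s))\<^sup>2))"
  proof -
    show "set_integrable lborel ?B (\<lambda>y. (LINT s:?C|lborel. (mid_defect u (x + y, x + s))\<^sup>2))"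
      using set_integral_Times(2)[OF cont_mid, of ?B ?C] by simp
    have "(LINT y:?B|lborel. (LINT s:?C|lborel. (mid_defect u (x + y, x + s))\<^sup>2)) =
        (LINT z:?B \<times> ?C|lborel. (mid_defect u (x + fst z, x + snd z))\<^sup>2)"
      using set_integral_Times(1)[OF cont_mid, of ?B ?C] by simp
    also have "\<dots> \<le> (LINT z:?C \<times> ?C|lborel. (mid_defect u (x + fst z, x + snd z))\<^sup>2)"
      using \<rho> by (intro set_integral_mono_set set_integrable_compact compact_Times continuous_on_subset[OF cont_mid])
        (auto intro!: borel_compact compact_Times)
    also have "\<dots> = E"
    proof -
      have "{z::'a \<times> 'a. z + (x, x) \<in> cball x (2 * \<rho>) \<times> cball x (2 * \<rho>)} = ?C \<times> ?C"
        by (auto simp: dist_norm)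
      then show ?thesis unfolding E_def jensen_energy_def
        by (subst set_integral_translate[where z="(x, x)"])
          (auto intro!: borel_measurable_continuous_onI continuous_intros continuous_on_mid_defect[OF u] borel_compact compact_Times
            simp: add.commute plus_prod_def)
    qed
    finally show "(LINT y:?B|lborel. (LINT s:?C|lborel. (mid_defect u (x + y, x + s))\<^sup>2)) \<le> E" .
  qed
  have "(LINT y:cball x \<rho>|lborel. (u y - (a \<bullet> y + (b - a \<bullet> x)))\<^sup>2) = (LINT y:?B|lborel. (u (x + y) - (a \<bullet> y + b))\<^sup>2)"
  proof -
    have "{y. y + x \<in> cball x \<rho>} = ?B" by (auto simp: dist_norm)
    then show ?thesis
      by (subst set_integral_translate[where z=x])
        (auto intro!: borel_measurable_continuous_onI continuous_intros continuous_on_cc[OF u] simp: algebra_simps)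
  qed
  also have "\<dots> \<le> (LINT y:?B|lborel. 2 * ((1 / W) * (LINT s:?C|lborel. (mid_defect u (x + y, x + s))\<^sup>2)) + 2 * (8 * DIM('a) * \<delta>)\<^sup>2)"
  proof (rule set_integral_mono)
    show "set_integrable lborel ?B (\<lambda>y. (u (x + y) - (a \<bullet> y + b))\<^sup>2)"
      by (intro set_integrable_compact continuous_intros continuous_on_cc[OF u]) auto
    have c: "set_integrable lborel ?B (\<lambda>y. 2 * (8 * DIM('a) * \<delta>)\<^sup>2)"
      by (rule set_integrable_compact) auto
    show "set_integrable lborel ?B (\<lambda>y. 2 * ((1 / W) * (LINT s:?C|lborel. (mid_defect u (x + y, x + s))\<^sup>2)) + 2 * (8 * DIM('a) * \<delta>)\<^sup>2)"
      using Fubi c by (intro set_integral_add(1) set_integrable_mult_right) auto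
  qed (use pt in auto)
  also have "\<dots> = 2 * ((1 / W) * (LINT y:?B|lborel. (LINT s:?C|lborel. (mid_defect u (x + y, x + s))\<^sup>2))) + V * (2 * (8 * DIM('a) * \<delta>)\<^sup>2)"
  proof -
    have c: "set_integrable lborel ?B (\<lambda>y. 2 * (8 * DIM('a) * \<delta>)\<^sup>2)"
      by (rule set_integrable_compact) auto
    show ?thesis using Fubi c
      by (subst set_integral_add) (auto simp: set_integral_const_lborel V_def)
  qed
  also have "\<dots> \<le> 2 * ((1 / V) * E) + V * (2 * (8 * DIM('a) * \<delta>)\<^sup>2)"
  proof -
    have "(1 / W) * (LINT y:?B|lborel. (LINT s:?C|lborel. (mid_defect u (x + y, x + s))\<^sup>2)) \<le> (1 / V) * E"
      using Fub W V E0 by (intro mult_mono) (auto simp: field_simps intro!: set_integral_nonneg_real)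
    then show ?thesis by simp
  qed
  also have "\<dots> = 2 * (1 + (16 * DIM('a))\<^sup>2) * E / V"
    using V E0 by (simp add: \<delta>_def power_mult_distrib power_divide field_simps) (simp add: power2_eq_square)
  finally show ?thesis unfolding E_def V_def by blast
qed

section \<open>Shape regularity and the sizes of the tetrahedra\<close>

section \<open>Geometry of a tetrahedron\<close>

text \<open>Six times the signed volume.\<close>

definition tri :: "real^3 \<Rightarrow> real^3 \<Rightarrow> real^3 \<Rightarrow> real^3 \<Rightarrow> real" where
  "tri a b c d = (b - a) \<bullet> cross3 (c - a) (d - a)"

text \<open>Angles are bounded from below only, and an angle near \<open>pi\<close> also has a small
  sine. The sign condition makes the angle at most \<open>pi / 2\<close>, where the lower bound does
  control the cosine.\<close>

lemma angle_bound:
  fixes v w :: "real^3"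
  assumes \<theta>: "0 < \<theta>" "\<theta> \<le> vec_angle v w" and vw: "0 \<le> v \<bullet> w"
  shows "(v \<bullet> w)\<^sup>2 \<le> (cos \<theta>)\<^sup>2 * ((norm v)\<^sup>2 * (norm w)\<^sup>2)" "\<theta> \<le> pi / 2"
proof -
  define y where "y = (v \<bullet> w) / (norm v * norm w)"
  have y: "0 \<le> y" "y \<le> 1"
  proof -
    show "0 \<le> y" using vw by (simp add: y_def)
    show "y \<le> 1" using norm_cauchy_schwarz[of v w]
      by (cases "norm v * norm w = 0") (auto simp: y_def divide_le_eq_1 less_le)
  qed
  have \<theta>y: "\<theta> \<le> arccos y" using \<theta> by (simp add: vec_angle_def y_def)
  have "arccos y \<le> pi / 2" using y by (intro arccos_le_pi2) auto
  then show \<theta>2: "\<theta> \<le> pi / 2" using \<theta>y by simp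
  have "y \<le> cos \<theta>"
    using \<theta>y \<theta> y arccos_ubound[of y] cos_mono_le_eq[of "arccos y" \<theta>] arccos_lbound[of y] cos_arccos[of y] \<theta>2 by auto
  then have "y\<^sup>2 \<le> (cos \<theta>)\<^sup>2" using y by (intro power_mono)
  then have "y\<^sup>2 * ((norm v)\<^sup>2 * (norm w)\<^sup>2) \<le> (cos \<theta>)\<^sup>2 * ((norm v)\<^sup>2 * (norm w)\<^sup>2)"
    by (rule mult_right_mono) simp
  moreover have "y\<^sup>2 * ((norm v)\<^sup>2 * (norm w)\<^sup>2) = (v \<bullet> w)\<^sup>2"
    by (auto simp: y_def power_divide power_mult_distrib)
  ultimately show "(v \<bullet> w)\<^sup>2 \<le> (cos \<theta>)\<^sup>2 * ((norm v)\<^sup>2 * (norm w)\<^sup>2)" by simp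
qed

lemma cross_angle_bound:
  fixes v w :: "real^3"
  assumes "(v \<bullet> w)\<^sup>2 \<le> (cos \<theta>)\<^sup>2 * ((norm v)\<^sup>2 * (norm w)\<^sup>2)"
  shows "(sin \<theta>)\<^sup>2 * ((norm v)\<^sup>2 * (norm w)\<^sup>2) \<le> (norm (cross3 v w))\<^sup>2"
proof -
  have "(norm (cross3 v w))\<^sup>2 = (norm v)\<^sup>2 * (norm w)\<^sup>2 - (v \<bullet> w)\<^sup>2"
    using norm_cross_dot[of v w] by (simp add: power_mult_distrib)
  moreover have "(sin \<theta>)\<^sup>2 = 1 - (cos \<theta>)\<^sup>2" by (simp add: sin_squared_eq)
  ultimately show ?thesis using assms by (simp add: left_diff_distrib)
qed

text \<open>The Binet-Cauchy identity: the dihedral angle at the edge \<open>e\<close> equals the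
  angle between the face normals \<open>cross3 e f\<close> and \<open>cross3 e g\<close>.\<close>

lemma orth_part_inner:
  fixes e f g :: "real^3"
  assumes "e \<noteq> 0"
  shows "(e \<bullet> e) * (orth_part e f \<bullet> orth_part e g) = cross3 e f \<bullet> cross3 e g"
proof -
  have "orth_part e f \<bullet> orth_part e g = f \<bullet> g - (f \<bullet> e) * (g \<bullet> e) / (e \<bullet> e)"
    using assms by (simp add: orth_part_def inner_diff_left inner_diff_right inner_commute)
  then have "(e \<bullet> e) * (orth_part e f \<bullet> orth_part e g) = (e \<bullet> e) * (f \<bullet> g) - (f \<bullet> e) * (g \<bullet> e)"
    using assms by (simp add: field_simps)
  also have "\<dots> = cross3 e f \<bullet> cross3 e g"
    by (simp add: cross3_simps)
  finally show ?thesis .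
qed

lemma cross_cross_common: "cross3 (cross3 e f) (cross3 e g) = (e \<bullet> cross3 f g) *\<^sub>R e"
  by (simp add: cross3_simps forall_3)

text \<open>\<open>cross_angle_bound\<close> is applied to the two face normals; their cross product
  is the common edge times \<open>tri\<close>, so an acute dihedral angle bounds the volume from
  below by the two face areas.\<close>

lemma dihedral_bound:
  fixes p q r d :: "real^3"
  assumes \<theta>: "0 < \<theta>" "\<theta> \<le> dihedral_angle p q r d" and pq: "p \<noteq> q"
    and n: "0 \<le> cross3 (q - p) (r - p) \<bullet> cross3 (q - p) (d - p)"
  shows "(sin \<theta>)\<^sup>2 * ((norm (cross3 (q - p) (r - p)))\<^sup>2 * (norm (cross3 (q - p) (d - p)))\<^sup>2)
     \<le> (tri p q r d)\<^sup>2 * (norm (q - p))\<^sup>2"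
proof -
  define e f g where "e = q - p" and "f = r - p" and "g = d - p"
  have e: "e \<noteq> 0" using pq by (simp add: e_def)
  then have ee: "e \<bullet> e > 0" by simp
  note [simp] = e_def[symmetric] f_def[symmetric] g_def[symmetric]
  let ?of = "orth_part e f" and ?og = "orth_part e g"
  have ofg: "?of \<bullet> ?og \<ge> 0" using orth_part_inner[OF e, of f g] n ee
    by (metis e_def f_def g_def zero_le_mult_iff not_le)
  have "(?of \<bullet> ?og)\<^sup>2 \<le> (cos \<theta>)\<^sup>2 * ((norm ?of)\<^sup>2 * (norm ?og)\<^sup>2)"
    using angle_bound(1)[OF \<theta>(1), of ?of ?og] \<theta>(2) ofg by (simp add: dihedral_angle_def)
  then have "(e \<bullet> e)\<^sup>2 * (?of \<bullet> ?og)\<^sup>2 \<le> (e \<bullet> e)\<^sup>2 * ((cos \<theta>)\<^sup>2 * ((norm ?of)\<^sup>2 * (norm ?og)\<^sup>2))"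
    by (rule mult_left_mono) simp
  also have "(e \<bullet> e)\<^sup>2 * (?of \<bullet> ?og)\<^sup>2 = (cross3 e f \<bullet> cross3 e g)\<^sup>2"
    by (simp flip: power_mult_distrib add: orth_part_inner[OF e])
  also have "(e \<bullet> e)\<^sup>2 * ((cos \<theta>)\<^sup>2 * ((norm ?of)\<^sup>2 * (norm ?og)\<^sup>2)) =
      (cos \<theta>)\<^sup>2 * (((e \<bullet> e) * (norm ?of)\<^sup>2) * ((e \<bullet> e) * (norm ?og)\<^sup>2))"
    by (simp add: power2_eq_square)
  also have "\<dots> = (cos \<theta>)\<^sup>2 * ((norm (cross3 e f))\<^sup>2 * (norm (cross3 e g))\<^sup>2)"
    by (simp add: power2_norm_eq_inner orth_part_inner[OF e])
  finally have "(sin \<theta>)\<^sup>2 * ((norm (cross3 e f))\<^sup>2 * (norm (cross3 e g))\<^sup>2) \<le> (norm (cross3 (cross3 e f) (cross3 e g)))\<^sup>2"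
    by (rule cross_angle_bound)
  then show ?thesis by (simp add: cross_cross_common tri_def power_mult_distrib)
qed

text \<open>An edge \<open>a b\<close> at least as long as \<open>b c\<close> makes the face angle
  at \<open>a\<close> acute, so the base has area of order \<open>D\<^sup>2\<close>. Of the three
  other faces one meets the base at an acute dihedral angle with comparable area, and the dihedral
  bound at that edge gives the volume.\<close>

lemma tri_lower_longest:
  fixes a b c d :: "real^3"
  assumes \<theta>: "0 < \<theta>" and dist: "distinct [a, b, c, d]"
    and face: "\<theta> \<le> face_angle a b c"
    and dih: "\<theta> \<le> dihedral_angle a b c d" "\<theta> \<le> dihedral_angle b c a d" "\<theta> \<le> dihedral_angle c a b d"
    and long: "norm (c - b) \<le> norm (b - a)" "norm (c - a) \<le> norm (b - a)" "norm (b - a) \<le> 2 * norm (c - a)"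
  shows "(sin \<theta>)^3 * (norm (b - a))^3 / 12 \<le> \<bar>tri a b c d\<bar>"
proof -
  define D where "D = norm (b - a)"
  have D: "D > 0" using dist by (auto simp: D_def)
  define n where "n = cross3 (b - a) (c - a)"
  \<comment> \<open>The law of cosines: the side opposite to \<open>a\<close> is not longer than
    \<open>a b\<close>.\<close>
  have "(norm (c - b))\<^sup>2 = (norm (c - a))\<^sup>2 + (norm (b - a))\<^sup>2 - 2 * ((b - a) \<bullet> (c - a))"
    by (simp add: power2_norm_eq_inner inner_diff_left inner_diff_right inner_commute)
  moreover have "(norm (c - b))\<^sup>2 \<le> (norm (b - a))\<^sup>2" using long by (intro power_mono) auto
  moreover have "0 \<le> (norm (c - a))\<^sup>2" by simp
  ultimately have inn: "0 \<le> (b - a) \<bullet> (c - a)" by linarith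
  have \<theta>2: "\<theta> \<le> pi / 2" using angle_bound(2)[OF \<theta> _ inn] face by (simp add: face_angle_def)
  then have s: "sin \<theta> > 0" using \<theta> pi_gt_zero by (intro sin_gt_zero) linarith+
  have "(sin \<theta>)\<^sup>2 * (D\<^sup>2 * (norm (c - a))\<^sup>2) \<le> (norm n)\<^sup>2"
    unfolding n_def D_def using angle_bound(1)[OF \<theta> _ inn] face by (intro cross_angle_bound) (auto simp: face_angle_def)
  then have "(sin \<theta> * (D * norm (c - a)))\<^sup>2 \<le> (norm n)\<^sup>2" by (simp add: power_mult_distrib)
  then have "sin \<theta> * (D * norm (c - a)) \<le> norm n" by (rule power2_le_imp_le) simp
  moreover have "sin \<theta> * (D * (D / 2)) \<le> sin \<theta> * (D * norm (c - a))"
    using long s D by (intro mult_left_mono) (auto simp: D_def)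
  ultimately have nD: "sin \<theta> * D\<^sup>2 / 2 \<le> norm n" by (simp add: power2_eq_square)
  then have n0: "norm n > 0" using s D by (smt (verit) divide_pos_pos mult_pos_pos zero_less_power)
  \<comment> \<open>The argument for one base edge \<open>p q\<close>. The constant is
    \<open>12 = 2 * 2 * 3\<close>: the area bound with its factor 1/2 enters twice, and the adjacent
    face has at least a third of the base.\<close>
  have step: "(sin \<theta>)^3 * D^3 / 12 \<le> \<bar>tri a b c d\<bar>"
    if pq: "\<theta> \<le> dihedral_angle p q r d" "p \<noteq> q" "norm (q - p) \<le> D" "cross3 (q - p) (r - p) = n" "\<bar>tri p q r d\<bar> = \<bar>tri a b c d\<bar>"
      and big: "(norm n)\<^sup>2 / 3 \<le> n \<bullet> cross3 (q - p) (d - p)" for p q r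
  proof -
    let ?m = "cross3 (q - p) (d - p)"
    have "(norm n)\<^sup>2 / 3 \<le> norm n * norm ?m" using big norm_cauchy_schwarz[of n ?m] by linarith
    then have m: "norm n / 3 \<le> norm ?m" using n0 by (simp add: power2_eq_square field_simps)
    have "0 \<le> n \<bullet> ?m" using big by (smt (verit) divide_nonneg_nonneg zero_le_power2)
    then have "(sin \<theta>)\<^sup>2 * ((norm n)\<^sup>2 * (norm ?m)\<^sup>2) \<le> (tri a b c d)\<^sup>2 * (norm (q - p))\<^sup>2"
      using dihedral_bound[OF \<theta> pq(1,2)] pq(4,5) by (metis power2_abs)
    then have "(sin \<theta> * (norm n * norm ?m))\<^sup>2 \<le> (\<bar>tri a b c d\<bar> * norm (q - p))\<^sup>2"
      by (simp add: power_mult_distrib)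
    then have "sin \<theta> * (norm n * norm ?m) \<le> \<bar>tri a b c d\<bar> * norm (q - p)" by (rule power2_le_imp_le) simp
    also have "\<dots> \<le> \<bar>tri a b c d\<bar> * D" using pq by (intro mult_left_mono) auto
    finally have 1: "sin \<theta> * (norm n * norm ?m) \<le> \<bar>tri a b c d\<bar> * D" .
    have "sin \<theta> * ((sin \<theta> * D\<^sup>2 / 2) * ((sin \<theta> * D\<^sup>2 / 2) / 3)) \<le> sin \<theta> * (norm n * norm ?m)"
      using nD m s by (intro mult_left_mono mult_mono) auto
    with 1 have "sin \<theta> * ((sin \<theta> * D\<^sup>2 / 2) * ((sin \<theta> * D\<^sup>2 / 2) / 3)) \<le> \<bar>tri a b c d\<bar> * D" by linarith
    then have "((sin \<theta>)^3 * D^3 / 12) * D \<le> \<bar>tri a b c d\<bar> * D"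
      by (simp add: power2_eq_square power3_eq_cube algebra_simps)
    then show ?thesis using D by (rule mult_right_le_imp_le)
  qed
  \<comment> \<open>The area vectors of a closed surface sum to zero, so the base normal is the sum
    of the other three with suitable orientation; one of them has at least a third of the component
    along \<open>n\<close>, and in particular an acute angle with it.\<close>
  have "n = cross3 (b - a) (d - a) + cross3 (c - b) (d - b) + cross3 (a - c) (d - c)"
    by (simp add: n_def cross3_simps forall_3)
  then have "n \<bullet> n = n \<bullet> cross3 (b - a) (d - a) + n \<bullet> cross3 (c - b) (d - b) + n \<bullet> cross3 (a - c) (d - c)"
    by (metis inner_add_right)
  then consider "(norm n)\<^sup>2 / 3 \<le> n \<bullet> cross3 (b - a) (d - a)" | "(norm n)\<^sup>2 / 3 \<le> n \<bullet> cross3 (c - b) (d - b)"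
    | "(norm n)\<^sup>2 / 3 \<le> n \<bullet> cross3 (a - c) (d - c)"
    unfolding power2_norm_eq_inner by linarith
  then have "(sin \<theta>)^3 * D^3 / 12 \<le> \<bar>tri a b c d\<bar>"
  proof cases
    case 1
    then show ?thesis by (intro step[of a b c]) (use dih dist in \<open>auto simp: n_def D_def\<close>)
  next
    case 2
    have "cross3 (c - b) (a - b) = n" "tri b c a d = tri a b c d"
      by (simp_all add: n_def tri_def cross3_simps forall_3)
    then show ?thesis using long dist by (intro step[OF dih(2) _ _ _ _ 2]) (auto simp: D_def)
  next
    case 3
    have "cross3 (a - c) (b - c) = n" "tri c a b d = tri a b c d"
      by (simp_all add: n_def tri_def cross3_simps forall_3)
    moreover have "norm (a - c) \<le> D" using long by (simp add: D_def norm_minus_commute)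
    ultimately show ?thesis using dist by (intro step[OF dih(3) _ _ _ _ 3]) auto
  qed
  then show ?thesis by (simp add: D_def)
qed

lemma vol_tetra:
  assumes "distinct [a, b, c, d]"
  shows "measure lborel (convex hull {a, b, c, d}) = \<bar>tri a b c d\<bar> / 6"
proof -
  define f :: "3 \<Rightarrow> real^3" where "f = (\<lambda>i. if i = 1 then b else if i = 2 then c else d)"
  have bij: "bij_betw f UNIV ({a, b, c, d} - {a})"
    unfolding bij_betw_def inj_on_def UNIV_3 using assms by (auto simp: f_def)
  have "measure lborel (convex hull {a, b, c, d}) = \<bar>det (\<chi> i j. f j $ i - a $ i)\<bar> / fact CARD(3)"
    by (rule content_simplex[OF _ _ _ bij]) (use assms in auto)
  also have "det (\<chi> i j. f j $ i - a $ i) = tri a b c d"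
    by (simp add: tri_def f_def cross3_simps)
  finally show ?thesis by (simp add: fact_numeral)
qed

lemma tetra_corners:
  assumes "tetrahedron \<tau>"
  obtains a b c d where "distinct [a, b, c, d]" "\<tau> = convex hull {a, b, c, d}" "corners \<tau> = {a, b, c, d}"
    "tri a b c d \<noteq> 0"
proof -
  obtain C where C: "\<not> affine_dependent C" "int (card C) = 3 + 1" "\<tau> = convex hull C"
    using assms unfolding simplex_def by blast
  then have "card C = 4" by linarith
  then obtain a b c d where abcd: "C = {a, b, c, d}" "distinct [a, b, c, d]"
    by (auto simp: card_Suc_eq eval_nat_numeral)
  have cor: "corners \<tau> = {a, b, c, d}"
    using extreme_point_of_convex_hull_affine_independent[OF C(1)] C(3) abcd by (auto simp: corners_def)
  have "affine hull \<tau> = UNIV"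
    using aff_dim_simplex[OF assms] by (simp flip: aff_dim_eq_full)
  then have "rel_interior \<tau> = interior \<tau>" by (rule rel_interior_interior)
  moreover have "rel_interior \<tau> \<noteq> {}"
    using convex_simplex[OF assms] C(3) abcd by (subst rel_interior_eq_empty) auto
  ultimately have "interior \<tau> \<noteq> {}" by simp
  then have "\<not> negligible \<tau>"
    using open_not_negligible[of "interior \<tau>"] negligible_subset[OF _ interior_subset] by blast
  then have "measure lborel \<tau> \<noteq> 0"
    using compact_simplex[OF assms] lmeasurable_compact[of \<tau>]
    by (simp add: negligible_iff_measure compact_imp_closed)
  then have "tri a b c d \<noteq> 0" using vol_tetra[OF abcd(2)] C abcd by auto
  then show thesis using that abcd C cor by blast
qed

lemma tri_not_distinct: "\<not> distinct [a, b, c, d] \<Longrightarrow> tri a b c d = 0"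
  by (auto simp: tri_def cross3_simps)

lemma vol_tetra_tri: "tri a b c d \<noteq> 0 \<Longrightarrow> measure lborel (convex hull {a, b, c, d}) = \<bar>tri a b c d\<bar> / 6"
  using tri_not_distinct vol_tetra by blast

lemma tetrahedron_eq_hull: "tetrahedron \<tau> \<Longrightarrow> \<tau> = convex hull (corners \<tau>)"
  by (metis tetra_corners)

lemma tetrahedron_vol_pos: "tetrahedron \<tau> \<Longrightarrow> 0 < measure lborel \<tau>"
  by (metis tetra_corners vol_tetra_tri zero_less_abs_iff zero_less_divide_iff zero_less_numeral)

lemma finite_corners: "tetrahedron \<tau> \<Longrightarrow> finite (corners \<tau>)"
  by (metis tetra_corners finite.emptyI finite.insertI)

lemma corners_subset: "corners \<tau> \<subseteq> \<tau>"
  by (auto simp: corners_def extreme_point_of_def)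

lemma dist_convex_hull_le:
  fixes C :: "'a::real_normed_vector set"
  assumes "\<And>p q. p \<in> C \<Longrightarrow> q \<in> C \<Longrightarrow> dist p q \<le> D" "x \<in> convex hull C" "y \<in> convex hull C"
  shows "dist x y \<le> D"
proof -
  have "convex hull C \<subseteq> cball c D" if "c \<in> C" for c
    by (rule hull_minimal) (use assms(1) that convex_cball in auto)
  then have "C \<subseteq> cball x D" using assms(2) by (force simp: dist_commute)
  then have "convex hull C \<subseteq> cball x D" by (rule hull_minimal) (rule convex_cball)
  then show ?thesis using assms(3) by auto
qed

lemma tetra_edge_choice:
  assumes \<tau>: "tetrahedron \<tau>" and pq: "p \<in> corners \<tau>" "q \<in> corners \<tau>" "p \<noteq> q"
  obtains r s where "distinct [p, q, r, s]" "corners \<tau> = {p, q, r, s}" "tri p q r s \<noteq> 0"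
proof -
  obtain a b c d where abcd: "distinct [a, b, c, d]" "\<tau> = convex hull {a, b, c, d}" "corners \<tau> = {a, b, c, d}" "tri a b c d \<noteq> 0"
    using tetra_corners[OF \<tau>] by blast
  have "\<exists>r s. distinct [p, q, r, s] \<and> {a, b, c, d} = {p, q, r, s}"
  proof -
    have "card ({a, b, c, d} - {p, q}) = 2"
      using abcd pq by (subst card_Diff_subset) auto
    then obtain r s where rs: "{a, b, c, d} - {p, q} = {r, s}" "r \<noteq> s" by (auto simp: card_2_iff)
    then have "{a, b, c, d} = {p, q, r, s}" using pq abcd(3) by blast
    moreover have "distinct [p, q, r, s]" using rs pq by auto
    ultimately show ?thesis by blast
  qed
  then obtain r s where rs: "distinct [p, q, r, s]" "{a, b, c, d} = {p, q, r, s}" by blast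
  have "tri p q r s \<noteq> 0"
    using vol_tetra[OF rs(1)] vol_tetra[OF abcd(1)] abcd(4) rs(2) by auto
  then show thesis using that rs abcd(3) by blast
qed

text \<open>\<open>D\<close> is the length of the longest edge, and a convex hull has the diameter
  of its vertex set. The 72 is the 12 of the bound on \<open>tri\<close> times the 6 between
  \<open>tri\<close> and the volume.\<close>

lemma tetra_shape:
  assumes \<tau>: "tetrahedron \<tau>" and \<theta>: "0 < \<theta>" "\<And>\<alpha>. \<alpha> \<in> interior_angles \<tau> \<Longrightarrow> \<theta> \<le> \<alpha>"
  obtains D where "D > 0" "\<And>x y. x \<in> \<tau> \<Longrightarrow> y \<in> \<tau> \<Longrightarrow> dist x y \<le> D" "sin \<theta> ^ 3 * D ^ 3 / 72 \<le> measure lborel \<tau>"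
proof -
  let ?C = "corners \<tau>"
  have ne: "?C \<noteq> {}" and fin: "finite ?C" using tetra_corners[OF \<tau>] finite_corners[OF \<tau>] by auto
  obtain w where w: "w \<in> ?C \<times> ?C" "\<And>v. v \<in> ?C \<times> ?C \<Longrightarrow> dist (fst v) (snd v) \<le> dist (fst w) (snd w)"
  proof -
    let ?I = "(\<lambda>v. dist (fst v) (snd v)) ` (?C \<times> ?C)"
    have I: "finite ?I" "?I \<noteq> {}" using ne fin by auto
    from Max_in[OF I] obtain w where w: "w \<in> ?C \<times> ?C" "Max ?I = dist (fst w) (snd w)" by (rule imageE)
    have "dist (fst v) (snd v) \<le> Max ?I" if "v \<in> ?C \<times> ?C" for v
      by (rule Max_ge[OF I(1)], rule imageI, rule that)
    then show thesis using that[OF w(1)] w(2) by simp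
  qed
  define P Q where "P = fst w" and "Q = snd w"
  have PQ: "P \<in> ?C" "Q \<in> ?C" and max: "\<And>x y. x \<in> ?C \<Longrightarrow> y \<in> ?C \<Longrightarrow> dist x y \<le> dist P Q"
  proof -
    show "P \<in> ?C" "Q \<in> ?C" using w(1) by (simp_all add: P_def Q_def mem_Times_iff)
    show "dist x y \<le> dist P Q" if "x \<in> ?C" "y \<in> ?C" for x y
      using w(2)[of "(x, y)"] that by (simp add: P_def Q_def)
  qed
  obtain a b c d where abcd: "distinct [a, b, c, d]" "\<tau> = convex hull {a, b, c, d}" "?C = {a, b, c, d}" "tri a b c d \<noteq> 0"
    by (rule tetra_corners[OF \<tau>])
  have "dist a b \<le> dist P Q" using max abcd by blast
  then have "P \<noteq> Q" using abcd by auto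
  obtain r s where rs: "distinct [P, Q, r, s]" "?C = {P, Q, r, s}" "tri P Q r s \<noteq> 0"
    by (rule tetra_edge_choice[OF \<tau> PQ \<open>P \<noteq> Q\<close>])
  \<comment> \<open>The third corner \<open>r\<close> keeps at least half the length of the longest
    edge from one of its ends; that end is renamed \<open>p\<close>.\<close>
  have "dist P Q \<le> dist r P + dist r Q" by (metis dist_commute dist_triangle)
  then have "dist P Q \<le> 2 * dist r P \<or> dist P Q \<le> 2 * dist r Q" by linarith
  then obtain p q where pq: "distinct [p, q, r, s]" "?C = {p, q, r, s}" "dist p q = dist P Q" "dist p q \<le> 2 * dist r p"
  proof
    assume "dist P Q \<le> 2 * dist r P" then show thesis using that[of P Q] rs by auto
  next
    assume "dist P Q \<le> 2 * dist r Q" then show thesis using that[of Q P] rs by (auto simp: dist_commute)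
  qed
  have face: "\<theta> \<le> face_angle p q r" by (rule \<theta>(2)) (use pq in \<open>auto simp: interior_angles_def\<close>)
  have di: "\<theta> \<le> dihedral_angle p' q' r' s'" if "{p', q', r', s'} \<subseteq> ?C" "distinct [p', q', r', s']" for p' q' r' s'
    by (rule \<theta>(2)) (unfold interior_angles_def, rule UnI2, use that in blast)
  have "sin \<theta> ^ 3 * (norm (q - p))^3 / 12 \<le> \<bar>tri p q r s\<bar>"
  proof (rule tri_lower_longest[OF \<theta>(1) pq(1) face])
    show "\<theta> \<le> dihedral_angle p q r s" "\<theta> \<le> dihedral_angle q r p s" "\<theta> \<le> dihedral_angle r p q s"
      by (rule di; use pq in auto)+
    show "norm (r - q) \<le> norm (q - p)" "norm (r - p) \<le> norm (q - p)" "norm (q - p) \<le> 2 * norm (r - p)"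
      using pq(3,4) max[of r q] max[of r p] pq(2) by (auto simp: dist_norm norm_minus_commute)
  qed
  then have "sin \<theta> ^ 3 * (dist p q)^3 / 72 \<le> measure lborel \<tau>"
    using vol_tetra[OF pq(1)] tetrahedron_eq_hull[OF \<tau>] pq(2) by (simp add: dist_norm norm_minus_commute)
  moreover have "dist x y \<le> dist p q" if "x \<in> \<tau>" "y \<in> \<tau>" for x y
    using dist_convex_hull_le[of ?C "dist p q" x y] max pq(3) that tetrahedron_eq_hull[OF \<tau>] by auto
  moreover have "dist p q > 0" using pq(1) by simp
  ultimately show thesis using that by blast
qed

text \<open>Cramer's rule in dimension three.\<close>

lemma vec3_representation:
  fixes f g h y :: "real^3"
  shows "(f \<bullet> cross3 g h) *\<^sub>R y = (y \<bullet> cross3 g h) *\<^sub>R f + (y \<bullet> cross3 h f) *\<^sub>R g + (y \<bullet> cross3 f g) *\<^sub>R h"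
  by (simp add: cross3_simps forall_3)

lemma norm_cross3_le: "norm (cross3 x y) \<le> norm x * norm y"
proof -
  have "(norm (cross3 x y))\<^sup>2 \<le> (norm x * norm y)\<^sup>2" using norm_cross_dot[of x y] by (smt (verit) zero_le_power2)
  then show ?thesis by (rule power2_le_imp_le) simp
qed

text \<open>At the centroid all barycentric coordinates are 1/4, and each has a gradient of length
  at most \<open>D\<^sup>2 / \<bar>tri a b c d\<bar>\<close>. Within the given radius they therefore
  change by at most 1/4 and stay nonnegative.\<close>

lemma tetra_inball:
  assumes T: "tri a b c d \<noteq> 0" and D: "\<And>x y. x \<in> {a, b, c, d} \<Longrightarrow> y \<in> {a, b, c, d} \<Longrightarrow> norm (x - y) \<le> D"
  shows "cball ((1/4) *\<^sub>R (a + b + c + d)) (\<bar>tri a b c d\<bar> / (4 * D\<^sup>2)) \<subseteq> convex hull {a, b, c, d}"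
proof
  define m where "m = (1/4) *\<^sub>R (a + b + c + d)"
  fix x assume "x \<in> cball ((1/4) *\<^sub>R (a + b + c + d)) (\<bar>tri a b c d\<bar> / (4 * D\<^sup>2))"
  then have x: "norm (x - m) \<le> \<bar>tri a b c d\<bar> / (4 * D\<^sup>2)" by (simp add: m_def dist_norm norm_minus_commute)
  define T where "T = tri a b c d"
  have T0: "T \<noteq> 0" using T by (simp add: T_def)
  have "D \<noteq> 0"
  proof
    assume "D = 0"
    then have "a = b" using D[of a b] by simp
    then show False using T by (simp add: tri_def cross3_simps)
  qed
  then have D2: "D\<^sup>2 > 0" by simp
  have D0: "D \<ge> 0" using D[of a a] by simp
  define lb lc ld where "lb = (x - a) \<bullet> cross3 (c - a) (d - a) / T" and "lc = (x - a) \<bullet> cross3 (d - a) (b - a) / T"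
    and "ld = (x - a) \<bullet> cross3 (b - a) (c - a) / T"
  have rep: "x - a = lb *\<^sub>R (b - a) + lc *\<^sub>R (c - a) + ld *\<^sub>R (d - a)"
  proof -
    have "T *\<^sub>R (x - a) = T *\<^sub>R (lb *\<^sub>R (b - a) + lc *\<^sub>R (c - a) + ld *\<^sub>R (d - a))"
      using vec3_representation[of "b - a" "c - a" "d - a" "x - a"] T0
      by (simp add: T_def[symmetric] tri_def[symmetric] lb_def lc_def ld_def scaleR_add_right)
    then show ?thesis using T0 by simp
  qed
  have bound: "\<bar>(x - m) \<bullet> cross3 u v / T\<bar> \<le> 1 / 4" if "norm u \<le> D" "norm v \<le> D" for u v
  proof -
    have "\<bar>(x - m) \<bullet> cross3 u v\<bar> \<le> norm (x - m) * norm (cross3 u v)" by (rule Cauchy_Schwarz_ineq2)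
    also have "\<dots> \<le> \<bar>T\<bar> / (4 * D\<^sup>2) * (D * D)"
      using x that D0 norm_cross3_le[of u v] mult_mono[OF that] by (intro mult_mono) (auto simp: T_def intro: order.trans)
    also have "\<dots> = \<bar>T\<bar> / 4" using \<open>D \<noteq> 0\<close> by (simp add: power2_eq_square)
    finally show ?thesis using T0 by (simp add: field_simps)
  qed
  have m4: "4 *\<^sub>R (m - a) = (b - a) + (c - a) + (d - a)"
    by (simp add: vec_eq_iff m_def)
  have m4n: "4 * ((m - a) \<bullet> n) = (b - a) \<bullet> n + (c - a) \<bullet> n + (d - a) \<bullet> n" for n
    unfolding m4[THEN arg_cong[of _ _ "\<lambda>v. v \<bullet> n"], unfolded inner_add_left inner_scaleR_left] ..
  have cyc: "(c - a) \<bullet> cross3 (d - a) (b - a) = T" "(d - a) \<bullet> cross3 (b - a) (c - a) = T"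
    by (simp_all add: T_def tri_def cross3_simps)
  have eqb: "lb = 1/4 + (x - m) \<bullet> cross3 (c - a) (d - a) / T"
  proof -
    have "4 * ((m - a) \<bullet> cross3 (c - a) (d - a)) = T" by (simp add: m4n dot_cross_self cyc T_def tri_def)
    then have "(x - a) \<bullet> cross3 (c - a) (d - a) = T / 4 + (x - m) \<bullet> cross3 (c - a) (d - a)"
      by (simp add: inner_diff_left)
    then show ?thesis unfolding lb_def using T0 by (simp add: add_divide_distrib)
  qed
  have eqc: "lc = 1/4 + (x - m) \<bullet> cross3 (d - a) (b - a) / T"
  proof -
    have "4 * ((m - a) \<bullet> cross3 (d - a) (b - a)) = T" by (simp add: m4n dot_cross_self cyc T_def tri_def)
    then have "(x - a) \<bullet> cross3 (d - a) (b - a) = T / 4 + (x - m) \<bullet> cross3 (d - a) (b - a)"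
      by (simp add: inner_diff_left)
    then show ?thesis unfolding lc_def using T0 by (simp add: add_divide_distrib)
  qed
  have eqd: "ld = 1/4 + (x - m) \<bullet> cross3 (b - a) (c - a) / T"
  proof -
    have "4 * ((m - a) \<bullet> cross3 (b - a) (c - a)) = T" by (simp add: m4n dot_cross_self cyc T_def tri_def)
    then have "(x - a) \<bullet> cross3 (b - a) (c - a) = T / 4 + (x - m) \<bullet> cross3 (b - a) (c - a)"
      by (simp add: inner_diff_left)
    then show ?thesis unfolding ld_def using T0 by (simp add: add_divide_distrib)
  qed
  have crs: "cross3 (c - a) (d - a) + cross3 (d - a) (b - a) + cross3 (b - a) (c - a) = cross3 (c - b) (d - b)"
    by (simp add: cross3_simps forall_3)
  have eqa: "1 - lb - lc - ld = 1/4 - (x - m) \<bullet> cross3 (c - b) (d - b) / T"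
    unfolding eqb eqc eqd crs[symmetric] by (simp add: inner_add_right add_divide_distrib)
  have nn: "lb \<ge> 0" "lc \<ge> 0" "ld \<ge> 0" "1 - lb - lc - ld \<ge> 0"
  proof -
    have "norm (u - v) \<le> D" if "u \<in> {b, c, d}" "v \<in> {a, b}" for u v using D[of u v] that by blast
    then have D': "norm (b - a) \<le> D" "norm (c - a) \<le> D" "norm (d - a) \<le> D" "norm (c - b) \<le> D" "norm (d - b) \<le> D"
      by auto
    show "lb \<ge> 0" using bound[OF D'(2,3)] unfolding eqb abs_le_iff by linarith
    show "lc \<ge> 0" using bound[OF D'(3,1)] unfolding eqc abs_le_iff by linarith
    show "ld \<ge> 0" using bound[OF D'(1,2)] unfolding eqd abs_le_iff by linarith
    show "1 - lb - lc - ld \<ge> 0" using bound[OF D'(4,5)] unfolding eqa abs_le_iff by linarith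
  qed
  have "x = (1 - lb - lc - ld) *\<^sub>R a + lb *\<^sub>R b + lc *\<^sub>R c + ld *\<^sub>R d"
    using rep by (simp add: algebra_simps)
  moreover have "\<dots> \<in> convex hull {a, b, c, d}"
  proof -
    let ?S = "{a, b, c, d}"
    have "(\<Sum>i\<in>{..<4::nat}. (\<lambda>i. [1 - lb - lc - ld, lb, lc, ld] ! i) i *\<^sub>R ([a,b,c,d] ! i)) \<in> convex hull ?S"
      by (rule convex_sum) (use nn in \<open>auto simp: eval_nat_numeral lessThan_Suc hull_inc nth_Cons' \<close>)
    then show ?thesis by (simp add: eval_nat_numeral lessThan_Suc algebra_simps)
  qed
  ultimately show "x \<in> convex hull {a, b, c, d}" by simp
qed

text \<open>The three cross products, divided by \<open>tri a b c d\<close>, are the gradients of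
  the barycentric coordinates of \<open>b\<close>, \<open>c\<close> and \<open>d\<close>.\<close>

lemma affine_interpolation:
  fixes a b c d :: "real^3"
  assumes T: "tri a b c d \<noteq> 0"
  shows "\<exists>g k. g \<bullet> a + k = \<alpha> \<and> g \<bullet> b + k = \<beta> \<and> g \<bullet> c + k = \<gamma> \<and> g \<bullet> d + (k::real) = \<delta>"
proof -
  define T' where "T' = tri a b c d"
  define n where "n = (\<beta> - \<alpha>) *\<^sub>R cross3 (c - a) (d - a) + (\<gamma> - \<alpha>) *\<^sub>R cross3 (d - a) (b - a) + (\<delta> - \<alpha>) *\<^sub>R cross3 (b - a) (c - a)"
  have n: "n \<bullet> (b - a) = (\<beta> - \<alpha>) * T'" "n \<bullet> (c - a) = (\<gamma> - \<alpha>) * T'" "n \<bullet> (d - a) = (\<delta> - \<alpha>) * T'"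
    unfolding n_def T'_def tri_def inner_add_left inner_scaleR_left
    by (simp_all add: cross3_simps)
  define g where "g = (1 / T') *\<^sub>R n"
  have g: "g \<bullet> (b - a) = \<beta> - \<alpha>" "g \<bullet> (c - a) = \<gamma> - \<alpha>" "g \<bullet> (d - a) = \<delta> - \<alpha>"
    using T n by (auto simp: g_def T'_def)
  show ?thesis
    by (rule exI[of _ g], rule exI[of _ "\<alpha> - g \<bullet> a"]) (use g in \<open>auto simp: inner_diff_right\<close>)
qed

section \<open>Levels and sizes\<close>

lemma midpoint_half: "midpoint a b = (1/2) *\<^sub>R (a + b)" for a b :: "'a::real_vector"
  by (simp add: midpoint_def scaleR_right_distrib)

text \<open>In the basis \<open>f\<close>, \<open>g\<close>, \<open>h\<close> the edge vectors have
  half-integer coordinates, and a 3 by 3 determinant of such is an integer divided by 8.\<close>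

lemma tri_lattice:
  fixes i :: "nat \<Rightarrow> int" and j :: "nat \<Rightarrow> int" and k :: "nat \<Rightarrow> int"
  assumes s: "\<And>n. n < 4 \<Longrightarrow> s n = a + (1/2) *\<^sub>R (of_int (i n) *\<^sub>R f + of_int (j n) *\<^sub>R g + of_int (k n) *\<^sub>R h)"
  shows "\<exists>m::int. tri (s 0) (s 1) (s 2) (s 3) = of_int m / 8 * (f \<bullet> cross3 g h)"
proof -
  define P where "P n = i n - i 0" for n
  define Q where "Q n = j n - j 0" for n
  define R where "R n = k n - k 0" for n
  have d: "s n - s 0 = (1/2) *\<^sub>R (of_int (P n) *\<^sub>R f + of_int (Q n) *\<^sub>R g + of_int (R n) *\<^sub>R h)" if "n < 4" for n
    unfolding s[OF that] s[of 0, simplified] by (simp add: P_def Q_def R_def algebra_simps)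
  have det: "(p1 *\<^sub>R f + q1 *\<^sub>R g + r1 *\<^sub>R h) \<bullet> cross3 (p2 *\<^sub>R f + q2 *\<^sub>R g + r2 *\<^sub>R h) (p3 *\<^sub>R f + q3 *\<^sub>R g + r3 *\<^sub>R h)
     = (p1 * (q2 * r3 - q3 * r2) - q1 * (p2 * r3 - p3 * r2) + r1 * (p2 * q3 - p3 * q2)) * (f \<bullet> cross3 g h)"
    for p1 q1 r1 p2 q2 r2 p3 q3 r3 :: real
    by (simp add: cross_add_left cross_add_right cross_mult_left cross_mult_right inner_add_left inner_add_right)
      (simp add: cross3_simps)
  define m where "m = P 1 * (Q 2 * R 3 - Q 3 * R 2) - Q 1 * (P 2 * R 3 - P 3 * R 2) + R 1 * (P 2 * Q 3 - P 3 * Q 2)"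
  have "tri (s 0) (s 1) (s 2) (s 3) = (1/8) * ((of_int (P 1) *\<^sub>R f + of_int (Q 1) *\<^sub>R g + of_int (R 1) *\<^sub>R h) \<bullet>
      cross3 (of_int (P 2) *\<^sub>R f + of_int (Q 2) *\<^sub>R g + of_int (R 2) *\<^sub>R h) (of_int (P 3) *\<^sub>R f + of_int (Q 3) *\<^sub>R g + of_int (R 3) *\<^sub>R h))"
    unfolding tri_def using d[of 1] d[of 2] d[of 3] by (simp add: cross_mult_left cross_mult_right)
  also have "\<dots> = of_int m / 8 * (f \<bullet> cross3 g h)"
    unfolding det by (simp add: m_def)
  finally show ?thesis by blast
qed

text \<open>Corners and edge midpoints lie on the half lattice of the father, so the volume ratio is
  an integer over 8, and it is nonzero because the son is a genuine tetrahedron. This covers every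
  irregular pattern without a case distinction.\<close>

lemma son_vol_ge:
  assumes \<tau>: "tetrahedron \<tau>" and \<sigma>: "tetrahedron \<sigma>" and sub: "corners \<sigma> \<subseteq> corners \<tau> \<union> edge_midpoints \<tau>"
  shows "measure lborel \<tau> / 8 \<le> measure lborel \<sigma>"
proof -
  obtain a b c d where abcd: "distinct [a, b, c, d]" "\<tau> = convex hull {a, b, c, d}" "corners \<tau> = {a, b, c, d}" "tri a b c d \<noteq> 0"
    by (rule tetra_corners[OF \<tau>])
  obtain p q r t where pqrt: "distinct [p, q, r, t]" "\<sigma> = convex hull {p, q, r, t}" "corners \<sigma> = {p, q, r, t}" "tri p q r t \<noteq> 0"
    by (rule tetra_corners[OF \<sigma>])
  define L where "L v \<longleftrightarrow> (\<exists>i j k::int. v = a + (1/2) *\<^sub>R (of_int i *\<^sub>R (b - a) + of_int j *\<^sub>R (c - a) + of_int k *\<^sub>R (d - a)))" for v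
  have Lc: "\<exists>i j k::int. v = a + (of_int i *\<^sub>R (b - a) + of_int j *\<^sub>R (c - a) + of_int k *\<^sub>R (d - a))" if "v \<in> {a, b, c, d}" for v
  proof -
    have "a = a + (of_int 0 *\<^sub>R (b - a) + of_int 0 *\<^sub>R (c - a) + of_int 0 *\<^sub>R (d - a))"
      "b = a + (of_int 1 *\<^sub>R (b - a) + of_int 0 *\<^sub>R (c - a) + of_int 0 *\<^sub>R (d - a))"
      "c = a + (of_int 0 *\<^sub>R (b - a) + of_int 1 *\<^sub>R (c - a) + of_int 0 *\<^sub>R (d - a))"
      "d = a + (of_int 0 *\<^sub>R (b - a) + of_int 0 *\<^sub>R (c - a) + of_int 1 *\<^sub>R (d - a))" by simp_all
    then show ?thesis using that by blast
  qed
  have Lm: "L (midpoint v w)" if v: "v \<in> {a, b, c, d}" and w: "w \<in> {a, b, c, d}" for v w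
  proof -
    obtain i j k :: int where 1: "v = a + (of_int i *\<^sub>R (b - a) + of_int j *\<^sub>R (c - a) + of_int k *\<^sub>R (d - a))" using Lc[OF v] by blast
    obtain i' j' k' :: int where 2: "w = a + (of_int i' *\<^sub>R (b - a) + of_int j' *\<^sub>R (c - a) + of_int k' *\<^sub>R (d - a))" using Lc[OF w] by blast
    have "v + w = 2 *\<^sub>R a + (of_int (i + i') *\<^sub>R (b - a) + of_int (j + j') *\<^sub>R (c - a) + of_int (k + k') *\<^sub>R (d - a))"
      unfolding 1 2 by (simp only: scaleR_left.add of_int_add scaleR_2 add_ac)
    then have "midpoint v w = a + (1/2) *\<^sub>R (of_int (i + i') *\<^sub>R (b - a) + of_int (j + j') *\<^sub>R (c - a) + of_int (k + k') *\<^sub>R (d - a))"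
      by (simp only: midpoint_half scaleR_right_distrib[of _ "2 *\<^sub>R a"]) simp
    then show ?thesis unfolding L_def by blast
  qed
  have L: "L v" if "v \<in> corners \<sigma>" for v
  proof -
    have "v \<in> corners \<tau> \<or> v \<in> edge_midpoints \<tau>" using sub that by blast
    then show ?thesis
    proof
      assume "v \<in> corners \<tau>"
      then show ?thesis using Lm[of v v] abcd(3) by simp
    next
      assume "v \<in> edge_midpoints \<tau>"
      then show ?thesis using Lm abcd(3) unfolding edge_midpoints_def by auto
    qed
  qed
  define s where "s n = [p, q, r, t] ! n" for n
  have "\<exists>i j k::int. s n = a + (1/2) *\<^sub>R (of_int i *\<^sub>R (b - a) + of_int j *\<^sub>R (c - a) + of_int k *\<^sub>R (d - a))" if "n < 4" for n
  proof -
    have "s n \<in> set [p, q, r, t]" unfolding s_def by (rule nth_mem) (use that in simp)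
    then show ?thesis using L[of "s n"] pqrt(3) by (simp add: L_def)
  qed
  then obtain i j k :: "nat \<Rightarrow> int" where ijk: "\<And>n. n < 4 \<Longrightarrow> s n = a + (1/2) *\<^sub>R (of_int (i n) *\<^sub>R (b - a) + of_int (j n) *\<^sub>R (c - a) + of_int (k n) *\<^sub>R (d - a))"
    by metis
  have "\<exists>m::int. tri (s 0) (s 1) (s 2) (s 3) = of_int m / 8 * ((b - a) \<bullet> cross3 (c - a) (d - a))"
    by (rule tri_lattice) (rule ijk)
  moreover have "s 0 = p" "s 1 = q" "s 2 = r" "s 3 = t" by (simp_all add: s_def)
  ultimately obtain m :: int where m: "tri p q r t = of_int m / 8 * tri a b c d"
    by (metis tri_def)
  then have "m \<noteq> 0" using pqrt(4) by auto
  then have "1 \<le> \<bar>real_of_int m\<bar>" by linarith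
  then have "1 / 8 * \<bar>tri a b c d\<bar> \<le> \<bar>real_of_int m / 8\<bar> * \<bar>tri a b c d\<bar>" by (intro mult_right_mono) auto
  then have "1 / 8 * \<bar>tri a b c d\<bar> \<le> \<bar>tri p q r t\<bar>" unfolding m abs_mult .
  then show ?thesis using vol_tetra[OF abcd(1)] vol_tetra[OF pqrt(1)] abcd(2) pqrt(2) by simp
qed

lemma regular_son_vol:
  assumes \<tau>: "tetrahedron \<tau>" and reg: "regular_refinement \<tau> S" and \<sigma>: "\<sigma> \<in> S"
  shows "measure lborel \<sigma> = measure lborel \<tau> / 8"
proof -
  obtain a b c d where abcd: "corners \<tau> = {a, b, c, d}" "distinct [a, b, c, d]" and
    S: "S = {convex hull {a, midpoint a b, midpoint a c, midpoint a d},
             convex hull {b, midpoint a b, midpoint b c, midpoint b d},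
             convex hull {c, midpoint a c, midpoint b c, midpoint c d},
             convex hull {d, midpoint a d, midpoint b d, midpoint c d},
             convex hull {midpoint a c, midpoint b d, midpoint a b, midpoint b c},
             convex hull {midpoint a c, midpoint b d, midpoint b c, midpoint c d},
             convex hull {midpoint a c, midpoint b d, midpoint c d, midpoint a d},
             convex hull {midpoint a c, midpoint b d, midpoint a d, midpoint a b}}"
    using reg unfolding regular_refinement_def by blast
  have vt: "measure lborel \<tau> = \<bar>tri a b c d\<bar> / 6"
    using vol_tetra[OF abcd(2)] tetrahedron_eq_hull[OF \<tau>] abcd(1) by simp
  then have T: "tri a b c d \<noteq> 0" using tetrahedron_vol_pos[OF \<tau>] by auto
  have *: "measure lborel (convex hull {p, q, r, s}) = measure lborel \<tau> / 8" if "\<bar>8 * tri p q r s\<bar> = \<bar>tri a b c d\<bar>" for p q r s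
  proof -
    have "tri p q r s \<noteq> 0" using that T by auto
    then show ?thesis using vol_tetra_tri[of p q r s] vt that by simp
  qed
  \<comment> \<open>The factor 8 clears the denominators of the midpoints and leaves polynomial
    identities in the corners.\<close>
  have **: "8 * tri p q r s = (2 *\<^sub>R q - 2 *\<^sub>R p) \<bullet> cross3 (2 *\<^sub>R r - 2 *\<^sub>R p) (2 *\<^sub>R s - 2 *\<^sub>R p)" for p q r s
    by (simp add: tri_def cross_mult_left cross_mult_right flip: scaleR_diff_right)
  have m2: "2 *\<^sub>R midpoint v w = v + w" for v w :: "real^3" by (simp add: midpoint_half)
  have tri': "tri a b c d = (b - a) \<bullet> cross3 (c - a) (d - a)" by (simp add: tri_def)
  have e1: "\<bar>8 * tri a (midpoint a b) (midpoint a c) (midpoint a d)\<bar> = \<bar>tri a b c d\<bar>"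
  proof -
    have "8 * tri a (midpoint a b) (midpoint a c) (midpoint a d) = tri a b c d"
      unfolding ** m2 tri' by (simp add: cross3_simps)
    then show ?thesis by simp
  qed
  have e2: "\<bar>8 * tri b (midpoint a b) (midpoint b c) (midpoint b d)\<bar> = \<bar>tri a b c d\<bar>"
  proof -
    have "8 * tri b (midpoint a b) (midpoint b c) (midpoint b d) = - tri a b c d"
      unfolding ** m2 tri' by (simp add: cross3_simps)
    then show ?thesis by simp
  qed
  have e3: "\<bar>8 * tri c (midpoint a c) (midpoint b c) (midpoint c d)\<bar> = \<bar>tri a b c d\<bar>"
  proof -
    have "8 * tri c (midpoint a c) (midpoint b c) (midpoint c d) = tri a b c d"
      unfolding ** m2 tri' by (simp add: cross3_simps)
    then show ?thesis by simp
  qed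
  have e4: "\<bar>8 * tri d (midpoint a d) (midpoint b d) (midpoint c d)\<bar> = \<bar>tri a b c d\<bar>"
  proof -
    have "8 * tri d (midpoint a d) (midpoint b d) (midpoint c d) = - tri a b c d"
      unfolding ** m2 tri' by (simp add: cross3_simps)
    then show ?thesis by simp
  qed
  have e5: "\<bar>8 * tri (midpoint a c) (midpoint b d) (midpoint a b) (midpoint b c)\<bar> = \<bar>tri a b c d\<bar>"
  proof -
    have "8 * tri (midpoint a c) (midpoint b d) (midpoint a b) (midpoint b c) = tri a b c d
      \<or> 8 * tri (midpoint a c) (midpoint b d) (midpoint a b) (midpoint b c) = - tri a b c d"
      unfolding ** m2 tri' by (simp add: cross3_simps)
    then show ?thesis by auto
  qed
  have e6: "\<bar>8 * tri (midpoint a c) (midpoint b d) (midpoint b c) (midpoint c d)\<bar> = \<bar>tri a b c d\<bar>"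
  proof -
    have "8 * tri (midpoint a c) (midpoint b d) (midpoint b c) (midpoint c d) = tri a b c d
      \<or> 8 * tri (midpoint a c) (midpoint b d) (midpoint b c) (midpoint c d) = - tri a b c d"
      unfolding ** m2 tri' by (simp add: cross3_simps)
    then show ?thesis by auto
  qed
  have e7: "\<bar>8 * tri (midpoint a c) (midpoint b d) (midpoint c d) (midpoint a d)\<bar> = \<bar>tri a b c d\<bar>"
  proof -
    have "8 * tri (midpoint a c) (midpoint b d) (midpoint c d) (midpoint a d) = tri a b c d
      \<or> 8 * tri (midpoint a c) (midpoint b d) (midpoint c d) (midpoint a d) = - tri a b c d"
      unfolding ** m2 tri' by (simp add: cross3_simps)
    then show ?thesis by auto
  qed
  have e8: "\<bar>8 * tri (midpoint a c) (midpoint b d) (midpoint a d) (midpoint a b)\<bar> = \<bar>tri a b c d\<bar>"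
  proof -
    have "8 * tri (midpoint a c) (midpoint b d) (midpoint a d) (midpoint a b) = tri a b c d
      \<or> 8 * tri (midpoint a c) (midpoint b d) (midpoint a d) (midpoint a b) = - tri a b c d"
      unfolding ** m2 tri' by (simp add: cross3_simps)
    then show ?thesis by auto
  qed
  show ?thesis
    using \<sigma> unfolding S
    by (elim insertE emptyE) (simp_all only: *[OF e1] *[OF e2] *[OF e3] *[OF e4] *[OF e5] *[OF e6] *[OF e7] *[OF e8])
qed

lemma bek_tetrahedron:
  assumes "bek_sequence \<Omega> \<T>" "\<tau> \<in> \<T> j" shows "tetrahedron \<tau>"
  using assms by (simp add: bek_sequence_def triangulation_of_def)

lemma tet_level_mem:
  assumes "\<sigma> \<in> \<T> j" shows "\<sigma> \<in> \<T> (tet_level \<T> \<sigma>)" "tet_level \<T> \<sigma> \<le> j"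
  unfolding tet_level_def using assms by (auto intro: LeastI Least_le)

text \<open>A tetrahedron of level \<open>Suc l\<close> is absent at level \<open>l\<close>, so its
  father was properly refined in that step. Condition (5) then gives the father level
  \<open>l\<close>, and condition (4) excludes that it is irregular.\<close>

lemma bek_father:
  assumes bek: "bek_sequence \<Omega> \<T>" and \<sigma>: "\<sigma> \<in> \<T> j" and L: "tet_level \<T> \<sigma> = Suc l"
  obtains \<tau> where "\<tau> \<in> \<T> l" "\<sigma> \<subseteq> \<tau>" "\<sigma> \<in> sons \<T> l \<tau>" "tet_level \<T> \<tau> = l" "\<not> irregular_tet \<T> \<tau>"
    "corners \<sigma> \<subseteq> corners \<tau> \<union> edge_midpoints \<tau>"
    "regular_refinement \<tau> (sons \<T> l \<tau>) \<or> irregular_refinement \<tau> (sons \<T> l \<tau>)"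
proof -
  have \<sigma>l: "\<sigma> \<in> \<T> (Suc l)" using tet_level_mem(1)[of \<sigma> \<T>] \<sigma> L by simp
  have nest: "nested \<T>" and step: "refinement_step \<T> l" and irr: "irregular_not_refined \<T>" and new: "only_newest_refined \<T>"
    using bek by (auto simp: bek_sequence_def)
  obtain \<tau> where \<tau>: "\<tau> \<in> \<T> l" "\<sigma> \<subseteq> \<tau>" using nest \<sigma>l unfolding nested_def by blast
  have cor: "corners \<sigma> \<subseteq> corners \<tau> \<union> edge_midpoints \<tau>" using nest \<sigma>l \<tau> unfolding nested_def by blast
  have son: "\<sigma> \<in> sons \<T> l \<tau>" using \<sigma>l \<tau> by (simp add: sons_def)
  have "\<sigma> \<notin> \<T> l"
    using tet_level_mem(2)[of \<sigma> \<T> l] L by auto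
  then have ns: "sons \<T> l \<tau> \<noteq> {\<tau>}" using son \<tau> by auto
  then have ref: "is_refined \<T> l \<tau>" using \<tau> by (simp add: is_refined_def)
  then have "tet_level \<T> \<tau> = l" using new by (simp add: only_newest_refined_def)
  moreover have "\<not> irregular_tet \<T> \<tau>" using irr ref by (auto simp: irregular_not_refined_def)
  moreover have "regular_refinement \<tau> (sons \<T> l \<tau>) \<or> irregular_refinement \<tau> (sons \<T> l \<tau>)"
    using step \<tau> ns unfolding refinement_step_def by blast
  ultimately show thesis using that \<tau> son cor by blast
qed

text \<open>The upper bound leaves out irregular sons, whose share of the father is not fixed. The
  induction still closes, because fathers are never irregular and regular sons have exactly an
  eighth of the volume.\<close>

lemma bek_vol:
  assumes bek: "bek_sequence \<Omega> \<T>"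
  obtains c C where "c > 0" "C > 0"
    "\<And>j \<sigma>. \<sigma> \<in> \<T> j \<Longrightarrow> c / 8 ^ tet_level \<T> \<sigma> \<le> measure lborel \<sigma>"
    "\<And>j \<sigma>. \<sigma> \<in> \<T> j \<Longrightarrow> tet_level \<T> \<sigma> = 0 \<or> \<not> irregular_tet \<T> \<sigma> \<Longrightarrow> measure lborel \<sigma> \<le> C / 8 ^ tet_level \<T> \<sigma>"
proof -
  \<comment> \<open>The added 1 keeps minimum and maximum well defined and the maximum
    positive.\<close>
  let ?V = "insert 1 (measure lborel ` \<T> 0)"
  have fin: "finite ?V" using bek by (simp add: bek_sequence_def triangulation_of_def)
  define c where "c = Min ?V"
  define C where "C = Max ?V"
  have c: "c > 0" unfolding c_def using fin bek_tetrahedron[OF bek, of _ 0] tetrahedron_vol_pos by (subst Min_gr_iff) auto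
  have C: "C > 0" unfolding C_def using fin by (subst Max_gr_iff) auto
  have lo: "c / 8 ^ l \<le> measure lborel \<sigma>" if "\<sigma> \<in> \<T> j" "tet_level \<T> \<sigma> = l" for j l \<sigma>
    using that
  proof (induction l arbitrary: \<sigma> j)
    case 0
    then have "\<sigma> \<in> \<T> 0" using tet_level_mem(1)[of \<sigma> \<T> j] by simp
    then show ?case unfolding c_def using fin by (auto intro: Min_le)
  next
    case (Suc l)
    obtain \<tau> where \<tau>: "\<tau> \<in> \<T> l" "tet_level \<T> \<tau> = l" "corners \<sigma> \<subseteq> corners \<tau> \<union> edge_midpoints \<tau>"
      using bek_father[OF bek Suc.prems] by metis
    have "measure lborel \<tau> / 8 \<le> measure lborel \<sigma>"
      by (rule son_vol_ge[OF bek_tetrahedron[OF bek \<tau>(1)] bek_tetrahedron[OF bek Suc.prems(1)] \<tau>(3)])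
    moreover have "c / 8 ^ l \<le> measure lborel \<tau>" by (rule Suc.IH[OF \<tau>(1,2)])
    ultimately show ?case by simp
  qed
  have hi: "measure lborel \<sigma> \<le> C / 8 ^ l" if "\<sigma> \<in> \<T> j" "tet_level \<T> \<sigma> = l" "l = 0 \<or> \<not> irregular_tet \<T> \<sigma>" for j l \<sigma>
    using that
  proof (induction l arbitrary: \<sigma> j)
    case 0
    then have "\<sigma> \<in> \<T> 0" using tet_level_mem(1)[of \<sigma> \<T> j] by simp
    then show ?case unfolding C_def using fin by (auto intro: Max_ge)
  next
    case (Suc l)
    obtain \<tau> where \<tau>: "\<tau> \<in> \<T> l" "\<sigma> \<in> sons \<T> l \<tau>" "tet_level \<T> \<tau> = l" "\<not> irregular_tet \<T> \<tau>"
      "regular_refinement \<tau> (sons \<T> l \<tau>) \<or> irregular_refinement \<tau> (sons \<T> l \<tau>)"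
      using bek_father[OF bek Suc.prems(1,2)] by metis
    have "\<not> irregular_refinement \<tau> (sons \<T> l \<tau>)" using Suc.prems(3) \<tau>(1,2) unfolding irregular_tet_def by blast
    then have "measure lborel \<sigma> = measure lborel \<tau> / 8"
      using \<tau>(5) by (intro regular_son_vol[OF bek_tetrahedron[OF bek \<tau>(1)] _ \<tau>(2)]) auto
    moreover have "measure lborel \<tau> \<le> C / 8 ^ l" by (rule Suc.IH[OF \<tau>(1,3)]) (use \<tau>(4) in blast)
    ultimately show ?case by simp
  qed
  show thesis by (rule that[OF c C]) (use lo hi in blast)+
qed

text \<open>With angles bounded below, the volume is comparable to the cube of the diameter, so an
  upper volume bound gives the diameter; a lower volume bound together with the diameter then gives
  the inscribed ball.\<close>

lemma bek_shape:
  assumes bek: "bek_sequence \<Omega> \<T>"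
  obtains r D where "r > 0" "D > 0"
    "\<And>j \<sigma>. \<sigma> \<in> \<T> j \<Longrightarrow> \<exists>m. cball m (r / 2 ^ tet_level \<T> \<sigma>) \<subseteq> \<sigma>"
    "\<And>j \<sigma> x y. \<sigma> \<in> \<T> j \<Longrightarrow> x \<in> \<sigma> \<Longrightarrow> y \<in> \<sigma> \<Longrightarrow> dist x y \<le> D / 2 ^ tet_level \<T> \<sigma>"
proof -
  obtain c C where cC: "c > 0" "C > 0" and
    lo: "\<And>j \<sigma>. \<sigma> \<in> \<T> j \<Longrightarrow> c / 8 ^ tet_level \<T> \<sigma> \<le> measure lborel \<sigma>" and
    hi: "\<And>j \<sigma>. \<sigma> \<in> \<T> j \<Longrightarrow> tet_level \<T> \<sigma> = 0 \<or> \<not> irregular_tet \<T> \<sigma> \<Longrightarrow> measure lborel \<sigma> \<le> C / 8 ^ tet_level \<T> \<sigma>"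
    by (rule bek_vol[OF bek], rule that; blast)
  obtain \<theta>' where \<theta>': "\<theta>' > 0" "\<And>j \<tau> \<alpha>. \<tau> \<in> \<T> j \<Longrightarrow> \<alpha> \<in> interior_angles \<tau> \<Longrightarrow> \<theta>' \<le> \<alpha>"
    using bek unfolding bek_sequence_def nondegenerate_def by blast
  \<comment> \<open>Cut off at 1, hence below \<open>pi\<close>, so that the sine is
    positive.\<close>
  define \<theta> where "\<theta> = min \<theta>' 1"
  have \<theta>: "\<theta> > 0" "\<And>j \<tau> \<alpha>. \<tau> \<in> \<T> j \<Longrightarrow> \<alpha> \<in> interior_angles \<tau> \<Longrightarrow> \<theta> \<le> \<alpha>"
    using \<theta>' by (auto simp: \<theta>_def min.coboundedI1)
  have "\<theta> < pi" using pi_gt3 by (simp add: \<theta>_def)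
  then have s: "sin \<theta> > 0" using \<theta>(1) by (intro sin_gt_zero)
  \<comment> \<open>The solution for the diameter of
    \<open>sin \<theta> ^ 3 * D0 ^ 3 / 72 = C\<close>.\<close>
  define D0 where "D0 = root 3 (72 * C / sin \<theta> ^ 3)"
  have D0: "D0 > 0" "D0 ^ 3 = 72 * C / sin \<theta> ^ 3" using cC s by (auto simp: D0_def)
  define D where "D = 2 * D0"
  have D: "D > 0" using D0 by (simp add: D_def)
  have d0: "dist x y \<le> D0 / 2 ^ tet_level \<T> \<sigma>"
    if \<sigma>: "\<sigma> \<in> \<T> j" "tet_level \<T> \<sigma> = 0 \<or> \<not> irregular_tet \<T> \<sigma>" and xy: "x \<in> \<sigma>" "y \<in> \<sigma>" for j \<sigma> x y
  proof -
    define l where "l = tet_level \<T> \<sigma>"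
    obtain E where E: "E > 0" "\<And>x y. x \<in> \<sigma> \<Longrightarrow> y \<in> \<sigma> \<Longrightarrow> dist x y \<le> E" "sin \<theta> ^ 3 * E ^ 3 / 72 \<le> measure lborel \<sigma>"
      by (rule tetra_shape[OF bek_tetrahedron[OF bek \<sigma>(1)] \<theta>(1)]) (use \<theta>(2) \<sigma>(1) in blast)+
    have "sin \<theta> ^ 3 * E ^ 3 / 72 \<le> C / 8 ^ l" using E(3) hi[OF \<sigma>] unfolding l_def by linarith
    then have "E ^ 3 \<le> (72 * C / sin \<theta> ^ 3) / 8 ^ l" using s by (simp add: field_simps)
    also have "\<dots> = (D0 / 2 ^ l) ^ 3"
      unfolding power_divide D0(2) by (simp flip: power_mult add: mult.commute[of l 3] power_mult)
    finally have "E \<le> D0 / 2 ^ l" using D0 by (intro power_le_imp_le_base[of E 2]) (auto simp: eval_nat_numeral)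
    then show ?thesis using E(2)[OF xy] by (simp add: l_def)
  qed
  have diam: "dist x y \<le> D / 2 ^ tet_level \<T> \<sigma>" if \<sigma>: "\<sigma> \<in> \<T> j" and xy: "x \<in> \<sigma>" "y \<in> \<sigma>" for j \<sigma> x y
  proof (cases "tet_level \<T> \<sigma> = 0 \<or> \<not> irregular_tet \<T> \<sigma>")
    case True
    have "D0 / 2 ^ tet_level \<T> \<sigma> \<le> D / 2 ^ tet_level \<T> \<sigma>" using D0 by (simp add: D_def divide_right_mono)
    then show ?thesis using d0[OF \<sigma> True xy] by linarith
  next
    case False
    then obtain l where l: "tet_level \<T> \<sigma> = Suc l" by (cases "tet_level \<T> \<sigma>") auto
    \<comment> \<open>An irregular tetrahedron lies in its father, which is not irregular and one
      level coarser; this accounts for the factor 2 in \<open>D\<close>.\<close>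
    obtain \<tau> where \<tau>: "\<tau> \<in> \<T> l" "\<sigma> \<subseteq> \<tau>" "tet_level \<T> \<tau> = l" "\<not> irregular_tet \<T> \<tau>"
      using bek_father[OF bek \<sigma> l] by metis
    have "dist x y \<le> D0 / 2 ^ l" using d0[OF \<tau>(1), of x y] \<tau> xy by blast
    then show ?thesis by (simp add: l D_def)
  qed
  \<comment> \<open>From the radius \<open>\<bar>tri\<bar> / (4 * diam\<^sup>2)\<close> of
    \<open>tetra_inball\<close> with \<open>\<bar>tri\<bar>\<close> at least
    \<open>6 * c / 8 ^ l\<close> and \<open>diam\<close> at most \<open>D / 2 ^ l\<close>.\<close>
  define r where "r = 3 * c / (2 * D\<^sup>2)"
  have r: "r > 0" using cC D by (simp add: r_def)
  have ball: "\<exists>m. cball m (r / 2 ^ tet_level \<T> \<sigma>) \<subseteq> \<sigma>" if \<sigma>: "\<sigma> \<in> \<T> j" for j \<sigma>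
  proof -
    define l where "l = tet_level \<T> \<sigma>"
    obtain p q u v where p: "distinct [p, q, u, v]" "\<sigma> = convex hull {p, q, u, v}" "corners \<sigma> = {p, q, u, v}" "tri p q u v \<noteq> 0"
      by (rule tetra_corners[OF bek_tetrahedron[OF bek \<sigma>]])
    have "cball ((1/4) *\<^sub>R (p + q + u + v)) (\<bar>tri p q u v\<bar> / (4 * (D / 2 ^ l)\<^sup>2)) \<subseteq> \<sigma>"
      unfolding p(2)
    proof (rule tetra_inball[OF p(4)])
      fix x y assume "x \<in> {p, q, u, v}" "y \<in> {p, q, u, v}"
      then have "x \<in> \<sigma>" "y \<in> \<sigma>" using corners_subset p(3) by auto
      then show "norm (x - y) \<le> D / 2 ^ l" using diam[OF \<sigma>] by (simp add: l_def dist_norm)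
    qed
    moreover have "r / 2 ^ l \<le> \<bar>tri p q u v\<bar> / (4 * (D / 2 ^ l)\<^sup>2)"
    proof -
      have "r / 2 ^ l = (6 * (c / 8 ^ l)) / (4 * (D / 2 ^ l)\<^sup>2)"
      proof -
        have "(8::real) ^ l = 2 ^ l * 2 ^ l * 2 ^ l" by (simp flip: power_mult_distrib)
        then show ?thesis using D by (simp add: r_def field_simps power2_eq_square)
      qed
      also have "\<dots> \<le> \<bar>tri p q u v\<bar> / (4 * (D / 2 ^ l)\<^sup>2)"
        using lo[OF \<sigma>] vol_tetra[OF p(1)] p(2) by (intro divide_right_mono) (auto simp: l_def mult.commute[of 6])
      finally show ?thesis .
    qed
    ultimately show ?thesis unfolding l_def by (meson dual_order.trans subset_cball)
  qed
  show thesis by (rule that[OF r D]) (use ball diam in blast)+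
qed

section \<open>Finite element spaces and L2 projections\<close>

section \<open>Finite element functions\<close>

lemma affine_agree_convex_hull:
  fixes g g' :: "'a::real_inner" and k k' :: real
  assumes "\<And>s. s \<in> S \<Longrightarrow> g \<bullet> s + k = g' \<bullet> s + k'" "x \<in> convex hull S"
  shows "g \<bullet> x + k = g' \<bullet> x + k'"
proof -
  have "convex {x. (g - g') \<bullet> x = k' - k}" by (rule convex_hyperplane)
  moreover have "S \<subseteq> {x. (g - g') \<bullet> x = k' - k}" using assms(1) by (auto simp: inner_diff_left) (smt (verit))
  ultimately have "convex hull S \<subseteq> {x. (g - g') \<bullet> x = k' - k}" by (rule hull_minimal[rotated])
  then have "(g - g') \<bullet> x = k' - k" using assms(2) by blast
  then show ?thesis by (simp add: inner_diff_left)
qed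

lemma affine_abs_le_convex_hull:
  fixes g :: "'a::real_inner" and k :: real
  assumes "\<And>s. s \<in> S \<Longrightarrow> \<bar>g \<bullet> s + k\<bar> \<le> K" "x \<in> convex hull S"
  shows "\<bar>g \<bullet> x + k\<bar> \<le> K"
proof -
  have "convex ({x. g \<bullet> x \<le> K - k} \<inter> {x. g \<bullet> x \<ge> - K - k})"
    by (intro convex_Int convex_halfspace_le convex_halfspace_ge)
  moreover have "S \<subseteq> {x. g \<bullet> x \<le> K - k} \<inter> {x. g \<bullet> x \<ge> - K - k}" using assms(1) by (auto simp: abs_le_iff) (smt (verit))+
  ultimately have "convex hull S \<subseteq> {x. g \<bullet> x \<le> K - k} \<inter> {x. g \<bullet> x \<ge> - K - k}" by (rule hull_minimal[rotated])
  then have "g \<bullet> x \<le> K - k" "- K - k \<le> g \<bullet> x" using assms(2) by auto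
  then show ?thesis by (simp add: abs_le_iff)
qed

text \<open>A point \<open>y\<close> of the segment close to \<open>p\<close> is interior to the
  union. Every simplex containing \<open>y\<close> also contains the prolongation point
  \<open>q\<close>, since it meets \<open>\<tau>\<close> in a face. So a neighbourhood of
  \<open>y\<close> is covered by simplices through \<open>q\<close>, and contracting it towards
  \<open>q\<close> covers a neighbourhood of \<open>x\<close>.\<close>

lemma interior_along_simplex:
  fixes T :: "'a::euclidean_space set set"
  assumes fin: "finite T" and cl: "\<And>\<tau>. \<tau> \<in> T \<Longrightarrow> closed \<tau>" and cvx: "\<And>\<tau>. \<tau> \<in> T \<Longrightarrow> convex \<tau>"
    and face: "\<And>\<tau> \<tau>'. \<tau> \<in> T \<Longrightarrow> \<tau>' \<in> T \<Longrightarrow> (\<tau> \<inter> \<tau>') face_of \<tau>"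
    and \<tau>: "\<tau> \<in> T" "p \<in> \<tau>" and q: "x + e *\<^sub>R (x - p) \<in> \<tau>" and e: "e > 0" and p: "p \<in> interior (\<Union>T)"
  shows "x \<in> interior (\<Union>T)"
proof (cases "x = p")
  case False
  define q where "q = x + e *\<^sub>R (x - p)"
  obtain s where s: "0 < s" "s < 1" "p + s *\<^sub>R (x - p) \<in> interior (\<Union>T)"
  proof -
    obtain d where d: "d > 0" "ball p d \<subseteq> interior (\<Union>T)" using p open_contains_ball[of "interior (\<Union>T)"] by auto
    define s where "s = min (1/2) (d / (2 * norm (x - p)))"
    have nx: "norm (x - p) > 0" using False by simp
    have s: "0 < s" "s < 1" using d nx by (auto simp: s_def min_less_iff_disj)
    have "s * norm (x - p) \<le> d / 2" using nx by (simp add: s_def min_def field_simps)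
    then have "p + s *\<^sub>R (x - p) \<in> ball p d" using d s by (simp add: dist_norm)
    then show thesis using that s d by blast
  qed
  define y where "y = p + s *\<^sub>R (x - p)"
  obtain d1 where d1: "d1 > 0" "ball y d1 \<subseteq> \<Union>T" using s(3) unfolding y_def mem_interior by blast
  obtain d2 where d2: "d2 > 0" "\<And>\<tau>'. \<tau>' \<in> T \<Longrightarrow> y \<notin> \<tau>' \<Longrightarrow> \<tau>' \<inter> ball y d2 = {}"
  proof -
    have "closed (\<Union>{\<tau>' \<in> T. y \<notin> \<tau>'})" using fin cl by (intro closed_Union) auto
    then have "open (- \<Union>{\<tau>' \<in> T. y \<notin> \<tau>'})" by (simp add: open_Compl)
    moreover have "y \<in> - \<Union>{\<tau>' \<in> T. y \<notin> \<tau>'}" by auto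
    ultimately obtain d2 where d2: "d2 > 0" "ball y d2 \<subseteq> - \<Union>{\<tau>' \<in> T. y \<notin> \<tau>'}" using open_contains_ball by blast
    show thesis by (rule that[OF d2(1)]) (use d2(2) in blast)
  qed
  \<comment> \<open>The ratio of the homothety with centre \<open>q\<close> that carries
    \<open>x\<close> to \<open>y\<close>.\<close>
  define k where "k = (1 - s + e) / e"
  have k: "k > 1" using s e by (simp add: k_def)
  have yq: "y - q = k *\<^sub>R (x - q)"
  proof -
    have "k * e = 1 - s + e" using e by (simp add: k_def)
    moreover have "k *\<^sub>R (x - q) = - (k * e) *\<^sub>R (x - p)" by (simp add: q_def)
    ultimately have "k *\<^sub>R (x - q) = - (1 - s + e) *\<^sub>R (x - p)" by simp
    then show ?thesis by (simp add: y_def q_def algebra_simps)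
  qed
  \<comment> \<open>A face that contains a point of the open segment from \<open>p\<close> to
    \<open>q\<close> contains both ends.\<close>
  have qin: "q \<in> \<tau>'" if \<tau>': "\<tau>' \<in> T" "y \<in> \<tau>'" for \<tau>'
  proof -
    have t: "y = (1 - s / (1 + e)) *\<^sub>R p + (s / (1 + e)) *\<^sub>R q" "0 < s / (1 + e)" "s / (1 + e) < 1"
    proof -
      have "q - p = (1 + e) *\<^sub>R (x - p)" by (simp add: q_def algebra_simps)
      then have "(s / (1 + e)) *\<^sub>R (q - p) = s *\<^sub>R (x - p)" using e by simp
      then show "y = (1 - s / (1 + e)) *\<^sub>R p + (s / (1 + e)) *\<^sub>R q" by (simp add: y_def algebra_simps)
      show "0 < s / (1 + e)" "s / (1 + e) < 1" using s e by auto
    qed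
    have "q \<noteq> p" using False e
    proof -
      have "q - p = (1 + e) *\<^sub>R (x - p)" by (simp add: q_def algebra_simps)
      then show ?thesis using False e by auto
    qed
    then have seg: "y \<in> open_segment p q" unfolding in_segment using t by blast
    have q\<tau>: "q \<in> \<tau>" using q by (simp add: q_def)
    have "y \<in> \<tau>" using seg cvx[OF \<tau>(1)] \<tau>(2) q\<tau> by (meson closed_segment_subset open_closed_segment subsetD)
    then show ?thesis using face[OF \<tau>(1) \<tau>'(1)] seg \<tau>(2) q\<tau> \<tau>' unfolding face_of_def by blast
  qed
  define \<eta> where "\<eta> = min d1 d2 / k"
  have \<eta>: "\<eta> > 0" using d1 d2 k by (simp add: \<eta>_def)
  have "ball x \<eta> \<subseteq> \<Union>T"
  proof
    fix z assume z: "z \<in> ball x \<eta>"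
    define z' where "z' = q + k *\<^sub>R (z - q)"
    have "z' - y = k *\<^sub>R (z - x)" using yq by (simp add: z'_def algebra_simps)
    then have "norm (z' - y) = k * norm (z - x)" using k by simp
    then have "dist y z' = k * dist x z" by (simp only: dist_norm norm_minus_commute[of y] norm_minus_commute[of x])
    then have "dist y z' < min d1 d2" using z k by (simp add: \<eta>_def field_simps)
    then have z'b: "z' \<in> ball y d1" "z' \<in> ball y d2" by auto
    then obtain \<tau>' where \<tau>': "\<tau>' \<in> T" "z' \<in> \<tau>'" using d1 by blast
    then have "y \<in> \<tau>'" using d2(2) z'b(2) by blast
    then have "q \<in> \<tau>'" using qin \<tau>' by blast
    moreover have "z = (1 - 1/k) *\<^sub>R q + (1/k) *\<^sub>R z'" using k by (simp add: z'_def algebra_simps)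
    ultimately have "z \<in> \<tau>'" using cvx[OF \<tau>'(1)] \<tau>'(2) k by (simp add: convex_alt)
    then show "z \<in> \<Union>T" using \<tau>' by blast
  qed
  then show ?thesis using \<eta> mem_interior by blast
qed (use p in simp)

text \<open>If a corner with positive weight were interior to the closure,
  \<open>interior_along_simplex\<close> would make \<open>x\<close> interior as well. This is what
  lets zero values at boundary vertices force zero values on the whole boundary, although no list of
  boundary faces is given.\<close>

lemma frontier_corner:
  assumes tri: "triangulation_of (closure \<Omega>) T" and conf: "conforming T" and \<Omega>: "interior (closure \<Omega>) = \<Omega>"
    and \<tau>: "\<tau> \<in> T" and w: "\<And>v. v \<in> corners \<tau> \<Longrightarrow> 0 \<le> w v" "sum w (corners \<tau>) = 1"
    and x: "x = (\<Sum>v\<in>corners \<tau>. w v *\<^sub>R v)" "x \<in> frontier \<Omega>"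
    and p: "p \<in> corners \<tau>" "w p > 0"
  shows "p \<in> frontier \<Omega>"
proof (rule ccontr)
  assume np: "p \<notin> frontier \<Omega>"
  have T: "finite T" "\<And>\<tau>. \<tau> \<in> T \<Longrightarrow> tetrahedron \<tau>" "\<Union>T = closure \<Omega>" using tri by (auto simp: triangulation_of_def)
  have "open \<Omega>" using \<Omega> open_interior by metis
  then have fr: "frontier \<Omega> = closure \<Omega> - \<Omega>" by (simp add: frontier_def interior_open)
  have p\<tau>: "p \<in> \<tau>" using p corners_subset by blast
  then have "p \<in> closure \<Omega>" using T \<tau> by blast
  then have pi: "p \<in> interior (\<Union>T)" using np fr \<Omega> T by auto
  \<comment> \<open>Moving away from \<open>p\<close> beyond \<open>x\<close> by this factor leaves
    the weight \<open>(w p)\<^sup>2\<close> at \<open>p\<close>, so the new point is still in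
    \<open>\<tau>\<close>.\<close>
  define e where "e = w p"
  define w' where "w' v = (if v = p then (1 + e) * w v - e else (1 + e) * w v)" for v
  have fin: "finite (corners \<tau>)" by (rule finite_corners[OF T(2)[OF \<tau>]])
  have e0: "e > 0" using p by (simp add: e_def)
  have w'nn: "0 \<le> w' v" if "v \<in> corners \<tau>" for v
    using w(1)[OF that] e0 by (auto simp: w'_def e_def algebra_simps)
  have w'1: "sum w' (corners \<tau>) = 1"
  proof -
    have "sum w' (corners \<tau>) = (\<Sum>v\<in>corners \<tau>. (1 + e) * w v - (if v = p then e else 0))"
      by (rule sum.cong) (auto simp: w'_def)
    also have "\<dots> = (1 + e) * sum w (corners \<tau>) - e"
      using fin p by (simp add: sum_subtractf sum_distrib_left)
    finally show ?thesis using w(2) by simp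
  qed
  have q: "x + e *\<^sub>R (x - p) = (\<Sum>v\<in>corners \<tau>. w' v *\<^sub>R v)"
  proof -
    have "(\<Sum>v\<in>corners \<tau>. w' v *\<^sub>R v) = (\<Sum>v\<in>corners \<tau>. (1 + e) *\<^sub>R (w v *\<^sub>R v) - (if v = p then e *\<^sub>R v else 0))"
      by (rule sum.cong) (auto simp: w'_def algebra_simps)
    also have "\<dots> = (1 + e) *\<^sub>R x - e *\<^sub>R p"
      using fin p by (simp add: sum_subtractf x(1) scaleR_sum_right)
    finally show ?thesis by (simp add: algebra_simps)
  qed
  have "x + e *\<^sub>R (x - p) \<in> convex hull (corners \<tau>)"
    unfolding q convex_hull_finite[OF fin] using w'nn w'1 by blast
  then have qin: "x + e *\<^sub>R (x - p) \<in> \<tau>" using tetrahedron_eq_hull[OF T(2)[OF \<tau>]] by simp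
  have "x \<in> interior (\<Union>T)"
  proof (rule interior_along_simplex[OF T(1) _ _ _ \<tau> p\<tau> qin e0 pi])
    show "closed \<tau>" "convex \<tau>" if "\<tau> \<in> T" for \<tau> using T(2)[OF that] closed_simplex convex_simplex by blast+
    show "(\<tau> \<inter> \<tau>') face_of \<tau>" if "\<tau> \<in> T" "\<tau>' \<in> T" for \<tau> \<tau>' using conf that by (auto simp: conforming_def)
  qed
  then show False using x(2) fr \<Omega> T(3) by auto
qed

lemma fe_space_eq_affine:
  assumes "u \<in> fe_space \<Omega> T" "\<tau> \<in> T" shows "\<exists>a b. \<forall>x\<in>\<tau>. u x = a \<bullet> x + b"
  using assms by (auto simp: fe_space_def)

text \<open>The affine pieces fit together because, by conformity, two tetrahedra meet in the convex
  hull of common corners. Zero boundary values follow from \<open>frontier_corner\<close>.\<close>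

lemma nodal_interpolation:
  assumes tri: "triangulation_of (closure \<Omega>) T" and conf: "conforming T" and \<Omega>: "interior (closure \<Omega>) = \<Omega>"
    and val: "\<And>p. p \<in> frontier \<Omega> \<Longrightarrow> val p = (0::real)"
  obtains v where "v \<in> fe_space \<Omega> T" "\<And>\<tau> p. \<tau> \<in> T \<Longrightarrow> p \<in> corners \<tau> \<Longrightarrow> v p = val p"
proof -
  have T: "finite T" "\<And>\<tau>. \<tau> \<in> T \<Longrightarrow> tetrahedron \<tau>" "\<Union>T = closure \<Omega>" using tri by (auto simp: triangulation_of_def)
  have "\<exists>g k. \<forall>p\<in>corners \<tau>. g \<bullet> p + k = val p" if \<tau>: "\<tau> \<in> T" for \<tau>
  proof -
    obtain a b c d where abcd: "distinct [a, b, c, d]" "\<tau> = convex hull {a, b, c, d}" "corners \<tau> = {a, b, c, d}" "tri a b c d \<noteq> 0"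
      by (rule tetra_corners[OF T(2)[OF \<tau>]])
    show ?thesis using affine_interpolation[OF abcd(4), of "val a" "val b" "val c" "val d"] abcd(3) by auto
  qed
  then obtain g k where gk: "\<And>\<tau> p. \<tau> \<in> T \<Longrightarrow> p \<in> corners \<tau> \<Longrightarrow> g \<tau> \<bullet> p + k \<tau> = val p" by metis
  have agree: "g \<tau> \<bullet> x + k \<tau> = g \<tau>' \<bullet> x + k \<tau>'" if \<tau>: "\<tau> \<in> T" "\<tau>' \<in> T" "x \<in> \<tau>" "x \<in> \<tau>'" for \<tau> \<tau>' x
  proof -
    have f: "(\<tau> \<inter> \<tau>') face_of \<tau>" "(\<tau> \<inter> \<tau>') face_of \<tau>'" using conf \<tau> by (auto simp: conforming_def)
    have hull: "\<tau> = convex hull (corners \<tau>)" by (rule tetrahedron_eq_hull[OF T(2)[OF \<tau>(1)]])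
    have "compact (corners \<tau>)" using finite_corners[OF T(2)[OF \<tau>(1)]] by (rule finite_imp_compact)
    then obtain S where S: "S \<subseteq> corners \<tau>" "\<tau> \<inter> \<tau>' = convex hull S"
      using face_of_convex_hull_subset[of "corners \<tau>" "\<tau> \<inter> \<tau>'"] f(1) hull by metis
    show ?thesis
    proof (rule affine_agree_convex_hull)
      show "x \<in> convex hull S" using S \<tau> by blast
      fix s assume s: "s \<in> S"
      then have s1: "s \<in> corners \<tau>" "s \<in> \<tau> \<inter> \<tau>'" using S hull_subset[of S convex] by auto
      then have "s extreme_point_of (\<tau> \<inter> \<tau>')" using extreme_point_of_face[OF f(1)] by (simp add: corners_def)
      then have "s \<in> corners \<tau>'" using extreme_point_of_face[OF f(2)] by (simp add: corners_def)
      then show "g \<tau> \<bullet> s + k \<tau> = g \<tau>' \<bullet> s + k \<tau>'" using gk \<tau> s1 by simp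
    qed
  qed
  \<comment> \<open>Any tetrahedron containing the point will do, as the pieces agree.\<close>
  define t where "t x = (SOME \<tau>. \<tau> \<in> T \<and> x \<in> \<tau>)" for x
  define v where "v x = (if x \<in> closure \<Omega> then g (t x) \<bullet> x + k (t x) else 0)" for x
  have veq: "v x = g \<tau> \<bullet> x + k \<tau>" if "\<tau> \<in> T" "x \<in> \<tau>" for \<tau> x
  proof -
    have "t x \<in> T \<and> x \<in> t x" unfolding t_def by (rule someI[of _ \<tau>]) (use that in simp)
    moreover have "x \<in> closure \<Omega>" using T that by blast
    ultimately show ?thesis using agree[of "t x" \<tau> x] that by (simp add: v_def)
  qed
  show thesis
  proof (rule that)
    show "v p = val p" if "\<tau> \<in> T" "p \<in> corners \<tau>" for \<tau> p
      using veq[OF that(1), of p] gk[OF that] corners_subset that by auto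
    have "continuous_on (\<Union>T) v"
    proof -
      have "continuous_on (\<Union>\<tau>\<in>T. \<tau>) v"
      proof (rule continuous_on_closed_Union[OF T(1)])
        fix \<tau> assume \<tau>: "\<tau> \<in> T"
        show "closed \<tau>" using T(2)[OF \<tau>] closed_simplex by blast
        have "continuous_on \<tau> (\<lambda>x. g \<tau> \<bullet> x + k \<tau>)" by (intro continuous_intros)
        then show "continuous_on \<tau> v" using veq[OF \<tau>] by (simp cong: continuous_on_cong)
      qed
      then show ?thesis by simp
    qed
    moreover have "\<exists>a b. \<forall>x\<in>\<tau>. v x = a \<bullet> x + b" if "\<tau> \<in> T" for \<tau> using veq[OF that] by blast
    moreover have "v x = 0" if x: "x \<in> frontier \<Omega>" for x
    proof -
      have "x \<in> closure \<Omega>" using x by (simp add: frontier_def)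
      then obtain \<tau> where \<tau>: "\<tau> \<in> T" "x \<in> \<tau>" using T by blast
      have fin: "finite (corners \<tau>)" by (rule finite_corners[OF T(2)[OF \<tau>(1)]])
      have "x \<in> convex hull (corners \<tau>)" using tetrahedron_eq_hull[OF T(2)[OF \<tau>(1)]] \<tau> by simp
      then obtain w where w: "\<And>v. v \<in> corners \<tau> \<Longrightarrow> 0 \<le> w v" "sum w (corners \<tau>) = 1" "x = (\<Sum>v\<in>corners \<tau>. w v *\<^sub>R v)"
        unfolding convex_hull_finite[OF fin] by blast
      have "v x = g \<tau> \<bullet> (\<Sum>p\<in>corners \<tau>. w p *\<^sub>R p) + sum w (corners \<tau>) * k \<tau>" using veq[OF \<tau>] w by simp
      also have "\<dots> = (\<Sum>p\<in>corners \<tau>. w p * (g \<tau> \<bullet> p + k \<tau>))"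
        by (simp add: inner_sum_right sum_distrib_right sum.distrib distrib_left)
      also have "\<dots> = (\<Sum>p\<in>corners \<tau>. 0)"
      proof (rule sum.cong)
        fix p assume p: "p \<in> corners \<tau>"
        show "w p * (g \<tau> \<bullet> p + k \<tau>) = 0"
        proof (cases "w p = 0")
          case False
          then have "w p > 0" using w(1)[OF p] by simp
          have "p \<in> frontier \<Omega>"
            by (rule frontier_corner[OF tri conf \<Omega> \<tau>(1) _ w(2,3) x p \<open>w p > 0\<close>]) (rule w(1))
          then show ?thesis using gk[OF \<tau>(1) p] val by simp
        qed simp
      qed simp
      finally show ?thesis by simp
    qed
    moreover have "v x = 0" if "x \<notin> closure \<Omega>" for x using that by (simp add: v_def)
    ultimately show "v \<in> fe_space \<Omega> T" using T(3) by (simp add: fe_space_def)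
  qed
qed

lemma fe_eqI:
  assumes tri: "triangulation_of (closure \<Omega>) T" and u: "u \<in> fe_space \<Omega> T" "v \<in> fe_space \<Omega> T"
    and eq: "\<And>\<tau> p. \<tau> \<in> T \<Longrightarrow> p \<in> corners \<tau> \<Longrightarrow> u p = v p"
  shows "u = v"
proof
  fix x
  show "u x = v x"
  proof (cases "x \<in> closure \<Omega>")
    case False then show ?thesis using u by (simp add: fe_space_def)
  next
    case True
    then have "x \<in> \<Union>T" using tri by (simp add: triangulation_of_def)
    then obtain \<tau> where \<tau>: "\<tau> \<in> T" "x \<in> \<tau>" by blast
    then have t3: "tetrahedron \<tau>" using tri by (simp add: triangulation_of_def)
    obtain a b where ab: "\<And>x. x \<in> \<tau> \<Longrightarrow> u x = a \<bullet> x + b" using fe_space_eq_affine[OF u(1) \<tau>(1)] by blast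
    obtain a' b' where ab': "\<And>x. x \<in> \<tau> \<Longrightarrow> v x = a' \<bullet> x + b'" using fe_space_eq_affine[OF u(2) \<tau>(1)] by blast
    have "a \<bullet> x + b = a' \<bullet> x + b'"
    proof (rule affine_agree_convex_hull)
      show "x \<in> convex hull corners \<tau>" using tetrahedron_eq_hull[OF t3] \<tau> by simp
      show "a \<bullet> s + b = a' \<bullet> s + b'" if "s \<in> corners \<tau>" for s
        using ab[of s] ab'[of s] eq[OF \<tau>(1) that] subsetD[OF corners_subset that] by simp
    qed
    then show ?thesis using ab ab' \<tau> by simp
  qed
qed

text \<open>The zero boundary values make the extension by zero continuous across the boundary, so
  all integrals may be taken over the whole space.\<close>

lemma fe_space_cc:
  assumes "open \<Omega>" "bounded \<Omega>" "u \<in> fe_space \<Omega> T" shows "u \<in> cc"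
proof -
  have u: "continuous_on (closure \<Omega>) u" "\<And>x. x \<in> - \<Omega> \<Longrightarrow> u x = 0"
    using assms by (auto simp: fe_space_def frontier_def interior_open)
  have "continuous_on (- \<Omega>) u"
    using u(2) by (subst continuous_on_cong[OF refl, of _ _ "\<lambda>_. 0"]) auto
  then have "continuous_on (closure \<Omega> \<union> - \<Omega>) u"
    using u(1) assms(1) by (intro continuous_on_closed_Un) (auto simp: closed_Compl)
  moreover have "closure \<Omega> \<union> - \<Omega> = UNIV" using closure_subset by auto
  ultimately have "continuous_on UNIV u" by simp
  moreover have "{x. u x \<noteq> 0} \<subseteq> \<Omega>" using u(2) by auto
  ultimately show ?thesis using assms(2) bounded_subset by (auto simp: cc_def)
qed

lemma fe_space_zero_outside:
  assumes "open \<Omega>" "u \<in> fe_space \<Omega> T" "x \<notin> \<Omega>" shows "u x = 0"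
  using assms by (cases "x \<in> closure \<Omega>") (auto simp: fe_space_def frontier_def interior_open)

lemma fe_space_zero: "(\<lambda>x. 0) \<in> fe_space \<Omega> T"
  by (auto simp: fe_space_def intro!: exI[of _ 0])

lemma fe_space_add_cmult:
  assumes "u \<in> fe_space \<Omega> T" "v \<in> fe_space \<Omega> T"
  shows "(\<lambda>x. u x + c * v x) \<in> fe_space \<Omega> T"
proof -
  have "\<exists>a b. \<forall>x\<in>\<tau>. u x + c * v x = a \<bullet> x + b" if \<tau>: "\<tau> \<in> T" for \<tau>
  proof -
    obtain a b where ab: "\<And>x. x \<in> \<tau> \<Longrightarrow> u x = a \<bullet> x + b" using fe_space_eq_affine[OF assms(1) \<tau>] by blast
    obtain a' b' where ab': "\<And>x. x \<in> \<tau> \<Longrightarrow> v x = a' \<bullet> x + b'" using fe_space_eq_affine[OF assms(2) \<tau>] by blast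
    have "\<forall>x\<in>\<tau>. u x + c * v x = (a + c *\<^sub>R a') \<bullet> x + (b + c * b')"
      using ab ab' by (auto simp: inner_add_left algebra_simps)
    then show ?thesis by blast
  qed
  moreover have "continuous_on (closure \<Omega>) (\<lambda>x. u x + c * v x)"
    using assms by (auto simp: fe_space_def intro!: continuous_intros)
  ultimately show ?thesis using assms by (auto simp: fe_space_def)
qed

lemma fe_space_diff:
  assumes "u \<in> fe_space \<Omega> T" "v \<in> fe_space \<Omega> T"
  shows "(\<lambda>x. u x - v x) \<in> fe_space \<Omega> T"
  using fe_space_add_cmult[OF assms, of "-1"] by simp

lemma fe_space_nested:
  assumes "\<And>\<sigma>. \<sigma> \<in> T' \<Longrightarrow> \<exists>\<tau>\<in>T. \<sigma> \<subseteq> \<tau>" shows "fe_space \<Omega> T \<subseteq> fe_space \<Omega> T'"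
proof
  fix u assume u: "u \<in> fe_space \<Omega> T"
  have "\<exists>a b. \<forall>x\<in>\<sigma>. u x = a \<bullet> x + b" if \<sigma>: "\<sigma> \<in> T'" for \<sigma>
  proof -
    obtain \<tau> where \<tau>: "\<tau> \<in> T" "\<sigma> \<subseteq> \<tau>" using assms[OF \<sigma>] by blast
    obtain a b where "\<And>x. x \<in> \<tau> \<Longrightarrow> u x = a \<bullet> x + b" using fe_space_eq_affine[OF u \<tau>(1)] by blast
    then show ?thesis using \<tau> by blast
  qed
  then show "u \<in> fe_space \<Omega> T'" using u by (simp add: fe_space_def)
qed

section \<open>Orthogonal projections\<close>

definition ip :: "('a::euclidean_space \<Rightarrow> real) \<Rightarrow> ('a \<Rightarrow> real) \<Rightarrow> real" where
  "ip f g = (LINT x|lborel. f x * g x)"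

lemma ip_add: "f \<in> cc \<Longrightarrow> g \<in> cc \<Longrightarrow> h \<in> cc \<Longrightarrow> ip (\<lambda>x. f x + c * g x) h = ip f h + c * ip g h"
proof -
  assume a: "f \<in> cc" "g \<in> cc" "h \<in> cc"
  have "(\<lambda>x. (f x + c * g x) * h x) = (\<lambda>x. f x * h x + c * (g x * h x))" by (auto simp: algebra_simps)
  then show ?thesis unfolding ip_def using cc_mult_integrable[of f h] cc_mult_integrable[of g h] a by simp
qed

lemma ip_commute: "ip f g = ip g f"
  by (simp add: ip_def mult.commute)

lemma ip_add_right: "f \<in> cc \<Longrightarrow> g \<in> cc \<Longrightarrow> h \<in> cc \<Longrightarrow> ip h (\<lambda>x. f x + c * g x) = ip h f + c * ip h g"
  using ip_add[of f g h c] by (simp add: ip_commute)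

lemma ip_self: "ip f f = (nrm lborel f)\<^sup>2"
  unfolding ip_def nrm_power2 by (simp add: power2_eq_square)

definition has_projections :: "('a::euclidean_space \<Rightarrow> real) set \<Rightarrow> bool" where
  "has_projections S \<longleftrightarrow> (\<forall>u\<in>cc. \<exists>q\<in>S. \<forall>v\<in>S. ip (\<lambda>x. u x - q x) v = 0)"

text \<open>A Gram-Schmidt step: the new direction is the part \<open>r\<close> of \<open>b\<close>
  orthogonal to \<open>S\<close>.\<close>

lemma has_projections_extend:
  assumes S: "S \<subseteq> cc" "\<And>f g c. f \<in> S \<Longrightarrow> g \<in> S \<Longrightarrow> (\<lambda>x. f x + c * g x) \<in> S"
    and proj: "has_projections S" and b: "b \<in> cc"
  shows "has_projections {\<lambda>x. f x + c * b x | f c. f \<in> S}"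
  unfolding has_projections_def
proof
  fix u :: "'a \<Rightarrow> real" assume u: "u \<in> cc"
  obtain Pu where Pu: "Pu \<in> S" "\<And>v. v \<in> S \<Longrightarrow> ip (\<lambda>x. u x - Pu x) v = 0" using proj u unfolding has_projections_def by blast
  obtain Pb where Pb: "Pb \<in> S" "\<And>v. v \<in> S \<Longrightarrow> ip (\<lambda>x. b x - Pb x) v = 0" using proj b unfolding has_projections_def by blast
  define r where "r x = b x - Pb x" for x
  have cc: "Pu \<in> cc" "Pb \<in> cc" "r \<in> cc" using S Pu Pb b unfolding r_def by (auto intro: cc_diff)
  define \<alpha> where "\<alpha> = ip (\<lambda>x. u x - Pu x) r / ip r r"
  define e where "e x = u x - Pu x" for x
  have ecc: "e \<in> cc" unfolding e_def using u cc by (auto intro: cc_diff)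
  define q where "q x = Pu x + \<alpha> * r x" for x
  have uq: "(\<lambda>x. u x - q x) = (\<lambda>x. e x + (-\<alpha>) * r x)" by (auto simp: q_def e_def)
  \<comment> \<open>If \<open>b\<close> already lies in \<open>S\<close>, then \<open>r\<close> is
    zero by continuity and the identity holds whatever value the quotient \<open>\<alpha>\<close>
    takes.\<close>
  have orthr: "ip e r - \<alpha> * ip r r = 0"
  proof (cases "ip r r = 0")
    case True
    then have "r x = 0" for x using cc_eq_0[OF cc(3)] by (simp add: ip_self nrm_power2)
    then show ?thesis by (simp add: ip_def)
  qed (simp add: \<alpha>_def e_def[abs_def])
  show "\<exists>q\<in>{\<lambda>x. f x + c * b x | f c. f \<in> S}. \<forall>v\<in>{\<lambda>x. f x + c * b x | f c. f \<in> S}. ip (\<lambda>x. u x - q x) v = 0"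
  proof (intro bexI ballI)
    show "q \<in> {\<lambda>x. f x + c * b x | f c. f \<in> S}"
      using S(2)[OF Pu(1) Pb(1), of "-\<alpha>"] by (auto simp: q_def r_def fun_eq_iff algebra_simps intro!: exI[of _ "\<lambda>x. Pu x - \<alpha> * Pb x"])
    fix v assume "v \<in> {\<lambda>x. f x + c * b x | f c. f \<in> S}"
    then obtain f c where f: "f \<in> S" "v = (\<lambda>x. f x + c * b x)" by blast
    define h where "h x = f x + c * Pb x" for x
    have h: "h \<in> S" "h \<in> cc" using S f(1) Pb(1) unfolding h_def by auto
    have v: "v = (\<lambda>x. h x + c * r x)" by (auto simp: f h_def r_def algebra_simps)
    have 1: "ip e h = 0" "ip r h = 0" using Pu(2)[OF h(1)] Pb(2)[OF h(1)] by (simp_all add: e_def[abs_def] r_def[abs_def])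
    have "ip (\<lambda>x. u x - q x) v = ip (\<lambda>x. e x + (-\<alpha>) * r x) h + c * ip (\<lambda>x. e x + (-\<alpha>) * r x) r"
      unfolding uq v by (intro ip_add_right h(2) cc(3) cc_add cc_cmult ecc)
    also have "\<dots> = (ip e h + (-\<alpha>) * ip r h) + c * (ip e r + (-\<alpha>) * ip r r)"
      by (subst (1 2) ip_add) (auto simp: h ecc cc)
    also have "\<dots> = c * (ip e r - \<alpha> * ip r r)" by (simp add: 1)
    finally show "ip (\<lambda>x. u x - q x) v = 0" using orthr by simp
  qed
qed

lemma has_projections_span:
  fixes \<phi> :: "'i \<Rightarrow> 'a::euclidean_space \<Rightarrow> real"
  assumes "finite I" "\<And>i. i \<in> I \<Longrightarrow> \<phi> i \<in> cc"
  shows "has_projections {\<lambda>x. \<Sum>i\<in>I. c i * \<phi> i x | c. True}"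
  using assms
proof (induction I)
  case empty
  then show ?case by (auto simp: has_projections_def ip_def)
next
  case (insert i I)
  let ?S = "{\<lambda>x. \<Sum>i\<in>I. c i * \<phi> i x | c. True}"
  have "has_projections {\<lambda>x. f x + c * \<phi> i x | f c. f \<in> ?S}"
  proof (rule has_projections_extend)
    show "?S \<subseteq> cc" using insert by (auto intro!: cc_sum cc_cmult)
    show "(\<lambda>x. f x + c * g x) \<in> ?S" if fg: "f \<in> ?S" "g \<in> ?S" for f g c
    proof -
      obtain cf cg where "f = (\<lambda>x. \<Sum>i\<in>I. cf i * \<phi> i x)" "g = (\<lambda>x. \<Sum>i\<in>I. cg i * \<phi> i x)" using fg by blast
      then have "(\<lambda>x. f x + c * g x) = (\<lambda>x. \<Sum>i\<in>I. (cf i + c * cg i) * \<phi> i x)"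
        by (auto simp: sum_distrib_left sum.distrib algebra_simps)
      then show ?thesis by (auto intro!: exI[of _ "\<lambda>i. cf i + c * cg i"])
    qed
    show "has_projections ?S" using insert by auto
    show "\<phi> i \<in> cc" using insert by auto
  qed
  also have "{\<lambda>x. f x + c * \<phi> i x | f c. f \<in> ?S} = {\<lambda>x. \<Sum>i\<in>insert i I. c i * \<phi> i x | c. True}"
  proof (intro equalityI subsetI)
    fix h assume "h \<in> {\<lambda>x. f x + c * \<phi> i x | f c. f \<in> ?S}"
    then obtain cf c where h: "h = (\<lambda>x. (\<Sum>i\<in>I. cf i * \<phi> i x) + c * \<phi> i x)" by blast
    have "(\<Sum>j\<in>I. (if j = i then c else cf j) * \<phi> j x) = (\<Sum>j\<in>I. cf j * \<phi> j x)" for x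
      by (rule sum.cong) (use insert in auto)
    then have "h = (\<lambda>x. \<Sum>j\<in>insert i I. (if j = i then c else cf j) * \<phi> j x)"
      unfolding h using insert by (auto simp: fun_eq_iff)
    then show "h \<in> {\<lambda>x. \<Sum>i\<in>insert i I. c i * \<phi> i x | c. True}" by (auto intro!: exI[of _ "\<lambda>j. if j = i then c else cf j"])
  next
    fix h assume "h \<in> {\<lambda>x. \<Sum>i\<in>insert i I. c i * \<phi> i x | c. True}"
    then obtain c where "h = (\<lambda>x. \<Sum>i\<in>insert i I. c i * \<phi> i x)" by blast
    then have "h = (\<lambda>x. (\<Sum>i\<in>I. c i * \<phi> i x) + c i * \<phi> i x)" using insert by (auto simp: fun_eq_iff)
    moreover have "(\<lambda>x. \<Sum>i\<in>I. c i * \<phi> i x) \<in> ?S" by blast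
    moreover have "(\<lambda>x. f x + c * \<phi> i x) \<in> {\<lambda>x. f x + c * \<phi> i x | f c. f \<in> ?S}" if "f \<in> ?S" for f c
      by (rule CollectI, rule exI[of _ f], rule exI[of _ c]) (use that in simp)
    ultimately show "h \<in> {\<lambda>x. f x + c * \<phi> i x | f c. f \<in> ?S}" by simp
  qed
  finally show ?case .
qed

text \<open>The hat functions of the vertices off the boundary are a finite spanning set.\<close>

lemma has_projections_fe_space:
  assumes tri: "triangulation_of (closure \<Omega>) T" and conf: "conforming T"
    and \<Omega>: "interior (closure \<Omega>) = \<Omega>" "bounded \<Omega>"
  shows "has_projections (fe_space \<Omega> T)"
proof -
  have op: "open \<Omega>" using \<Omega> open_interior by metis
  have T: "finite T" "\<And>\<tau>. \<tau> \<in> T \<Longrightarrow> tetrahedron \<tau>" using tri by (auto simp: triangulation_of_def)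
  define V where "V = (\<Union>\<tau>\<in>T. corners \<tau>) - frontier \<Omega>"
  have V: "finite V" unfolding V_def using T finite_corners by auto
  have "\<exists>v. v \<in> fe_space \<Omega> T \<and> (\<forall>\<tau>\<in>T. \<forall>p\<in>corners \<tau>. v p = (if p = i then 1 else 0))" if i: "i \<in> V" for i
  proof -
    have "i \<notin> frontier \<Omega>" using i by (simp add: V_def)
    then show ?thesis
      using nodal_interpolation[OF tri conf \<Omega>(1), of "\<lambda>p. if p = i then 1 else 0"] by (metis (mono_tags, lifting))
  qed
  then obtain \<phi> where \<phi>: "\<And>i. i \<in> V \<Longrightarrow> \<phi> i \<in> fe_space \<Omega> T"
    "\<And>i \<tau> p. i \<in> V \<Longrightarrow> \<tau> \<in> T \<Longrightarrow> p \<in> corners \<tau> \<Longrightarrow> \<phi> i p = (if p = i then 1 else 0)" by metis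
  have sub: "(\<lambda>x. \<Sum>i\<in>I. c i * \<phi> i x) \<in> fe_space \<Omega> T" if "I \<subseteq> V" for c I
  proof -
    have "finite I" using that V finite_subset by blast
    then show ?thesis using that
    proof (induction I)
      case (insert i I)
      then show ?case using fe_space_add_cmult[of "\<lambda>x. \<Sum>i\<in>I. c i * \<phi> i x" \<Omega> T "\<phi> i" "c i"] \<phi>(1)[of i] by (simp add: add.commute)
    qed (simp add: fe_space_zero)
  qed
  have "fe_space \<Omega> T = {\<lambda>x. \<Sum>i\<in>V. c i * \<phi> i x | c. True}"
  proof (intro equalityI subsetI)
    fix u assume u: "u \<in> fe_space \<Omega> T"
    have "u = (\<lambda>x. \<Sum>i\<in>V. u i * \<phi> i x)"
    proof (rule fe_eqI[OF tri u sub[OF order.refl]])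
      fix \<tau> p assume p: "\<tau> \<in> T" "p \<in> corners \<tau>"
      have "(\<Sum>i\<in>V. u i * \<phi> i p) = (\<Sum>i\<in>V. if i = p then u p else 0)"
        by (rule sum.cong) (use \<phi>(2)[OF _ p] in auto)
      also have "\<dots> = (if p \<in> V then u p else 0)" using V by simp
      also have "\<dots> = u p" using p u by (auto simp: V_def fe_space_def)
      finally show "u p = (\<Sum>i\<in>V. u i * \<phi> i p)" by simp
    qed
    then show "u \<in> {\<lambda>x. \<Sum>i\<in>V. c i * \<phi> i x | c. True}" by (auto intro: exI[of _ u])
  qed (use sub in auto)
  moreover have "\<phi> i \<in> cc" if "i \<in> V" for i using fe_space_cc[OF op \<Omega>(2) \<phi>(1)[OF that]] .
  ultimately show ?thesis using has_projections_span[OF V, of \<phi>] by simp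
qed

lemma L2_inner_eq_ip:
  assumes "open \<Omega>" "\<And>x. x \<notin> \<Omega> \<Longrightarrow> f x * g x = 0" "f \<in> borel_measurable borel" "g \<in> borel_measurable borel"
  shows "L2_inner \<Omega> f g = ip f g"
proof -
  have "(\<lambda>x. indicator \<Omega> x *\<^sub>R (f x * g x)) = (\<lambda>x. f x * g x)"
    using assms(2) by (auto simp: indicator_def fun_eq_iff)
  then have "L2_inner \<Omega> f g = (LINT x|lebesgue. f x * g x)" by (simp add: L2_inner_def set_lebesgue_integral_def)
  also have "\<dots> = ip f g" unfolding ip_def using assms by (intro integral_completion) auto
  finally show ?thesis .
qed

text \<open>The definite description asks for uniqueness: the difference of two candidates lies in
  the space and is orthogonal to itself, hence zero everywhere by \<open>cc_eq_0\<close>.\<close>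

lemma L2_proj_props:
  assumes tri: "triangulation_of (closure \<Omega>) T" and conf: "conforming T"
    and \<Omega>: "interior (closure \<Omega>) = \<Omega>" "bounded \<Omega>" and u: "u \<in> cc"
  shows "L2_proj \<Omega> (fe_space \<Omega> T) u \<in> fe_space \<Omega> T"
    and "\<And>v. v \<in> fe_space \<Omega> T \<Longrightarrow> ip (\<lambda>x. u x - L2_proj \<Omega> (fe_space \<Omega> T) u x) v = 0"
proof -
  have op: "open \<Omega>" using \<Omega> open_interior by metis
  note cc = fe_space_cc[OF op \<Omega>(2)]
  have eq: "L2_inner \<Omega> (\<lambda>x. u x - q x) v = ip (\<lambda>x. u x - q x) v" if "q \<in> fe_space \<Omega> T" "v \<in> fe_space \<Omega> T" for q v
    using fe_space_zero_outside[OF op that(2)] cc_diff[OF u cc[OF that(1)]] cc[OF that(2)]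
    by (intro L2_inner_eq_ip op) (auto dest: cc_measurable)
  obtain q where q: "q \<in> fe_space \<Omega> T" "\<And>v. v \<in> fe_space \<Omega> T \<Longrightarrow> ip (\<lambda>x. u x - q x) v = 0"
    using has_projections_fe_space[OF tri conf \<Omega>] u unfolding has_projections_def by blast
  have "L2_proj \<Omega> (fe_space \<Omega> T) u = q"
    unfolding L2_proj_def
  proof (rule the_equality)
    show "q \<in> fe_space \<Omega> T \<and> (\<forall>v\<in>fe_space \<Omega> T. L2_inner \<Omega> (\<lambda>x. u x - q x) v = 0)" using q eq by simp
    fix q' assume q': "q' \<in> fe_space \<Omega> T \<and> (\<forall>v\<in>fe_space \<Omega> T. L2_inner \<Omega> (\<lambda>x. u x - q' x) v = 0)"
    define d where "d x = q' x - q x" for x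
    have d: "d \<in> fe_space \<Omega> T" unfolding d_def using q q' fe_space_diff by blast
    have "ip d d = ip (\<lambda>x. (u x - q x) + (-1) * (u x - q' x)) d" by (simp add: d_def[abs_def])
    also have "\<dots> = ip (\<lambda>x. u x - q x) d + (-1) * ip (\<lambda>x. u x - q' x) d"
      using q q' d u by (intro ip_add cc_diff cc[OF q(1)] cc[OF d] u) (auto intro: cc)
    also have "\<dots> = 0" using q(2)[OF d] bspec[OF conjunct2[OF q'] d] eq[OF conjunct1[OF q'] d] by simp
    finally have "d x = 0" for x using cc_eq_0[OF cc[OF d]] by (simp add: ip_self nrm_power2)
    then show "q' = q" by (simp add: d_def fun_eq_iff)
  qed
  then show "L2_proj \<Omega> (fe_space \<Omega> T) u \<in> fe_space \<Omega> T"
    "\<And>v. v \<in> fe_space \<Omega> T \<Longrightarrow> ip (\<lambda>x. u x - L2_proj \<Omega> (fe_space \<Omega> T) u x) v = 0" using q by simp_all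
qed

section \<open>Weak derivatives and the H1 norm of finite element functions\<close>

section \<open>Smooth bump functions and uniqueness of weak derivatives\<close>

text \<open>The polynomial factor makes the family closed under differentiation, which
  \<open>exp (- c / t)\<close> alone is not.\<close>

definition poly_exp_cutoff :: "real poly \<Rightarrow> real \<Rightarrow> real \<Rightarrow> real" where
  "poly_exp_cutoff p c t = (if t > 0 then poly p (1 / t) * exp (- c / t) else 0)"

lemma poly_exp_tendsto_0:
  assumes c: "c > (0::real)" shows "((\<lambda>y. poly p y * exp (- c * y)) \<longlongrightarrow> 0) at_top"
proof -
  have mono: "((\<lambda>y. y ^ k * exp (- c * y)) \<longlongrightarrow> 0) at_top" for k
  proof -
    have "((\<lambda>y. (1 / c ^ k) * ((c * y) ^ k / exp (c * y))) \<longlongrightarrow> (1 / c ^ k) * 0) at_top"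
      by (intro tendsto_mult_left filterlim_compose[OF tendsto_power_div_exp_0] filterlim_tendsto_pos_mult_at_top[OF tendsto_const c filterlim_ident])
    moreover have "(\<lambda>y. (1 / c ^ k) * ((c * y) ^ k / exp (c * y))) = (\<lambda>y. y ^ k * exp (- c * y))"
      using c by (auto simp: power_mult_distrib exp_minus field_simps)
    ultimately show ?thesis by simp
  qed
  have "((\<lambda>y. \<Sum>i\<le>degree p. coeff p i * (y ^ i * exp (- c * y))) \<longlongrightarrow> (\<Sum>i\<le>degree p. coeff p i * 0)) at_top"
    by (intro tendsto_sum tendsto_mult_left mono)
  then show ?thesis by (simp add: poly_altdef sum_distrib_right mult.assoc)
qed

lemma poly_exp_cutoff_deriv:
  assumes c: "c > 0"
  shows "(poly_exp_cutoff p c has_real_derivative poly_exp_cutoff ([:0, 0, 1:] * (smult c p - pderiv p)) c t) (at t)"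
proof -
  \<comment> \<open>The chain rule for positive \<open>t\<close>; the factor
    \<open>1 / t\<^sup>2\<close> is \<open>[:0, 0, 1:]\<close> evaluated at
    \<open>1 / t\<close>.\<close>
  let ?q = "[:0, 0, 1:] * (smult c p - pderiv p)"
  consider "t > 0" | "t < 0" | "t = 0" by linarith
  then show ?thesis
  proof cases
    case 1
    have "((\<lambda>t. poly p (1 / t) * exp (- c / t)) has_real_derivative poly ?q (1 / t) * exp (- c / t)) (at t)"
      using 1 by (auto intro!: derivative_eq_intros poly_DERIV[THEN DERIV_chain2] simp: power2_eq_square field_simps)
    then have "((\<lambda>t. poly p (1 / t) * exp (- c / t)) has_real_derivative poly_exp_cutoff ?q c t) (at t)"
      using 1 by (simp add: poly_exp_cutoff_def)
    then show ?thesis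
      by (rule DERIV_cong_ev[THEN iffD1, OF refl _ refl, rotated])
        (use 1 eventually_nhds_in_open[of "{0<..}" t] in \<open>auto simp: poly_exp_cutoff_def elim: eventually_mono\<close>)
  next
    case 2
    have "((\<lambda>t. 0) has_real_derivative poly_exp_cutoff ?q c t) (at t)"
      using 2 by (simp add: poly_exp_cutoff_def)
    then show ?thesis
      by (rule DERIV_cong_ev[THEN iffD1, OF refl _ refl, rotated])
        (use 2 eventually_nhds_in_open[of "{..<0}" t] in \<open>auto simp: poly_exp_cutoff_def elim: eventually_mono\<close>)
  next
    case 3
    have "((\<lambda>h. poly_exp_cutoff p c h / h) \<longlongrightarrow> 0) (at_right 0)"
    proof -
      \<comment> \<open>Division by \<open>h\<close> multiplies the polynomial by its own variable
        \<open>1 / h\<close>, hence \<open>pCons 0 p\<close>.\<close>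
      have "((\<lambda>h. poly (pCons 0 p) (inverse h) * exp (- c * inverse h)) \<longlongrightarrow> 0) (at_right 0)"
        by (rule filterlim_compose[OF poly_exp_tendsto_0[OF c] filterlim_inverse_at_top_right])
      then show ?thesis
        by (rule tendsto_cong[THEN iffD1, rotated])
          (auto simp: eventually_at_right_less poly_exp_cutoff_def field_simps eventually_at_filter)
    qed
    moreover have "((\<lambda>h. poly_exp_cutoff p c h / h) \<longlongrightarrow> 0) (at_left 0)"
      by (rule tendsto_eventually) (auto simp: eventually_at_filter poly_exp_cutoff_def)
    ultimately have "((\<lambda>h. poly_exp_cutoff p c h / h) \<longlongrightarrow> 0) (at 0)"
      by (simp add: filterlim_split_at)
    then show ?thesis
      unfolding DERIV_def using 3 by (simp add: poly_exp_cutoff_def)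
  qed
qed

text \<open>An algebra closed under partial derivatives by rule induction; \<open>C_k\<close> for
  every \<open>k\<close> follows without computing any higher derivative.\<close>

inductive smooth_alg :: "(real^3 \<Rightarrow> real) \<Rightarrow> bool" where
  const: "smooth_alg (\<lambda>x. k)"
| base: "c > 0 \<Longrightarrow> smooth_alg (\<lambda>x. poly_exp_cutoff p c (s * x $ i + r))"
| add: "smooth_alg f \<Longrightarrow> smooth_alg g \<Longrightarrow> smooth_alg (\<lambda>x. f x + g x)"
| mult: "smooth_alg f \<Longrightarrow> smooth_alg g \<Longrightarrow> smooth_alg (\<lambda>x. f x * g x)"

lemma smooth_alg_deriv:
  assumes "smooth_alg f"
  shows "f differentiable_on UNIV \<and> (\<forall>i. smooth_alg (partial_deriv i f))"
proof -
  have "\<exists>f'. (\<forall>x. (f has_derivative f' x) (at x)) \<and> (\<forall>i. smooth_alg (\<lambda>x. f' x (axis i 1)))"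
    using assms
  proof induction
    case (const k)
    show ?case by (rule exI[of _ "\<lambda>x h. 0"]) (auto intro: smooth_alg.const)
  next
    case (base c p s i r)
    let ?q = "[:0, 0, 1:] * (smult c p - pderiv p)"
    let ?f' = "\<lambda>x h. poly_exp_cutoff ?q c (s * x $ i + r) * (s * h $ i)"
    have "((\<lambda>x. poly_exp_cutoff p c (s * x $ i + r)) has_derivative ?f' x) (at x)" for x :: "real^3"
    proof -
      have "((\<lambda>x::real^3. s * x $ i + r) has_derivative (\<lambda>h. s * h $ i)) (at x)"
        by (auto intro!: derivative_eq_intros bounded_linear_imp_has_derivative[OF bounded_linear_vec_nth])
      moreover have "(poly_exp_cutoff p c has_derivative (\<lambda>h. poly_exp_cutoff ?q c (s * x $ i + r) * h)) (at (s * x $ i + r))"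
        using poly_exp_cutoff_deriv[OF base, of p "s * x $ i + r"] by (simp add: has_field_derivative_def)
      ultimately show ?thesis by (rule has_derivative_compose)
    qed
    moreover have "smooth_alg (\<lambda>x. ?f' x (axis j 1))" for j
      by (intro smooth_alg.mult smooth_alg.base base smooth_alg.const)
    ultimately show ?case by (intro exI[of _ ?f'] conjI allI)
  next
    case (add f g)
    obtain f' g' where f': "\<And>x. (f has_derivative f' x) (at x)" "\<And>i. smooth_alg (\<lambda>x. f' x (axis i 1))"
      and g': "\<And>x. (g has_derivative g' x) (at x)" "\<And>i. smooth_alg (\<lambda>x. g' x (axis i 1))" using add.IH by blast
    show ?case
      by (rule exI[of _ "\<lambda>x h. f' x h + g' x h"]) (auto intro!: has_derivative_add smooth_alg.add f' g')
  next
    case (mult f g)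
    obtain f' g' where f': "\<And>x. (f has_derivative f' x) (at x)" "\<And>i. smooth_alg (\<lambda>x. f' x (axis i 1))"
      and g': "\<And>x. (g has_derivative g' x) (at x)" "\<And>i. smooth_alg (\<lambda>x. g' x (axis i 1))" using mult.IH by blast
    show ?case
      by (rule exI[of _ "\<lambda>x h. f x * g' x h + f' x h * g x"])
        (auto intro!: has_derivative_mult smooth_alg.add smooth_alg.mult f' g' mult.hyps)
  qed
  then obtain f' where f': "\<And>x. (f has_derivative f' x) (at x)" "\<And>i. smooth_alg (\<lambda>x. f' x (axis i 1))" by blast
  have "partial_deriv i f = (\<lambda>x. f' x (axis i 1))" for i
    using frechet_derivative_at[OF f'(1)] by (auto simp: partial_deriv_def)
  then show ?thesis using f' by (auto simp: differentiable_on_def differentiable_def)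
qed

lemma smooth_alg_C_k: "smooth_alg f \<Longrightarrow> C_k k f"
proof (induction k arbitrary: f)
  case 0
  then show ?case using smooth_alg_deriv[of f] differentiable_imp_continuous_on by auto
next
  case (Suc k)
  then show ?case using smooth_alg_deriv[of f] by auto
qed

lemma smooth_alg_prod: "(\<And>i. i \<in> I \<Longrightarrow> smooth_alg (f i)) \<Longrightarrow> smooth_alg (\<lambda>x. \<Prod>i\<in>I. f i x)"
  by (induction I rule: infinite_finite_induct) (auto intro: smooth_alg.const smooth_alg.mult)

text \<open>As \<open>n\<close> grows the exponents tend to 0, and the functions converge, bounded
  by 1, to the indicator of the open box.\<close>

definition bump :: "real^3 \<Rightarrow> real^3 \<Rightarrow> nat \<Rightarrow> real^3 \<Rightarrow> real" where
  "bump a b n x = (\<Prod>i\<in>UNIV. poly_exp_cutoff 1 (1 / Suc n) (x $ i - a $ i) * poly_exp_cutoff 1 (1 / Suc n) (b $ i - x $ i))"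

lemma bump_smooth: "smooth_alg (bump a b n)"
proof -
  have "smooth_alg (\<lambda>x. poly_exp_cutoff 1 (1 / Suc n) (1 * x $ i + - a $ i) * poly_exp_cutoff 1 (1 / Suc n) ((-1) * x $ i + b $ i))" for i
    by (intro smooth_alg.mult smooth_alg.base) auto
  then have "smooth_alg (\<lambda>x. \<Prod>i\<in>UNIV. poly_exp_cutoff 1 (1 / Suc n) (1 * x $ i + - a $ i) * poly_exp_cutoff 1 (1 / Suc n) ((-1) * x $ i + b $ i))"
    by (rule smooth_alg_prod)
  then show ?thesis by (simp add: bump_def[abs_def])
qed

lemma poly_exp_cutoff_1_bounds: "c > 0 \<Longrightarrow> 0 \<le> poly_exp_cutoff 1 c t" "c > 0 \<Longrightarrow> poly_exp_cutoff 1 c t \<le> 1"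
  by (auto simp: poly_exp_cutoff_def)

lemma bump_bounds: "0 \<le> bump a b n x" "bump a b n x \<le> 1"
  unfolding bump_def by (auto intro!: prod_nonneg prod_le_1 mult_nonneg_nonneg mult_le_one poly_exp_cutoff_1_bounds)

lemma bump_zero: "x \<notin> box a b \<Longrightarrow> bump a b n x = 0"
proof -
  assume "x \<notin> box a b"
  then obtain i where "x $ i \<le> a $ i \<or> b $ i \<le> x $ i" by (auto simp: mem_box_cart not_less)
  then show ?thesis unfolding bump_def by (intro prod_zero bexI[of _ i]) (auto simp: poly_exp_cutoff_def)
qed

lemma bump_tendsto: "(\<lambda>n. bump a b n x) \<longlonglongrightarrow> indicator (box a b) x"
proof (cases "x \<in> box a b")
  case True
  have *: "(\<lambda>n. poly_exp_cutoff 1 (1 / Suc n) t) \<longlonglongrightarrow> 1" if "t > 0" for t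
  proof -
    have "(\<lambda>n. exp (- (1 / t) * (1 / real (Suc n)))) \<longlonglongrightarrow> exp (- (1 / t) * 0)"
      by (intro tendsto_intros LIMSEQ_Suc lim_1_over_n)
    then show ?thesis using that by (simp add: poly_exp_cutoff_def mult.commute)
  qed
  have "(\<lambda>n. bump a b n x) \<longlonglongrightarrow> (\<Prod>i\<in>(UNIV::3 set). 1 * 1)"
    unfolding bump_def by (intro tendsto_prod tendsto_mult *) (use True in \<open>auto simp: mem_box_cart\<close>)
  then show ?thesis using True by simp
qed (simp add: bump_zero)

lemma bump_test_function:
  assumes "cbox a b \<subseteq> \<Omega>" shows "test_function \<Omega> (bump a b n)"
proof -
  have "{x. bump a b n x \<noteq> 0} \<subseteq> cbox a b" using bump_zero box_subset_cbox by blast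
  then have c: "closure {x. bump a b n x \<noteq> 0} \<subseteq> cbox a b" by (simp add: closure_minimal closed_cbox)
  then have "compact (closure {x. bump a b n x \<noteq> 0})"
    using bounded_subset[OF bounded_cbox c] compact_eq_bounded_closed by blast
  then show ?thesis using c assms smooth_alg_C_k[OF bump_smooth] by (auto simp: test_function_def)
qed

lemma test_function_cc: "test_function \<Omega> \<phi> \<Longrightarrow> \<phi> \<in> cc"
proof -
  assume t: "test_function \<Omega> \<phi>"
  then have "C_k 0 \<phi>" by (simp only: test_function_def)
  moreover have "bounded {x. \<phi> x \<noteq> 0}"
    using t bounded_subset[OF compact_imp_bounded closure_subset] unfolding test_function_def by blast
  ultimately show ?thesis by (simp add: cc_def)
qed

lemma square_integrable_completion:
  "square_integrable lborel f \<Longrightarrow> square_integrable lebesgue f"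
  by (auto simp: square_integrable_def integrable_completion intro: measurable_completion)

lemma in_L2_square_integrable:
  assumes "in_L2 \<Omega> g" shows "square_integrable lebesgue (\<lambda>x. indicator \<Omega> x * g x)"
proof -
  have "(\<lambda>x. (indicator \<Omega> x * g x)\<^sup>2) = (\<lambda>x. indicator \<Omega> x *\<^sub>R (g x)\<^sup>2)"
    by (auto simp: indicator_def)
  then show ?thesis using assms by (simp add: in_L2_def square_integrable_def set_borel_measurable_def set_integrable_def)
qed

text \<open>The fundamental lemma of the calculus of variations. Dominated convergence of the bumps
  shows that the difference \<open>h\<close> has integral zero over every box whose closure lies in
  \<open>\<Omega>\<close>, and Lebesgue differentiation along shrinking cubes gives
  \<open>h = 0\<close> almost everywhere.\<close>

lemma L2_fundamental:
  assumes \<Omega>: "open \<Omega>" "bounded \<Omega>" and g: "in_L2 \<Omega> g1" "in_L2 \<Omega> g2"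
    and eq: "\<And>\<phi>. test_function \<Omega> \<phi> \<Longrightarrow> L2_inner \<Omega> g1 \<phi> = L2_inner \<Omega> g2 \<phi>"
  shows "L2_norm \<Omega> g1 = L2_norm \<Omega> g2"
proof -
  define h1 h2 where "h1 x = indicator \<Omega> x * g1 x" and "h2 x = indicator \<Omega> x * g2 x" for x
  define h where "h x = h1 x - h2 x" for x
  have sq: "square_integrable lebesgue h1" "square_integrable lebesgue h2"
    unfolding h1_def h2_def using g in_L2_square_integrable by blast+
  then have sqh: "square_integrable lebesgue h" unfolding h_def by (rule square_integrable_diff)
  \<comment> \<open>\<open>\<Omega>\<close> has finite measure, so the square integrable
    \<open>h\<close> is integrable and can serve as dominating function.\<close>
  have ind: "square_integrable lebesgue (\<lambda>x. indicat_real \<Omega> x)"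
  proof -
    have "integrable lebesgue (indicat_real \<Omega>)"
      using lmeasurable_open[OF \<Omega>(2,1)] by (intro integrable_real_indicator) (auto simp: fmeasurable_def)
    moreover have "(\<lambda>x. (indicat_real \<Omega> x)\<^sup>2) = indicat_real \<Omega>" by (auto simp: indicator_def)
    ultimately show ?thesis using \<Omega> by (auto simp: square_integrable_def)
  qed
  have hind: "h x * indicat_real \<Omega> x = h x" for x by (simp add: h_def h1_def h2_def indicator_def)
  have hint: "integrable lebesgue h" using square_integrable_mult[OF sqh ind] by (simp add: hind)
  have zero: "(LINT x|lebesgue. h x * \<phi> x) = 0" if t: "test_function \<Omega> \<phi>" for \<phi>
  proof -
    have \<phi>: "square_integrable lebesgue \<phi>"
      using test_function_cc[OF t] cc_square_integrable square_integrable_completion by blast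
    have 1: "(LINT x|lebesgue. h1 x * \<phi> x) = L2_inner \<Omega> g1 \<phi>" "(LINT x|lebesgue. h2 x * \<phi> x) = L2_inner \<Omega> g2 \<phi>"
      by (simp_all add: L2_inner_def set_lebesgue_integral_def h1_def h2_def mult.assoc)
    have "(LINT x|lebesgue. h x * \<phi> x) = (LINT x|lebesgue. h1 x * \<phi> x) - (LINT x|lebesgue. h2 x * \<phi> x)"
      unfolding h_def left_diff_distrib using square_integrable_mult[OF sq(1) \<phi>] square_integrable_mult[OF sq(2) \<phi>] by simp
    then show ?thesis using eq[OF t] by (simp add: 1)
  qed
  have box0: "(LINT x|lebesgue. h x * indicator (box a b) x) = 0" if ab: "cbox a b \<subseteq> \<Omega>" for a b
  proof -
    have "(\<lambda>n. LINT x|lebesgue. h x * bump a b n x) \<longlonglongrightarrow> (LINT x|lebesgue. h x * indicator (box a b) x)"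
    proof (rule integral_dominated_convergence[where w="\<lambda>x. norm (h x)"])
      show "(\<lambda>x. h x * indicator (box a b) x) \<in> borel_measurable lebesgue"
        using hint by (intro borel_measurable_times borel_measurable_indicator) auto
      show "(\<lambda>x. h x * bump a b n x) \<in> borel_measurable lebesgue" for n
        using hint square_integrable_completion[OF cc_square_integrable[OF test_function_cc[OF bump_test_function[OF ab]]], of n]
        by (intro borel_measurable_times) (auto simp: square_integrable_def)
      show "AE x in lebesgue. (\<lambda>n. h x * bump a b n x) \<longlonglongrightarrow> h x * indicator (box a b) x"
        by (intro AE_I2 tendsto_mult_left bump_tendsto)
      show "AE x in lebesgue. norm (h x * bump a b n x) \<le> norm (h x)" for n
        using bump_bounds by (intro AE_I2) (auto simp: abs_mult intro!: mult_left_le)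
    qed (use hint in auto)
    then show ?thesis using zero[OF bump_test_function[OF ab]] by (simp add: LIMSEQ_const_iff)
  qed
  have hk: "h integrable_on cbox a b" for a b
    by (intro set_lebesgue_integral_eq_integral(1), unfold set_integrable_def, rule integrable_mult_indicator)
      (use hint in auto)
  \<comment> \<open>The Lebesgue differentiation theorem for cubes with corner
    \<open>x\<close>.\<close>
  obtain N where N: "negligible N" "\<And>x e. x \<notin> N \<Longrightarrow> 0 < e \<Longrightarrow>
      \<exists>d>0. \<forall>k. 0 < k \<and> k < d \<longrightarrow> norm (integral (cbox x (x + k *\<^sub>R One)) h /\<^sub>R k ^ DIM(real^3) - h x) < e"
    using integrable_ccontinuous_explicit[OF hk] by blast
  have "h x = 0" if x: "x \<notin> N" for x
  proof (cases "x \<in> \<Omega>")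
    case True
    obtain \<delta> where \<delta>: "\<delta> > 0" "cball x \<delta> \<subseteq> \<Omega>" using True \<Omega>(1) open_contains_cball by blast
    have "norm (h x) < e" if e: "e > 0" for e
    proof -
      obtain d where d: "d > 0" "\<And>k. 0 < k \<Longrightarrow> k < d \<Longrightarrow> norm (integral (cbox x (x + k *\<^sub>R One)) h /\<^sub>R k ^ DIM(real^3) - h x) < e"
        using N(2)[OF x e] by blast
      \<comment> \<open>The cube of side \<open>k\<close> lies within distance \<open>3 * k\<close>
        of \<open>x\<close>, by comparison with the sum of coordinates, hence inside
        \<open>\<Omega>\<close>.\<close>
      define k where "k = min (d / 2) (\<delta> / 3)"
      have k: "0 < k" "k < d" "3 * k \<le> \<delta>" using d \<delta> by (auto simp: k_def)
      have sub: "cbox x (x + k *\<^sub>R One) \<subseteq> \<Omega>"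
      proof
        fix y assume y: "y \<in> cbox x (x + k *\<^sub>R One)"
        have "norm (y - x) \<le> (\<Sum>i\<in>UNIV. \<bar>(y - x) $ i\<bar>)" by (rule norm_le_l1_cart)
        also have "\<dots> \<le> (\<Sum>i\<in>(UNIV::3 set). k)"
        proof (rule sum_mono)
          fix i :: 3
          have ai: "axis i 1 \<in> (Basis :: (real^3) set)" by simp
          have "(One :: real^3) $ i = (\<Sum>b\<in>(Basis :: (real^3) set). b \<bullet> axis i 1)"
            by (simp only: cart_eq_inner_axis inner_sum_left)
          also have "\<dots> = (\<Sum>b\<in>(Basis :: (real^3) set). if b = axis i 1 then 1 else 0)"
            by (rule sum.cong) (use ai in \<open>simp_all add: inner_Basis\<close>)
          also have "\<dots> = (1::real)" using ai by (subst sum.delta) auto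
          finally have One: "(One :: real^3) $ i = 1" .
          have "x $ i \<le> y $ i" "y $ i \<le> (x + k *\<^sub>R One) $ i" using y unfolding mem_box_cart by blast+
          then have "x $ i \<le> y $ i" "y $ i \<le> x $ i + k"
            by (simp_all only: vector_add_component vector_scaleR_component One real_scaleR_def mult_1_right)
          then show "\<bar>(y - x) $ i\<bar> \<le> k" using k(1) unfolding vector_minus_component by linarith
        qed
        also have "\<dots> = 3 * k" by simp
        finally show "y \<in> \<Omega>" using \<delta> k by (auto simp: dist_norm norm_minus_commute)
      qed
      have "integral (cbox x (x + k *\<^sub>R One)) h = (LINT y:box x (x + k *\<^sub>R One)|lebesgue. h y)"
      proof -
        have "set_integrable lebesgue (box x (x + k *\<^sub>R One)) h"
          by (unfold set_integrable_def, rule integrable_mult_indicator) (use hint in auto)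
        from set_lebesgue_integral_eq_integral(2)[OF this] show ?thesis by (simp add: integral_open_interval)
      qed
      also have "\<dots> = 0" using box0[OF sub] by (simp add: set_lebesgue_integral_def mult.commute)
      finally show ?thesis using d(2)[OF k(1,2)] by simp
    qed
    then show ?thesis by (metis less_irrefl norm_ge_zero norm_eq_zero le_less)
  qed (simp add: h_def h1_def h2_def)
  then have "AE x in lebesgue. h x = 0"
    using N(1) by (intro AE_I'[of N]) (auto simp: negligible_iff_null_sets)
  then have "AE x in lebesgue. indicator \<Omega> x *\<^sub>R (g1 x * g1 x) = indicator \<Omega> x *\<^sub>R (g2 x * g2 x)"
    by (rule AE_mp) (auto simp: h_def h1_def h2_def indicator_def)
  moreover have "(\<lambda>x. indicator \<Omega> x *\<^sub>R (g x * g x)) \<in> borel_measurable lebesgue" if "in_L2 \<Omega> g" for g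
    using that by (auto simp: in_L2_def set_integrable_def power2_eq_square)
  ultimately have "L2_inner \<Omega> g1 g1 = L2_inner \<Omega> g2 g2"
    unfolding L2_inner_def set_lebesgue_integral_def using g by (intro integral_cong_AE)
  then show ?thesis by (simp add: L2_norm_def)
qed

text \<open>The representative picked by \<open>SOME\<close> is inaccessible, but any two weak
  derivatives have the same norm, so a concrete one can replace it.\<close>

lemma L2_norm_weak_partial:
  assumes \<Omega>: "open \<Omega>" "bounded \<Omega>" and g: "has_weak_partial \<Omega> i u g"
  shows "L2_norm \<Omega> (weak_partial \<Omega> i u) = L2_norm \<Omega> g"
proof -
  have w: "has_weak_partial \<Omega> i u (weak_partial \<Omega> i u)"
    unfolding weak_partial_def by (rule someI[where P="has_weak_partial \<Omega> i u", OF g])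
  show ?thesis
    using w g by (intro L2_fundamental[OF \<Omega>]) (auto simp: has_weak_partial_def)
qed

section \<open>Gradients of finite element functions\<close>

text \<open>Along the segment \<open>u\<close> is Lipschitz on each of finitely many closed pieces,
  hence on the whole. Only gradients of tetrahedra met by the segment enter the constant, which
  keeps the bound local for \<open>diff2_pointwise\<close>.\<close>

lemma fe_segment_bound:
  assumes \<Omega>: "open \<Omega>" and tri: "triangulation_of (closure \<Omega>) T" and u: "u \<in> fe_space \<Omega> T"
    and g: "\<And>\<tau> y. \<tau> \<in> T \<Longrightarrow> y \<in> \<tau> \<Longrightarrow> u y = g \<tau> \<bullet> y + k \<tau>"
    and K: "K \<ge> 0" "\<And>\<tau>. \<tau> \<in> T \<Longrightarrow> \<tau> \<inter> closed_segment x (x + z) \<noteq> {} \<Longrightarrow> norm (g \<tau>) \<le> K"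
  shows "\<bar>u (x + z) - u x\<bar> \<le> K * norm z"
proof -
  have T: "finite T" "\<And>\<tau>. \<tau> \<in> T \<Longrightarrow> tetrahedron \<tau>" "\<Union>T = closure \<Omega>" using tri by (auto simp: triangulation_of_def)
  define f where "f s = u (x + s *\<^sub>R z)" for s
  \<comment> \<open>The index \<open>None\<close> stands for the complement of
    \<open>\<Omega>\<close>, where \<open>u\<close> is zero; a segment may leave a nonconvex
    domain.\<close>
  define U where "U i = {0..1} \<inter> (\<lambda>s. x + s *\<^sub>R z) -` (case i of None \<Rightarrow> - \<Omega> | Some \<tau> \<Rightarrow> \<tau>)" for i
  have seg: "x + s *\<^sub>R z \<in> closed_segment x (x + z)" if "s \<in> {0..1}" for s
    unfolding in_segment using that by (intro exI[of _ s]) (auto simp: algebra_simps)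
  have "(K * norm z)-lipschitz_on {0..1} f"
  proof (rule lipschitz_on_closed_Union[where I="insert None (Some ` T)" and U=U])
    show "(K * norm z)-lipschitz_on (U i) f" if i: "i \<in> insert None (Some ` T)" for i
    proof (rule lipschitz_onI)
      fix s t assume st: "s \<in> U i" "t \<in> U i"
      show "dist (f s) (f t) \<le> K * norm z * dist s t"
      proof (cases i)
        case None
        then have "f s = 0" "f t = 0" using st fe_space_zero_outside[OF \<Omega> u] by (auto simp: U_def f_def)
        then show ?thesis using K(1) by simp
      next
        case (Some \<tau>)
        then have \<tau>: "\<tau> \<in> T" using i by auto
        have in\<tau>: "x + s *\<^sub>R z \<in> \<tau>" "x + t *\<^sub>R z \<in> \<tau>" using st Some by (auto simp: U_def)
        have "\<tau> \<inter> closed_segment x (x + z) \<noteq> {}" using in\<tau> seg st by (auto simp: U_def)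
        then have gK: "norm (g \<tau>) \<le> K" using K(2)[OF \<tau>] by simp
        have "f s - f t = (s - t) * (g \<tau> \<bullet> z)"
          using g[OF \<tau> in\<tau>(1)] g[OF \<tau> in\<tau>(2)] by (simp add: f_def inner_add_right algebra_simps)
        then have "dist (f s) (f t) = \<bar>s - t\<bar> * \<bar>g \<tau> \<bullet> z\<bar>" by (simp add: dist_real_def abs_mult)
        also have "\<dots> \<le> \<bar>s - t\<bar> * (K * norm z)"
          using Cauchy_Schwarz_ineq2[of "g \<tau>" z] mult_right_mono[OF gK norm_ge_zero[of z]] by (intro mult_left_mono) linarith+
        finally show ?thesis by (simp add: dist_real_def mult.commute)
      qed
    qed (use K in auto)
    show "closed (U i)" if "i \<in> insert None (Some ` T)" for i
    proof -
      have "closed (case i of None \<Rightarrow> - \<Omega> | Some \<tau> \<Rightarrow> \<tau>)"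
        using that \<Omega> by (auto simp: closed_Compl intro: closed_simplex[OF T(2)])
      then show ?thesis unfolding U_def by (intro continuous_closed_preimage continuous_intros) auto
    qed
    show "{0..1} \<subseteq> (\<Union>i\<in>insert None (Some ` T). U i)"
    proof
      fix s :: real assume s: "s \<in> {0..1}"
      show "s \<in> (\<Union>i\<in>insert None (Some ` T). U i)"
      proof (cases "x + s *\<^sub>R z \<in> \<Omega>")
        case True
        then have "x + s *\<^sub>R z \<in> \<Union>T" using T(3) closure_subset by blast
        then obtain \<tau> where "\<tau> \<in> T" "x + s *\<^sub>R z \<in> \<tau>" by blast
        then show ?thesis using s by (auto simp: U_def)
      qed (use s in \<open>auto simp: U_def\<close>)
    qed
  qed (use T K in auto)
  from lipschitz_onD[OF this, of 1 0] show ?thesis by (simp add: f_def dist_real_def)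
qed

lemma fe_gradients:
  assumes "u \<in> fe_space \<Omega> T"
  shows "\<exists>g k. \<forall>\<tau>\<in>T. \<forall>y\<in>\<tau>. u y = g \<tau> \<bullet> y + k \<tau>"
proof -
  have "\<forall>\<tau>\<in>T. \<exists>p. \<forall>y\<in>\<tau>. u y = fst p \<bullet> y + snd p" using fe_space_eq_affine[OF assms] by auto
  from bchoice[OF this] obtain p where "\<forall>\<tau>\<in>T. \<forall>y\<in>\<tau>. u y = fst (p \<tau>) \<bullet> y + snd (p \<tau>)" by blast
  then show ?thesis by (intro exI[of _ "\<lambda>\<tau>. fst (p \<tau>)"] exI[of _ "\<lambda>\<tau>. snd (p \<tau>)"])
qed

lemma fe_Lipschitz:
  assumes \<Omega>: "open \<Omega>" and tri: "triangulation_of (closure \<Omega>) T" and u: "u \<in> fe_space \<Omega> T"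
  obtains L where "L \<ge> 0" "\<And>x z. \<bar>u (x + z) - u x\<bar> \<le> L * norm z"
proof -
  have T: "finite T" using tri by (auto simp: triangulation_of_def)
  obtain g k where g: "\<And>\<tau> y. \<tau> \<in> T \<Longrightarrow> y \<in> \<tau> \<Longrightarrow> u y = g \<tau> \<bullet> y + k \<tau>" using fe_gradients[OF u] by blast
  define L where "L = (\<Sum>\<tau>\<in>T. norm (g \<tau>))"
  have L: "norm (g \<tau>) \<le> L" if "\<tau> \<in> T" for \<tau> unfolding L_def using T that by (intro member_le_sum) auto
  have L0: "L \<ge> 0" unfolding L_def by (intro sum_nonneg) auto
  have "\<bar>u (x + z) - u x\<bar> \<le> L * norm z" for x z
    by (rule fe_segment_bound[OF \<Omega> tri u g L0 L])
  then show thesis using that L0 by blast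
qed

text \<open>Off the mesh boundary this is the directional derivative; on that null set the limit may
  be meaningless. The dyadic sequence makes measurability immediate and matches
  \<open>diff_energy\<close>.\<close>

definition grad :: "'a::real_normed_vector \<Rightarrow> ('a \<Rightarrow> real) \<Rightarrow> 'a \<Rightarrow> real" where
  "grad z u x = lim (\<lambda>n. 2 ^ n * diff1 ((1 / 2 ^ n) *\<^sub>R z) u x)"

lemma scaled_diff1_le:
  fixes u :: "'a::real_normed_vector \<Rightarrow> real"
  assumes "\<And>x z. \<bar>u (x + z) - u x\<bar> \<le> L * norm z"
  shows "\<bar>2 ^ n * diff1 ((1 / 2 ^ n) *\<^sub>R z) u x\<bar> \<le> L * norm z"
proof -
  have "\<bar>diff1 ((1 / 2 ^ n) *\<^sub>R z) u x\<bar> \<le> L * (norm z / 2 ^ n)"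
    using assms[of x "(1 / 2 ^ n) *\<^sub>R z"] by (simp add: diff1_def)
  then have "2 ^ n * \<bar>diff1 ((1 / 2 ^ n) *\<^sub>R z) u x\<bar> \<le> 2 ^ n * (L * (norm z / 2 ^ n))"
    by (rule mult_left_mono) simp
  then show ?thesis by (simp only: abs_mult) simp
qed

lemma half_powers_eventually_small:
  fixes z :: "'a::real_normed_vector"
  assumes "e > 0" shows "eventually (\<lambda>n. norm ((1 / 2 ^ n) *\<^sub>R z) < e) sequentially"
proof -
  have "(\<lambda>n. (1 / 2) ^ n * norm z) \<longlonglongrightarrow> 0 * norm z" by (intro tendsto_mult_right LIMSEQ_power_zero) auto
  then have "eventually (\<lambda>n. (1 / 2) ^ n * norm z < e) sequentially" using assms by (intro order_tendstoD(2)) auto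
  then show ?thesis by (simp add: power_one_over)
qed

lemma AE_not_mesh_boundary:
  assumes tri: "triangulation_of R T"
  shows "AE x in lborel. x \<notin> (\<Union>\<tau>\<in>T. frontier \<tau>)"
proof -
  have T: "finite T" "\<And>\<tau>. \<tau> \<in> T \<Longrightarrow> tetrahedron \<tau>" using tri by (auto simp: triangulation_of_def)
  have "negligible (\<Union>\<tau>\<in>T. frontier \<tau>)"
    using T convex_simplex by (intro negligible_Union) (auto intro!: negligible_convex_frontier)
  moreover have "closed (\<Union>\<tau>\<in>T. frontier \<tau>)" using T by (intro closed_UN) auto
  ultimately have "(\<Union>\<tau>\<in>T. frontier \<tau>) \<in> null_sets lborel"
    by (simp add: negligible_iff_null_sets null_sets_completion_iff)
  then show ?thesis by (rule AE_not_in)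
qed

text \<open>Off the mesh boundary small steps remain inside one tetrahedron or outside the closure,
  so the quotients are eventually constant, with one vector \<open>g\<close> for all
  directions.\<close>

lemma fe_diff_quotient:
  assumes \<Omega>: "open \<Omega>" and tri: "triangulation_of (closure \<Omega>) T" and u: "u \<in> fe_space \<Omega> T"
    and x: "x \<notin> (\<Union>\<tau>\<in>T. frontier \<tau>)"
  shows "\<exists>g. (\<forall>z. (\<lambda>n. 2 ^ n * diff1 ((1 / 2 ^ n) *\<^sub>R z) u x) \<longlonglongrightarrow> g \<bullet> z) \<and> (x \<notin> closure \<Omega> \<longrightarrow> g = 0)"
proof (cases "x \<in> closure \<Omega>")
  case True
  then have "x \<in> \<Union>T" using tri by (simp add: triangulation_of_def)
  then obtain \<tau> where \<tau>: "\<tau> \<in> T" "x \<in> \<tau>" by blast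
  have "closed \<tau>" using tri \<tau> closed_simplex by (auto simp: triangulation_of_def)
  then have "x \<in> interior \<tau>" using x \<tau> by (auto simp: frontier_def)
  then obtain e where e: "e > 0" "ball x e \<subseteq> \<tau>" using mem_interior by blast
  obtain g k where g: "\<And>y. y \<in> \<tau> \<Longrightarrow> u y = g \<bullet> y + k" using fe_space_eq_affine[OF u \<tau>(1)] by blast
  have "(\<lambda>n. 2 ^ n * diff1 ((1 / 2 ^ n) *\<^sub>R z) u x) \<longlonglongrightarrow> g \<bullet> z" for z
  proof (rule tendsto_eventually)
    show "eventually (\<lambda>n. 2 ^ n * diff1 ((1 / 2 ^ n) *\<^sub>R z) u x = g \<bullet> z) sequentially"
      using half_powers_eventually_small[OF e(1), of z]
    proof (rule eventually_mono)
      fix n assume "norm ((1 / 2 ^ n) *\<^sub>R z) < e"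
      then have "x + (1 / 2 ^ n) *\<^sub>R z \<in> ball x e" by (simp add: dist_norm)
      then have "u (x + (1 / 2 ^ n) *\<^sub>R z) = g \<bullet> (x + (1 / 2 ^ n) *\<^sub>R z) + k" using g e by blast
      then show "2 ^ n * diff1 ((1 / 2 ^ n) *\<^sub>R z) u x = g \<bullet> z"
        using g[OF \<tau>(2)] by (simp add: diff1_def inner_add_right)
    qed
  qed
  then show ?thesis using True by blast
next
  case False
  then obtain e where e: "e > 0" "ball x e \<subseteq> - closure \<Omega>" using open_contains_ball[of "- closure \<Omega>"] by auto
  have u0: "u y = 0" if "y \<in> ball x e" for y
    using fe_space_zero_outside[OF \<Omega> u, of y] e that closure_subset by blast
  have "(\<lambda>n. 2 ^ n * diff1 ((1 / 2 ^ n) *\<^sub>R z) u x) \<longlonglongrightarrow> 0 \<bullet> z" for z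
  proof (rule tendsto_eventually)
    show "eventually (\<lambda>n. 2 ^ n * diff1 ((1 / 2 ^ n) *\<^sub>R z) u x = 0 \<bullet> z) sequentially"
      using half_powers_eventually_small[OF e(1), of z]
    proof (rule eventually_mono)
      fix n assume "norm ((1 / 2 ^ n) *\<^sub>R z) < e"
      then have "u (x + (1 / 2 ^ n) *\<^sub>R z) = 0" by (intro u0) (simp add: dist_norm)
      moreover have "u x = 0" using e by (intro u0) simp
      ultimately show "2 ^ n * diff1 ((1 / 2 ^ n) *\<^sub>R z) u x = 0 \<bullet> z" by (simp add: diff1_def)
    qed
  qed
  then show ?thesis by blast
qed

lemma grad_eq: "(\<lambda>n. 2 ^ n * diff1 ((1 / 2 ^ n) *\<^sub>R z) u x) \<longlonglongrightarrow> l \<Longrightarrow> grad z u x = l"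
  unfolding grad_def by (rule limI)

lemma grad_measurable: "u \<in> cc \<Longrightarrow> grad z u \<in> borel_measurable borel"
  unfolding grad_def[abs_def]
  by (intro borel_measurable_lim_metric borel_measurable_times borel_measurable_const cc_measurable cc_diff1)

lemma grad_energy:
  assumes \<Omega>: "open \<Omega>" "bounded \<Omega>" and tri: "triangulation_of (closure \<Omega>) T" and u: "u \<in> fe_space \<Omega> T"
  shows "diff_energy z u \<longlonglongrightarrow> (nrm lborel (grad z u))\<^sup>2" "square_integrable lborel (grad z u)"
proof -
  have ucc: "u \<in> cc" by (rule fe_space_cc[OF \<Omega> u])
  obtain L where L: "L \<ge> 0" "\<And>x z. \<bar>u (x + z) - u x\<bar> \<le> L * norm z" by (rule fe_Lipschitz[OF \<Omega>(1) tri u], rule that; blast)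
  obtain r where r: "r > 0" "\<And>x. norm x > r \<Longrightarrow> u x = 0" using cc_support[OF ucc] by blast
  \<comment> \<open>All steps are at most \<open>norm z\<close>, so the differences vanish outside
    the enlarged ball, and the Lipschitz constant bounds the quotients inside.\<close>
  define w where "w x = indicat_real (cball 0 (r + norm z)) x * (L * norm z)\<^sup>2" for x :: "real^3"
  have wi: "integrable lborel w" unfolding w_def
    by (intro integrable_mult_left integrable_real_indicator) (use emeasure_compact_finite[OF compact_cball] in auto)
  have eq: "diff_energy z u n = (LINT x|lborel. (2 ^ n * diff1 ((1 / 2 ^ n) *\<^sub>R z) u x)\<^sup>2)" for n
  proof -
    have "(2 ^ n)\<^sup>2 = (4::real) ^ n" by (simp add: power2_eq_square flip: power_mult_distrib)
    then show ?thesis by (simp add: diff_energy_def nrm_power2 power_mult_distrib)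
  qed
  have bound: "norm ((2 ^ n * diff1 ((1 / 2 ^ n) *\<^sub>R z) u x)\<^sup>2) \<le> w x" for n x
  proof (cases "norm x \<le> r + norm z")
    case True
    have "\<bar>2 ^ n * diff1 ((1 / 2 ^ n) *\<^sub>R z) u x\<bar> \<le> L * norm z"
      by (rule scaled_diff1_le[OF L(2)])
    then have "(2 ^ n * diff1 ((1 / 2 ^ n) *\<^sub>R z) u x)\<^sup>2 \<le> (L * norm z)\<^sup>2"
      by (metis abs_ge_zero power2_abs power_mono)
    then show ?thesis using True by (simp add: w_def)
  next
    case False
    then have "u x = 0" by (intro r(2)) (use norm_ge_zero[of z] in linarith)
    have "norm ((1 / 2 ^ n) *\<^sub>R z) \<le> norm z" by (simp add: divide_le_eq mult_le_cancel_left1)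
    then have "norm (x + (1 / 2 ^ n) *\<^sub>R z) > r" using False norm_diff_ineq[of x "(1 / 2 ^ n) *\<^sub>R z"] by linarith
    then have "u (x + (1 / 2 ^ n) *\<^sub>R z) = 0" by (rule r(2))
    then show ?thesis using \<open>u x = 0\<close> by (simp add: w_def diff1_def)
  qed
  have lim: "AE x in lborel. (\<lambda>n. (2 ^ n * diff1 ((1 / 2 ^ n) *\<^sub>R z) u x)\<^sup>2) \<longlonglongrightarrow> (grad z u x)\<^sup>2"
    using AE_not_mesh_boundary[OF tri]
  proof (rule AE_mp, intro AE_I2 impI)
    fix x assume "x \<notin> (\<Union>\<tau>\<in>T. frontier \<tau>)"
    from fe_diff_quotient[OF \<Omega>(1) tri u this] obtain g where
      g: "(\<lambda>n. 2 ^ n * diff1 ((1 / 2 ^ n) *\<^sub>R z) u x) \<longlonglongrightarrow> g \<bullet> z" by blast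
    then show "(\<lambda>n. (2 ^ n * diff1 ((1 / 2 ^ n) *\<^sub>R z) u x)\<^sup>2) \<longlonglongrightarrow> (grad z u x)\<^sup>2"
      unfolding grad_eq[OF g] by (rule tendsto_power)
  qed
  have m: "(\<lambda>x. (grad z u x)\<^sup>2) \<in> borel_measurable lborel" using grad_measurable[OF ucc] by simp
  have ms: "(\<lambda>x. (2 ^ n * diff1 ((1 / 2 ^ n) *\<^sub>R z) u x)\<^sup>2) \<in> borel_measurable lborel" for n
    using cc_measurable[OF cc_diff1[OF ucc]] by simp
  show "diff_energy z u \<longlonglongrightarrow> (nrm lborel (grad z u))\<^sup>2"
    unfolding eq[abs_def] nrm_power2
    by (rule integral_dominated_convergence[OF m ms wi lim]) (use bound in auto)
  show "square_integrable lborel (grad z u)"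
    unfolding square_integrable_def
    using integrable_dominated_convergence[OF m ms wi lim] bound grad_measurable[OF ucc] by auto
qed

text \<open>By monotonicity the limit bounds each scale with constant 1; the directional derivative
  is then estimated by the full gradient pointwise.\<close>

lemma diff_energy_le_grad:
  assumes \<Omega>: "open \<Omega>" "bounded \<Omega>" and tri: "triangulation_of (closure \<Omega>) T" and u: "u \<in> fe_space \<Omega> T"
  shows "diff_energy z u n \<le> (norm z)\<^sup>2 * (\<Sum>i\<in>UNIV. (nrm lborel (grad (axis i 1) u))\<^sup>2)"
proof -
  have ucc: "u \<in> cc" by (rule fe_space_cc[OF \<Omega> u])
  have "diff_energy z u n \<le> (nrm lborel (grad z u))\<^sup>2"
    by (rule incseq_le[OF incseq_diff_energy[OF ucc] grad_energy(1)[OF \<Omega> tri u]])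
  also have "\<dots> \<le> (LINT x|lborel. (norm z)\<^sup>2 * (\<Sum>i\<in>UNIV. (grad (axis i 1) u x)\<^sup>2))"
    unfolding nrm_power2
  proof (rule integral_mono_AE)
    show "integrable lborel (\<lambda>x. (grad z u x)\<^sup>2)"
      using grad_energy(2)[OF \<Omega> tri u] by (simp add: square_integrable_def)
    show "integrable lborel (\<lambda>x. (norm z)\<^sup>2 * (\<Sum>i\<in>UNIV. (grad (axis i 1) u x)\<^sup>2))"
      using grad_energy(2)[OF \<Omega> tri u] by (intro integrable_mult_right Bochner_Integration.integrable_sum) (simp add: square_integrable_def)
    show "AE x in lborel. (grad z u x)\<^sup>2 \<le> (norm z)\<^sup>2 * (\<Sum>i\<in>UNIV. (grad (axis i 1) u x)\<^sup>2)"
      using AE_not_mesh_boundary[OF tri]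
    proof (rule AE_mp, intro AE_I2 impI)
      fix x assume "x \<notin> (\<Union>\<tau>\<in>T. frontier \<tau>)"
      from fe_diff_quotient[OF \<Omega>(1) tri u this] obtain g where
        g: "\<And>z. (\<lambda>n. 2 ^ n * diff1 ((1 / 2 ^ n) *\<^sub>R z) u x) \<longlonglongrightarrow> g \<bullet> z" by blast
      have gr: "grad z u x = g \<bullet> z" for z by (rule grad_eq[OF g])
      have "(\<Sum>i\<in>UNIV. (grad (axis i 1) u x)\<^sup>2) = (\<Sum>i\<in>UNIV. g $ i * g $ i)"
        by (simp add: gr inner_axis power2_eq_square)
      also have "\<dots> = (norm g)\<^sup>2" by (simp add: power2_norm_eq_inner inner_vec_def)
      finally have s: "(\<Sum>i\<in>UNIV. (grad (axis i 1) u x)\<^sup>2) = (norm g)\<^sup>2" .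
      have "(g \<bullet> z)\<^sup>2 \<le> (norm g * norm z)\<^sup>2"
        using Cauchy_Schwarz_ineq2[of g z] by (metis abs_ge_zero power2_abs power_mono)
      then show "(grad z u x)\<^sup>2 \<le> (norm z)\<^sup>2 * (\<Sum>i\<in>UNIV. (grad (axis i 1) u x)\<^sup>2)"
        unfolding s unfolding gr by (simp add: power_mult_distrib mult.commute)
    qed
  qed
  also have "\<dots> = (norm z)\<^sup>2 * (\<Sum>i\<in>UNIV. (nrm lborel (grad (axis i 1) u))\<^sup>2)"
    using grad_energy(2)[OF \<Omega> tri u] by (simp add: nrm_power2 square_integrable_def Bochner_Integration.integral_sum)
  finally show ?thesis .
qed

lemma test_function_partial:
  assumes t: "test_function \<Omega> \<phi>"
  shows "partial_deriv i \<phi> \<in> cc"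
    and "((\<lambda>s. \<phi> (x + s *\<^sub>R axis i 1)) has_real_derivative partial_deriv i \<phi> (x + s *\<^sub>R axis i 1)) (at s)"
proof -
  have C1: "C_k (Suc 0) \<phi>" using t unfolding test_function_def by blast
  then have diff: "\<phi> differentiable at x" for x by (auto simp: differentiable_on_def)
  have der: "(\<phi> has_derivative frechet_derivative \<phi> (at x)) (at x)" for x
    using diff frechet_derivative_works by blast
  have cont: "continuous_on UNIV (partial_deriv i \<phi>)" using C1 by simp
  have "partial_deriv i \<phi> x = 0" if x: "x \<notin> closure {x. \<phi> x \<noteq> 0}" for x
  proof -
    have z0: "\<phi> y = 0" if "y \<in> - closure {x. \<phi> x \<noteq> 0}" for y
      using that subsetD[OF closure_subset, of y "{x. \<phi> x \<noteq> 0}"] by auto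
    have "(\<phi> has_derivative (\<lambda>_. 0)) (at x)"
    proof (rule has_derivative_transform_within_open[where f="\<lambda>_. 0" and s="- closure {x. \<phi> x \<noteq> 0}", OF has_derivative_const])
      show "open (- closure {x. \<phi> x \<noteq> 0})" by (rule open_Compl) (rule closed_closure)
      show "x \<in> - closure {x. \<phi> x \<noteq> 0}" using x by blast
    qed (rule sym, rule z0)
    from frechet_derivative_at[OF this, symmetric] show ?thesis by (simp only: partial_deriv_def)
  qed
  then have "{x. partial_deriv i \<phi> x \<noteq> 0} \<subseteq> closure {x. \<phi> x \<noteq> 0}" by blast
  moreover have "bounded (closure {x. \<phi> x \<noteq> 0})" using t unfolding test_function_def by (blast intro: compact_imp_bounded)
  ultimately have "bounded {x. partial_deriv i \<phi> x \<noteq> 0}" by (rule bounded_subset[rotated])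
  then show "partial_deriv i \<phi> \<in> cc" using cont by (simp add: cc_def)
  have "((\<lambda>s. x + s *\<^sub>R axis i 1) has_derivative (\<lambda>h. h *\<^sub>R axis i 1)) (at s)" by (auto intro!: derivative_eq_intros)
  from has_derivative_compose[OF this der]
  have "((\<lambda>s. \<phi> (x + s *\<^sub>R axis i 1)) has_derivative (\<lambda>h. frechet_derivative \<phi> (at (x + s *\<^sub>R axis i 1)) (h *\<^sub>R axis i 1))) (at s)" .
  moreover have "frechet_derivative \<phi> (at y) (h *\<^sub>R axis i 1) = partial_deriv i \<phi> y * h" for y h
    using linear_cmul[OF linear_frechet_derivative[OF diff[of y]], of h "axis i 1"] by (simp add: partial_deriv_def)
  ultimately show "((\<lambda>s. \<phi> (x + s *\<^sub>R axis i 1)) has_real_derivative partial_deriv i \<phi> (x + s *\<^sub>R axis i 1)) (at s)"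
    by (simp add: has_field_derivative_def)
qed

lemma cc_bounded:
  assumes "u \<in> cc" obtains K where "K \<ge> 0" "\<And>x. \<bar>u x\<bar> \<le> K"
proof -
  obtain r where r: "r > 0" "\<And>x. norm x > r \<Longrightarrow> u x = 0" using cc_support[OF assms] by blast
  have "compact (u ` cball 0 r)"
    by (rule compact_continuous_image[OF continuous_on_subset[OF cc_continuous[OF assms]]]) auto
  then obtain K where K: "\<And>y. y \<in> cball 0 r \<Longrightarrow> \<bar>u y\<bar> \<le> K"
    using compact_imp_bounded bounded_iff[of "u ` cball 0 r"] by (metis image_eqI real_norm_def)
  have "\<bar>u y\<bar> \<le> max K 0" for y
    using K[of y] r(2)[of y] by (cases "norm y \<le> r") auto
  then show thesis using that[of "max K 0"] by simp
qed

text \<open>Summation by parts: translation invariance moves the difference quotient from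
  \<open>\<phi>\<close> to \<open>u\<close> exactly, and both sides converge. Thus no boundary terms
  on the faces of the mesh ever appear.\<close>

lemma fe_integration_by_parts:
  assumes \<Omega>: "open \<Omega>" "bounded \<Omega>" and tri: "triangulation_of (closure \<Omega>) T" and u: "u \<in> fe_space \<Omega> T"
    and t: "test_function \<Omega>' \<phi>"
  shows "(LINT x|lborel. u x * partial_deriv i \<phi> x) = - (LINT x|lborel. grad (axis i 1) u x * \<phi> x)"
proof -
  let ?e = "axis i (1::real) :: real^3"
  have ucc: "u \<in> cc" by (rule fe_space_cc[OF \<Omega> u])
  have \<phi>: "\<phi> \<in> cc" by (rule test_function_cc[OF t])
  have dcc: "partial_deriv i \<phi> \<in> cc" by (rule test_function_partial(1)[OF t])
  have der: "((\<lambda>s. \<phi> (x + s *\<^sub>R ?e)) has_real_derivative partial_deriv i \<phi> (x + s *\<^sub>R ?e)) (at s)" for x s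
    by (rule test_function_partial(2)[OF t])
  obtain K where K: "K \<ge> 0" "\<And>x. \<bar>partial_deriv i \<phi> x\<bar> \<le> K" using cc_bounded[OF dcc] by metis
  obtain L where L: "L \<ge> 0" "\<And>x z. \<bar>u (x + z) - u x\<bar> \<le> L * norm z" by (rule fe_Lipschitz[OF \<Omega>(1) tri u], rule that; blast)
  define h where "h n = (1 / 2 ^ n :: real)" for n
  have h: "h n > 0" for n by (simp add: h_def)
  define A where "A n = (LINT x|lborel. u x * (2 ^ n * (\<phi> x - \<phi> (x - h n *\<^sub>R ?e))))" for n
  define B where "B n = (LINT x|lborel. 2 ^ n * diff1 (h n *\<^sub>R ?e) u x * \<phi> x)" for n
  \<comment> \<open>A backward difference of \<open>\<phi>\<close> corresponds to a forward
    difference of \<open>u\<close>.\<close>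
  have AB: "A n = - B n" for n
  proof -
    have m: "(\<lambda>x. u x * \<phi> (x - h n *\<^sub>R ?e)) \<in> cc" "(\<lambda>x. u (x + h n *\<^sub>R ?e) * \<phi> x) \<in> cc" "(\<lambda>x. u x * \<phi> x) \<in> cc"
      using cc_translate[OF \<phi>, of "- h n *\<^sub>R ?e"] cc_translate[OF ucc, of "h n *\<^sub>R ?e"] \<phi> ucc
      by (auto intro!: cc_mult_left cc_continuous)
    have tr: "(LINT x|lborel. u x * \<phi> (x - h n *\<^sub>R ?e)) = (LINT x|lborel. u (x + h n *\<^sub>R ?e) * \<phi> x)"
      using integral_translate[OF cc_measurable[OF m(1)], of "h n *\<^sub>R ?e"] by simp
    have "A n = (LINT x|lborel. 2 ^ n * (u x * \<phi> x) - 2 ^ n * (u x * \<phi> (x - h n *\<^sub>R ?e)))"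
      unfolding A_def by (simp add: algebra_simps)
    also have "\<dots> = 2 ^ n * (LINT x|lborel. u x * \<phi> x) - 2 ^ n * (LINT x|lborel. u x * \<phi> (x - h n *\<^sub>R ?e))"
      using cc_integrable[OF m(1)] cc_integrable[OF m(3)] by simp
    also have "\<dots> = - (2 ^ n * (LINT x|lborel. u (x + h n *\<^sub>R ?e) * \<phi> x) - 2 ^ n * (LINT x|lborel. u x * \<phi> x))"
      unfolding tr by simp
    also have "\<dots> = - (LINT x|lborel. 2 ^ n * (u (x + h n *\<^sub>R ?e) * \<phi> x) - 2 ^ n * (u x * \<phi> x))"
      using cc_integrable[OF m(2)] cc_integrable[OF m(3)] by simp
    also have "\<dots> = - B n" unfolding B_def diff1_def by (simp add: algebra_simps)
    finally show ?thesis .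
  qed
  have "A \<longlonglongrightarrow> (LINT x|lborel. u x * partial_deriv i \<phi> x)"
    unfolding A_def
  proof (rule integral_dominated_convergence[where w="\<lambda>x. K * norm (u x)"])
    show "(\<lambda>x. u x * partial_deriv i \<phi> x) \<in> borel_measurable lborel" using cc_measurable[OF ucc] cc_measurable[OF dcc] by simp
    show "(\<lambda>x. u x * (2 ^ n * (\<phi> x - \<phi> (x - h n *\<^sub>R ?e)))) \<in> borel_measurable lborel" for n
      using cc_measurable[OF ucc] cc_measurable[OF \<phi>] cc_measurable[OF cc_translate[OF \<phi>, of "- h n *\<^sub>R ?e"]] by simp
    show "integrable lborel (\<lambda>x. K * norm (u x))" using cc_integrable[OF ucc] by simp
    show "AE x in lborel. norm (u x * (2 ^ n * (\<phi> x - \<phi> (x - h n *\<^sub>R ?e)))) \<le> K * norm (u x)" for n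
    proof (rule AE_I2)
      fix x
      \<comment> \<open>The mean value theorem turns the quotient into a derivative at an
        intermediate point, which gives the uniform bound \<open>K\<close>.\<close>
      have "\<exists>s. - h n < s \<and> s < 0 \<and> \<phi> (x + 0 *\<^sub>R ?e) - \<phi> (x + (- h n) *\<^sub>R ?e) = (0 - (- h n)) * partial_deriv i \<phi> (x + s *\<^sub>R ?e)"
        by (rule MVT2) (use h der in auto)
      then obtain s where "\<phi> x - \<phi> (x - h n *\<^sub>R ?e) = h n * partial_deriv i \<phi> (x + s *\<^sub>R ?e)" by auto
      then have "2 ^ n * (\<phi> x - \<phi> (x - h n *\<^sub>R ?e)) = partial_deriv i \<phi> (x + s *\<^sub>R ?e)" by (simp add: h_def)
      then show "norm (u x * (2 ^ n * (\<phi> x - \<phi> (x - h n *\<^sub>R ?e)))) \<le> K * norm (u x)"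
        using mult_left_mono[OF K(2)[of "x + s *\<^sub>R ?e"], of "\<bar>u x\<bar>"] by (simp only: abs_mult real_norm_def mult.commute)
    qed
    show "AE x in lborel. (\<lambda>n. u x * (2 ^ n * (\<phi> x - \<phi> (x - h n *\<^sub>R ?e)))) \<longlonglongrightarrow> u x * partial_deriv i \<phi> x"
    proof (intro AE_I2 tendsto_mult_left)
      fix x
      have "((\<lambda>s. (\<phi> (x + (0 + s) *\<^sub>R ?e) - \<phi> (x + 0 *\<^sub>R ?e)) / s) \<longlongrightarrow> partial_deriv i \<phi> (x + 0 *\<^sub>R ?e)) (at 0)"
        using der[of x 0] unfolding DERIV_def .
      then have 1: "((\<lambda>s. (\<phi> (x + s *\<^sub>R ?e) - \<phi> x) / s) \<longlongrightarrow> partial_deriv i \<phi> x) (at 0)" by simp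
      have "(\<lambda>n. - ((1 / 2) ^ n) :: real) \<longlonglongrightarrow> - 0" by (intro tendsto_minus LIMSEQ_power_zero) auto
      then have 2: "filterlim (\<lambda>n. - h n) (at 0) sequentially"
        using h by (intro filterlim_atI) (auto simp: h_def power_one_over less_imp_neq)
      have "(\<lambda>n. (\<phi> (x + (- h n) *\<^sub>R ?e) - \<phi> x) / (- h n)) \<longlonglongrightarrow> partial_deriv i \<phi> x"
        by (rule filterlim_compose[OF 1 2])
      moreover have "(\<phi> (x + (- h n) *\<^sub>R ?e) - \<phi> x) / (- h n) = 2 ^ n * (\<phi> x - \<phi> (x - h n *\<^sub>R ?e))" for n
        by (simp add: h_def algebra_simps)
      ultimately show "(\<lambda>n. 2 ^ n * (\<phi> x - \<phi> (x - h n *\<^sub>R ?e))) \<longlonglongrightarrow> partial_deriv i \<phi> x" by simp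
    qed
  qed
  moreover have "B \<longlonglongrightarrow> (LINT x|lborel. grad ?e u x * \<phi> x)"
    unfolding B_def
  proof (rule integral_dominated_convergence[where w="\<lambda>x. L * norm (\<phi> x)"])
    show "(\<lambda>x. grad ?e u x * \<phi> x) \<in> borel_measurable lborel" using grad_measurable[OF ucc] cc_measurable[OF \<phi>] by simp
    show "(\<lambda>x. 2 ^ n * diff1 (h n *\<^sub>R ?e) u x * \<phi> x) \<in> borel_measurable lborel" for n
      using cc_measurable[OF cc_diff1[OF ucc]] cc_measurable[OF \<phi>] by simp
    show "integrable lborel (\<lambda>x. L * norm (\<phi> x))" using cc_integrable[OF \<phi>] by simp
    show "AE x in lborel. norm (2 ^ n * diff1 (h n *\<^sub>R ?e) u x * \<phi> x) \<le> L * norm (\<phi> x)" for n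
    proof (rule AE_I2)
      fix x
      have "\<bar>2 ^ n * diff1 (h n *\<^sub>R ?e) u x\<bar> \<le> L"
        using scaled_diff1_le[OF L(2), of n ?e x] by (simp add: h_def)
      then show "norm (2 ^ n * diff1 (h n *\<^sub>R ?e) u x * \<phi> x) \<le> L * norm (\<phi> x)"
        unfolding real_norm_def abs_mult[of "2 ^ n * diff1 (h n *\<^sub>R ?e) u x"] by (rule mult_right_mono) simp
    qed
    show "AE x in lborel. (\<lambda>n. 2 ^ n * diff1 (h n *\<^sub>R ?e) u x * \<phi> x) \<longlonglongrightarrow> grad ?e u x * \<phi> x"
      using AE_not_mesh_boundary[OF tri]
    proof (rule AE_mp, intro AE_I2 impI tendsto_mult_right)
      fix x assume "x \<notin> (\<Union>\<tau>\<in>T. frontier \<tau>)"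
      from fe_diff_quotient[OF \<Omega>(1) tri u this] obtain g where
        g: "(\<lambda>n. 2 ^ n * diff1 ((1 / 2 ^ n) *\<^sub>R ?e) u x) \<longlonglongrightarrow> g \<bullet> ?e" by blast
      then show "(\<lambda>n. 2 ^ n * diff1 (h n *\<^sub>R ?e) u x) \<longlonglongrightarrow> grad ?e u x"
        unfolding grad_eq[OF g] h_def .
    qed
  qed
  then have "(\<lambda>n. - B n) \<longlonglongrightarrow> - (LINT x|lborel. grad ?e u x * \<phi> x)" by (rule tendsto_minus)
  ultimately show ?thesis unfolding AB[abs_def] by (rule LIMSEQ_unique)
qed

lemma L2_norm_eq_nrm:
  assumes "open \<Omega>" "f \<in> borel_measurable borel" "AE x in lborel. x \<notin> \<Omega> \<longrightarrow> f x = 0"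
  shows "L2_norm \<Omega> f = nrm lborel f"
proof -
  have m: "(\<lambda>x. indicat_real \<Omega> x *\<^sub>R (f x * f x)) \<in> borel_measurable borel"
    using assms by (intro borel_measurable_scaleR borel_measurable_indicator borel_measurable_times) auto
  have "L2_inner \<Omega> f f = (LINT x|lborel. indicator \<Omega> x *\<^sub>R (f x * f x))"
    unfolding L2_inner_def set_lebesgue_integral_def
    by (subst integral_completion) (use m in simp_all)
  also have "\<dots> = (LINT x|lborel. (f x)\<^sup>2)"
  proof (rule integral_cong_AE)
    show "AE x in lborel. indicat_real \<Omega> x *\<^sub>R (f x * f x) = (f x)\<^sup>2"
      using assms(3) by (rule AE_mp) (auto simp: power2_eq_square indicator_def)
  qed (use m assms(2) in auto)
  finally show ?thesis by (simp add: L2_norm_def nrm_def)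
qed

lemma H1_norm_fe:
  assumes \<Omega>: "open \<Omega>" "bounded \<Omega>" "interior (closure \<Omega>) = \<Omega>"
    and tri: "triangulation_of (closure \<Omega>) T" and u: "u \<in> fe_space \<Omega> T"
  shows "(H1_norm \<Omega> u)\<^sup>2 = (nrm lborel u)\<^sup>2 + (\<Sum>i\<in>UNIV. (nrm lborel (grad (axis i 1) u))\<^sup>2)"
proof -
  have ucc: "u \<in> cc" by (rule fe_space_cc[OF \<Omega>(1,2) u])
  have gm: "grad z u \<in> borel_measurable borel" for z by (rule grad_measurable[OF ucc])
  have g0: "AE x in lborel. x \<notin> \<Omega> \<longrightarrow> grad z u x = 0" for z
    using AE_not_mesh_boundary[OF tri]
  proof (rule AE_mp, intro AE_I2 impI)
    fix x assume x: "x \<notin> (\<Union>\<tau>\<in>T. frontier \<tau>)" "x \<notin> \<Omega>"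
    \<comment> \<open>A point of the closure off all mesh boundaries is interior to a tetrahedron,
      hence in \<open>interior (closure \<Omega>)\<close>, which is \<open>\<Omega>\<close>
      itself.\<close>
    have "x \<notin> closure \<Omega>"
    proof
      assume "x \<in> closure \<Omega>"
      then have "x \<in> \<Union>T" using tri by (simp add: triangulation_of_def)
      then obtain \<tau> where \<tau>: "\<tau> \<in> T" "x \<in> \<tau>" by blast
      have "closed \<tau>" using tri \<tau> closed_simplex by (auto simp: triangulation_of_def)
      then have "x \<in> interior \<tau>" using x \<tau> by (auto simp: frontier_def)
      moreover have "\<tau> \<subseteq> closure \<Omega>" using tri \<tau> by (auto simp: triangulation_of_def)
      ultimately have "x \<in> interior (closure \<Omega>)" using interior_mono by blast
      then show False using x \<Omega> by simp
    qed
    with fe_diff_quotient[OF \<Omega>(1) tri u x(1)] have "(\<lambda>n. 2 ^ n * diff1 ((1 / 2 ^ n) *\<^sub>R z) u x) \<longlonglongrightarrow> 0 \<bullet> z" by blast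
    then have "grad z u x = 0 \<bullet> z" by (rule grad_eq)
    then show "grad z u x = 0" by simp
  qed
  have weak: "has_weak_partial \<Omega> i u (grad (axis i 1) u)" for i
    unfolding has_weak_partial_def
  proof (intro conjI allI impI)
    let ?g = "grad (axis i 1) u"
    have "square_integrable lebesgue ?g"
      by (rule square_integrable_completion[OF grad_energy(2)[OF \<Omega>(1,2) tri u]])
    moreover have "(\<lambda>x. indicator \<Omega> x *\<^sub>R ?g x) \<in> borel_measurable lebesgue"
      using gm \<Omega>(1) by (intro measurable_completion) auto
    moreover have \<Omega>l: "\<Omega> \<in> sets lebesgue" using \<Omega>(1) by simp
    ultimately show "in_L2 \<Omega> ?g"
      unfolding in_L2_def set_borel_measurable_def set_integrable_def square_integrable_def
      using integrable_mult_indicator[OF \<Omega>l, of "\<lambda>x. (?g x)\<^sup>2"] by simp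
    fix \<phi> assume t: "test_function \<Omega> \<phi>"
    have \<phi>: "\<phi> \<in> cc" by (rule test_function_cc[OF t])
    have "{x. \<phi> x \<noteq> 0} \<subseteq> \<Omega>"
      using t closure_subset[of "{x. \<phi> x \<noteq> 0}"] unfolding test_function_def by (meson order_trans)
    then have \<phi>0: "\<phi> x = 0" if "x \<notin> \<Omega>" for x using that by blast
    have "L2_inner \<Omega> u (partial_deriv i \<phi>) = ip u (partial_deriv i \<phi>)"
    proof (rule L2_inner_eq_ip[OF \<Omega>(1) _ cc_measurable[OF ucc] cc_measurable[OF test_function_partial(1)[OF t]]])
      show "u x * partial_deriv i \<phi> x = 0" if "x \<notin> \<Omega>" for x using fe_space_zero_outside[OF \<Omega>(1) u that] by simp
    qed
    moreover have "L2_inner \<Omega> ?g \<phi> = ip ?g \<phi>"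
      by (rule L2_inner_eq_ip[OF \<Omega>(1) _ gm cc_measurable[OF \<phi>]]) (simp add: \<phi>0)
    ultimately show "L2_inner \<Omega> u (partial_deriv i \<phi>) = - L2_inner \<Omega> ?g \<phi>"
      using fe_integration_by_parts[OF \<Omega>(1,2) tri u t] by (simp add: ip_def)
  qed
  have "L2_norm \<Omega> u = nrm lborel u"
    by (rule L2_norm_eq_nrm[OF \<Omega>(1) cc_measurable[OF ucc]]) (simp add: fe_space_zero_outside[OF \<Omega>(1) u])
  moreover have "L2_norm \<Omega> (weak_partial \<Omega> i u) = nrm lborel (grad (axis i 1) u)" for i
    unfolding L2_norm_weak_partial[OF \<Omega>(1,2) weak] by (rule L2_norm_eq_nrm[OF \<Omega>(1) gm g0])
  ultimately show ?thesis by (simp add: H1_norm_def sum_nonneg)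
qed

section \<open>Second differences of finite element functions and the upper bound\<close>

section \<open>Affine functions on balls\<close>

lemma set_integral_reflect_zero:
  fixes f :: "'a::euclidean_space \<Rightarrow> real"
  assumes "f \<in> borel_measurable borel" "\<And>x. f (- x) = - f x"
  shows "(LINT x:cball 0 r|lborel. f x) = 0"
proof -
  define g where "g x = indicat_real (cball 0 r) x *\<^sub>R f x" for x
  have g: "g \<in> borel_measurable borel" unfolding g_def using assms(1) by (intro borel_measurable_scaleR borel_measurable_indicator) auto
  define T where "T = (\<lambda>x::'a. 0 + (-1) *\<^sub>R x)"
  have "(lborel :: 'a measure) = distr lborel borel T"
    using lborel_affine[of "-1" "0::'a"] by (simp add: T_def density_1)
  then have "(LINT x|lborel. g x) = (LINT x|distr lborel borel T. g x)" by (rule arg_cong[of _ _ "\<lambda>M. LINT x|M. g x"])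
  also have "\<dots> = (LINT x|lborel. g (T x))" using g by (subst integral_distr) (auto simp: T_def)
  also have "\<dots> = (LINT x|lborel. - g x)"
    using assms(2) by (intro Bochner_Integration.integral_cong) (auto simp: T_def g_def indicator_def)
  finally show ?thesis by (simp add: set_lebesgue_integral_def g_def)
qed

lemma set_integral_cball_shift:
  fixes f :: "'a::euclidean_space \<Rightarrow> real"
  assumes "f \<in> borel_measurable borel"
  shows "(LINT x:cball c r|lborel. f x) = (LINT x:cball 0 r|lborel. f (c + x))"
proof -
  have "{x. x + c \<in> cball c r} = cball 0 r" by (auto simp: dist_norm)
  then show ?thesis using set_integral_translate[OF assms, of "cball c r" c] by (simp add: add.commute)
qed

lemma affine_ball_average:
  fixes g :: "'a::euclidean_space" and k :: real
  shows "(LINT x:cball c r|lborel. g \<bullet> x + k) = measure lborel (cball (0::'a) r) * (g \<bullet> c + k)"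
proof -
  have i: "set_integrable lborel (cball 0 r) (\<lambda>x::'a. g \<bullet> x)" "set_integrable lborel (cball 0 r) (\<lambda>x::'a. g \<bullet> c + k)"
    by (intro set_integrable_compact continuous_intros compact_cball)+
  have "(LINT x:cball c r|lborel. g \<bullet> x + k) = (LINT x:cball 0 r|lborel. g \<bullet> x + (g \<bullet> c + k))"
    by (subst set_integral_cball_shift) (auto simp: inner_add_right algebra_simps)
  also have "\<dots> = measure lborel (cball (0::'a) r) * (g \<bullet> c + k)"
    using i by (subst set_integral_add) (auto simp: set_integral_const_lborel set_integral_reflect_zero)
  finally show ?thesis .
qed

text \<open>The value at the centre is the mean over the ball, and Cauchy-Schwarz bounds the
  mean.\<close>

lemma affine_point_le_ball:
  fixes g :: "'a::euclidean_space" and k :: real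
  assumes "r > 0"
  shows "measure lborel (cball (0::'a) r) * (g \<bullet> c + k)\<^sup>2 \<le> (LINT x:cball c r|lborel. (g \<bullet> x + k)\<^sup>2)"
proof -
  let ?V = "measure lborel (cball (0::'a) r)"
  have V: "?V > 0" using assms by (rule content_cball_pos)
  have eqV: "measure lborel (cball c r) = ?V" using assms by (simp add: content_cball)
  have "(LINT x:cball c r|lborel. g \<bullet> x + k)\<^sup>2 \<le> measure lborel (cball c r) * (LINT x:cball c r|lborel. (g \<bullet> x + k)\<^sup>2)"
    by (rule set_integral_square_le) (auto intro!: continuous_intros)
  then have "?V * (?V * (g \<bullet> c + k)\<^sup>2) \<le> ?V * (LINT x:cball c r|lborel. (g \<bullet> x + k)\<^sup>2)"
    unfolding affine_ball_average eqV by (simp add: power_mult_distrib power2_eq_square ac_simps)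
  then show ?thesis using V by simp
qed

text \<open>An inverse inequality: the values at the two points at distance
  \<open>\<rho> / 2\<close> from \<open>m\<close> in the gradient direction differ by
  \<open>\<rho> * norm g\<close>, and half-size balls around both fit into the given one.\<close>

lemma affine_gradient_le_ball:
  fixes g :: "'a::euclidean_space" and k :: real
  assumes \<rho>: "\<rho> > 0"
  shows "measure lborel (cball (0::'a) (\<rho> / 2)) * (\<rho>\<^sup>2 * (norm g)\<^sup>2) \<le> 4 * (LINT x:cball m \<rho>|lborel. (g \<bullet> x + k)\<^sup>2)"
proof (cases "g = 0")
  case True
  then show ?thesis by (auto intro!: set_integral_nonneg_real)
next
  case False
  define e where "e = (\<rho> / 2 / norm g) *\<^sub>R g"
  have ne: "norm e = \<rho> / 2" using False \<rho> by (simp add: e_def)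
  let ?I = "LINT x:cball m \<rho>|lborel. (g \<bullet> x + k)\<^sup>2" and ?V = "measure lborel (cball (0::'a) (\<rho> / 2))"
  have p: "?V * (g \<bullet> c + k)\<^sup>2 \<le> ?I" if c: "norm (c - m) \<le> \<rho> / 2" for c
  proof -
    have "?V * (g \<bullet> c + k)\<^sup>2 \<le> (LINT x:cball c (\<rho>/2)|lborel. (g \<bullet> x + k)\<^sup>2)"
      using \<rho> by (intro affine_point_le_ball) simp
    also have "\<dots> \<le> ?I"
    proof (rule set_integral_mono_set)
      show "cball c (\<rho> / 2) \<subseteq> cball m \<rho>"
      proof
        fix x assume "x \<in> cball c (\<rho> / 2)"
        then show "x \<in> cball m \<rho>" using c dist_triangle[of m x c] by (simp add: dist_norm norm_minus_commute)
      qed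
    qed (auto intro!: set_integrable_compact continuous_intros)
    finally show ?thesis .
  qed
  have "?V * ((g \<bullet> (m + e) + k) - (g \<bullet> (m - e) + k))\<^sup>2 \<le> ?V * (2 * (g \<bullet> (m + e) + k)\<^sup>2 + 2 * (g \<bullet> (m - e) + k)\<^sup>2)"
  proof (intro mult_left_mono)
    have "(s - t)\<^sup>2 \<le> 2 * s\<^sup>2 + 2 * t\<^sup>2" for s t :: real
      using zero_le_power2[of "s + t"] unfolding power2_sum power2_diff by linarith
    then show "((g \<bullet> (m + e) + k) - (g \<bullet> (m - e) + k))\<^sup>2 \<le> 2 * (g \<bullet> (m + e) + k)\<^sup>2 + 2 * (g \<bullet> (m - e) + k)\<^sup>2" .
  qed simp
  also have "\<dots> \<le> 4 * ?I" using p[of "m + e"] p[of "m - e"] ne by (simp add: algebra_simps)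
  also have "(g \<bullet> (m + e) + k) - (g \<bullet> (m - e) + k) = \<rho> * norm g"
  proof -
    have "(g \<bullet> (m + e) + k) - (g \<bullet> (m - e) + k) = 2 * (g \<bullet> e)" by (simp add: inner_add_right inner_diff_right)
    also have "\<dots> = \<rho> * norm g" using False by (simp add: e_def power2_norm_eq_inner[symmetric] power2_eq_square)
    finally show ?thesis .
  qed
  finally show ?thesis by (simp add: power_mult_distrib)
qed

section \<open>Second differences of finite element functions\<close>

definition dilate :: "real \<Rightarrow> 'a::real_vector \<Rightarrow> 'a set \<Rightarrow> 'a set" where
  "dilate a c S = (\<lambda>x. c + a *\<^sub>R (x - c)) ` S"

text \<open>Homotheties replace distance estimates near the boundary, because they scale volume
  exactly. Here \<open>x\<close> is the image of a convex combination of \<open>y\<close> and a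
  point of the inscribed ball, with weights \<open>1 / (1 + t)\<close> and
  \<open>t / (1 + t)\<close>.\<close>

lemma mem_dilate_outer:
  fixes S :: "'a::euclidean_space set"
  assumes S: "convex S" "cball c \<rho> \<subseteq> S" and \<rho>: "\<rho> > 0" and y: "y \<in> S" "norm (x - y) \<le> t * \<rho>" and t: "t > 0"
  shows "x \<in> dilate (1 + t) c S"
proof -
  define p where "p = (1 / (1 + t)) *\<^sub>R y + (t / (1 + t)) *\<^sub>R (c + (1 / t) *\<^sub>R (x - y))"
  have "norm ((1 / t) *\<^sub>R (x - y)) \<le> \<rho>" using y t by (simp only: norm_scaleR) (simp add: divide_le_eq mult.commute)
  moreover have "c + v \<in> cball c \<rho>" if "norm v \<le> \<rho>" for v using that by (simp add: dist_norm)
  ultimately have "c + (1 / t) *\<^sub>R (x - y) \<in> cball c \<rho>" by blast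
  then have "p \<in> S" unfolding p_def
    using S y t by (intro convexD) (auto simp: add_divide_distrib[symmetric])
  moreover have "x = c + (1 + t) *\<^sub>R (p - c)"
  proof -
    have "(1 + t) *\<^sub>R p = y + t *\<^sub>R (c + (1 / t) *\<^sub>R (x - y))"
      using t by (simp add: p_def scaleR_add_right)
    also have "\<dots> = t *\<^sub>R c + x" using t by (simp add: scaleR_add_right)
    finally have "(1 + t) *\<^sub>R p = t *\<^sub>R c + x" .
    then show ?thesis by (simp add: algebra_simps)
  qed
  ultimately show ?thesis by (auto simp: dilate_def)
qed

text \<open>The point \<open>w\<close> is a convex combination of the preimage of \<open>x\<close>
  and a point of the inscribed ball, with weights \<open>1 - t\<close> and \<open>t\<close>.\<close>

lemma mem_dilate_inner:
  fixes S :: "'a::euclidean_space set"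
  assumes S: "convex S" "cball c \<rho> \<subseteq> S" and x: "x \<in> dilate (1 - t) c S" and w: "norm (w - x) \<le> t * \<rho>" and t: "0 < t" "t \<le> 1"
  shows "w \<in> S"
proof -
  obtain p where p: "p \<in> S" "x = c + (1 - t) *\<^sub>R (p - c)" using x by (auto simp: dilate_def)
  have "norm ((1 / t) *\<^sub>R (w - x)) \<le> \<rho>" using w t by (simp only: norm_scaleR) (simp add: divide_le_eq mult.commute)
  moreover have "c + v \<in> cball c \<rho>" if "norm v \<le> \<rho>" for v using that by (simp add: dist_norm)
  ultimately have "c + (1 / t) *\<^sub>R (w - x) \<in> cball c \<rho>" by blast
  then have "(1 - t) *\<^sub>R p + t *\<^sub>R (c + (1 / t) *\<^sub>R (w - x)) \<in> S"
    using S p t by (intro convexD) auto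
  also have "(1 - t) *\<^sub>R p + t *\<^sub>R (c + (1 / t) *\<^sub>R (w - x)) = w"
    using t p(2) by (simp add: algebra_simps)
  finally show ?thesis .
qed

lemma compact_dilate: "compact S \<Longrightarrow> compact (dilate a c S)" for S :: "'a::euclidean_space set"
  unfolding dilate_def by (intro compact_continuous_image continuous_intros)

lemma measure_dilate:
  fixes S :: "(real^3) set"
  assumes "compact S"
  shows "measure lborel (dilate a c S) = \<bar>a\<bar> ^ 3 * measure lborel S"
proof -
  have "dilate a c S = (\<lambda>x. a *\<^sub>R x + (c - a *\<^sub>R c)) ` S"
    unfolding dilate_def by (rule image_cong) (auto simp: algebra_simps)
  then have "measure lebesgue (dilate a c S) = \<bar>a\<bar> ^ 3 * measure lebesgue S"
    using measure_lebesgue_affine[of a "c - a *\<^sub>R c" S] by simp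
  then show ?thesis using assms compact_dilate[OF assms, of a c]
    by (simp add: measure_completion borel_compact)
qed

text \<open>\<open>(1 + t) ^ 3 - (1 - t) ^ 3 = 6 * t + 2 * t ^ 3\<close>, which is at most
  \<open>8 * t\<close> for \<open>t\<close> up to 1.\<close>

lemma measure_dilate_shell:
  fixes S :: "(real^3) set"
  assumes S: "compact S" "convex S" "c \<in> S" and t: "0 < t" "t \<le> 1"
  shows "measure lborel (dilate (1 + t) c S - dilate (1 - t) c S) \<le> 8 * t * measure lborel S"
proof -
  have fin: "emeasure lborel (dilate a c S) < \<infinity>" for a by (rule emeasure_compact_finite[OF compact_dilate[OF S(1)]])
  have sub: "dilate (1 - t) c S \<subseteq> dilate (1 + t) c S"
  proof
    fix x assume "x \<in> dilate (1 - t) c S"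
    then obtain p where p: "p \<in> S" "x = c + (1 - t) *\<^sub>R (p - c)" by (auto simp: dilate_def)
    define s where "s = (1 - t) / (1 + t)"
    have s: "0 \<le> s" "s \<le> 1" "(1 + t) * s = 1 - t" using t by (auto simp: s_def)
    have "(1 - s) *\<^sub>R c + s *\<^sub>R p \<in> S" using S p s by (intro convexD) auto
    moreover have "c + (1 + t) *\<^sub>R ((1 - s) *\<^sub>R c + s *\<^sub>R p - c) = x"
    proof -
      have "(1 - s) *\<^sub>R c + s *\<^sub>R p - c = s *\<^sub>R (p - c)" by (simp add: algebra_simps)
      then show ?thesis using s by (simp add: p(2))
    qed
    ultimately show "x \<in> dilate (1 + t) c S" by (auto simp: dilate_def)
  qed
  have "measure lborel (dilate (1 + t) c S - dilate (1 - t) c S) = measure lborel (dilate (1 + t) c S) - measure lborel (dilate (1 - t) c S)"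
    using fin[of "1 + t"] fin[of "1 - t"] S(1) sub by (intro measure_Diff) (auto intro!: borel_compact compact_dilate)
  also have "\<dots> = ((1 + t)^3 - (1 - t)^3) * measure lborel S"
    using t by (simp add: measure_dilate[OF S(1)] left_diff_distrib)
  also have "(1 + t)^3 - (1 - t)^3 = 6 * t + 2 * t * t\<^sup>2" by (simp add: power3_eq_cube power2_eq_square algebra_simps)
  also have "(6 * t + 2 * t * t\<^sup>2) * measure lborel S \<le> (8 * t) * measure lborel S"
  proof (rule mult_right_mono)
    have "t\<^sup>2 \<le> 1" using t by (simp add: power_le_one)
    then have "2 * t * t\<^sup>2 \<le> 2 * t * 1" using t by (intro mult_left_mono) auto
    then show "6 * t + 2 * t * t\<^sup>2 \<le> 8 * t" by simp
  qed simp
  finally show ?thesis .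
qed

lemma affine_diff2_zero:
  assumes "\<And>y. y \<in> S \<Longrightarrow> u y = g \<bullet> y + (k::real)" "x \<in> S" "x + z \<in> S" "x + 2 *\<^sub>R z \<in> S"
  shows "diff2 z u x = 0"
  using assms by (simp add: diff2_def inner_add_right)

text \<open>If one tetrahedron contains the segment from \<open>x\<close> to \<open>x + 2 z\<close>,
  then \<open>u\<close> is affine along it and the difference vanishes. Otherwise \<open>x\<close>
  lies in the shell of each tetrahedron that the segment meets; \<open>t * \<rho>\<close> is the
  length of the segment.\<close>

lemma diff2_pointwise:
  assumes \<Omega>: "open \<Omega>" and tri: "triangulation_of (closure \<Omega>) T" and u: "u \<in> fe_space \<Omega> T"
    and g: "\<And>\<tau> y. \<tau> \<in> T \<Longrightarrow> y \<in> \<tau> \<Longrightarrow> u y = g \<tau> \<bullet> y + k \<tau>"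
    and ball: "\<And>\<tau>. \<tau> \<in> T \<Longrightarrow> cball (c \<tau>) \<rho> \<subseteq> \<tau>" and \<rho>: "\<rho> > 0"
    and t: "2 * norm z = t * \<rho>" "0 < t" "t \<le> 1"
  shows "(diff2 z u x)\<^sup>2 \<le> 4 * (norm z)\<^sup>2 * (\<Sum>\<tau>\<in>T. (norm (g \<tau>))\<^sup>2 * indicat_real (dilate (1 + t) (c \<tau>) \<tau> - dilate (1 - t) (c \<tau>) \<tau>) x)"
proof -
  have T: "finite T" "\<And>\<tau>. \<tau> \<in> T \<Longrightarrow> convex \<tau>" using tri convex_simplex by (auto simp: triangulation_of_def)
  let ?A = "\<lambda>\<tau>. dilate (1 + t) (c \<tau>) \<tau> - dilate (1 - t) (c \<tau>) \<tau>"
  \<comment> \<open>Collects the gradients of the tetrahedra in whose shell \<open>x\<close> lies,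
    so \<open>sqrt Q\<close> bounds the gradient of each tetrahedron met by the segment.\<close>
  define Q where "Q = (\<Sum>\<tau>\<in>T. (norm (g \<tau>))\<^sup>2 * indicat_real (?A \<tau>) x)"
  have Q0: "Q \<ge> 0" unfolding Q_def by (intro sum_nonneg) auto
  have segnorm: "norm (y - x) \<le> t * \<rho>" if "y \<in> closed_segment x (x + 2 *\<^sub>R z)" for y
    using segment_bound(1)[OF that] t(1) by simp
  have sub1: "closed_segment x (x + z) \<subseteq> closed_segment x (x + 2 *\<^sub>R z)" "closed_segment (x + z) (x + z + z) \<subseteq> closed_segment x (x + 2 *\<^sub>R z)"
  proof -
    have m: "x + z \<in> closed_segment x (x + 2 *\<^sub>R z)" unfolding in_segment by (intro exI[of _ "1/2"]) (simp add: algebra_simps flip: scaleR_add_left)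
    then show "closed_segment x (x + z) \<subseteq> closed_segment x (x + 2 *\<^sub>R z)" by (simp add: subset_closed_segment)
    show "closed_segment (x + z) (x + z + z) \<subseteq> closed_segment x (x + 2 *\<^sub>R z)"
      using m by (simp add: subset_closed_segment scaleR_2 add.assoc)
  qed
  have "(diff2 z u x)\<^sup>2 \<le> 4 * (norm z)\<^sup>2 * Q"
  proof (cases "\<exists>\<tau>\<in>T. closed_segment x (x + 2 *\<^sub>R z) \<subseteq> \<tau>")
    case True
    then obtain \<tau> where \<tau>: "\<tau> \<in> T" "closed_segment x (x + 2 *\<^sub>R z) \<subseteq> \<tau>" by blast
    have "x \<in> \<tau>" "x + 2 *\<^sub>R z \<in> \<tau>" using \<tau>(2) by auto
    moreover have "x + z \<in> \<tau>" using sub1(1) \<tau>(2) by auto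
    ultimately have "diff2 z u x = 0" using g[OF \<tau>(1)] by (intro affine_diff2_zero) auto
    then show ?thesis using Q0 by simp
  next
    case False
    have K: "norm (g \<tau>) \<le> sqrt Q" if \<tau>: "\<tau> \<in> T" "\<tau> \<inter> closed_segment x (x + 2 *\<^sub>R z) \<noteq> {}" for \<tau>
    proof -
      obtain y where y: "y \<in> \<tau>" "y \<in> closed_segment x (x + 2 *\<^sub>R z)" using \<tau> by blast
      have "norm (x - y) \<le> t * \<rho>" using segnorm[OF y(2)] by (simp add: norm_minus_commute)
      then have 1: "x \<in> dilate (1 + t) (c \<tau>) \<tau>"
        by (rule mem_dilate_outer[OF T(2)[OF \<tau>(1)] ball[OF \<tau>(1)] \<rho> y(1) _ t(2)])
      have 2: "x \<notin> dilate (1 - t) (c \<tau>) \<tau>"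
      proof
        assume x: "x \<in> dilate (1 - t) (c \<tau>) \<tau>"
        have "closed_segment x (x + 2 *\<^sub>R z) \<subseteq> \<tau>"
          using mem_dilate_inner[OF T(2)[OF \<tau>(1)] ball[OF \<tau>(1)] x segnorm t(2,3)] by blast
        then show False using False \<tau> by blast
      qed
      have "(norm (g \<tau>))\<^sup>2 = (norm (g \<tau>))\<^sup>2 * indicat_real (?A \<tau>) x" using 1 2 by simp
      also have "\<dots> \<le> Q" unfolding Q_def using T(1) \<tau>(1)
        by (intro member_le_sum[where f="\<lambda>\<tau>. (norm (g \<tau>))\<^sup>2 * indicat_real (?A \<tau>) x"]) auto
      finally show ?thesis by (rule real_le_rsqrt)
    qed
    have sQ: "sqrt Q \<ge> 0" using Q0 by simp
    have "\<bar>u (x + z) - u x\<bar> \<le> sqrt Q * norm z"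
      by (rule fe_segment_bound[OF \<Omega> tri u g sQ]) (use K sub1 in blast)+
    moreover have "\<bar>u (x + z + z) - u (x + z)\<bar> \<le> sqrt Q * norm z"
      by (rule fe_segment_bound[OF \<Omega> tri u g sQ]) (use K sub1 in blast)+
    moreover have "diff2 z u x = (u (x + z + z) - u (x + z)) - (u (x + z) - u x)"
      by (simp add: diff2_def scaleR_2 add.assoc)
    ultimately have "\<bar>diff2 z u x\<bar> \<le> 2 * norm z * sqrt Q" by (simp add: abs_le_iff mult.commute)
    then have "(diff2 z u x)\<^sup>2 \<le> (2 * norm z * sqrt Q)\<^sup>2" by (metis abs_ge_zero power2_abs power_mono)
    then show ?thesis using Q0 by (simp add: power_mult_distrib)
  qed
  then show ?thesis by (simp add: Q_def)
qed

lemma sum_disjoint_integrals_le: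
  fixes B :: "'i \<Rightarrow> 'a::euclidean_space set" and f :: "'a \<Rightarrow> real"
  assumes I: "finite I" and dis: "\<And>i j. i \<in> I \<Longrightarrow> j \<in> I \<Longrightarrow> i \<noteq> j \<Longrightarrow> B i \<inter> B j = {}"
    and B: "\<And>i. i \<in> I \<Longrightarrow> B i \<in> sets borel" and f: "integrable lborel f" "\<And>x. 0 \<le> f x"
  shows "(\<Sum>i\<in>I. (LINT x:B i|lborel. f x)) \<le> (LINT x|lborel. f x)"
proof -
  have int: "integrable lborel (\<lambda>x. indicat_real (B i) x *\<^sub>R f x)" if "i \<in> I" for i
    using B[OF that] by (intro integrable_mult_indicator[OF _ f(1)]) simp
  have "(\<Sum>i\<in>I. (LINT x:B i|lborel. f x)) = (LINT x|lborel. (\<Sum>i\<in>I. indicat_real (B i) x *\<^sub>R f x))"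
    unfolding set_lebesgue_integral_def using int by (rule Bochner_Integration.integral_sum[symmetric])
  also have "\<dots> \<le> (LINT x|lborel. f x)"
  proof (rule integral_mono)
    show "integrable lborel (\<lambda>x. \<Sum>i\<in>I. indicat_real (B i) x *\<^sub>R f x)" using int by (rule Bochner_Integration.integrable_sum)
    fix x
    have "(\<Sum>i\<in>I. indicat_real (B i) x) \<le> 1"
    proof (cases "\<exists>i\<in>I. x \<in> B i")
      case True
      then obtain i where i: "i \<in> I" "x \<in> B i" by blast
      have "(\<Sum>j\<in>I. indicat_real (B j) x) = (\<Sum>j\<in>I. if j = i then 1 else 0)"
        by (rule sum.cong) (use dis i in \<open>auto simp: indicator_def\<close>)
      then show ?thesis using I i by simp
    next
      case False
      then show ?thesis by (simp add: indicator_def)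
    qed
    then have "(\<Sum>i\<in>I. indicat_real (B i) x) * f x \<le> 1 * f x" using f(2) by (rule mult_right_mono)
    then show "(\<Sum>i\<in>I. indicat_real (B i) x *\<^sub>R f x) \<le> f x" by (simp add: sum_distrib_right)
  qed (use f in auto)
  finally show ?thesis .
qed

text \<open>The centres depend on the tetrahedron alone and not on the triangulation index. Halving
  the radius places the closed balls in the interiors, so balls in different tetrahedra of one
  triangulation are disjoint.\<close>

lemma bek_shape_interior:
  assumes bek: "bek_sequence \<Omega> \<T>"
  shows "\<exists>r D c. r > 0 \<and> D > 0 \<and> (\<forall>j. \<forall>\<sigma>\<in>\<T> j. cball (c \<sigma>) (r / 2 ^ tet_level \<T> \<sigma>) \<subseteq> interior \<sigma> \<and>
     (\<forall>x\<in>\<sigma>. \<forall>y\<in>\<sigma>. dist x y \<le> D / 2 ^ tet_level \<T> \<sigma>))"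
proof -
  obtain r D where rD: "r > 0" "D > 0" "\<And>j \<sigma>. \<sigma> \<in> \<T> j \<Longrightarrow> \<exists>m. cball m (r / 2 ^ tet_level \<T> \<sigma>) \<subseteq> \<sigma>"
    "\<And>j \<sigma> x y. \<sigma> \<in> \<T> j \<Longrightarrow> x \<in> \<sigma> \<Longrightarrow> y \<in> \<sigma> \<Longrightarrow> dist x y \<le> D / 2 ^ tet_level \<T> \<sigma>"
    by (rule bek_shape[OF bek], rule that; blast)
  define c where "c \<sigma> = (SOME m. cball m (r / 2 ^ tet_level \<T> \<sigma>) \<subseteq> \<sigma>)" for \<sigma>
  have c: "cball (c \<sigma>) (r / 2 ^ tet_level \<T> \<sigma>) \<subseteq> \<sigma>" if "\<sigma> \<in> \<T> j" for j \<sigma>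
    unfolding c_def by (rule someI_ex[OF rD(3)[OF that]])
  have "cball (c \<sigma>) (r / 2 / 2 ^ tet_level \<T> \<sigma>) \<subseteq> interior \<sigma>" if "\<sigma> \<in> \<T> j" for j \<sigma>
  proof -
    have "cball (c \<sigma>) (r / 2 / 2 ^ tet_level \<T> \<sigma>) \<subseteq> ball (c \<sigma>) (r / 2 ^ tet_level \<T> \<sigma>)"
      using rD(1) by (auto simp: field_simps intro: order.strict_trans1)
    moreover have "ball (c \<sigma>) (r / 2 ^ tet_level \<T> \<sigma>) \<subseteq> interior \<sigma>"
      using c[OF that] by (intro interior_maximal) (auto intro: order.trans[OF ball_subset_cball])
    ultimately show ?thesis by blast
  qed
  then show ?thesis using rD by (intro exI[of _ "r/2"] exI[of _ D] exI[of _ c]) auto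
qed

text \<open>The shells carry a share of order \<open>t\<close> of each volume, and the inverse
  inequality turns the gradients into values at the cost of \<open>1 / \<rho>\<^sup>2\<close>; with
  the factor \<open>(norm z)\<^sup>2\<close> this is \<open>t ^ 3\<close>. Tetrahedra of lower level
  are larger and satisfy the same bound.\<close>

lemma diff2_fe_estimate:
  assumes \<Omega>: "open \<Omega>" "bounded \<Omega>" and bek: "bek_sequence \<Omega> \<T>"
  shows "\<exists>C>0. \<forall>k. \<forall>u\<in>fe_space \<Omega> (\<T> k). \<forall>z. (nrm lborel (diff2 z u))\<^sup>2 \<le> C * (norm z * 2 ^ k) ^ 3 * (nrm lborel u)\<^sup>2"
proof -
  obtain r D c where rD: "r > 0" "D > 0" and
    all: "\<forall>j. \<forall>\<sigma>\<in>\<T> j. cball (c \<sigma>) (r / 2 ^ tet_level \<T> \<sigma>) \<subseteq> interior \<sigma> \<and>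
     (\<forall>x\<in>\<sigma>. \<forall>y\<in>\<sigma>. dist x y \<le> D / 2 ^ tet_level \<T> \<sigma>)"
    using bek_shape_interior[OF bek] by (elim exE conjE)
  have c: "cball (c \<sigma>) (r / 2 ^ tet_level \<T> \<sigma>) \<subseteq> interior \<sigma>" if "\<sigma> \<in> \<T> j" for j \<sigma>
    using all that by blast
  have D: "dist x y \<le> D / 2 ^ tet_level \<T> \<sigma>" if "\<sigma> \<in> \<T> j" "x \<in> \<sigma>" "y \<in> \<sigma>" for j \<sigma> x y
    using all that by blast
  define \<beta> where "\<beta> = unit_ball_vol 3"
  have \<beta>: "\<beta> > 0" by (simp add: \<beta>_def)
  have vol: "measure lborel (cball (x::real^3) s) = \<beta> * s ^ 3" if "s \<ge> 0" for x s
    using that by (simp add: content_cball \<beta>_def)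
  \<comment> \<open>The first entry serves steps with \<open>t > 1\<close>, where the trivial factor
    16 is at most \<open>16 * t ^ 3\<close>; the second serves the shell estimate.\<close>
  define C where "C = max (128 / r ^ 3) (8 * 8 * (32 * (D / r) ^ 3) / r ^ 3)"
  have C: "C > 0" "128 / r ^ 3 \<le> C" "8 * 8 * (32 * (D / r) ^ 3) / r ^ 3 \<le> C"
    using rD by (auto simp: C_def less_max_iff_disj)
  have "(nrm lborel (diff2 z u))\<^sup>2 \<le> C * (norm z * 2 ^ k) ^ 3 * (nrm lborel u)\<^sup>2"
    if u: "u \<in> fe_space \<Omega> (\<T> k)" for k u z
  proof (cases "z = 0")
    case True
    then show ?thesis by (simp add: diff2_def nrm_def)
  next
    case False
    have ucc: "u \<in> cc" by (rule fe_space_cc[OF \<Omega> u])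
    define \<rho> where "\<rho> = r / 2 ^ k"
    have \<rho>: "\<rho> > 0" using rD by (simp add: \<rho>_def)
    define t where "t = 2 * norm z / \<rho>"
    have t: "2 * norm z = t * \<rho>" "t > 0" using False \<rho> by (auto simp: t_def)
    have t3: "t ^ 3 = 8 / r ^ 3 * (norm z * 2 ^ k) ^ 3" using rD by (simp add: t_def \<rho>_def power_divide power_mult_distrib)
    show ?thesis
    proof (cases "t \<le> 1")
      case False
      have "nrm lborel (diff2 z u) \<le> 4 * nrm lborel u" by (rule nrm_diff2_le[OF ucc])
      then have "(nrm lborel (diff2 z u))\<^sup>2 \<le> (4 * nrm lborel u)\<^sup>2" by (rule power_mono) simp
      also have "\<dots> = 16 * 1 * (nrm lborel u)\<^sup>2" by (simp add: power_mult_distrib)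
      also have "\<dots> \<le> 16 * t ^ 3 * (nrm lborel u)\<^sup>2"
        using False by (intro mult_right_mono mult_left_mono one_le_power) auto
      also have "16 * t ^ 3 = 128 / r ^ 3 * (norm z * 2 ^ k) ^ 3" by (simp add: t3)
      also have "\<dots> * (nrm lborel u)\<^sup>2 \<le> C * (norm z * 2 ^ k) ^ 3 * (nrm lborel u)\<^sup>2"
        using C by (intro mult_right_mono) auto
      finally show ?thesis .
    next
      case True
      have tri: "triangulation_of (closure \<Omega>) (\<T> k)" using bek by (simp add: bek_sequence_def)
      then have T: "finite (\<T> k)" "\<And>\<tau>. \<tau> \<in> \<T> k \<Longrightarrow> tetrahedron \<tau>" by (auto simp: triangulation_of_def)
      obtain g b where g: "\<And>\<tau> y. \<tau> \<in> \<T> k \<Longrightarrow> y \<in> \<tau> \<Longrightarrow> u y = g \<tau> \<bullet> y + b \<tau>" using fe_gradients[OF u] by blast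
      \<comment> \<open>The true radius of the ball in each tetrahedron, whereas
        \<open>\<rho>\<close> is the smallest one and sets the common shell width.\<close>
      define \<rho>' where "\<rho>' \<tau> = r / 2 ^ tet_level \<T> \<tau>" for \<tau>
      have \<rho>': "\<rho>' \<tau> > 0" "\<rho> \<le> \<rho>' \<tau>" if "\<tau> \<in> \<T> k" for \<tau>
        using rD tet_level_mem(2)[of \<tau> \<T> k] that
        by (auto simp: \<rho>'_def \<rho>_def intro!: divide_left_mono)
      have ball: "cball (c \<tau>) (\<rho>' \<tau>) \<subseteq> interior \<tau>" if "\<tau> \<in> \<T> k" for \<tau> using c[OF that] by (simp add: \<rho>'_def)
      have ball\<rho>: "cball (c \<tau>) \<rho> \<subseteq> \<tau>" if "\<tau> \<in> \<T> k" for \<tau>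
        using ball[OF that] \<rho>'(2)[OF that] interior_subset[of \<tau>] by (meson order_trans subset_cball)
      let ?A = "\<lambda>\<tau>. dilate (1 + t) (c \<tau>) \<tau> - dilate (1 - t) (c \<tau>) \<tau>"
      have Am: "?A \<tau> \<in> sets borel" "emeasure lborel (?A \<tau>) < \<infinity>" "measure lborel (?A \<tau>) \<le> 8 * t * measure lborel \<tau>" if "\<tau> \<in> \<T> k" for \<tau>
      proof -
        have cmp: "compact \<tau>" "convex \<tau>" using T(2)[OF that] compact_simplex convex_simplex by blast+
        show "?A \<tau> \<in> sets borel" using compact_dilate[OF cmp(1)] by (intro sets.Diff borel_compact)
        have "emeasure lborel (?A \<tau>) \<le> emeasure lborel (dilate (1 + t) (c \<tau>) \<tau>)"
          using compact_dilate[OF cmp(1)] by (intro emeasure_mono) (auto intro: borel_compact)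
        also have "\<dots> < \<infinity>" by (rule emeasure_compact_finite[OF compact_dilate[OF cmp(1)]])
        finally show "emeasure lborel (?A \<tau>) < \<infinity>" .
        have "c \<tau> \<in> \<tau>" using ball\<rho>[OF that] \<rho> by auto
        then show "measure lborel (?A \<tau>) \<le> 8 * t * measure lborel \<tau>"
          using cmp t(2) True by (intro measure_dilate_shell)
      qed
      have volle: "measure lborel \<tau> \<le> \<beta> * (D / r) ^ 3 * \<rho>' \<tau> ^ 3" if \<tau>: "\<tau> \<in> \<T> k" for \<tau>
      proof -
        have c\<tau>: "c \<tau> \<in> \<tau>" using ball\<rho>[OF \<tau>] \<rho> by auto
        have "\<tau> \<subseteq> cball (c \<tau>) (D / 2 ^ tet_level \<T> \<tau>)" using D[OF \<tau> c\<tau>] by auto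
        then have "measure lborel \<tau> \<le> measure lborel (cball (c \<tau>) (D / 2 ^ tet_level \<T> \<tau>))"
        proof (rule measure_mono_fmeasurable)
          show "\<tau> \<in> sets lborel" using closed_simplex[OF T(2)[OF \<tau>]] by (simp add: borel_closed)
          show "cball (c \<tau>) (D / 2 ^ tet_level \<T> \<tau>) \<in> fmeasurable lborel"
            by (rule fmeasurableI) (use emeasure_compact_finite[OF compact_cball] in auto)
        qed
        also have "\<dots> = \<beta> * (D / r) ^ 3 * \<rho>' \<tau> ^ 3" using rD by (simp add: vol \<rho>'_def power_divide power_mult_distrib)
        finally show ?thesis .
      qed
      \<comment> \<open>The inverse inequality, with the volume of \<open>\<tau>\<close> replaced by
        a fixed multiple of the volume of its ball; 32 is \<open>4 * 2 ^ 3\<close>, the cube coming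
        from the half radius.\<close>
      have grad: "(norm (g \<tau>))\<^sup>2 * measure lborel \<tau> \<le> 32 * (D / r) ^ 3 / \<rho>\<^sup>2 * (LINT x:cball (c \<tau>) (\<rho>' \<tau>)|lborel. (u x)\<^sup>2)" if \<tau>: "\<tau> \<in> \<T> k" for \<tau>
      proof -
        let ?I = "LINT x:cball (c \<tau>) (\<rho>' \<tau>)|lborel. (u x)\<^sup>2"
        have I: "?I = (LINT x:cball (c \<tau>) (\<rho>' \<tau>)|lborel. (g \<tau> \<bullet> x + b \<tau>)\<^sup>2)"
        proof (rule set_lebesgue_integral_cong)
          have "u x = g \<tau> \<bullet> x + b \<tau>" if "x \<in> cball (c \<tau>) (\<rho>' \<tau>)" for x
            using g[OF \<tau>] subsetD[OF ball[OF \<tau>] that] interior_subset by blast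
          then show "\<forall>x. x \<in> cball (c \<tau>) (\<rho>' \<tau>) \<longrightarrow> (u x)\<^sup>2 = (g \<tau> \<bullet> x + b \<tau>)\<^sup>2" by simp
        qed simp
        have "\<beta> * (\<rho>' \<tau> / 2) ^ 3 * ((\<rho>' \<tau>)\<^sup>2 * (norm (g \<tau>))\<^sup>2) \<le> 4 * ?I"
          using affine_gradient_le_ball[OF \<rho>'(1)[OF \<tau>], of "g \<tau>" "c \<tau>" "b \<tau>"] \<rho>'(1)[OF \<tau>] unfolding I by (simp add: vol)
        then have 1: "\<beta> * \<rho>' \<tau> ^ 3 * (norm (g \<tau>))\<^sup>2 \<le> 32 * ?I / (\<rho>' \<tau>)\<^sup>2"
          using \<rho>'(1)[OF \<tau>] by (simp add: field_simps power_divide)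
        have I0: "?I \<ge> 0" by (rule set_integral_nonneg_real) simp
        have "(norm (g \<tau>))\<^sup>2 * measure lborel \<tau> \<le> (norm (g \<tau>))\<^sup>2 * (\<beta> * (D / r) ^ 3 * \<rho>' \<tau> ^ 3)"
          by (rule mult_left_mono[OF volle[OF \<tau>]]) simp
        also have "\<dots> = (D / r) ^ 3 * (\<beta> * \<rho>' \<tau> ^ 3 * (norm (g \<tau>))\<^sup>2)" by simp
        also have "\<dots> \<le> (D / r) ^ 3 * (32 * ?I / (\<rho>' \<tau>)\<^sup>2)" using 1 rD by (intro mult_left_mono) auto
        also have "\<dots> \<le> (D / r) ^ 3 * (32 * ?I / \<rho>\<^sup>2)"
          using rD I0 \<rho> \<rho>'[OF \<tau>] by (intro mult_left_mono divide_left_mono power_mono mult_pos_pos) auto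
        finally show ?thesis by (simp add: mult.assoc mult.commute mult.left_commute)
      qed
      have int: "integrable lborel (\<lambda>x. (norm (g \<tau>))\<^sup>2 * indicat_real (?A \<tau>) x)" if "\<tau> \<in> \<T> k" for \<tau>
        using Am[OF that] by (intro integrable_mult_right integrable_real_indicator) auto
      have "(nrm lborel (diff2 z u))\<^sup>2 \<le> (LINT x|lborel. 4 * (norm z)\<^sup>2 * (\<Sum>\<tau>\<in>\<T> k. (norm (g \<tau>))\<^sup>2 * indicat_real (?A \<tau>) x))"
        unfolding nrm_power2
      proof (rule integral_mono)
        show "integrable lborel (\<lambda>x. (diff2 z u x)\<^sup>2)" by (rule cc_integrable[OF cc_power2[OF cc_diff2[OF ucc]]])
        show "integrable lborel (\<lambda>x. 4 * (norm z)\<^sup>2 * (\<Sum>\<tau>\<in>\<T> k. (norm (g \<tau>))\<^sup>2 * indicat_real (?A \<tau>) x))"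
          by (rule integrable_mult_right, rule Bochner_Integration.integrable_sum, rule int)
        show "(diff2 z u x)\<^sup>2 \<le> 4 * (norm z)\<^sup>2 * (\<Sum>\<tau>\<in>\<T> k. (norm (g \<tau>))\<^sup>2 * indicat_real (?A \<tau>) x)" for x
          by (rule diff2_pointwise[OF \<Omega>(1) tri u g ball\<rho> \<rho> t True])
      qed
      also have "\<dots> = 4 * (norm z)\<^sup>2 * (\<Sum>\<tau>\<in>\<T> k. (norm (g \<tau>))\<^sup>2 * measure lborel (?A \<tau>))"
        using int Am by (simp add: Bochner_Integration.integral_sum)
      also have "\<dots> \<le> 4 * (norm z)\<^sup>2 * (\<Sum>\<tau>\<in>\<T> k. 8 * t * (32 * (D / r) ^ 3 / \<rho>\<^sup>2 * (LINT x:cball (c \<tau>) (\<rho>' \<tau>)|lborel. (u x)\<^sup>2)))"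
      proof (intro mult_left_mono sum_mono)
        fix \<tau> assume \<tau>: "\<tau> \<in> \<T> k"
        have "(norm (g \<tau>))\<^sup>2 * measure lborel (?A \<tau>) \<le> (norm (g \<tau>))\<^sup>2 * (8 * t * measure lborel \<tau>)"
          by (rule mult_left_mono[OF Am(3)[OF \<tau>]]) simp
        also have "\<dots> = 8 * t * ((norm (g \<tau>))\<^sup>2 * measure lborel \<tau>)" by simp
        also have "\<dots> \<le> 8 * t * (32 * (D / r) ^ 3 / \<rho>\<^sup>2 * (LINT x:cball (c \<tau>) (\<rho>' \<tau>)|lborel. (u x)\<^sup>2))"
          using grad[OF \<tau>] t by (intro mult_left_mono) auto
        finally show "(norm (g \<tau>))\<^sup>2 * measure lborel (?A \<tau>) \<le> 8 * t * (32 * (D / r) ^ 3 / \<rho>\<^sup>2 * (LINT x:cball (c \<tau>) (\<rho>' \<tau>)|lborel. (u x)\<^sup>2))" .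
      qed simp
      also have "\<dots> = 4 * (norm z)\<^sup>2 * (8 * t * (32 * (D / r) ^ 3 / \<rho>\<^sup>2) * (\<Sum>\<tau>\<in>\<T> k. (LINT x:cball (c \<tau>) (\<rho>' \<tau>)|lborel. (u x)\<^sup>2)))"
        by (simp add: sum_distrib_left mult.assoc)
      also have "\<dots> \<le> 4 * (norm z)\<^sup>2 * (8 * t * (32 * (D / r) ^ 3 / \<rho>\<^sup>2) * (nrm lborel u)\<^sup>2)"
      proof (intro mult_left_mono)
        show "(\<Sum>\<tau>\<in>\<T> k. (LINT x:cball (c \<tau>) (\<rho>' \<tau>)|lborel. (u x)\<^sup>2)) \<le> (nrm lborel u)\<^sup>2"
          unfolding nrm_power2
        proof (rule sum_disjoint_integrals_le[OF T(1)])
          show "cball (c \<tau>) (\<rho>' \<tau>) \<inter> cball (c \<tau>') (\<rho>' \<tau>') = {}" if "\<tau> \<in> \<T> k" "\<tau>' \<in> \<T> k" "\<tau> \<noteq> \<tau>'" for \<tau> \<tau>'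
          proof -
            have "interior \<tau> \<inter> interior \<tau>' = {}" using tri that by (simp add: triangulation_of_def)
            then show ?thesis using ball[OF that(1)] ball[OF that(2)] by blast
          qed
        qed (auto intro: cc_integrable cc_power2 ucc)
      qed (use t rD in auto)
      also have "\<dots> = (8 * 8 * (32 * (D / r) ^ 3) / r ^ 3) * (norm z * 2 ^ k) ^ 3 * (nrm lborel u)\<^sup>2"
      proof -
        have "4 * (norm z)\<^sup>2 * (8 * t * (32 * (D / r) ^ 3 / \<rho>\<^sup>2)) = 8 * t * (32 * (D / r) ^ 3) * (2 * norm z / \<rho>)\<^sup>2"
          using \<rho> by (simp add: power_divide power_mult_distrib)
        also have "\<dots> = 8 * (32 * (D / r) ^ 3) * t ^ 3" by (simp add: t_def[symmetric] power2_eq_square power3_eq_cube)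
        also have "\<dots> = (8 * 8 * (32 * (D / r) ^ 3) / r ^ 3) * (norm z * 2 ^ k) ^ 3" unfolding t3 by simp
        finally show ?thesis by (simp only: mult.assoc[symmetric])
      qed
      also have "\<dots> \<le> C * (norm z * 2 ^ k) ^ 3 * (nrm lborel u)\<^sup>2"
        using C by (intro mult_right_mono) auto
      finally show ?thesis .
    qed
  qed
  then show ?thesis using C(1) by blast
qed

section \<open>The upper bound\<close>

text \<open>Cauchy-Schwarz after splitting each weight into two square roots; together with a bound
  on the column sums this yields Schur's test.\<close>

lemma weighted_sum_square_le:
  fixes a b :: "'k \<Rightarrow> real"
  assumes "\<And>k. k \<in> K \<Longrightarrow> 0 \<le> a k" "(\<Sum>k\<in>K. a k) \<le> S"
  shows "(\<Sum>k\<in>K. a k * b k)\<^sup>2 \<le> S * (\<Sum>k\<in>K. a k * (b k)\<^sup>2)"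
proof -
  have "(\<Sum>k\<in>K. a k * b k) = (\<Sum>k\<in>K. sqrt (a k) * (sqrt (a k) * b k))"
    by (rule sum.cong) (use assms(1) in \<open>auto simp flip: mult.assoc\<close>)
  then have "(\<Sum>k\<in>K. a k * b k)\<^sup>2 \<le> (\<Sum>k\<in>K. (sqrt (a k))\<^sup>2) * (\<Sum>k\<in>K. (sqrt (a k) * b k)\<^sup>2)"
    using Cauchy_Schwarz_ineq_sum[of "\<lambda>k. sqrt (a k)" "\<lambda>k. sqrt (a k) * b k" K] by simp
  also have "(\<Sum>k\<in>K. (sqrt (a k))\<^sup>2) = (\<Sum>k\<in>K. a k)"
    by (rule sum.cong) (use assms(1) in auto)
  also have "(\<Sum>k\<in>K. (sqrt (a k) * b k)\<^sup>2) = (\<Sum>k\<in>K. a k * (b k)\<^sup>2)"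
    by (rule sum.cong) (use assms(1) in \<open>auto simp: power_mult_distrib\<close>)
  also have "(\<Sum>k\<in>K. a k) * (\<Sum>k\<in>K. a k * (b k)\<^sup>2) \<le> S * (\<Sum>k\<in>K. a k * (b k)\<^sup>2)"
    using assms by (intro mult_right_mono sum_nonneg mult_nonneg_nonneg) auto
  finally show ?thesis .
qed

text \<open>The absolute difference \<open>\<bar>m - k\<bar>\<close>: one of the two truncated
  subtractions is always 0.\<close>

definition ndist :: "nat \<Rightarrow> nat \<Rightarrow> nat" where "ndist m k = (m - k) + (k - m)"

lemma sum_powers_le:
  fixes q :: real
  assumes q: "0 < q" "q < 1" and D: "finite D"
  shows "(\<Sum>d\<in>D. q ^ d) \<le> 1 / (1 - q)"
proof -
  have "(\<Sum>d\<in>D. q ^ d) \<le> (\<Sum>d. q ^ d)"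
    using q D by (intro sum_le_suminf summable_geometric) auto
  then show ?thesis using q by (simp add: suminf_geometric)
qed

lemma sum_ndist_powers_le:
  fixes q :: real
  assumes q: "0 < q" "q < 1" and K: "finite K"
  shows "(\<Sum>k\<in>K. q ^ ndist m k) \<le> 2 / (1 - q)"
proof -
  define A where "A = {k \<in> K. k \<le> m}"
  define B where "B = {k \<in> K. m < k}"
  have "(\<Sum>k\<in>K. q ^ ndist m k) = (\<Sum>k\<in>A. q ^ ndist m k) + (\<Sum>k\<in>B. q ^ ndist m k)"
    using K by (subst sum.union_disjoint[symmetric]) (auto simp: A_def B_def intro!: sum.cong)
  also have "(\<Sum>k\<in>A. q ^ ndist m k) = (\<Sum>d\<in>(\<lambda>k. m - k) ` A. q ^ d)"
    by (subst sum.reindex) (auto simp: A_def inj_on_def ndist_def)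
  also have "(\<Sum>k\<in>B. q ^ ndist m k) = (\<Sum>d\<in>(\<lambda>k. k - m) ` B. q ^ d)"
    by (subst sum.reindex) (auto simp: B_def inj_on_def ndist_def)
  also have "(\<Sum>d\<in>(\<lambda>k. m - k) ` A. q ^ d) + (\<Sum>d\<in>(\<lambda>k. k - m) ` B. q ^ d) \<le> 1 / (1 - q) + 1 / (1 - q)"
    using K by (intro add_mono sum_powers_le q) (auto simp: A_def B_def)
  finally show ?thesis by simp
qed

lemma bek_fe_space_mono:
  assumes "bek_sequence \<Omega> \<T>" "j \<le> k" shows "fe_space \<Omega> (\<T> j) \<subseteq> fe_space \<Omega> (\<T> k)"
proof (rule lift_Suc_mono_le[of "\<lambda>k. fe_space \<Omega> (\<T> k)", OF _ assms(2)])
  have "nested \<T>" using assms(1) by (simp only: bek_sequence_def)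
  then have "\<exists>\<tau>\<in>\<T> k. \<sigma> \<subseteq> \<tau>" if "\<sigma> \<in> \<T> (Suc k)" for k \<sigma>
    using that unfolding nested_def by (metis ex1_implies_ex)
  then show "fe_space \<Omega> (\<T> k) \<subseteq> fe_space \<Omega> (\<T> (Suc k))" for k
    by (rule fe_space_nested)
qed

lemma fe_space_sum:
  assumes "\<And>i. i \<in> I \<Longrightarrow> w i \<in> fe_space \<Omega> T" shows "(\<lambda>x. \<Sum>i\<in>I. w i x) \<in> fe_space \<Omega> T"
  using assms
proof (induction I rule: infinite_finite_induct)
  case (insert i I)
  then show ?case using fe_space_add_cmult[of "w i" \<Omega> T "\<lambda>x. \<Sum>i\<in>I. w i x" 1] by simp
qed (simp_all add: fe_space_zero)

text \<open>Stated for every decomposition into levels, orthogonal or not. The second difference at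
  scale \<open>m\<close> of the part at level \<open>k\<close> decays in
  \<open>\<bar>m - k\<bar>\<close>, and Schur's test sums the interactions.\<close>

lemma H1_upper_bound:
  assumes \<Omega>: "open \<Omega>" "bounded \<Omega>" "interior (closure \<Omega>) = \<Omega>" and bek: "bek_sequence \<Omega> \<T>"
  shows "\<exists>c>0. \<forall>J w. (\<forall>k\<le>J. w k \<in> fe_space \<Omega> (\<T> k)) \<longrightarrow>
    (H1_norm \<Omega> (\<lambda>x. \<Sum>k\<le>J. w k x))\<^sup>2 \<le> c * (\<Sum>k\<le>J. 4 ^ k * (nrm lborel (w k))\<^sup>2)"
proof -
  obtain C where C: "C > 0" "\<And>k u z. u \<in> fe_space \<Omega> (\<T> k) \<Longrightarrow> (nrm lborel (diff2 z u))\<^sup>2 \<le> C * (norm z * 2 ^ k) ^ 3 * (nrm lborel u)\<^sup>2"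
    using diff2_fe_estimate[OF \<Omega>(1,2) bek] by blast
  \<comment> \<open>The slower of the two decay rates: for steps finer than the mesh the squares
    decay like \<open>2 ^ (2 * d) / 2 ^ (3 * d)\<close>.\<close>
  define q where "q = sqrt (1 / 2)"
  have q2: "q\<^sup>2 = 1 / 2" by (simp add: q_def)
  have q: "0 < q" "q < 1" by (simp_all add: q_def real_less_lsqrt)
  have half_le: "(1 / 2) ^ d \<le> q ^ d" for d
  proof (rule power_mono)
    have "q * q \<le> q * 1" using q by (intro mult_left_mono) auto
    then show "1 / 2 \<le> q" using q2 by (simp add: power2_eq_square)
  qed simp
  define C' where "C' = max 4 (sqrt C)"
  have C': "C' \<ge> 4" "C' \<ge> sqrt C" "C' > 0" by (auto simp: C'_def)
  have C'2: "C \<le> C'\<^sup>2"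
    using power_mono[OF C'(2), of 2] C(1) by simp
  define S where "S = 2 / (1 - q)"
  have S: "S > 0" using q by (simp add: S_def)
  \<comment> \<open>The 2 is for the function itself. Each of the three partial derivatives
    contributes 8 for the first difference at scale 0 and \<open>C'\<^sup>2 * S\<^sup>2\<close> for
    the telescoped second differences.\<close>
  define c where "c = 2 + 3 * (8 + C'\<^sup>2 * S\<^sup>2)"
  have c: "c > 0" unfolding c_def by (simp add: add_pos_nonneg)
  have "(H1_norm \<Omega> (\<lambda>x. \<Sum>k\<le>J. w k x))\<^sup>2 \<le> c * (\<Sum>k\<le>J. 4 ^ k * (nrm lborel (w k))\<^sup>2)"
    if w: "\<And>k. k \<le> J \<Longrightarrow> w k \<in> fe_space \<Omega> (\<T> k)" for J w
  proof -
    define u where "u x = (\<Sum>k\<le>J. w k x)" for x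
    define b where "b k = 2 ^ k * nrm lborel (w k)" for k
    define B where "B = (\<Sum>k\<le>J. (b k)\<^sup>2)"
    have B0: "B \<ge> 0" by (simp add: B_def sum_nonneg)
    have Beq: "B = (\<Sum>k\<le>J. 4 ^ k * (nrm lborel (w k))\<^sup>2)"
    proof -
      have "((2::real) ^ k)\<^sup>2 = 4 ^ k" for k by (simp add: power2_eq_square flip: power_mult_distrib)
      then show ?thesis by (simp add: B_def b_def power_mult_distrib)
    qed
    have wcc: "w k \<in> cc" if "k \<le> J" for k by (rule fe_space_cc[OF \<Omega>(1,2) w[OF that]])
    have ufe: "u \<in> fe_space \<Omega> (\<T> J)"
      unfolding u_def using w bek_fe_space_mono[OF bek] by (intro fe_space_sum) blast
    have ucc: "u \<in> cc" by (rule fe_space_cc[OF \<Omega>(1,2) ufe])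
    have tri: "triangulation_of (closure \<Omega>) (\<T> J)" using bek by (simp add: bek_sequence_def)
    have u2: "(nrm lborel u)\<^sup>2 \<le> 2 * B"
    proof -
      have "nrm lborel u \<le> (\<Sum>k\<le>J. nrm lborel (w k))"
        unfolding u_def by (rule nrm_sum_le) (use wcc cc_square_integrable in auto)
      also have "\<dots> = (\<Sum>k\<le>J. (1 / 2) ^ k * b k)" by (rule sum.cong) (auto simp: b_def power_one_over)
      finally have "(nrm lborel u)\<^sup>2 \<le> (\<Sum>k\<le>J. (1 / 2) ^ k * b k)\<^sup>2" by (rule power_mono) simp
      also have "\<dots> \<le> 2 * (\<Sum>k\<le>J. (1 / 2) ^ k * (b k)\<^sup>2)"
        using sum_powers_le[of "1/2" "{..J}"] by (intro weighted_sum_square_le) auto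
      also have "\<dots> \<le> 2 * B" unfolding B_def
        by (intro mult_left_mono sum_mono mult_left_le_one_le) (auto intro: power_le_one)
      finally show ?thesis .
    qed
    have en: "diff_energy e u n \<le> 8 * B + C'\<^sup>2 * S\<^sup>2 * B" if e: "norm e = 1" for e n
    proof -
      define z where "z m = (1 / 2 ^ Suc m) *\<^sub>R e" for m :: nat
      have nz: "norm (z m) = 1 / 2 ^ Suc m" for m using e by (simp add: z_def)
      have trm: "2 ^ m * nrm lborel (diff2 (z m) (w k)) \<le> C' * (q ^ ndist m k * b k)" if k: "k \<le> J" for m k
      proof (cases "m \<le> k")
        case True
        then obtain d where d: "k = m + d" using le_Suc_ex by blast
        \<comment> \<open>The weight \<open>2 ^ m\<close> is already small against
          \<open>2 ^ k\<close>, so the trivial bound on second differences gives the decay.\<close>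
        have "2 ^ m * nrm lborel (diff2 (z m) (w k)) \<le> 2 ^ m * (4 * nrm lborel (w k))"
          by (intro mult_left_mono nrm_diff2_le wcc k) auto
        also have "\<dots> = 4 * ((1 / 2) ^ d * b k)" by (simp add: b_def d power_add power_one_over)
        also have "\<dots> \<le> C' * (q ^ d * b k)"
          using C' half_le q by (intro mult_mono mult_right_mono) (auto simp: b_def)
        finally show ?thesis by (simp add: ndist_def d)
      next
        case False
        then obtain d where d: "m = k + d" by (metis le_Suc_ex nat_le_linear)
        \<comment> \<open>The step is finer than the mesh: in squares the weight loses
          \<open>2 ^ (2 * d)\<close>, and the cubic estimate gains
          \<open>2 ^ (3 * d)\<close>.\<close>
        have "(2 ^ m * nrm lborel (diff2 (z m) (w k)))\<^sup>2 \<le> (2 ^ m)\<^sup>2 * (C * (norm (z m) * 2 ^ k) ^ 3 * (nrm lborel (w k))\<^sup>2)"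
          unfolding power_mult_distrib[of "2 ^ m"] by (intro mult_left_mono C(2) w k) auto
        also have "\<dots> = (C / 8) * ((1 / 2) ^ d * (b k)\<^sup>2)"
        proof -
          have nk: "norm (z m) * 2 ^ k = (1 / 2) * (1 / 2) ^ d" unfolding nz d by (simp add: power_add power_one_over)
          have n3: "(norm (z m) * 2 ^ k) ^ 3 = (1 / 8) * ((1 / 2) ^ d * (1 / 2) ^ d * (1 / 2) ^ d)"
            unfolding nk by (simp add: power3_eq_cube)
          have m2: "(2 ^ m)\<^sup>2 = 2 ^ d * 2 ^ d * ((2::real) ^ k)\<^sup>2" unfolding d by (simp add: power_add power2_eq_square)
          have hd: "2 ^ d * (1 / 2) ^ d = (1::real)" by (simp flip: power_mult_distrib)
          have alg: "(P * P * K) * (C * (1 / 8 * (h * h * h)) * N) = (C / 8) * ((P * h) * (P * h) * (h * (K * N)))" for P h K N :: real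
            by (simp add: mult_ac)
          show ?thesis unfolding n3 m2 alg hd b_def power_mult_distrib[of "2 ^ k"] by simp
        qed
        also have "\<dots> \<le> C'\<^sup>2 * ((1 / 2) ^ d * (b k)\<^sup>2)"
          using C'2 C(1) by (intro mult_right_mono) auto
        also have "\<dots> = (C' * (q ^ d * b k))\<^sup>2"
        proof -
          have "(q ^ d)\<^sup>2 = (1 / 2) ^ d" unfolding q2[symmetric] power_mult[symmetric] by (simp only: mult.commute)
          then show ?thesis by (simp add: power_mult_distrib)
        qed
        finally have "2 ^ m * nrm lborel (diff2 (z m) (w k)) \<le> C' * (q ^ d * b k)"
          by (rule power2_le_imp_le) (use C' q in \<open>auto simp: b_def intro!: mult_nonneg_nonneg\<close>)
        then show ?thesis by (simp add: ndist_def d)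
      qed
      have am: "4 ^ m * (nrm lborel (diff2 (z m) u))\<^sup>2 \<le> C'\<^sup>2 * (S * (\<Sum>k\<le>J. q ^ ndist m k * (b k)\<^sup>2))" for m
      proof -
        have "diff2 (z m) u = (\<lambda>x. \<Sum>k\<le>J. diff2 (z m) (w k) x)"
          by (auto simp: diff2_def u_def sum.distrib sum_subtractf sum_distrib_left)
        then have "nrm lborel (diff2 (z m) u) \<le> (\<Sum>k\<le>J. nrm lborel (diff2 (z m) (w k)))"
          using nrm_sum_le[of "{..J}" lborel "\<lambda>k. diff2 (z m) (w k)"] wcc cc_diff2 cc_square_integrable by auto
        then have "2 ^ m * nrm lborel (diff2 (z m) u) \<le> 2 ^ m * (\<Sum>k\<le>J. nrm lborel (diff2 (z m) (w k)))"
          by (rule mult_left_mono) simp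
        also have "\<dots> = (\<Sum>k\<le>J. 2 ^ m * nrm lborel (diff2 (z m) (w k)))" by (rule sum_distrib_left)
        also have "\<dots> \<le> (\<Sum>k\<le>J. C' * (q ^ ndist m k * b k))" by (rule sum_mono) (use trm in auto)
        also have "\<dots> = C' * (\<Sum>k\<le>J. q ^ ndist m k * b k)" by (rule sum_distrib_left[symmetric])
        finally have "(2 ^ m * nrm lborel (diff2 (z m) u))\<^sup>2 \<le> (C' * (\<Sum>k\<le>J. q ^ ndist m k * b k))\<^sup>2"
          by (rule power_mono) simp
        also have "\<dots> = C'\<^sup>2 * (\<Sum>k\<le>J. q ^ ndist m k * b k)\<^sup>2" by (simp add: power_mult_distrib)
        also have "\<dots> \<le> C'\<^sup>2 * (S * (\<Sum>k\<le>J. q ^ ndist m k * (b k)\<^sup>2))"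
          unfolding S_def by (intro mult_left_mono weighted_sum_square_le sum_ndist_powers_le q) (use q in auto)
        finally have "(2 ^ m * nrm lborel (diff2 (z m) u))\<^sup>2 \<le> C'\<^sup>2 * (S * (\<Sum>k\<le>J. q ^ ndist m k * (b k)\<^sup>2))" .
        moreover have "(2 ^ m * nrm lborel (diff2 (z m) u))\<^sup>2 = 4 ^ m * (nrm lborel (diff2 (z m) u))\<^sup>2"
        proof -
          have "((2::real) ^ m)\<^sup>2 = 4 ^ m" by (simp add: power2_eq_square flip: power_mult_distrib)
          then show ?thesis by (simp add: power_mult_distrib)
        qed
        ultimately show ?thesis by simp
      qed
      have "(\<Sum>m<n. 4 ^ m * (nrm lborel (diff2 (z m) u))\<^sup>2) \<le> (\<Sum>m<n. C'\<^sup>2 * (S * (\<Sum>k\<le>J. q ^ ndist m k * (b k)\<^sup>2)))"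
        by (rule sum_mono) (rule am)
      also have "\<dots> = C'\<^sup>2 * (S * (\<Sum>m<n. \<Sum>k\<le>J. q ^ ndist m k * (b k)\<^sup>2))"
        by (simp only: sum_distrib_left)
      \<comment> \<open>The kernel is symmetric, so its column sums have the bound \<open>S\<close>
        of the row sums.\<close>
      also have "(\<Sum>m<n. \<Sum>k\<le>J. q ^ ndist m k * (b k)\<^sup>2) = (\<Sum>k\<le>J. (\<Sum>m<n. q ^ ndist k m) * (b k)\<^sup>2)"
        by (subst sum.swap) (simp add: sum_distrib_right ndist_def add.commute)
      also have "C'\<^sup>2 * (S * (\<Sum>k\<le>J. (\<Sum>m<n. q ^ ndist k m) * (b k)\<^sup>2)) \<le> C'\<^sup>2 * (S * (\<Sum>k\<le>J. S * (b k)\<^sup>2))"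
        using S unfolding S_def by (intro mult_left_mono sum_mono mult_right_mono sum_ndist_powers_le q) auto
      also have "\<dots> = C'\<^sup>2 * S\<^sup>2 * B" by (simp add: B_def sum_distrib_left[symmetric] power2_eq_square)
      finally have sum: "(\<Sum>m<n. 4 ^ m * (nrm lborel (diff2 (z m) u))\<^sup>2) \<le> C'\<^sup>2 * S\<^sup>2 * B" .
      have "diff_energy e u 0 \<le> (2 * nrm lborel u)\<^sup>2"
        using power_mono[OF nrm_diff1_le[OF ucc, of e] nrm_nonneg, of 2] by (simp add: diff_energy_def)
      also have "\<dots> \<le> 8 * B" using u2 by (simp add: power_mult_distrib)
      finally show ?thesis using sum unfolding diff_energy_sum[OF ucc, of e n] z_def by linarith
    qed
    have "(nrm lborel (grad (axis i 1) u))\<^sup>2 \<le> 8 * B + C'\<^sup>2 * S\<^sup>2 * B" for i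
      by (rule LIMSEQ_le_const2[OF grad_energy(1)[OF \<Omega>(1,2) tri ufe]]) (use en in auto)
    then have "(\<Sum>i\<in>(UNIV::3 set). (nrm lborel (grad (axis i 1) u))\<^sup>2) \<le> (\<Sum>i\<in>(UNIV::3 set). 8 * B + C'\<^sup>2 * S\<^sup>2 * B)"
      by (rule sum_mono)
    then have "(H1_norm \<Omega> u)\<^sup>2 \<le> 2 * B + 3 * (8 * B + C'\<^sup>2 * S\<^sup>2 * B)"
      unfolding H1_norm_fe[OF \<Omega> tri ufe] using u2 by simp
    also have "\<dots> = c * B" by (simp add: c_def algebra_simps)
    finally show ?thesis by (simp add: u_def[abs_def] Beq)
  qed
  then show ?thesis using c by blast
qed

section \<open>Quasi-interpolation and the lower bound\<close>

section \<open>Point functionals that reproduce affine functions\<close>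

text \<open>The ball at \<open>p + w\<close> is the image of the one at \<open>p + 2 w\<close> under
  the homothety with centre \<open>p\<close> and ratio 1/2. The last condition keeps both within
  distance \<open>h\<close> of \<open>p\<close>.\<close>

definition ball_pair :: "'a::euclidean_space set \<Rightarrow> 'a \<Rightarrow> real \<Rightarrow> real \<Rightarrow> 'a \<Rightarrow> bool" where
  "ball_pair S p h s w \<longleftrightarrow> cball (p + 2 *\<^sub>R w) s \<subseteq> S \<and> cball (p + w) (s / 2) \<subseteq> S \<and> 2 * norm w + s \<le> h"

lemma ball_pair_smaller: "ball_pair S p h s w \<Longrightarrow> s' \<le> s \<Longrightarrow> ball_pair S p h s' w"
  unfolding ball_pair_def by (auto intro: order.trans[OF subset_cball])

lemma ball_pair_mono: "ball_pair S p h s w \<Longrightarrow> S \<subseteq> S' \<Longrightarrow> ball_pair S' p h s w"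
  unfolding ball_pair_def by blast

text \<open>The homothety with centre \<open>p\<close> and ratio \<open>a\<close> maps the interior
  of a convex set into itself, even when \<open>p\<close> is only a boundary point.\<close>

lemma shrunk_ball_subset_interior:
  fixes S :: "'a::euclidean_space set"
  assumes S: "convex S" "cball c \<rho> \<subseteq> interior S" "p \<in> closure S" and a: "0 < a" "a \<le> 1"
  shows "cball (p + a *\<^sub>R (c - p)) (a * \<rho>) \<subseteq> interior S"
proof
  fix y assume y: "y \<in> cball (p + a *\<^sub>R (c - p)) (a * \<rho>)"
  define y' where "y' = p + (1 / a) *\<^sub>R (y - p)"
  have "c - y' = (1 / a) *\<^sub>R ((p + a *\<^sub>R (c - p)) - y)" using a by (simp add: y'_def algebra_simps)
  then have "norm (c - y') = (1 / a) * norm ((p + a *\<^sub>R (c - p)) - y)" using a by simp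
  also have "\<dots> \<le> \<rho>" using y a by (simp add: dist_norm pos_divide_le_eq mult.commute)
  finally have "y' \<in> interior S" using S(2) by (auto simp: dist_norm)
  then have "p - a *\<^sub>R (p - y') \<in> interior S" by (rule mem_interior_closure_convex_shrink[OF S(1) _ S(3) a])
  moreover have "p - a *\<^sub>R (p - y') = y" using a by (simp add: y'_def)
  ultimately show "y \<in> interior S" by simp
qed

lemma ball_pair_convex:
  fixes S :: "'a::euclidean_space set"
  assumes S: "convex S" "cball c \<rho> \<subseteq> interior S" "p \<in> closure S" and a: "0 < a" "a \<le> 1"
    and h: "a * (norm (c - p) + \<rho>) \<le> h"
  shows "ball_pair S p h (a * \<rho>) ((a / 2) *\<^sub>R (c - p))"
proof -
  have "cball (p + a *\<^sub>R (c - p)) (a * \<rho>) \<subseteq> S"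
    by (rule order.trans[OF shrunk_ball_subset_interior[OF S a] interior_subset])
  moreover have "0 < a / 2" "a / 2 \<le> 1" using a by auto
  then have "cball (p + (a / 2) *\<^sub>R (c - p)) (a / 2 * \<rho>) \<subseteq> S"
    by (rule order.trans[OF shrunk_ball_subset_interior[OF S] interior_subset])
  moreover have "2 *\<^sub>R (a / 2) *\<^sub>R (c - p) = a *\<^sub>R (c - p)" "a * \<rho> / 2 = a / 2 * \<rho>" by simp_all
  moreover have "2 * norm ((a / 2) *\<^sub>R (c - p)) + a * \<rho> = a * (norm (c - p) + \<rho>)"
    unfolding norm_scaleR using a by (simp add: distrib_left)
  ultimately show ?thesis using h unfolding ball_pair_def by (simp only: simp_thms)
qed

text \<open>The complement of a polytope is a finite union of open half-spaces; intersecting such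
  unions and distributing keeps the pieces open, convex and finite in number. Convexity supplies
  room near each boundary point in place of a cone condition.\<close>

lemma polytopes_complement_convex_cover:
  fixes \<P> :: "'a::euclidean_space set set"
  assumes "finite \<P>" "\<And>P. P \<in> \<P> \<Longrightarrow> polytope P"
  shows "\<exists>\<D>. finite \<D> \<and> (\<forall>D\<in>\<D>. open D \<and> convex D) \<and> \<Union>\<D> = - \<Union>\<P>"
  using assms
proof (induction \<P>)
  case empty
  show ?case by (rule exI[of _ "{UNIV}"]) auto
next
  case (insert P \<P>)
  obtain \<D> where \<D>: "finite \<D>" "\<forall>D\<in>\<D>. open D \<and> convex D" "\<Union>\<D> = - \<Union>\<P>" using insert by auto
  have "polyhedron P" using insert polytope_imp_polyhedron by blast
  then obtain F where F: "finite F" "P = \<Inter>F" "\<forall>h\<in>F. \<exists>a b. a \<noteq> 0 \<and> h = {x. a \<bullet> x \<le> b}"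
    unfolding polyhedron_def by blast
  have oc: "open (- h)" "convex (- h)" if h: "h \<in> F" for h
  proof -
    obtain a b where "h = {x. a \<bullet> x \<le> b}" using F(3) h by blast
    then have "- h = {x. a \<bullet> x > b}" by auto
    then show "open (- h)" "convex (- h)" using open_halfspace_gt convex_halfspace_gt by metis+
  qed
  show ?case
  proof (intro exI[of _ "(\<lambda>(h, D). - h \<inter> D) ` (F \<times> \<D>)"] conjI)
    show "finite ((\<lambda>(h, D). - h \<inter> D) ` (F \<times> \<D>))" using F \<D> by auto
    show "\<forall>D\<in>(\<lambda>(h, D). - h \<inter> D) ` (F \<times> \<D>). open D \<and> convex D"
      using oc \<D>(2) by (auto intro!: open_Int convex_Int)
    have "\<Union>((\<lambda>(h, D). - h \<inter> D) ` (F \<times> \<D>)) = - \<Inter>F \<inter> \<Union>\<D>" by auto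
    then show "\<Union>((\<lambda>(h, D). - h \<inter> D) ` (F \<times> \<D>)) = - \<Union>(insert P \<P>)" using \<D>(3) F(2) by auto
  qed
qed

lemma exterior_ball_pairs:
  assumes poly: "polyhedral_domain \<Omega>"
  shows "\<exists>\<kappa>>0. \<forall>p\<in>frontier \<Omega>. \<forall>h. 0 < h \<longrightarrow> h \<le> 1 \<longrightarrow> (\<exists>w. ball_pair (- closure \<Omega>) p h (\<kappa> * h) w)"
proof -
  have \<Omega>: "interior (closure \<Omega>) = \<Omega>" "bounded \<Omega>" using poly by (auto simp: polyhedral_domain_def)
  obtain \<P> where \<P>: "finite \<P>" "\<And>P. P \<in> \<P> \<Longrightarrow> polytope P" "\<Union>\<P> = closure \<Omega>"
    using poly unfolding polyhedral_domain_def by blast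
  obtain \<D>' where \<D>': "finite \<D>'" "\<forall>D\<in>\<D>'. open D \<and> convex D" "\<Union>\<D>' = - closure \<Omega>"
    using polytopes_complement_convex_cover[OF \<P>(1,2)] \<P>(3) by auto
  define \<D> where "\<D> = \<D>' - {{}}"
  have \<D>: "finite \<D>" "\<And>D. D \<in> \<D> \<Longrightarrow> open D \<and> convex D \<and> D \<noteq> {}" "\<Union>\<D> = - closure \<Omega>" using \<D>' by (auto simp: \<D>_def)
  have "\<exists>c \<rho>. \<rho> > 0 \<and> cball c \<rho> \<subseteq> D" if "D \<in> \<D>" for D
    using \<D>(2)[OF that] open_contains_cball[of D] by blast
  then obtain c \<rho> where c\<rho>: "\<And>D. D \<in> \<D> \<Longrightarrow> \<rho> D > 0" "\<And>D. D \<in> \<D> \<Longrightarrow> cball (c D) (\<rho> D) \<subseteq> D" by metis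
  define \<rho>0 where "\<rho>0 = Min (insert 1 (\<rho> ` \<D>))"
  have \<rho>0: "\<rho>0 > 0" "\<And>D. D \<in> \<D> \<Longrightarrow> \<rho>0 \<le> \<rho> D"
    using \<D>(1) c\<rho>(1) by (auto simp: \<rho>0_def)
  have "bounded (frontier \<Omega>)" using bounded_closure[OF \<Omega>(2)] by (rule bounded_subset) (simp add: frontier_def)
  then obtain R where R: "\<And>p. p \<in> frontier \<Omega> \<Longrightarrow> norm p \<le> R" unfolding bounded_iff by blast
  \<comment> \<open>Bounds the distance from any boundary point to the far side of any chosen ball,
    so shrinking by \<open>h / M\<close> brings everything within \<open>h\<close>.\<close>
  define M where "M = Max (insert 1 ((\<lambda>D. norm (c D) + R + \<rho>0) ` \<D>))"
  have M: "M \<ge> 1" "\<And>D. D \<in> \<D> \<Longrightarrow> norm (c D) + R + \<rho>0 \<le> M" using \<D>(1) by (auto simp: M_def)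
  define \<kappa> where "\<kappa> = \<rho>0 / M"
  have "\<exists>w. ball_pair (- closure \<Omega>) p h (\<kappa> * h) w" if p: "p \<in> frontier \<Omega>" and h: "0 < h" "h \<le> 1" for p h
  proof -
    \<comment> \<open>Here slits are excluded: every boundary point is a limit of points outside the
      closure.\<close>
    have "p \<notin> interior (closure \<Omega>)" using p \<Omega> open_interior[of "closure \<Omega>"] by (simp add: frontier_def interior_open)
    then have "p \<in> closure (- closure \<Omega>)" by (simp add: closure_complement)
    then have "p \<in> closure (\<Union>\<D>)" by (simp add: \<D>(3))
    moreover have "closure (\<Union>\<D>) \<subseteq> (\<Union>D\<in>\<D>. closure D)"
      using \<D>(1) closure_subset by (intro closure_minimal closed_UN) auto
    ultimately obtain D where D: "D \<in> \<D>" "p \<in> closure D" by blast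
    define a where "a = h / M"
    have a: "0 < a" "a \<le> 1" using h M(1) by (auto simp: a_def divide_le_eq)
    have "ball_pair D p h (a * \<rho>0) ((a / 2) *\<^sub>R (c D - p))"
    proof (rule ball_pair_convex[OF _ _ D(2) a])
      show "convex D" using \<D>(2)[OF D(1)] by blast
      have "interior D = D" using \<D>(2)[OF D(1)] interior_open by blast
      moreover have "cball (c D) \<rho>0 \<subseteq> cball (c D) (\<rho> D)" using \<rho>0(2)[OF D(1)] by (rule subset_cball)
      ultimately show "cball (c D) \<rho>0 \<subseteq> interior D" using c\<rho>(2)[OF D(1)] by blast
      have "norm (c D - p) + \<rho>0 \<le> M" using M(2)[OF D(1)] R[OF p] norm_triangle_ineq4[of "c D" p] by linarith
      then have "a * (norm (c D - p) + \<rho>0) \<le> a * M" using a by (intro mult_left_mono) auto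
      also have "a * M = h" using M(1) by (simp add: a_def)
      finally show "a * (norm (c D - p) + \<rho>0) \<le> h" .
    qed
    then have "ball_pair (- closure \<Omega>) p h (a * \<rho>0) ((a / 2) *\<^sub>R (c D - p))"
      by (rule ball_pair_mono) (use D(1) \<D>(3) in blast)
    moreover have "a * \<rho>0 = \<kappa> * h" by (simp add: a_def \<kappa>_def)
    ultimately show ?thesis by auto
  qed
  moreover have "\<kappa> > 0" using \<rho>0(1) M(1) by (simp add: \<kappa>_def)
  ultimately show ?thesis by (intro exI[of _ \<kappa>]) auto
qed

text \<open>A tetrahedron of lower level is larger than the mesh width \<open>1 / 2 ^ j\<close>; the
  ratio \<open>a\<close> shrinks its inscribed ball towards \<open>p\<close> down to that scale, so
  one ball size serves all levels.\<close>

lemma tetrahedron_ball_pair: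
  assumes \<tau>: "convex \<tau>" "cball c (r / 2 ^ l) \<subseteq> interior \<tau>" and p: "p \<in> \<tau>" and r: "r > 0"
    and D: "\<And>x y. x \<in> \<tau> \<Longrightarrow> y \<in> \<tau> \<Longrightarrow> dist x y \<le> D / 2 ^ l" and M: "M = max 1 (D + r)" and l: "l \<le> j"
  shows "\<exists>w. ball_pair \<tau> p (1 / 2 ^ j) (r / M / 2 ^ j) w"
proof -
  define a where "a = 2 ^ l / 2 ^ j / M"
  have M1: "M \<ge> 1" "D + r \<le> M" using M by auto
  have "(2::real) ^ l \<le> 2 ^ j" using l by simp
  then have "1 * (2::real) ^ l \<le> M * 2 ^ j" using M1(1) by (intro mult_mono) auto
  then have a: "0 < a" "a \<le> 1" using M1(1) by (auto simp: a_def divide_le_eq mult.commute)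
  have c: "c \<in> \<tau>" using \<tau>(2) interior_subset r by fastforce
  have "ball_pair \<tau> p (1 / 2 ^ j) (a * (r / 2 ^ l)) ((a / 2) *\<^sub>R (c - p))"
  proof (rule ball_pair_convex[OF \<tau> _ a])
    show "p \<in> closure \<tau>" using p closure_subset by blast
    have "a * (norm (c - p) + r / 2 ^ l) \<le> a * ((D + r) / 2 ^ l)"
      using a D[OF c p] by (intro mult_left_mono) (auto simp: dist_norm add_divide_distrib)
    also have "\<dots> \<le> a * (M / 2 ^ l)" using a M1(2) by (intro mult_left_mono divide_right_mono) auto
    also have "\<dots> = 1 / 2 ^ j" using M1(1) by (simp add: a_def)
    finally show "a * (norm (c - p) + r / 2 ^ l) \<le> 1 / 2 ^ j" .
  qed
  moreover have "a * (r / 2 ^ l) = r / M / 2 ^ j" by (simp add: a_def)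
  ultimately show ?thesis by auto
qed

text \<open>The two means of an affine function are its values at \<open>p + w\<close> and \<open>p + 2 w\<close>, which extrapolate to
  the value at \<open>p\<close>, and unlike point values they are bounded in \<open>L\<^sub>2\<close>.\<close>

definition pt_fun :: "('a::euclidean_space \<Rightarrow> real) \<Rightarrow> 'a \<Rightarrow> real \<Rightarrow> 'a \<Rightarrow> real" where
  "pt_fun f p s w = 2 * avg f (s / 2) (p + w) - avg f s (p + 2 *\<^sub>R w)"

lemma avg_affine:
  fixes g :: "'a::euclidean_space" and k :: real
  assumes "r > 0" shows "avg (\<lambda>x. g \<bullet> x + k) r c = g \<bullet> c + k"
proof -
  have "(LINT x:cball 0 r|lborel. g \<bullet> (c + x) + k) = (LINT x:cball c r|lborel. g \<bullet> x + k)"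
    by (rule set_integral_cball_shift[symmetric]) auto
  then show ?thesis using content_cball_pos[OF assms, of "0::'a"] by (simp add: avg_def affine_ball_average)
qed

lemma pt_fun_affine:
  fixes g :: "'a::euclidean_space" and k :: real
  assumes "s > 0" shows "pt_fun (\<lambda>x. g \<bullet> x + k) p s w = g \<bullet> p + k"
  using assms by (simp add: pt_fun_def avg_affine inner_add_right)

lemma avg_cong:
  assumes "\<And>x. x \<in> cball c r \<Longrightarrow> f x = g x" shows "avg f r c = avg g r c"
proof -
  have "(LINT s:cball 0 r|lborel. f (c + s)) = (LINT s:cball 0 r|lborel. g (c + s))"
    by (rule set_lebesgue_integral_cong) (use assms in \<open>auto simp: dist_norm\<close>)
  then show ?thesis by (simp add: avg_def)
qed

lemma pt_fun_cong:
  assumes "ball_pair S p h s w" "\<And>x. x \<in> S \<Longrightarrow> f x = g x" shows "pt_fun f p s w = pt_fun g p s w"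
  unfolding pt_fun_def using assms by (intro arg_cong2[of _ _ _ _ "\<lambda>a b. 2 * a - b"] avg_cong) (auto simp: ball_pair_def)

lemma avg_diff:
  fixes f g :: "'a::euclidean_space \<Rightarrow> real"
  assumes "continuous_on UNIV f" "continuous_on UNIV g"
  shows "avg (\<lambda>x. f x - g x) r c = avg f r c - avg g r c"
proof -
  have "set_integrable lborel (cball 0 r) (\<lambda>s. f (c + s))" "set_integrable lborel (cball 0 r) (\<lambda>s. g (c + s))"
    by (intro set_integrable_compact compact_cball continuous_on_compose2[OF assms(1)] continuous_on_compose2[OF assms(2)] continuous_intros; simp)+
  then show ?thesis by (simp add: avg_def diff_divide_distrib)
qed

lemma avg_square_le:
  fixes f :: "'a::euclidean_space \<Rightarrow> real"
  assumes f: "continuous_on UNIV f" and r: "r > 0"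
  shows "measure lborel (cball (0::'a) r) * (avg f r c)\<^sup>2 \<le> (LINT x:cball c r|lborel. (f x)\<^sup>2)"
proof -
  let ?V = "measure lborel (cball (0::'a) r)"
  have V: "?V > 0" by (rule content_cball_pos[OF r])
  have fc: "continuous_on UNIV (\<lambda>s. f (c + s))" by (rule continuous_on_compose2[OF f]) (auto intro!: continuous_intros)
  have "(?V * avg f r c)\<^sup>2 \<le> ?V * (LINT s:cball 0 r|lborel. (f (c + s))\<^sup>2)"
    using set_integral_square_le[OF compact_cball fc, of 0 r] V by (simp add: avg_def)
  also have "(LINT s:cball 0 r|lborel. (f (c + s))\<^sup>2) = (LINT x:cball c r|lborel. (f x)\<^sup>2)"
    by (rule set_integral_cball_shift[symmetric]) (intro borel_measurable_continuous_onI continuous_intros f)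
  finally have "?V * (?V * (avg f r c)\<^sup>2) \<le> ?V * (LINT x:cball c r|lborel. (f x)\<^sup>2)"
    by (simp add: power2_eq_square ac_simps)
  then show ?thesis using V by simp
qed

lemma pt_fun_square_le:
  fixes f :: "'a::euclidean_space \<Rightarrow> real"
  assumes f: "continuous_on UNIV f" and s: "s > 0" and bp: "ball_pair S p h s w"
  shows "measure lborel (cball (0::'a) (s / 2)) * (pt_fun f p s w)\<^sup>2 \<le> 10 * (LINT x:cball p h|lborel. (f x)\<^sup>2)"
proof -
  let ?V = "measure lborel (cball (0::'a) (s / 2))" and ?I = "LINT x:cball p h|lborel. (f x)\<^sup>2"
  have nw: "2 * norm w + s \<le> h" using bp by (simp add: ball_pair_def)
  have le: "(LINT x:cball c r|lborel. (f x)\<^sup>2) \<le> ?I" if "norm (c - p) + r \<le> h" for c r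
  proof (rule set_integral_mono_set)
    show "cball c r \<subseteq> cball p h"
    proof
      fix x assume "x \<in> cball c r"
      then show "x \<in> cball p h" using that dist_triangle[of p x c] by (simp add: dist_norm norm_minus_commute)
    qed
    show "set_integrable lborel (cball p h) (\<lambda>x. (f x)\<^sup>2)"
      by (intro set_integrable_compact compact_cball continuous_intros continuous_on_subset[OF f]) auto
  qed auto
  have V12: "?V \<le> measure lborel (cball (0::'a) s)"
    using s by (simp add: content_cball power_mono mult_left_mono)
  have 1: "?V * (avg f (s / 2) (p + w))\<^sup>2 \<le> ?I"
    using avg_square_le[OF f, of "s / 2" "p + w"] le[of "p + w" "s / 2"] s nw norm_ge_zero[of w] by (simp; linarith)
  have "?V * (avg f s (p + 2 *\<^sub>R w))\<^sup>2 \<le> measure lborel (cball (0::'a) s) * (avg f s (p + 2 *\<^sub>R w))\<^sup>2"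
    using V12 by (intro mult_right_mono) auto
  then have 2: "?V * (avg f s (p + 2 *\<^sub>R w))\<^sup>2 \<le> ?I"
    using avg_square_le[OF f s, of "p + 2 *\<^sub>R w"] le[of "p + 2 *\<^sub>R w" s] nw by simp
  \<comment> \<open>The source of the constant \<open>10 = 8 + 2\<close>.\<close>
  have sq: "(2 * a - b)\<^sup>2 \<le> 8 * a\<^sup>2 + 2 * b\<^sup>2" for a b :: real
  proof -
    have "8 * a\<^sup>2 + 2 * b\<^sup>2 - (2 * a - b)\<^sup>2 = (2 * a + b)\<^sup>2" by (simp add: power2_eq_square algebra_simps)
    then show ?thesis using zero_le_power2[of "2 * a + b"] by linarith
  qed
  have "?V * (pt_fun f p s w)\<^sup>2 \<le> ?V * (8 * (avg f (s / 2) (p + w))\<^sup>2 + 2 * (avg f s (p + 2 *\<^sub>R w))\<^sup>2)"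
    unfolding pt_fun_def by (intro mult_left_mono sq) simp
  also have "\<dots> = 8 * (?V * (avg f (s / 2) (p + w))\<^sup>2) + 2 * (?V * (avg f s (p + 2 *\<^sub>R w))\<^sup>2)" by (simp add: algebra_simps)
  also have "\<dots> \<le> 10 * ?I" using 1 2 by simp
  finally show ?thesis .
qed

section \<open>Summing local energies\<close>

lemma set_integral_swap:
  fixes f :: "'a::euclidean_space \<times> 'b::euclidean_space \<Rightarrow> real"
  assumes f: "continuous_on UNIV f" and S: "compact S" and T: "compact T"
  shows "(LINT x:S|lborel. (LINT y:T|lborel. f (x, y))) = (LINT y:T|lborel. (LINT x:S|lborel. f (x, y)))"
proof -
  define F where "F = (\<lambda>x y. indicator (S \<times> T) (x, y) *\<^sub>R f (x, y))"
  have "integrable lborel (\<lambda>z. indicator (S \<times> T) z *\<^sub>R f z)"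
    by (intro borel_integrable_compact compact_Times S T continuous_on_subset[OF f]) auto
  then have "integrable (lborel \<Otimes>\<^sub>M lborel) (case_prod F)"
    by (simp add: lborel_prod F_def case_prod_beta')
  then have "(LINT y|lborel. LINT x|lborel. F x y) = (LINT x|lborel. LINT y|lborel. F x y)"
    by (rule lborel_pair.Fubini_integral)
  moreover have "(LINT y|lborel. F x y) = indicator S x *\<^sub>R (LINT y:T|lborel. f (x, y))" for x
    by (auto simp: F_def set_lebesgue_integral_def indicator_def)
  moreover have "(LINT x|lborel. F x y) = indicator T y *\<^sub>R (LINT x:S|lborel. f (x, y))" for y
    by (auto simp: F_def set_lebesgue_integral_def indicator_def)
  ultimately show ?thesis by (simp add: set_lebesgue_integral_def)
qed

text \<open>A packing argument: the disjoint small balls whose large ball contains \<open>P\<close>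
  all lie in the ball of radius \<open>R + s\<close> around \<open>P\<close>, so volumes bound their
  number.\<close>

lemma ball_overlap_count:
  fixes c :: "'i \<Rightarrow> 'a::euclidean_space"
  assumes I: "finite I" and dis: "\<And>i j. i \<in> I \<Longrightarrow> j \<in> I \<Longrightarrow> i \<noteq> j \<Longrightarrow> cball (c i) s \<inter> cball (c j) s = {}"
    and s: "s > 0" and R: "R \<ge> 0"
  shows "real (card {i \<in> I. P \<in> cball (c i) R}) \<le> ((R + s) / s) ^ DIM('a)"
proof -
  let ?J = "{i \<in> I. P \<in> cball (c i) R}" and ?B = "cball P (R + s)"
  define \<beta> where "\<beta> = unit_ball_vol (real DIM('a))"
  have \<beta>: "\<beta> > 0" by (simp add: \<beta>_def)
  have int: "integrable lborel (indicat_real ?B)"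
    by (rule integrable_real_indicator) (use emeasure_compact_finite[OF compact_cball] in auto)
  have "(\<Sum>i\<in>?J. (LINT x:cball (c i) s|lborel. indicat_real ?B x)) \<le> (LINT x|lborel. indicat_real ?B x)"
    by (rule sum_disjoint_integrals_le[OF _ _ _ int]) (use I dis in auto)
  also have "(\<Sum>i\<in>?J. (LINT x:cball (c i) s|lborel. indicat_real ?B x)) = (\<Sum>i\<in>?J. \<beta> * s ^ DIM('a))"
  proof (rule sum.cong)
    fix i assume i: "i \<in> ?J"
    have "cball (c i) s \<subseteq> ?B"
    proof
      fix x assume "x \<in> cball (c i) s"
      then show "x \<in> ?B" using i dist_triangle[of P x "c i"] by (simp add: dist_commute)
    qed
    then have "(LINT x:cball (c i) s|lborel. indicat_real ?B x) = (LINT x:cball (c i) s|lborel. 1)"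
      by (intro set_lebesgue_integral_cong) auto
    then show "(LINT x:cball (c i) s|lborel. indicat_real ?B x) = \<beta> * s ^ DIM('a)"
      using s set_integral_const_lborel[OF compact_cball, of "c i" s 1] by (simp add: content_cball \<beta>_def)
  qed simp
  also have "(LINT x|lborel. indicat_real ?B x) = \<beta> * (R + s) ^ DIM('a)"
    using s R by (simp add: content_cball \<beta>_def)
  finally have "real (card ?J) * (\<beta> * s ^ DIM('a)) \<le> \<beta> * (R + s) ^ DIM('a)" by simp
  then have "real (card ?J) * s ^ DIM('a) \<le> (R + s) ^ DIM('a)" using \<beta> by (simp add: mult.left_commute)
  then show ?thesis using s by (simp add: power_divide pos_le_divide_eq)
qed

text \<open>With \<open>Q = P + e\<close> the defect becomes a second difference with step
  \<open>e / 2\<close>, and two points of one ball have \<open>norm e\<close> at most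
  \<open>2 * R\<close>. Enlarging the range of \<open>P\<close> to the whole space costs the overlap
  number \<open>N\<close>.\<close>

lemma jensen_energy_sum_le:
  fixes u :: "'a::euclidean_space \<Rightarrow> real" and c :: "'i \<Rightarrow> 'a"
  assumes u: "u \<in> cc" and I: "finite I" and R: "R > 0"
    and N: "\<And>P. real (card {i \<in> I. P \<in> cball (c i) R}) \<le> N"
  shows "set_integrable lborel (cball 0 (2 * R)) (\<lambda>e. (nrm lborel (diff2 ((1/2) *\<^sub>R e) u))\<^sup>2)"
    and "(\<Sum>i\<in>I. jensen_energy u (c i) R) \<le> N * (LINT e:cball 0 (2 * R)|lborel. (nrm lborel (diff2 ((1/2) *\<^sub>R e) u))\<^sup>2)"
proof -
  obtain r where r: "r > 0" "\<And>x. norm x > r \<Longrightarrow> u x = 0" using cc_support[OF u] by blast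
  \<comment> \<open>A radius large enough for all the balls and for the supports of all second
    differences involved, so that the exchange of integrals takes place on compact sets.\<close>
  define A where "A = r + 2 * R + (\<Sum>i\<in>I. norm (c i) + R)"
  have A: "r + 2 * R \<le> A" unfolding A_def using R by (simp add: sum_nonneg)
  have Ac: "norm (c i) + R \<le> A" if "i \<in> I" for i
  proof -
    have "norm (c i) + R \<le> (\<Sum>i\<in>I. norm (c i) + R)" using I that R by (intro member_le_sum) auto
    then show ?thesis using r R by (simp add: A_def)
  qed
  let ?S = "cball (0::'a) A" and ?E = "cball (0::'a) (2 * R)"
  define f where "f z = (diff2 ((1/2) *\<^sub>R snd z) u (fst z))\<^sup>2" for z :: "'a \<times> 'a"
  have cf: "continuous_on UNIV f" unfolding f_def diff2_def
    by (intro continuous_intros continuous_on_cc[OF u])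
  have cf': "continuous_on UNIV (\<lambda>z. f (snd z, fst z))"
    by (rule continuous_on_compose2[OF cf]) (auto intro!: continuous_intros)
  have full: "(LINT P:?S|lborel. f (P, e)) = (nrm lborel (diff2 ((1/2) *\<^sub>R e) u))\<^sup>2" if e: "e \<in> ?E" for e
  proof -
    have "diff2 ((1/2) *\<^sub>R e) u P = 0" if P: "P \<notin> ?S" for P
    proof -
      have nP: "norm P > r + 2 * R" using P A by simp
      have ne: "norm e \<le> 2 * R" using e by simp
      have "norm (P + e) > r" using norm_diff_ineq[of P e] nP ne by linarith
      moreover have "norm (P + (1/2) *\<^sub>R e) > r" using norm_diff_ineq[of P "(1/2) *\<^sub>R e"] nP ne R by simp
      moreover have "norm P > r" using nP R by simp
      ultimately show ?thesis using r(2) by (simp add: diff2_def)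
    qed
    then have "(\<lambda>P. indicator ?S P *\<^sub>R f (P, e)) = (\<lambda>P. (diff2 ((1/2) *\<^sub>R e) u P)\<^sup>2)"
      by (auto simp: f_def indicator_def fun_eq_iff)
    then show ?thesis by (simp add: set_lebesgue_integral_def nrm_power2)
  qed
  have "set_integrable lborel ?E (\<lambda>e. LINT P:?S|lborel. f (P, e))"
    using set_integral_Times(2)[OF cf' compact_cball compact_cball, of 0 "2 * R" 0 A] by simp
  then show "set_integrable lborel ?E (\<lambda>e. (nrm lborel (diff2 ((1/2) *\<^sub>R e) u))\<^sup>2)"
    by (rule set_integrable_cong[THEN iffD1, rotated -1]) (use full in auto)
  define H where "H P = (LINT e:?E|lborel. f (P, e))" for P
  have Hint: "set_integrable lborel (cball x \<rho>) H" for x \<rho>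
    unfolding H_def using set_integral_Times(2)[OF cf compact_cball compact_cball] by simp
  have H0: "H P \<ge> 0" for P unfolding H_def by (rule set_integral_nonneg_real) (simp add: f_def)
  have je: "jensen_energy u (c i) R \<le> (LINT P:cball (c i) R|lborel. H P)" for i
  proof -
    let ?B = "cball (c i) R"
    have cm: "continuous_on UNIV (\<lambda>z. (mid_defect u z)\<^sup>2)" by (intro continuous_intros continuous_on_mid_defect[OF u])
    have "jensen_energy u (c i) R = (LINT P:?B|lborel. (LINT Q:?B|lborel. (mid_defect u (P, Q))\<^sup>2))"
      unfolding jensen_energy_def by (rule set_integral_Times(1)[OF cm]) auto
    also have "\<dots> \<le> (LINT P:?B|lborel. H P)"
    proof (rule set_integral_mono)
      show "set_integrable lborel ?B (\<lambda>P. LINT Q:?B|lborel. (mid_defect u (P, Q))\<^sup>2)"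
        by (rule set_integral_Times(2)[OF cm]) auto
      show "set_integrable lborel ?B H" by (rule Hint)
      fix P assume P: "P \<in> ?B"
      have mf: "(mid_defect u (P, P + e))\<^sup>2 = f (P, e)" for e
      proof -
        have "(1/2) *\<^sub>R (P + (P + e)) = P + (1/2) *\<^sub>R e" using half_scaleR_shift[of P 0 e] by simp
        then show ?thesis unfolding mid_defect_def f_def diff2_def fst_conv snd_conv by (simp add: add.commute add_diff_eq)
      qed
      have "(LINT Q:?B|lborel. (mid_defect u (P, Q))\<^sup>2) \<le> (LINT Q:cball P (2 * R)|lborel. (mid_defect u (P, Q))\<^sup>2)"
      proof (rule set_integral_mono_set)
        show "?B \<subseteq> cball P (2 * R)"
        proof
          fix x assume "x \<in> ?B"
          then show "x \<in> cball P (2 * R)" using P dist_triangle[of P x "c i"] by (simp add: dist_commute)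
        qed
        show "set_integrable lborel (cball P (2 * R)) (\<lambda>Q. (mid_defect u (P, Q))\<^sup>2)"
          by (intro set_integrable_compact compact_cball continuous_intros continuous_on_mid_defect[OF u])
      qed auto
      also have "\<dots> = (LINT e:?E|lborel. (mid_defect u (P, P + e))\<^sup>2)"
        by (rule set_integral_cball_shift) (intro borel_measurable_continuous_onI continuous_intros continuous_on_mid_defect[OF u])
      also have "\<dots> = H P" by (simp add: mf H_def)
      finally show "(LINT Q:?B|lborel. (mid_defect u (P, Q))\<^sup>2) \<le> H P" .
    qed
    finally show ?thesis .
  qed
  have "(\<Sum>i\<in>I. jensen_energy u (c i) R) \<le> (\<Sum>i\<in>I. (LINT P:cball (c i) R|lborel. H P))" by (rule sum_mono) (rule je)
  also have "\<dots> = (LINT P|lborel. (\<Sum>i\<in>I. indicat_real (cball (c i) R) P *\<^sub>R H P))"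
    unfolding set_lebesgue_integral_def
    by (rule Bochner_Integration.integral_sum[symmetric]) (use Hint in \<open>simp add: set_integrable_def\<close>)
  also have "\<dots> \<le> (LINT P|lborel. N * (indicat_real ?S P *\<^sub>R H P))"
  proof (rule integral_mono)
    show "integrable lborel (\<lambda>P. \<Sum>i\<in>I. indicat_real (cball (c i) R) P *\<^sub>R H P)"
      by (rule Bochner_Integration.integrable_sum) (use Hint in \<open>simp add: set_integrable_def\<close>)
    show "integrable lborel (\<lambda>P. N * (indicat_real ?S P *\<^sub>R H P))"
      by (rule integrable_mult_right) (use Hint in \<open>simp add: set_integrable_def\<close>)
    fix P
    have card: "(\<Sum>i\<in>I. indicat_real (cball (c i) R) P) = real (card {i \<in> I. P \<in> cball (c i) R})"
      using I by (simp add: indicator_def sum.If_cases Int_def)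
    show "(\<Sum>i\<in>I. indicat_real (cball (c i) R) P *\<^sub>R H P) \<le> N * (indicat_real ?S P *\<^sub>R H P)"
    proof (cases "P \<in> ?S")
      case True
      have "(\<Sum>i\<in>I. indicat_real (cball (c i) R) P) * H P \<le> N * H P" unfolding card using N H0 by (rule mult_right_mono)
      then show ?thesis using True by (simp add: sum_distrib_right)
    next
      case False
      have "P \<notin> cball (c i) R" if "i \<in> I" for i
        using False Ac[OF that] norm_triangle_ineq2[of P "c i"] by (auto simp: dist_norm norm_minus_commute)
      then show ?thesis using False by simp
    qed
  qed
  also have "\<dots> = N * (LINT P:?S|lborel. H P)" by (simp add: set_lebesgue_integral_def)
  also have "(LINT P:?S|lborel. H P) = (LINT e:?E|lborel. (LINT P:?S|lborel. f (P, e)))"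
    unfolding H_def by (rule set_integral_swap[OF cf]) auto
  also have "\<dots> = (LINT e:?E|lborel. (nrm lborel (diff2 ((1/2) *\<^sub>R e) u))\<^sup>2)"
    by (rule set_lebesgue_integral_cong) (use full in auto)
  finally show "(\<Sum>i\<in>I. jensen_energy u (c i) R) \<le> N * (LINT e:cball 0 (2 * R)|lborel. (nrm lborel (diff2 ((1/2) *\<^sub>R e) u))\<^sup>2)" .
qed

section \<open>The lower bound\<close>

lemma diff2_energy_measurable:
  fixes u :: "'a::euclidean_space \<Rightarrow> real"
  assumes u: "u \<in> cc"
  shows "(\<lambda>e. (nrm lborel (diff2 (t *\<^sub>R e) u))\<^sup>2) \<in> borel_measurable borel"
proof -
  have "continuous_on UNIV (\<lambda>z::'a \<times> 'a. (diff2 (t *\<^sub>R fst z) u (snd z))\<^sup>2)"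
    unfolding diff2_def by (intro continuous_intros continuous_on_cc[OF u])
  then have "(\<lambda>z::'a \<times> 'a. (diff2 (t *\<^sub>R fst z) u (snd z))\<^sup>2) \<in> borel_measurable borel"
    by (rule borel_measurable_continuous_onI)
  then have "(\<lambda>(e, x). (diff2 (t *\<^sub>R e) u x)\<^sup>2) \<in> borel_measurable (borel \<Otimes>\<^sub>M lborel)"
    by (simp add: case_prod_beta' borel_prod[symmetric] cong: measurable_cong_sets)
  then show ?thesis unfolding nrm_power2 by (rule sigma_finite_measure.borel_measurable_lebesgue_integral[OF sigma_finite_lborel])
qed

lemma diff2_energy_integrable:
  fixes u :: "'a::euclidean_space \<Rightarrow> real"
  assumes u: "u \<in> cc"
  shows "set_integrable lborel (cball 0 E) (\<lambda>e. (nrm lborel (diff2 (t *\<^sub>R e) u))\<^sup>2)"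
  unfolding set_integrable_def
proof (rule Bochner_Integration.integrable_bound)
  show "integrable lborel (\<lambda>e. indicat_real (cball (0::'a) E) e * (4 * nrm lborel u)\<^sup>2)"
    by (intro integrable_mult_left integrable_real_indicator) (use emeasure_compact_finite[OF compact_cball] in auto)
  show "(\<lambda>e. indicat_real (cball 0 E) e *\<^sub>R (nrm lborel (diff2 (t *\<^sub>R e) u))\<^sup>2) \<in> borel_measurable lborel"
    using diff2_energy_measurable[OF u, of t] by (intro borel_measurable_scaleR borel_measurable_indicator) auto
  show "AE e in lborel. norm (indicat_real (cball 0 E) e *\<^sub>R (nrm lborel (diff2 (t *\<^sub>R e) u))\<^sup>2) \<le> norm (indicat_real (cball 0 E) e * (4 * nrm lborel u)\<^sup>2)"
    using power_mono[OF nrm_diff2_le[OF u] nrm_nonneg, where n=2] by (intro AE_I2) (simp add: indicator_def)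
qed

lemma unrefined_tet_persists:
  assumes bek: "bek_sequence \<Omega> \<T>" and \<tau>: "\<tau> \<in> \<T> j" "tet_level \<T> \<tau> < j" and "j \<le> J"
  shows "\<tau> \<in> \<T> J"
  using \<open>j \<le> J\<close>
proof (induction J rule: dec_induct)
  case base
  show ?case by (rule \<tau>(1))
next
  case (step k)
  have "only_newest_refined \<T>" using bek by (simp only: bek_sequence_def)
  then have "\<not> is_refined \<T> k \<tau>" using \<tau>(2) step.hyps unfolding only_newest_refined_def by auto
  then have "sons \<T> k \<tau> = {\<tau>}" using step.IH by (simp add: is_refined_def)
  then have "\<tau> \<in> sons \<T> k \<tau>" by simp
  then show ?case by (simp add: sons_def)
qed

text \<open>Old tetrahedra contribute no error, so only those of level exactly \<open>j\<close>, of
  size \<open>2 ^ -j\<close>, remain. There both \<open>u\<close> and \<open>v\<close> are compared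
  with the affine function of \<open>Whitney_affine\<close>, and the local energies are summed by
  bounded overlap.\<close>

lemma quasi_interpolation:
  assumes poly: "polyhedral_domain \<Omega>" and bek: "bek_sequence \<Omega> \<T>"
  shows "\<exists>C>0. \<exists>E>0. \<forall>J j. \<forall>u\<in>fe_space \<Omega> (\<T> J). j \<le> J \<longrightarrow> (\<exists>v\<in>fe_space \<Omega> (\<T> j).
    (nrm lborel (\<lambda>x. u x - v x))\<^sup>2 \<le> C * (LINT e:cball 0 E|lborel. (nrm lborel (diff2 ((1 / 2 ^ Suc j) *\<^sub>R e) u))\<^sup>2))"
proof -
  have \<Omega>: "open \<Omega>" "bounded \<Omega>" "interior (closure \<Omega>) = \<Omega>" using poly by (auto simp: polyhedral_domain_def)
  obtain r D c where rD: "r > 0" "D > 0" and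
    all: "\<forall>j. \<forall>\<sigma>\<in>\<T> j. cball (c \<sigma>) (r / 2 ^ tet_level \<T> \<sigma>) \<subseteq> interior \<sigma> \<and>
     (\<forall>x\<in>\<sigma>. \<forall>y\<in>\<sigma>. dist x y \<le> D / 2 ^ tet_level \<T> \<sigma>)"
    using bek_shape_interior[OF bek] by (elim exE conjE)
  have c: "cball (c \<sigma>) (r / 2 ^ tet_level \<T> \<sigma>) \<subseteq> interior \<sigma>" if "\<sigma> \<in> \<T> j" for j \<sigma>
    using all that by blast
  have D: "dist x y \<le> D / 2 ^ tet_level \<T> \<sigma>" if "\<sigma> \<in> \<T> j" "x \<in> \<sigma>" "y \<in> \<sigma>" for j \<sigma> x y
    using all that by blast
  obtain \<kappa>1 where \<kappa>1: "\<kappa>1 > 0" "\<forall>p\<in>frontier \<Omega>. \<forall>h. 0 < h \<longrightarrow> h \<le> 1 \<longrightarrow> (\<exists>w. ball_pair (- closure \<Omega>) p h (\<kappa>1 * h) w)"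
    using exterior_ball_pairs[OF poly] by blast
  define M where "M = max 1 (D + r)"
  \<comment> \<open>The smaller of the ball sizes available outside \<open>\<Omega>\<close> and
    inside tetrahedra, so that a single radius \<open>s\<close> serves all vertices.\<close>
  define \<kappa> where "\<kappa> = min \<kappa>1 (r / M)"
  have M1: "M \<ge> 1" by (simp add: M_def)
  have \<kappa>: "\<kappa> > 0" "\<kappa> \<le> \<kappa>1" "\<kappa> \<le> r / M" using \<kappa>1 rD M1 by (auto simp: \<kappa>_def)
  define \<beta> where "\<beta> = unit_ball_vol 3"
  have \<beta>: "\<beta> > 0" by (simp add: \<beta>_def)
  have vol: "measure lborel (cball (x::real^3) s) = \<beta> * s ^ 3" if "s \<ge> 0" for x s
    using that by (simp add: content_cball \<beta>_def)
  define C0 where "C0 = real (2 * (1 + (16 * DIM(real^3))\<^sup>2))"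
  have C0: "C0 > 0" by (simp only: C0_def of_nat_0_less_iff) simp
  \<comment> \<open>The 160 is \<open>2 * 10 * 2 ^ 3\<close>: splitting a square, the bound on the
    point functional, and its half radius. The second factor is the Whitney constant over the volume
    of a ball of radius \<open>(D + 1) * h\<close>, without \<open>h ^ 3\<close>.\<close>
  define C1 where "C1 = (2 + 160 * (D / \<kappa>) ^ 3) * (C0 / (\<beta> * (D + 1) ^ 3))"
  have "2 + 160 * (D / \<kappa>) ^ 3 > 0" using rD \<kappa> by (intro add_pos_pos mult_pos_pos zero_less_power divide_pos_pos) auto
  then have C1: "C1 > 0" unfolding C1_def using C0 \<beta> rD by (intro mult_pos_pos divide_pos_pos zero_less_power) auto
  \<comment> \<open>The packing number for radii \<open>2 * (D + 1) * h\<close> and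
    \<open>r * h\<close>.\<close>
  define N where "N = ((2 * (D + 1) + r) / r) ^ 3"
  have N: "N > 0" using rD by (auto simp: N_def)
  define E where "E = 4 * (D + 1)"
  have E: "E > 0" using rD by (simp add: E_def)
  have main: "\<exists>v\<in>fe_space \<Omega> (\<T> j). (nrm lborel (\<lambda>x. u x - v x))\<^sup>2
      \<le> C1 * N * (LINT e:cball 0 E|lborel. (nrm lborel (diff2 ((1 / 2 ^ Suc j) *\<^sub>R e) u))\<^sup>2)"
    if u: "u \<in> fe_space \<Omega> (\<T> J)" and j: "j \<le> J" for J j u
  proof -
    define T where "T = \<T> j"
    have tri: "triangulation_of (closure \<Omega>) T" and conf: "conforming T" using bek by (auto simp: bek_sequence_def T_def)
    have T: "finite T" "\<And>\<tau>. \<tau> \<in> T \<Longrightarrow> tetrahedron \<tau>" "\<Union>T = closure \<Omega>" using tri by (auto simp: triangulation_of_def)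
    have ucc: "u \<in> cc" by (rule fe_space_cc[OF \<Omega>(1,2) u])
    have ucont: "continuous_on UNIV u" by (rule cc_continuous[OF ucc])
    define h where "h = (1 / 2 ^ j :: real)"
    have h: "h > 0" "h \<le> 1" by (auto simp: h_def)
    define s where "s = \<kappa> * h"
    have s: "s > 0" using \<kappa> h by (simp add: s_def)
    define old where "old \<tau> \<longleftrightarrow> tet_level \<T> \<tau> < j" for \<tau>
    have uold: "\<exists>a b. \<forall>x\<in>\<tau>. u x = a \<bullet> x + b" if "\<tau> \<in> T" "old \<tau>" for \<tau>
      using that unrefined_tet_persists[OF bek _ _ j] fe_space_eq_affine[OF u] by (auto simp: T_def old_def)
    have tetbp: "\<exists>w. ball_pair \<tau> p h s w" if \<tau>: "\<tau> \<in> T" and p: "p \<in> \<tau>" for \<tau> p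
    proof -
      have \<tau>j: "\<tau> \<in> \<T> j" using \<tau> by (simp add: T_def)
      have "\<exists>w. ball_pair \<tau> p (1 / 2 ^ j) (r / M / 2 ^ j) w"
        by (rule tetrahedron_ball_pair[OF convex_simplex[OF T(2)[OF \<tau>]] c[OF \<tau>j] p rD(1) D[OF \<tau>j] M_def tet_level_mem(2)[of \<tau> \<T>, OF \<tau>j]])
      then obtain w where "ball_pair \<tau> p h (r / M * h) w" by (auto simp: h_def)
      moreover have "s \<le> r / M * h" unfolding s_def using \<kappa>(3) h(1) by (intro mult_right_mono) auto
      ultimately show ?thesis using ball_pair_smaller by blast
    qed
    have extbp: "\<exists>w. ball_pair (- closure \<Omega>) p h s w" if p: "p \<in> frontier \<Omega>" for p
    proof -
      obtain w where "ball_pair (- closure \<Omega>) p h (\<kappa>1 * h) w" using \<kappa>1(2) p h by blast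
      moreover have "s \<le> \<kappa>1 * h" unfolding s_def using \<kappa>(2) h(1) by (intro mult_right_mono) auto
      ultimately show ?thesis using ball_pair_smaller by blast
    qed
    \<comment> \<open>At a vertex shared by old and new tetrahedra an old one is preferred, and a
      boundary vertex always uses the exterior; this yields exactness and zero boundary values at
      once.\<close>
    have "\<exists>w. p \<in> closure \<Omega> \<longrightarrow> (\<exists>S. ball_pair S p h s w \<and>
        (if p \<in> frontier \<Omega> then S = - closure \<Omega> else S \<in> T \<and> p \<in> S \<and> ((\<exists>\<tau>\<in>T. old \<tau> \<and> p \<in> \<tau>) \<longrightarrow> old S)))" for p
    proof (cases "p \<in> closure \<Omega> - frontier \<Omega>")
      case True
      then obtain \<tau> where \<tau>: "\<tau> \<in> T" "p \<in> \<tau>" "(\<exists>\<tau>\<in>T. old \<tau> \<and> p \<in> \<tau>) \<longrightarrow> old \<tau>" using T(3) by blast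
      then obtain w where "ball_pair \<tau> p h s w" using tetbp by blast
      then show ?thesis using \<tau> True by auto
    next
      case False
      then show ?thesis using extbp[of p] by (cases "p \<in> frontier \<Omega>") auto
    qed
    then obtain W where W: "\<And>p. p \<in> closure \<Omega> \<Longrightarrow> \<exists>S. ball_pair S p h s (W p) \<and>
        (if p \<in> frontier \<Omega> then S = - closure \<Omega> else S \<in> T \<and> p \<in> S \<and> ((\<exists>\<tau>\<in>T. old \<tau> \<and> p \<in> \<tau>) \<longrightarrow> old S))"
      by metis
    define val where "val p = pt_fun u p s (W p)" for p
    have val0: "val p = 0" if p: "p \<in> frontier \<Omega>" for p
    proof -
      have "p \<in> closure \<Omega>" using p by (simp add: frontier_def)
      then have bp: "ball_pair (- closure \<Omega>) p h s (W p)" using W[of p] p by auto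
      have "u x = (0::real^3) \<bullet> x + 0" if "x \<in> - closure \<Omega>" for x
        using fe_space_zero_outside[OF \<Omega>(1) u, of x] that closure_subset by auto
      from pt_fun_cong[OF bp this] show ?thesis using pt_fun_affine[OF s, of 0 0] by (simp add: val_def)
    qed
    obtain v where v: "v \<in> fe_space \<Omega> T" "\<And>\<tau> p. \<tau> \<in> T \<Longrightarrow> p \<in> corners \<tau> \<Longrightarrow> v p = val p"
      using nodal_interpolation[OF tri conf \<Omega>(3), of val] val0 by (metis (no_types, lifting))
    have vcc: "v \<in> cc" by (rule fe_space_cc[OF \<Omega>(1,2) v(1)])
    have inclosure: "p \<in> closure \<Omega>" if "\<tau> \<in> T" "p \<in> \<tau>" for \<tau> p using T(3) that by blast
    have corner\<tau>: "p \<in> \<tau>" if "p \<in> corners \<tau>" for \<tau> and p :: "real^3" using corners_subset that by blast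
    \<comment> \<open>At each corner off the boundary the functional lives on an old tetrahedron,
      where \<open>u\<close> is affine, so it returns \<open>u p\<close>; at a boundary corner both
      values are 0.\<close>
    have eq_old: "v x = u x" if \<tau>: "\<tau> \<in> T" "old \<tau>" and x: "x \<in> \<tau>" for \<tau> x
    proof -
      obtain a b where ab: "\<And>x. x \<in> \<tau> \<Longrightarrow> u x = a \<bullet> x + b" using uold[OF \<tau>] by blast
      obtain a' b' where ab': "\<And>x. x \<in> \<tau> \<Longrightarrow> v x = a' \<bullet> x + b'" using fe_space_eq_affine[OF v(1) \<tau>(1)] by blast
      have "a' \<bullet> x + b' = a \<bullet> x + b"
      proof (rule affine_agree_convex_hull)
        show "x \<in> convex hull corners \<tau>" using tetrahedron_eq_hull[OF T(2)[OF \<tau>(1)]] x by simp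
        fix p assume p: "p \<in> corners \<tau>"
        have p\<tau>: "p \<in> \<tau>" by (rule corner\<tau>[OF p])
        have "val p = u p"
        proof (cases "p \<in> frontier \<Omega>")
          case True
          then have "p \<notin> \<Omega>" using \<Omega>(1) by (simp add: frontier_def interior_open)
          then show ?thesis using val0[OF True] fe_space_zero_outside[OF \<Omega>(1) u] by simp
        next
          case False
          obtain S where S: "ball_pair S p h s (W p)" "S \<in> T" "p \<in> S" "old S"
            using W[OF inclosure[OF \<tau>(1) p\<tau>]] False \<tau> p\<tau> by auto
          obtain g k where gk: "\<And>x. x \<in> S \<Longrightarrow> u x = g \<bullet> x + k" using uold[OF S(2,4)] by blast
          have "val p = pt_fun (\<lambda>x. g \<bullet> x + k) p s (W p)" unfolding val_def by (rule pt_fun_cong[OF S(1) gk])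
          also have "\<dots> = u p" using gk[OF S(3)] by (simp add: pt_fun_affine[OF s])
          finally show ?thesis .
        qed
        then show "a' \<bullet> p + b' = a \<bullet> p + b" using v(2)[OF \<tau>(1) p] ab[OF p\<tau>] ab'[OF p\<tau>] by simp
      qed
      then show ?thesis using ab[OF x] ab'[OF x] by simp
    qed
    define New where "New = {\<tau> \<in> T. \<not> old \<tau>}"
    have lev: "tet_level \<T> \<tau> = j" if "\<tau> \<in> New" for \<tau>
      using that tet_level_mem(2)[of \<tau> \<T> j] by (auto simp: New_def old_def T_def)
    have New: "finite New" "\<And>\<tau>. \<tau> \<in> New \<Longrightarrow> \<tau> \<in> \<T> j" "\<And>\<tau>. \<tau> \<in> New \<Longrightarrow> \<tau> \<in> T" using T(1) by (auto simp: New_def T_def)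
    have Newsets: "\<tau> \<in> sets lborel" if "\<tau> \<in> New" for \<tau>
      using borel_closed[OF closed_simplex[OF T(2)[OF New(3)[OF that]]]] by simp
    define R where "R = 2 * ((D + 1) * h)"
    have R: "R > 0" using rD h by (simp add: R_def)
    have local: "(LINT x:\<tau>|lborel. (u x - v x)\<^sup>2) \<le> C1 / h ^ 3 * jensen_energy u (c \<tau>) R" if \<tau>: "\<tau> \<in> New" for \<tau>
    proof -
      have \<tau>T: "\<tau> \<in> T" and \<tau>j: "\<tau> \<in> \<T> j" using New \<tau> by auto
      define m where "m = c \<tau>"
      have cb: "cball m (r * h) \<subseteq> interior \<tau>" using c[OF \<tau>j] lev[OF \<tau>] by (simp add: m_def h_def)
      have m\<tau>: "m \<in> \<tau>" using cb interior_subset[of \<tau>] rD h by (auto simp: subset_iff)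
      have D\<tau>: "dist x y \<le> D * h" if "x \<in> \<tau>" "y \<in> \<tau>" for x y using D[OF \<tau>j that] lev[OF \<tau>] by (simp add: h_def)
      \<comment> \<open>Contains \<open>\<tau>\<close>, of diameter at most \<open>D * h\<close>,
        together with the reach \<open>h\<close> of the functionals at its corners.\<close>
      define \<rho> where "\<rho> = (D + 1) * h"
      have \<rho>: "\<rho> > 0" using rD h by (simp add: \<rho>_def)
      obtain a b where ab: "(LINT y:cball m \<rho>|lborel. (u y - (a \<bullet> y + b))\<^sup>2) \<le> C0 * jensen_energy u m (2 * \<rho>) / measure lborel (cball (0::real^3) \<rho>)"
        using Whitney_affine[OF ucc \<rho>, of m] unfolding C0_def by blast
      define f where "f x = u x - (a \<bullet> x + b)" for x
      have fcont: "continuous_on UNIV f" unfolding f_def by (intro continuous_intros ucont)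
      define I where "I = (LINT y:cball m \<rho>|lborel. (f y)\<^sup>2)"
      have I0: "I \<ge> 0" unfolding I_def by (rule set_integral_nonneg_real) simp
      have fint: "set_integrable lborel S (\<lambda>x. (f x)\<^sup>2)" if "compact S" for S
        by (intro set_integrable_compact that continuous_intros continuous_on_subset[OF fcont]) auto
      define K where "K = sqrt (10 * I / (\<beta> * (s / 2) ^ 3))"
      have K2: "K\<^sup>2 = 10 * I / (\<beta> * (s / 2) ^ 3)" using I0 \<beta> s by (simp add: K_def)
      \<comment> \<open>The functional reproduces affine functions, so it may be applied to the
        remainder \<open>f\<close>. Boundary corners fit in: their value 0 is the same functional
        evaluated on exterior balls.\<close>
      have corner: "\<bar>v p - (a \<bullet> p + b)\<bar> \<le> K" if p: "p \<in> corners \<tau>" for p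
      proof -
        have p\<tau>: "p \<in> \<tau>" by (rule corner\<tau>[OF p])
        obtain S where S: "ball_pair S p h s (W p)" using W[OF inclosure[OF \<tau>T p\<tau>]] by blast
        have "pt_fun f p s (W p) = pt_fun u p s (W p) - pt_fun (\<lambda>x. a \<bullet> x + b) p s (W p)"
          unfolding pt_fun_def f_def by (subst (1 2) avg_diff) (auto intro!: continuous_intros ucont)
        also have "\<dots> = v p - (a \<bullet> p + b)" using v(2)[OF \<tau>T p] by (simp add: pt_fun_affine[OF s] val_def)
        finally have pf: "pt_fun f p s (W p) = v p - (a \<bullet> p + b)" .
        have "\<beta> * (s / 2) ^ 3 * (v p - (a \<bullet> p + b))\<^sup>2 \<le> 10 * (LINT x:cball p h|lborel. (f x)\<^sup>2)"
          using pt_fun_square_le[OF fcont s S] s by (simp only: pf) (simp add: vol)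
        also have "(LINT x:cball p h|lborel. (f x)\<^sup>2) \<le> I"
          unfolding I_def
        proof (rule set_integral_mono_set)
          show "cball p h \<subseteq> cball m \<rho>"
          proof
            fix x assume "x \<in> cball p h"
            then show "x \<in> cball m \<rho>" using D\<tau>[OF m\<tau> p\<tau>] dist_triangle[of m x p] by (simp add: \<rho>_def distrib_right)
          qed
        qed (auto intro: fint)
        finally have "(v p - (a \<bullet> p + b))\<^sup>2 \<le> K\<^sup>2"
          unfolding K2 using \<beta> s by (simp add: pos_le_divide_eq mult.commute)
        then have "\<bar>v p - (a \<bullet> p + b)\<bar> \<le> \<bar>K\<bar>" by (simp add: abs_le_square_iff)
        then show ?thesis using I0 \<beta> s by (simp add: K_def)
      qed
      obtain g k where gk: "\<And>x. x \<in> \<tau> \<Longrightarrow> v x = g \<bullet> x + k" using fe_space_eq_affine[OF v(1) \<tau>T] by blast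
      have pt: "(u x - v x)\<^sup>2 \<le> 2 * (f x)\<^sup>2 + 2 * K\<^sup>2" if x: "x \<in> \<tau>" for x
      proof -
        have "\<bar>(g - a) \<bullet> x + (k - b)\<bar> \<le> K"
        proof (rule affine_abs_le_convex_hull)
          show "x \<in> convex hull corners \<tau>" using tetrahedron_eq_hull[OF T(2)[OF \<tau>T]] x by simp
          show "\<bar>(g - a) \<bullet> p + (k - b)\<bar> \<le> K" if p: "p \<in> corners \<tau>" for p
            using corner[OF p] gk[OF corner\<tau>[OF p]] by (simp add: inner_diff_left algebra_simps)
        qed
        then have "((g - a) \<bullet> x + (k - b))\<^sup>2 \<le> K\<^sup>2" by (metis abs_ge_zero power2_abs power_mono)
        moreover have "u x - v x = f x - ((g - a) \<bullet> x + (k - b))" using gk[OF x] by (simp add: f_def inner_diff_left)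
        moreover have "(s - t)\<^sup>2 \<le> 2 * s\<^sup>2 + 2 * t\<^sup>2" for s t :: real
          using zero_le_power2[of "s + t"] unfolding power2_sum power2_diff by linarith
        ultimately show ?thesis by (smt (verit))
      qed
      have cmp: "compact \<tau>" by (rule compact_simplex[OF T(2)[OF \<tau>T]])
      have kint: "set_integrable lborel \<tau> (\<lambda>x. 2 * K\<^sup>2)" by (rule set_integrable_compact[OF cmp]) auto
      have \<tau>sub: "\<tau> \<subseteq> cball m (D * h)" using D\<tau>[OF m\<tau>] by auto
      have mle: "measure lborel \<tau> \<le> \<beta> * (D * h) ^ 3"
      proof -
        have "measure lborel \<tau> \<le> measure lborel (cball m (D * h))"
        proof (rule measure_mono_fmeasurable[OF \<tau>sub])
          show "\<tau> \<in> sets lborel" using cmp by (simp add: borel_compact)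
          show "cball m (D * h) \<in> fmeasurable lborel"
            by (rule fmeasurableI) (use emeasure_compact_finite[OF compact_cball] in auto)
        qed
        then show ?thesis using rD h by (simp add: vol)
      qed
      have "(LINT x:\<tau>|lborel. (u x - v x)\<^sup>2) \<le> (LINT x:\<tau>|lborel. 2 * (f x)\<^sup>2 + 2 * K\<^sup>2)"
      proof (rule set_integral_mono)
        show "set_integrable lborel \<tau> (\<lambda>x. (u x - v x)\<^sup>2)"
          by (intro set_integrable_compact cmp continuous_intros continuous_on_subset[OF ucont] continuous_on_subset[OF cc_continuous[OF vcc]]) auto
        show "set_integrable lborel \<tau> (\<lambda>x. 2 * (f x)\<^sup>2 + 2 * K\<^sup>2)"
          by (rule set_integral_add(1)[OF set_integrable_mult_right kint]) (rule fint[OF cmp])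
      qed (rule pt)
      also have "\<dots> = 2 * (LINT x:\<tau>|lborel. (f x)\<^sup>2) + measure lborel \<tau> * (2 * K\<^sup>2)"
        by (subst set_integral_add(2)[OF set_integrable_mult_right kint]) (simp_all add: fint[OF cmp] set_integral_const_lborel[OF cmp])
      also have "\<dots> \<le> 2 * I + \<beta> * (D * h) ^ 3 * (2 * K\<^sup>2)"
      proof (intro add_mono mult_left_mono mult_right_mono mle)
        show "(LINT x:\<tau>|lborel. (f x)\<^sup>2) \<le> I"
          unfolding I_def
        proof (rule set_integral_mono_set[OF fint[OF compact_cball]])
          show "\<tau> \<in> sets lborel" using cmp by (simp add: borel_compact)
          have "D * h \<le> \<rho>" using h by (simp add: \<rho>_def distrib_right)
          then show "\<tau> \<subseteq> cball m \<rho>" using \<tau>sub by (meson order.trans subset_cball)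
        qed simp
      qed auto
      also have "\<dots> = (2 + 160 * (D / \<kappa>) ^ 3) * I"
        unfolding K2 s_def using \<beta> \<kappa> h by (simp add: power_mult_distrib power_divide field_simps)
      also have "\<dots> \<le> (2 + 160 * (D / \<kappa>) ^ 3) * (C0 * jensen_energy u m (2 * \<rho>) / (\<beta> * \<rho> ^ 3))"
        using ab \<rho> rD \<kappa> by (intro mult_left_mono) (auto simp: I_def f_def vol)
      also have "\<dots> = C1 / h ^ 3 * jensen_energy u (c \<tau>) R"
        by (simp add: C1_def \<rho>_def R_def m_def power_mult_distrib)
      finally show ?thesis .
    qed
    have "(nrm lborel (\<lambda>x. u x - v x))\<^sup>2 \<le> (LINT x|lborel. (\<Sum>\<tau>\<in>New. indicat_real \<tau> x *\<^sub>R (u x - v x)\<^sup>2))"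
      unfolding nrm_power2
    proof (rule integral_mono)
      have dcc: "(\<lambda>x. u x - v x) \<in> cc" using ucc vcc by (rule cc_diff)
      show "integrable lborel (\<lambda>x. (u x - v x)\<^sup>2)" by (rule cc_integrable[OF cc_power2[OF dcc]])
      show "integrable lborel (\<lambda>x. \<Sum>\<tau>\<in>New. indicat_real \<tau> x *\<^sub>R (u x - v x)\<^sup>2)"
        by (rule Bochner_Integration.integrable_sum, rule integrable_mult_indicator[OF _ cc_integrable[OF cc_power2[OF dcc]]])
          (rule Newsets)
      fix x
      show "(u x - v x)\<^sup>2 \<le> (\<Sum>\<tau>\<in>New. indicat_real \<tau> x *\<^sub>R (u x - v x)\<^sup>2)"
      proof (cases "u x = v x")
        case False
        have "x \<in> \<Omega>" using False fe_space_zero_outside[OF \<Omega>(1) u] fe_space_zero_outside[OF \<Omega>(1) v(1)] by metis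
        then have "x \<in> \<Union>T" using T(3) closure_subset by blast
        then obtain \<tau> where \<tau>: "\<tau> \<in> T" "x \<in> \<tau>" by blast
        then have "\<tau> \<in> New" using eq_old[of \<tau> x] False by (auto simp: New_def)
        then have "indicat_real \<tau> x *\<^sub>R (u x - v x)\<^sup>2 \<le> (\<Sum>\<tau>\<in>New. indicat_real \<tau> x *\<^sub>R (u x - v x)\<^sup>2)"
          using New(1) by (intro member_le_sum[where f="\<lambda>\<tau>. indicat_real \<tau> x *\<^sub>R (u x - v x)\<^sup>2"]) auto
        then show ?thesis using \<tau> by simp
      qed (simp add: sum_nonneg)
    qed
    also have "\<dots> = (\<Sum>\<tau>\<in>New. (LINT x:\<tau>|lborel. (u x - v x)\<^sup>2))"
      unfolding set_lebesgue_integral_def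
      by (rule Bochner_Integration.integral_sum, rule integrable_mult_indicator[OF _ cc_integrable[OF cc_power2[OF cc_diff[OF ucc vcc]]]])
        (rule Newsets)
    also have "\<dots> \<le> (\<Sum>\<tau>\<in>New. C1 / h ^ 3 * jensen_energy u (c \<tau>) R)" by (rule sum_mono) (rule local)
    also have "\<dots> = C1 / h ^ 3 * (\<Sum>\<tau>\<in>New. jensen_energy u (c \<tau>) R)" by (rule sum_distrib_left[symmetric])
    also have "\<dots> \<le> C1 / h ^ 3 * (N * (LINT e:cball 0 (2 * R)|lborel. (nrm lborel (diff2 ((1/2) *\<^sub>R e) u))\<^sup>2))"
    proof (rule mult_left_mono)
      show "(\<Sum>\<tau>\<in>New. jensen_energy u (c \<tau>) R) \<le> N * (LINT e:cball 0 (2 * R)|lborel. (nrm lborel (diff2 ((1/2) *\<^sub>R e) u))\<^sup>2)"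
      proof (rule jensen_energy_sum_le(2)[OF ucc New(1) R])
        fix P
        have "real (card {\<tau> \<in> New. P \<in> cball (c \<tau>) R}) \<le> ((R + r * h) / (r * h)) ^ DIM(real^3)"
        proof (rule ball_overlap_count[OF New(1)])
          fix \<tau> \<tau>' assume t: "\<tau> \<in> New" "\<tau>' \<in> New" "\<tau> \<noteq> \<tau>'"
          have "interior \<tau> \<inter> interior \<tau>' = {}" using tri t New(3) by (simp add: triangulation_of_def)
          moreover have "cball (c \<tau>) (r * h) \<subseteq> interior \<tau>" "cball (c \<tau>') (r * h) \<subseteq> interior \<tau>'"
            using c[OF New(2)[OF t(1)]] c[OF New(2)[OF t(2)]] lev t by (simp_all add: h_def)
          ultimately show "cball (c \<tau>) (r * h) \<inter> cball (c \<tau>') (r * h) = {}" by blast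
        qed (use rD h R in auto)
        also have "(R + r * h) / (r * h) = (2 * (D + 1) + r) / r"
        proof -
          have "R + r * h = (2 * (D + 1) + r) * h" by (simp add: R_def algebra_simps)
          then show ?thesis using h rD by simp
        qed
        finally show "real (card {\<tau> \<in> New. P \<in> cball (c \<tau>) R}) \<le> N" by (simp add: N_def)
      qed
    qed (use C1 h in auto)
    \<comment> \<open>Rescaling the step by \<open>h\<close> produces the factor
      \<open>h ^ 3\<close> that cancels the denominator, and \<open>2 * R\<close> becomes
      \<open>E\<close>.\<close>
    also have "(LINT e:cball 0 (2 * R)|lborel. (nrm lborel (diff2 ((1/2) *\<^sub>R e) u))\<^sup>2)
        = h ^ 3 * (LINT e:cball 0 E|lborel. (nrm lborel (diff2 ((1 / 2 ^ Suc j) *\<^sub>R e) u))\<^sup>2)"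
    proof -
      have "{e::real^3. h *\<^sub>R e \<in> cball 0 (2 * R)} = cball 0 E"
        using h by (auto simp: R_def E_def)
      then show ?thesis
        using set_integral_scale[OF diff2_energy_measurable[OF ucc, of "1/2"], of "cball 0 (2 * R)" h] h by (simp add: h_def)
    qed
    also have "C1 / h ^ 3 * (N * (h ^ 3 * (LINT e:cball 0 E|lborel. (nrm lborel (diff2 ((1 / 2 ^ Suc j) *\<^sub>R e) u))\<^sup>2)))
        = C1 * N * (LINT e:cball 0 E|lborel. (nrm lborel (diff2 ((1 / 2 ^ Suc j) *\<^sub>R e) u))\<^sup>2)"
      using h by simp
    finally show ?thesis using v(1) by (auto simp: T_def)
  qed
  show ?thesis
    by (rule exI[of _ "C1 * N"], intro conjI mult_pos_pos C1 N, rule exI[of _ E], intro conjI E allI ballI impI) (rule main)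
qed

text \<open>The sum over levels is moved inside the integral over the step direction, where for each
  fixed \<open>e\<close> it telescopes and is bounded by the gradient energy.\<close>

lemma H1_lower_bound:
  assumes poly: "polyhedral_domain \<Omega>" and bek: "bek_sequence \<Omega> \<T>"
  shows "\<exists>C>0. \<forall>J. \<forall>u\<in>fe_space \<Omega> (\<T> J). \<exists>v. (\<forall>j<J. v j \<in> fe_space \<Omega> (\<T> j)) \<and>
    (\<Sum>j<J. 4 ^ j * (nrm lborel (\<lambda>x. u x - v j x))\<^sup>2) \<le> C * (H1_norm \<Omega> u)\<^sup>2"
proof -
  have \<Omega>: "open \<Omega>" "bounded \<Omega>" "interior (closure \<Omega>) = \<Omega>" using poly by (auto simp: polyhedral_domain_def)
  obtain C E where CE: "C > 0" "E > 0" and qi: "\<forall>J j. \<forall>u\<in>fe_space \<Omega> (\<T> J). j \<le> J \<longrightarrow> (\<exists>v\<in>fe_space \<Omega> (\<T> j).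
    (nrm lborel (\<lambda>x. u x - v x))\<^sup>2 \<le> C * (LINT e:cball 0 E|lborel. (nrm lborel (diff2 ((1 / 2 ^ Suc j) *\<^sub>R e) u))\<^sup>2))"
    using quasi_interpolation[OF poly bek] by (elim exE conjE)
  define V where "V = measure lborel (cball (0::real^3) E)"
  have V: "V > 0" unfolding V_def using CE by (intro content_cball_pos)
  have "\<exists>v. (\<forall>j<J. v j \<in> fe_space \<Omega> (\<T> j)) \<and>
    (\<Sum>j<J. 4 ^ j * (nrm lborel (\<lambda>x. u x - v j x))\<^sup>2) \<le> C * (V * E\<^sup>2) * (H1_norm \<Omega> u)\<^sup>2"
    if u: "u \<in> fe_space \<Omega> (\<T> J)" for J u
  proof -
    have ucc: "u \<in> cc" by (rule fe_space_cc[OF \<Omega>(1,2) u])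
    have tri: "triangulation_of (closure \<Omega>) (\<T> J)" using bek by (simp add: bek_sequence_def)
    define G where "G = (\<Sum>i\<in>UNIV. (nrm lborel (grad (axis i 1) u))\<^sup>2)"
    have G: "0 \<le> G" "G \<le> (H1_norm \<Omega> u)\<^sup>2"
      unfolding H1_norm_fe[OF \<Omega> tri u] G_def by (auto intro: sum_nonneg)
    define en where "en j e = (nrm lborel (diff2 ((1 / 2 ^ Suc j) *\<^sub>R e) u))\<^sup>2" for j e
    have "\<exists>v. v \<in> fe_space \<Omega> (\<T> j) \<and> (nrm lborel (\<lambda>x. u x - v x))\<^sup>2 \<le> C * (LINT e:cball 0 E|lborel. en j e)" if "j \<le> J" for j
      using qi u that unfolding en_def by blast
    then obtain v where v: "\<And>j. j \<le> J \<Longrightarrow> v j \<in> fe_space \<Omega> (\<T> j)"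
      "\<And>j. j \<le> J \<Longrightarrow> (nrm lborel (\<lambda>x. u x - v j x))\<^sup>2 \<le> C * (LINT e:cball 0 E|lborel. en j e)" by metis
    have int: "set_integrable lborel (cball 0 E) (\<lambda>e. 4 ^ j * en j e)" for j
      unfolding en_def by (rule set_integrable_mult_right) (rule diff2_energy_integrable[OF ucc])
    have "(\<Sum>j<J. 4 ^ j * (nrm lborel (\<lambda>x. u x - v j x))\<^sup>2) \<le> (\<Sum>j<J. 4 ^ j * (C * (LINT e:cball 0 E|lborel. en j e)))"
      by (intro sum_mono mult_left_mono v(2)) auto
    also have "\<dots> = C * (\<Sum>j<J. (LINT e:cball 0 E|lborel. 4 ^ j * en j e))"
      by (simp add: sum_distrib_left mult.left_commute)
    also have "(\<Sum>j<J. (LINT e:cball 0 E|lborel. 4 ^ j * en j e)) = (LINT e:cball 0 E|lborel. (\<Sum>j<J. 4 ^ j * en j e))"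
      unfolding set_lebesgue_integral_def scaleR_sum_right
      by (rule Bochner_Integration.integral_sum[symmetric]) (use int in \<open>simp add: set_integrable_def\<close>)
    also have "\<dots> \<le> (LINT e:cball (0::real^3) E|lborel. E\<^sup>2 * G)"
    proof (rule set_integral_mono)
      show "set_integrable lborel (cball 0 E) (\<lambda>e. \<Sum>j<J. 4 ^ j * en j e)"
        unfolding set_integrable_def scaleR_sum_right
        by (rule Bochner_Integration.integrable_sum) (use int in \<open>simp add: set_integrable_def\<close>)
      show "set_integrable lborel (cball (0::real^3) E) (\<lambda>e. E\<^sup>2 * G)" by (rule set_integrable_compact) auto
      fix e :: "real^3" assume e: "e \<in> cball 0 E"
      \<comment> \<open>Weight \<open>4 ^ j\<close> at step \<open>e / 2 ^ (j + 1)\<close> is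
        exactly the summand of \<open>diff_energy_sum\<close>; the energy at scale 0 is nonnegative
        and dropped.\<close>
      have "(\<Sum>j<J. 4 ^ j * en j e) \<le> diff_energy e u J"
        unfolding diff_energy_sum[OF ucc, of e J] en_def by (simp add: diff_energy_def)
      also have "\<dots> \<le> (norm e)\<^sup>2 * G" unfolding G_def by (rule diff_energy_le_grad[OF \<Omega>(1,2) tri u])
      also have "\<dots> \<le> E\<^sup>2 * G" using e G by (intro mult_right_mono power_mono) auto
      finally show "(\<Sum>j<J. 4 ^ j * en j e) \<le> E\<^sup>2 * G" .
    qed
    also have "\<dots> = V * (E\<^sup>2 * G)" by (simp add: set_integral_const_lborel V_def)
    also have "C * (V * (E\<^sup>2 * G)) \<le> C * (V * (E\<^sup>2 * (H1_norm \<Omega> u)\<^sup>2))"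
      using CE V G by (intro mult_left_mono) auto
    finally have "(\<Sum>j<J. 4 ^ j * (nrm lborel (\<lambda>x. u x - v j x))\<^sup>2) \<le> C * (V * E\<^sup>2) * (H1_norm \<Omega> u)\<^sup>2"
      using CE by (simp add: mult.assoc)
    then show ?thesis using v(1) by (intro exI[of _ v]) auto
  qed
  then show ?thesis using CE V by (intro exI[of _ "C * (V * E\<^sup>2)"]) auto
qed

section \<open>Passage to the orthogonal projections\<close>

section \<open>The norm equivalence\<close>

theorem mainTheorem1:
  fixes \<Omega> :: "(real^3) set" and \<T> :: "nat \<Rightarrow> (real^3) set set"
  assumes "polyhedral_domain \<Omega>"
    and "bek_sequence \<Omega> \<T>"
  shows "\<exists>c1 c2 :: real. 0 < c1 \<and> 0 < c2 \<and>
    (\<forall>J. \<forall>u \<in> fe_space \<Omega> (\<T> J).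
       c1 * (\<Sum>j=0..J. 2 ^ (2 * j) * (L2_norm \<Omega> (proj_diff \<Omega> \<T> j u))\<^sup>2) \<le> (H1_norm \<Omega> u)\<^sup>2 \<and>
       (H1_norm \<Omega> u)\<^sup>2 \<le> c2 * (\<Sum>j=0..J. 2 ^ (2 * j) * (L2_norm \<Omega> (proj_diff \<Omega> \<T> j u))\<^sup>2))"
proof -
  have \<Omega>: "open \<Omega>" "bounded \<Omega>" "interior (closure \<Omega>) = \<Omega>" using assms(1) by (auto simp: polyhedral_domain_def)
  note bek = assms(2)
  obtain C where C: "C > 0" and lower: "\<forall>J. \<forall>u\<in>fe_space \<Omega> (\<T> J). \<exists>v. (\<forall>j<J. v j \<in> fe_space \<Omega> (\<T> j)) \<and>
    (\<Sum>j<J. 4 ^ j * (nrm lborel (\<lambda>x. u x - v j x))\<^sup>2) \<le> C * (H1_norm \<Omega> u)\<^sup>2"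
    using H1_lower_bound[OF assms] by (elim exE conjE)
  obtain c where c: "c > 0" and upper: "\<forall>J w. (\<forall>k\<le>J. w k \<in> fe_space \<Omega> (\<T> k)) \<longrightarrow>
    (H1_norm \<Omega> (\<lambda>x. \<Sum>k\<le>J. w k x))\<^sup>2 \<le> c * (\<Sum>k\<le>J. 4 ^ k * (nrm lborel (w k))\<^sup>2)"
    using H1_upper_bound[OF \<Omega> bek] by (elim exE conjE)
  have tri: "triangulation_of (closure \<Omega>) (\<T> j)" and conf: "conforming (\<T> j)" for j using bek by (auto simp: bek_sequence_def)
  note mono = bek_fe_space_mono[OF bek]
  note fecc = fe_space_cc[OF \<Omega>(1,2)]
  have four: "2 ^ (2 * j) = (4::real) ^ j" for j by (simp add: power_mult)
  have main: "(\<Sum>j=0..J. 2 ^ (2 * j) * (L2_norm \<Omega> (proj_diff \<Omega> \<T> j u))\<^sup>2) \<le> (1 + 4 * C) * (H1_norm \<Omega> u)\<^sup>2 \<and>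
       (H1_norm \<Omega> u)\<^sup>2 \<le> c * (\<Sum>j=0..J. 2 ^ (2 * j) * (L2_norm \<Omega> (proj_diff \<Omega> \<T> j u))\<^sup>2)"
    if u: "u \<in> fe_space \<Omega> (\<T> J)" for J u
  proof -
    have ucc: "u \<in> cc" by (rule fecc[OF u])
    define Q where "Q j = L2_proj \<Omega> (fe_space \<Omega> (\<T> j)) u" for j
    have Q: "Q j \<in> fe_space \<Omega> (\<T> j)" and orth: "\<And>v. v \<in> fe_space \<Omega> (\<T> j) \<Longrightarrow> ip (\<lambda>x. u x - Q j x) v = 0" for j
      unfolding Q_def using L2_proj_props[OF tri[of j] conf[of j] \<Omega>(3,2) ucc] by blast+
    have Qcc: "Q j \<in> cc" for j by (rule fecc[OF Q])
    \<comment> \<open>The projection of the previous level, with the convention of a zero projection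
      before level 0; on naturals \<open>j - 1\<close> alone would give \<open>Q 0\<close>
      there.\<close>
    define P where "P j = (if j = 0 then (\<lambda>x. 0) else Q (j - 1))" for j
    have P: "P j \<in> fe_space \<Omega> (\<T> j)" for j
      using Q[of "j - 1"] mono[of "j - 1" j] by (auto simp: P_def fe_space_zero)
    define w where "w = (\<lambda>j x. Q j x - P j x)"
    have pd: "proj_diff \<Omega> \<T> j u = w j" for j
      by (auto simp: proj_diff_def w_def P_def Q_def fun_eq_iff)
    have w: "w j \<in> fe_space \<Omega> (\<T> j)" for j unfolding w_def by (rule fe_space_diff[OF Q P])
    have wcc: "w j \<in> cc" for j by (rule fecc[OF w])
    have L2w: "L2_norm \<Omega> (w j) = nrm lborel (w j)" for j
      by (rule L2_norm_eq_nrm[OF \<Omega>(1) cc_measurable[OF wcc]]) (simp add: fe_space_zero_outside[OF \<Omega>(1) w])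
    have Sum: "(\<Sum>j=0..J. 2 ^ (2 * j) * (L2_norm \<Omega> (proj_diff \<Omega> \<T> j u))\<^sup>2) = (\<Sum>k\<le>J. 4 ^ k * (nrm lborel (w k))\<^sup>2)"
      by (simp add: pd L2w four atLeast0AtMost)
    have QJ: "Q J x = u x" for x
    proof -
      have d: "(\<lambda>x. u x - Q J x) \<in> fe_space \<Omega> (\<T> J)" by (rule fe_space_diff[OF u Q])
      have "ip (\<lambda>x. u x - Q J x) (\<lambda>x. u x - Q J x) = 0" by (rule orth[OF d])
      then have "u x - Q J x = 0" by (intro cc_eq_0[OF fecc[OF d]]) (simp add: ip_self nrm_power2)
      then show ?thesis by simp
    qed
    have tele: "(\<Sum>k\<le>n. w k x) = Q n x" for n x
      by (induction n) (auto simp: w_def P_def)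
    have ueq: "u = (\<lambda>x. \<Sum>k\<le>J. w k x)" by (simp add: tele QJ)
    have up: "(H1_norm \<Omega> u)\<^sup>2 \<le> c * (\<Sum>k\<le>J. 4 ^ k * (nrm lborel (w k))\<^sup>2)"
      using upper[rule_format, of J w] w by (subst ueq) simp
    \<comment> \<open>\<open>w j\<close> is also the projection of \<open>u - v\<close> onto the orthogonal complement of the previous space in the \<open>j\<close>-th one.\<close>
    have best: "nrm lborel (w j) \<le> nrm lborel (\<lambda>x. u x - v x)"
      if v: "v \<in> fe_space \<Omega> (\<T> j)" and vP: "j = 0 \<and> v = (\<lambda>x. 0) \<or> j > 0 \<and> v \<in> fe_space \<Omega> (\<T> (j - 1))" for j v
    proof -
      have vcc: "v \<in> cc" by (rule fecc[OF v])
      \<comment> \<open>For positive \<open>j\<close>, \<open>w j\<close> is the difference of the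
        residuals of \<open>u\<close> at levels \<open>j - 1\<close> and \<open>j\<close>, both
        orthogonal to the previous space.\<close>
      have ww: "ip (w j) g = 0" if g: "j = 0 \<and> g = (\<lambda>x. 0) \<or> j > 0 \<and> g \<in> fe_space \<Omega> (\<T> (j - 1))" for g
      proof (cases "j = 0")
        case True
        then show ?thesis using g by (simp add: ip_def)
      next
        case False
        then have g1: "g \<in> fe_space \<Omega> (\<T> (j - 1))" using g by simp
        then have g2: "g \<in> fe_space \<Omega> (\<T> j)" using mono[of "j - 1" j] by auto
        have "w j = (\<lambda>x. (u x - Q (j - 1) x) + (-1) * (u x - Q j x))" using False by (auto simp: w_def P_def)
        then have "ip (w j) g = ip (\<lambda>x. u x - Q (j - 1) x) g + (-1) * ip (\<lambda>x. u x - Q j x) g"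
          by (simp only:) (intro ip_add cc_diff ucc Qcc fecc[OF g1])
        then show ?thesis using orth[OF g1] orth[OF g2] by simp
      qed
      define a where "a = (\<lambda>x. u x - Q j x)"
      define b where "b = (\<lambda>x. P j x - v x)"
      have acc: "a \<in> cc" and bcc: "b \<in> cc" unfolding a_def b_def using ucc Qcc vcc fecc[OF P] by (auto intro: cc_diff)
      have "ip (\<lambda>x. u x - v x) (w j) = ip (\<lambda>x. (a x + 1 * b x) + 1 * w j x) (w j)"
        by (rule arg_cong[of _ _ "\<lambda>f. ip f (w j)"]) (auto simp: a_def b_def w_def)
      also have "\<dots> = (ip a (w j) + 1 * ip b (w j)) + 1 * ip (w j) (w j)"
        using ip_add[OF cc_add[OF acc cc_cmult[OF bcc, of 1]] wcc wcc, of 1 j j] ip_add[OF acc bcc wcc, of 1 j] by simp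
      also have "ip a (w j) = 0" unfolding a_def by (rule orth[OF w])
      also have "ip b (w j) = 0"
      proof -
        have "ip (w j) b = 0"
        proof (rule ww)
          show "j = 0 \<and> b = (\<lambda>x. 0) \<or> j > 0 \<and> b \<in> fe_space \<Omega> (\<T> (j - 1))"
            using vP fe_space_diff[OF Q[of "j - 1"], of v] by (auto simp: b_def P_def)
        qed
        then show ?thesis by (simp add: ip_commute)
      qed
      finally have eq: "(nrm lborel (w j))\<^sup>2 = ip (\<lambda>x. u x - v x) (w j)" by (simp add: ip_self)
      have dcc: "(\<lambda>x. u x - v x) \<in> cc" using ucc vcc by (rule cc_diff)
      have "(ip (\<lambda>x. u x - v x) (w j))\<^sup>2 \<le> (nrm lborel (\<lambda>x. u x - v x))\<^sup>2 * (nrm lborel (w j))\<^sup>2"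
        unfolding ip_def nrm_power2 by (intro Cauchy_Schwarz_integral cc_square_integrable dcc wcc)
      then have le: "(nrm lborel (w j))\<^sup>2 * (nrm lborel (w j))\<^sup>2 \<le> (nrm lborel (\<lambda>x. u x - v x))\<^sup>2 * (nrm lborel (w j))\<^sup>2"
        unfolding eq[symmetric] power2_eq_square .
      show ?thesis
      proof (cases "nrm lborel (w j) = 0")
        case False
        then have "(nrm lborel (w j))\<^sup>2 \<le> (nrm lborel (\<lambda>x. u x - v x))\<^sup>2"
          using le by (intro mult_right_le_imp_le[OF le]) simp
        then show ?thesis by (rule power2_le_imp_le) simp
      qed simp
    qed
    obtain v where v: "\<forall>j<J. v j \<in> fe_space \<Omega> (\<T> j)" "(\<Sum>j<J. 4 ^ j * (nrm lborel (\<lambda>x. u x - v j x))\<^sup>2) \<le> C * (H1_norm \<Omega> u)\<^sup>2"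
      using lower u by blast
    \<comment> \<open>Level \<open>k + 1\<close> is compared with the approximation
      \<open>v k\<close> from level \<open>k\<close>; this shift costs the factor 4 in
      \<open>1 + 4 * C\<close>, while level 0 is compared with the zero function and gives the
      1.\<close>
    have "(\<Sum>k\<le>J. 4 ^ k * (nrm lborel (w k))\<^sup>2) = (nrm lborel (w 0))\<^sup>2 + (\<Sum>k<J. 4 ^ Suc k * (nrm lborel (w (Suc k)))\<^sup>2)"
      by (simp add: sum.atMost_shift)
    also have "\<dots> \<le> (H1_norm \<Omega> u)\<^sup>2 + (\<Sum>k<J. 4 * (4 ^ k * (nrm lborel (\<lambda>x. u x - v k x))\<^sup>2))"
    proof (intro add_mono sum_mono)
      have "nrm lborel (w 0) \<le> nrm lborel (\<lambda>x. u x - 0)" by (rule best) (auto simp: fe_space_zero)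
      then have "(nrm lborel (w 0))\<^sup>2 \<le> (nrm lborel u)\<^sup>2" by (simp add: power_mono)
      also have "\<dots> \<le> (H1_norm \<Omega> u)\<^sup>2"
        unfolding H1_norm_fe[OF \<Omega> tri u] by (simp add: sum_nonneg)
      finally show "(nrm lborel (w 0))\<^sup>2 \<le> (H1_norm \<Omega> u)\<^sup>2" .
      fix k assume "k \<in> {..<J}"
      then have vk: "v k \<in> fe_space \<Omega> (\<T> k)" using v(1) by simp
      have "nrm lborel (w (Suc k)) \<le> nrm lborel (\<lambda>x. u x - v k x)"
        by (rule best) (use vk mono[of k "Suc k"] in auto)
      then have "(nrm lborel (w (Suc k)))\<^sup>2 \<le> (nrm lborel (\<lambda>x. u x - v k x))\<^sup>2" by (simp add: power_mono)
      then show "4 ^ Suc k * (nrm lborel (w (Suc k)))\<^sup>2 \<le> 4 * (4 ^ k * (nrm lborel (\<lambda>x. u x - v k x))\<^sup>2)" by simp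
    qed
    also have "\<dots> \<le> (1 + 4 * C) * (H1_norm \<Omega> u)\<^sup>2"
      using v(2) by (simp add: sum_distrib_left[symmetric] algebra_simps)
    finally show ?thesis using up unfolding Sum by blast
  qed
  show ?thesis
  proof (rule exI[of _ "1 / (1 + 4 * C)"], rule exI[of _ c], intro conjI allI ballI)
    show "0 < 1 / (1 + 4 * C)" "0 < c" using C c by auto
    fix J u assume u: "u \<in> fe_space \<Omega> (\<T> J)"
    show "1 / (1 + 4 * C) * (\<Sum>j=0..J. 2 ^ (2 * j) * (L2_norm \<Omega> (proj_diff \<Omega> \<T> j u))\<^sup>2) \<le> (H1_norm \<Omega> u)\<^sup>2"
      using main[OF u] C by (simp add: pos_divide_le_eq mult.commute)
    show "(H1_norm \<Omega> u)\<^sup>2 \<le> c * (\<Sum>j=0..J. 2 ^ (2 * j) * (L2_norm \<Omega> (proj_diff \<Omega> \<T> j u))\<^sup>2)"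
      using main[OF u] by blast
  qed
qed

end
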